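(* Let $\mathbb{K}$ be a field, $R$ a $\mathbb{K}$-algebra, $\Lambda$ a non-empty finite set, $X$ a finite set, $\deg\colon X\to G$ a map, and $\sigma^{ab}_{cd}\in M_\Lambda(R)$ $(a,b,c,d\in X)$ elements such that $\sigma^{ab}_{cd}(\lambda)\in Z(R)$ for all $\lambda\in\Lambda$, $a,b,c,d\in X$, and such that $\lambda\deg(d)\deg(b)\neq\lambda\deg(c)\deg(a)$ implies $\sigma^{bd}_{ac}(\lambda)=0$. Let $A_\sigma$ and $\mathfrak{A}(w_\sigma)$ be the left bialgebroids over $M_\Lambda(R)$ described in the context. Define the $\mathbb{K}$-linear map $\overline{\Phi}\colon\mathfrak{H}(Q)\to A_\sigma$ by $$\overline{\Phi}(r\otimes r'\otimes\mathbf{e}^{p}_{q})=(r_M\otimes r'_M)(\delta_{\mathfrak{s}(p)}\otimes\delta_{\mathfrak{s}(q)})L_{x_1y_1}\cdots L_{x_my_m}+I_\sigma$$ for $r,r'\in R$, $m\in\mathbb{Z}_{\ge0}$, $p=((\lambda_1,x_1),\dots,(\lambda_m,x_m))$ and $q=((\mu_1,y_1),\dots,(\mu_m,y_m))$ in $Q^{(m)}$ (for $m=0$, $p,q\in\Lambda$ and the product of $L$'s is empty). Then $\overline{\Phi}$ induces a left bialgebroid homomorphism $(\Phi\colon\mathfrak{A}(w_\sigma)\to A_\sigma,\ \mathrm{id}_{M_\Lambda(R)})$.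
   Context: Algebras are associative and unital, and algebra homomorphisms are unital. $Z(R)$ is the center of $R$. LEFT BIALGEBROIDS. A left bialgebroid is a sextuplet $\mathcal{A}_L=(A,L,s_L,t_L,\Delta_L,\pi_L)$ where $A,L$ are $\mathbb{K}$-algebras, and: (1) $s_L\colon L\to A$ and $t_L\colon L^{op}\to A$ are $\mathbb{K}$-algebra homomorphisms with $s_L(l)t_L(l')=t_L(l')s_L(l)$; $A$ is an $(L,L)$-bimodule by $l\cdot a=s_L(l)a$, $a\cdot l=t_L(l)a$ (so in $A\otimes_LA$, $t_L(l)a\otimes b=a\otimes s_L(l)b$). (2) $(A,\Delta_L\colon A\to A\otimes_LA,\pi_L\colon A\to L)$ is a comonoid in $(L,L)$-bimodules such that, with $\Delta_L(a)=a_{[1]}\otimes a_{[2]}$: $a_{[1]}t_L(l)\otimes a_{[2]}=a_{[1]}\otimes a_{[2]}s_L(l)$; $\Delta_L(1_A)=1_A\otimes1_A$; $\Delta_L(ab)=\Delta_L(a)\Delta_L(b)$; $\pi_L(1_A)=1_L$; $\pi_L(as_L(\pi_L(b)))=\pi_L(ab)=\pi_L(at_L(\pi_L(b)))$. A left bialgebroid homomorphism $\mathcal{A}_L\to\mathcal{A}'_{L'}$ is a pair of $\mathbb{K}$-algebra homomorphisms $(\Phi\colon A\to A',\phi\colon L\to L')$ with $s_{L'}\circ\phi=\Phi\circ s_L$, $t_{L'}\circ\phi=\Phi\circ t_L$, $\pi_{L'}\circ\Phi=\phi\circ\pi_L$, $\Delta_{L'}\circ\Phi=(\Phi\otimes\Phi)\circ\Delta_L$.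 NOTATION. $M_\Lambda(R)$ is the $\mathbb{K}$-algebra of maps $\Lambda\to R$ (pointwise operations). $r_M$ is the constant map with value $r\in R$; $\delta_\lambda\in M_\Lambda(R)$ is $\delta_\lambda(\mu)=\delta_{\lambda,\mu}$. $G$ is the opposite group of the symmetric group on $\Lambda$, acting on $\Lambda$ on the right by $\lambda\alpha=\alpha(\lambda)$. For $\alpha\in G$, $T_\alpha\colon M_\Lambda(R)\to M_\Lambda(R)$, $T_\alpha(f)(\lambda)=f(\lambda\alpha)$. THE LEFT BIALGEBROID $A_\sigma$ (known to be one under the stated conditions on $\sigma$). Let $\Lambda X=(M_\Lambda(R)\otimes_{\mathbb{K}}M_\Lambda(R)^{op})\sqcup\{L_{ab}\mid a,b\in X\}\sqcup\{(L^{-1})_{ab}\mid a,b\in X\}$ and $\mathbb{K}\langle\Lambda X\rangle$ the free $\mathbb{K}$-algebra on the set $\Lambda X$, with empty word $\emptyset$. $A_\sigma=\mathbb{K}\langle\Lambda X\rangle/I_\sigma$, where $I_\sigma$ is the two-sided ideal generated by (write $1=1_{M_\Lambda(R)}$): (1) the elements identifying addition, scalar multiplication and multiplication of elements of $M_\Lambda(R)\otimes_{\mathbb{K}}M_\Lambda(R)^{op}$ in the free algebra with those in $M_\Lambda(R)\otimes_{\mathbb{K}}M_\Lambda(R)^{op}$; (2) $\sum_{c\in X}L_{ac}(L^{-1})_{cb}-\delta_{a,b}\emptyset$, $\sum_{c\in X}(L^{-1})_{ac}L_{cb}-\delta_{a,b}\emptyset$; (3) $(T_{\deg(a)}(f)\otimes1)L_{ab}-L_{ab}(f\otimes1)$,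 $(1\otimes T_{\deg(b)}(f))L_{ab}-L_{ab}(1\otimes f)$, $(f\otimes1)(L^{-1})_{ab}-(L^{-1})_{ab}(T_{\deg(b)}(f)\otimes1)$, $(1\otimes f)(L^{-1})_{ab}-(L^{-1})_{ab}(1\otimes T_{\deg(a)}(f))$; (4) $\sum_{x,y\in X}(\sigma^{xy}_{ac}\otimes1)L_{yd}L_{xb}-\sum_{x,y\in X}(1\otimes\sigma^{bd}_{xy})L_{cy}L_{ax}$; (5) $\emptyset-1\otimes1$; for all $a,b,c,d\in X$, $f\in M_\Lambda(R)$. Structure maps: $s(f)=f\otimes1+I_\sigma$, $t(f)=1\otimes f+I_\sigma$; $\Delta$ is the multiplicative map induced by $f\otimes g\mapsto s(f)\otimes t(g)$, $L_{ab}\mapsto\sum_{c}L_{ac}\otimes L_{cb}$, $(L^{-1})_{ab}\mapsto\sum_c(L^{-1})_{cb}\otimes(L^{-1})_{ac}$ (classes mod $I_\sigma$); $\pi(a)=\chi(a)(1)$, where $\chi\colon A_\sigma\to\mathrm{End}_{\mathbb{K}}(M_\Lambda(R))$ is the algebra homomorphism with $\chi(f\otimes g)(h)=fhg$, $\chi(L_{ab})=\delta_{a,b}T_{\deg(a)}$, $\chi((L^{-1})_{ab})=\delta_{a,b}T_{\deg(a)^{-1}}$. QUIVER DATA FROM $\sigma$. Let $Q=\Lambda\times X$ with $\mathfrak{s}(\lambda,x)=\lambda$, $\mathfrak{t}(\lambda,x)=\lambda\deg(x)$. Put $Q^{(0)}=\Lambda$ (with $\mathfrak{s}=\mathfrak{t}=\mathrm{id}$),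 $Q^{(1)}=Q$, and $Q^{(m)}=\{(q_1,\dots,q_m)\in Q^m\mid\mathfrak{t}(q_i)=\mathfrak{s}(q_{i+1})\}$ with $\mathfrak{s}(q)=\mathfrak{s}(q_1)$, $\mathfrak{t}(q)=\mathfrak{t}(q_m)$ for $m>1$. For $((\lambda,a),(\lambda',b)),((\mu,c),(\mu',d))\in Q^{(2)}$ put $\mathbf{w}^{(\lambda,a),(\lambda',b)}_{(\mu,c),(\mu',d)}=\delta_{\lambda,\mu}\sigma^{ba}_{dc}(\lambda)\in R$. THE LEFT BIALGEBROID $\mathfrak{A}(w_\sigma)$. $\mathfrak{G}(Q)$ is the $\mathbb{K}$-algebra with basis $\mathbf{e}^{p}_{q}$ ($p,q\in Q^{(m)}$, $m\ge0$), product $\mathbf{e}^{p}_{q}\mathbf{e}^{p'}_{q'}=\delta_{\mathfrak{t}(p),\mathfrak{s}(p')}\delta_{\mathfrak{t}(q),\mathfrak{s}(q')}\mathbf{e}^{pp'}_{qq'}$ (concatenation, elements of $\Lambda$ being trivial paths) and unit $\sum_{\lambda,\mu}\mathbf{e}^{\lambda}_{\mu}$. $\mathfrak{H}(Q)=R\otimes_{\mathbb{K}}R^{op}\otimes_{\mathbb{K}}\mathfrak{G}(Q)$, and $\mathfrak{A}(w_\sigma)=\mathfrak{H}(Q)/\mathfrak{I}_{\mathbf{w}}$ where $\mathfrak{I}_{\mathbf{w}}$ is the two-sided ideal generated by $\sum_{(x,y)\in Q^{(2)}}\mathbf{w}^{x,y}_{a,b}\otimes1_R\otimes\mathbf{e}^{x}_{c}\mathbf{e}^{y}_{d}-\sum_{(x,y)\in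 Q^{(2)}}1_R\otimes\mathbf{w}^{c,d}_{x,y}\otimes\mathbf{e}^{a}_{x}\mathbf{e}^{b}_{y}$ for $(a,b),(c,d)\in Q^{(2)}$. Structure maps (classes mod $\mathfrak{I}_{\mathbf{w}}$): $s(f)=\sum_{\lambda,\mu}f(\lambda)\otimes1_R\otimes\mathbf{e}^{\lambda}_{\mu}$; $t(f)=\sum_{\lambda,\mu}1_R\otimes f(\lambda)\otimes\mathbf{e}^{\mu}_{\lambda}$; $\Delta(r\otimes r'\otimes\mathbf{e}^{p}_{q})=\sum_{u\in Q^{(m)}}(r\otimes1_R\otimes\mathbf{e}^{p}_{u})\otimes(1_R\otimes r'\otimes\mathbf{e}^{u}_{q})$; $\pi(r\otimes r'\otimes\mathbf{e}^{p}_{q})=\delta_{p,q}(rr')_M\delta_{\mathfrak{s}(q)}$. *)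

theory Defs
  imports "HOL-Algebra.Algebra" "HOL-Algebra.Algebraic_Closure_Type" "HOL-Library.Poly_Mapping"
begin

section \<open>Algebras over a field\<close>

text \<open>
  The ground field is a type \<open>'k\<close> of class \<open>field\<close>; \<open>ring_of_type_algebra\<close> is the same field as
  a record. Algebras are \<open>module\<close> records. The library locale \<open>algebra\<close> is not used because it
  requires the algebra to be commutative. The zero algebra is allowed.
\<close>

locale k_algebra =
  module "ring_of_type_algebra :: 'k ring" A + A: ring A
  for A :: "('k :: field, 'a) module" (structure) +
  assumes smult_mult_left: "\<lbrakk>x \<in> carrier A; y \<in> carrier A\<rbrakk> \<Longrightarrow> (c \<odot> x) \<otimes> y = c \<odot> (x \<otimes> y)"
    and smult_mult_right: "\<lbrakk>x \<in> carrier A; y \<in> carrier A\<rbrakk> \<Longrightarrow> x \<otimes> (c \<odot> y) = c \<odot> (x \<otimes> y)"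

definition k_linear_map ::
    "('k :: field, 'a) module \<Rightarrow> ('k, 'b) module \<Rightarrow> ('a \<Rightarrow> 'b) set" where
  "k_linear_map A B = {f \<in> hom (add_monoid A) (add_monoid B).
     \<forall>c. \<forall>x\<in>carrier A. f (c \<odot>\<^bsub>A\<^esub> x) = c \<odot>\<^bsub>B\<^esub> f x}"

definition k_algebra_hom ::
    "('k :: field, 'a) module \<Rightarrow> ('k, 'b) module \<Rightarrow> ('a \<Rightarrow> 'b) set" where
  "k_algebra_hom A B = ring_hom A B \<inter> k_linear_map A B"

definition op_algebra :: "('k, 'a) module \<Rightarrow> ('k, 'a) module" where
  "op_algebra A = A\<lparr>monoid.mult := \<lambda>x y. y \<otimes>\<^bsub>A\<^esub> x\<rparr>"

definition center :: "('k, 'a) module \<Rightarrow> 'a set" where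
  "center A = {z \<in> carrier A. \<forall>x\<in>carrier A. z \<otimes>\<^bsub>A\<^esub> x = x \<otimes>\<^bsub>A\<^esub> z}"

definition quot_algebra :: "('k, 'a) module \<Rightarrow> 'a set \<Rightarrow> ('k, 'a set) module" where
  "quot_algebra A I =
     \<lparr>carrier = carrier (A Quot I), monoid.mult = monoid.mult (A Quot I), one = one (A Quot I),
      ring.zero = ring.zero (A Quot I), add = add (A Quot I),
      module.smult = (\<lambda>c U. \<Union>u\<in>U. I +>\<^bsub>A\<^esub> (c \<odot>\<^bsub>A\<^esub> u))\<rparr>"

text \<open>The map on cosets induced by a map that is constant on each coset.\<close>

definition induced :: "('a \<Rightarrow> 'b) \<Rightarrow> 'a set \<Rightarrow> 'b" where
  "induced h U = the_elem (h ` U)"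


section \<open>Tensor products\<close>

text \<open>
  \<open>M \<otimes>\<^sub>S N\<close> for a right action \<open>ra\<close> of \<open>S\<close> on \<open>M\<close> and a left action \<open>la\<close> of \<open>S\<close> on \<open>N\<close>: the free
  abelian group on \<open>carrier M \<times> carrier N\<close> modulo the subgroup generated by the biadditivity and
  balancing relations. Only the additive structures of \<open>M\<close> and \<open>N\<close> enter.
\<close>

definition balanced_rels ::
    "'s set \<Rightarrow> ('m \<Rightarrow> 's \<Rightarrow> 'm) \<Rightarrow> ('s \<Rightarrow> 'n \<Rightarrow> 'n) \<Rightarrow> ('k, 'm) module \<Rightarrow> ('k, 'n) module
      \<Rightarrow> ('m \<times> 'n \<Rightarrow>\<^sub>0 int) set" where
  "balanced_rels S ra la M N =
     {frag_of (x \<oplus>\<^bsub>M\<^esub> x', y) - frag_of (x, y) - frag_of (x', y) | x x' y.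
        x \<in> carrier M \<and> x' \<in> carrier M \<and> y \<in> carrier N} \<union>
     {frag_of (x, y \<oplus>\<^bsub>N\<^esub> y') - frag_of (x, y) - frag_of (x, y') | x y y'.
        x \<in> carrier M \<and> y \<in> carrier N \<and> y' \<in> carrier N} \<union>
     {frag_of (ra x l, y) - frag_of (x, la l y) | x l y.
        x \<in> carrier M \<and> l \<in> S \<and> y \<in> carrier N}"

definition balanced_null ::
    "'s set \<Rightarrow> ('m \<Rightarrow> 's \<Rightarrow> 'm) \<Rightarrow> ('s \<Rightarrow> 'n \<Rightarrow> 'n) \<Rightarrow> ('k, 'm) module \<Rightarrow> ('k, 'n) module
      \<Rightarrow> ('m \<times> 'n \<Rightarrow>\<^sub>0 int) set" where
  "balanced_null S ra la M N =
     generate (free_Abelian_group (carrier M \<times> carrier N)) (balanced_rels S ra la M N)"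

definition tensor_elt ::
    "'s set \<Rightarrow> ('m \<Rightarrow> 's \<Rightarrow> 'm) \<Rightarrow> ('s \<Rightarrow> 'n \<Rightarrow> 'n) \<Rightarrow> ('k, 'm) module \<Rightarrow> ('k, 'n) module
      \<Rightarrow> 'm \<Rightarrow> 'n \<Rightarrow> ('m \<times> 'n \<Rightarrow>\<^sub>0 int) set" where
  "tensor_elt S ra la M N x y =
     balanced_null S ra la M N #>\<^bsub>free_Abelian_group (carrier M \<times> carrier N)\<^esub> frag_of (x, y)"

text \<open>\<open>tensor_lift T v\<close> is the additive map into \<open>T\<close> with \<open>x \<otimes> y \<mapsto> v x y\<close>, for biadditive balanced \<open>v\<close>.\<close>

definition tensor_lift ::
    "('t, 'z) ring_scheme \<Rightarrow> ('m \<Rightarrow> 'n \<Rightarrow> 't) \<Rightarrow> ('m \<times> 'n \<Rightarrow>\<^sub>0 int) set \<Rightarrow> 't" where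
  "tensor_lift T v =
     induced (\<lambda>u. \<Oplus>\<^bsub>T\<^esub>z\<in>Poly_Mapping.keys u.
       [Poly_Mapping.lookup u z] \<cdot>\<^bsub>T\<^esub> v (fst z) (snd z))"

definition tensor_group ::
    "'s set \<Rightarrow> ('m \<Rightarrow> 's \<Rightarrow> 'm) \<Rightarrow> ('s \<Rightarrow> 'n \<Rightarrow> 'n) \<Rightarrow> ('k, 'm) module \<Rightarrow> ('k, 'n) module
      \<Rightarrow> ('m \<times> 'n \<Rightarrow>\<^sub>0 int) set ring" where
  "tensor_group S ra la M N =
     (let Q = free_Abelian_group (carrier M \<times> carrier N) Mod balanced_null S ra la M N
      in \<lparr>carrier = carrier Q, monoid.mult = undefined, one = undefined,
          ring.zero = \<one>\<^bsub>Q\<^esub>, add = (\<otimes>\<^bsub>Q\<^esub>)\<rparr>)"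

text \<open>
  The product is induced by \<open>(x \<otimes> y)(x' \<otimes> y') = xx' \<otimes> yy'\<close>. For a tensor product of algebras over
  the ground field it is defined everywhere. For \<open>A \<otimes>\<^sub>L A\<close> of a left bialgebroid it makes sense for
  every right factor when the left factor \<open>U\<close> satisfies \<open>U (t l \<otimes> 1) = U (1 \<otimes> s l)\<close>; the lift
  over \<open>V\<close> therefore has to be the outer one.
\<close>

definition tensor ::
    "'s set \<Rightarrow> ('m \<Rightarrow> 's \<Rightarrow> 'm) \<Rightarrow> ('s \<Rightarrow> 'n \<Rightarrow> 'n) \<Rightarrow> ('k, 'm) module \<Rightarrow> ('k, 'n) module
      \<Rightarrow> ('k, ('m \<times> 'n \<Rightarrow>\<^sub>0 int) set) module" where
  "tensor S ra la M N =
     (let T = tensor_group S ra la M N; el = tensor_elt S ra la M N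
      in \<lparr>carrier = carrier T,
          monoid.mult = (\<lambda>U V. tensor_lift T
                   (\<lambda>x' y'. tensor_lift T (\<lambda>x y. el (x \<otimes>\<^bsub>M\<^esub> x') (y \<otimes>\<^bsub>N\<^esub> y')) U) V),
          one = el \<one>\<^bsub>M\<^esub> \<one>\<^bsub>N\<^esub>, ring.zero = \<zero>\<^bsub>T\<^esub>, add = (\<oplus>\<^bsub>T\<^esub>),
          module.smult = (\<lambda>c. tensor_lift T (\<lambda>x y. el (c \<odot>\<^bsub>M\<^esub> x) y))\<rparr>)"

definition tensor_algebra ::
    "('k, 'm) module \<Rightarrow> ('k, 'n) module \<Rightarrow> ('k, ('m \<times> 'n \<Rightarrow>\<^sub>0 int) set) module" where
  "tensor_algebra A B = tensor UNIV (\<lambda>x c. c \<odot>\<^bsub>A\<^esub> x) (\<lambda>c y. c \<odot>\<^bsub>B\<^esub> y) A B"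

definition pure_tensor ::
    "('k, 'm) module \<Rightarrow> ('k, 'n) module \<Rightarrow> 'm \<Rightarrow> 'n \<Rightarrow> ('m \<times> 'n \<Rightarrow>\<^sub>0 int) set" where
  "pure_tensor A B = tensor_elt UNIV (\<lambda>x c. c \<odot>\<^bsub>A\<^esub> x) (\<lambda>c y. c \<odot>\<^bsub>B\<^esub> y) A B"


section \<open>Left bialgebroids\<close>

locale bialgebroid_data =
  fixes A :: "('k :: field, 'a) module" and L :: "('k, 'l) module"
    and s :: "'l \<Rightarrow> 'a" and t :: "'l \<Rightarrow> 'a"
    and \<Delta> :: "'a \<Rightarrow> ('a \<times> 'a \<Rightarrow>\<^sub>0 int) set" and \<pi> :: "'a \<Rightarrow> 'l"
begin

text \<open>\<open>AA\<close> is \<open>A \<otimes>\<^sub>L A\<close>, with \<open>t l a \<otimes> b = a \<otimes> s l b\<close>.\<close>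

definition AA :: "('k, ('a \<times> 'a \<Rightarrow>\<^sub>0 int) set) module" where
  "AA = tensor (carrier L) (\<lambda>a l. t l \<otimes>\<^bsub>A\<^esub> a) (\<lambda>l b. s l \<otimes>\<^bsub>A\<^esub> b) A A"

definition elt2 :: "'a \<Rightarrow> 'a \<Rightarrow> ('a \<times> 'a \<Rightarrow>\<^sub>0 int) set" where
  "elt2 = tensor_elt (carrier L) (\<lambda>a l. t l \<otimes>\<^bsub>A\<^esub> a) (\<lambda>l b. s l \<otimes>\<^bsub>A\<^esub> b) A A"

definition lact2 :: "'l \<Rightarrow> ('a \<times> 'a \<Rightarrow>\<^sub>0 int) set \<Rightarrow> ('a \<times> 'a \<Rightarrow>\<^sub>0 int) set" where
  "lact2 l = tensor_lift AA (\<lambda>a b. elt2 (s l \<otimes>\<^bsub>A\<^esub> a) b)"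

definition ract2 :: "('a \<times> 'a \<Rightarrow>\<^sub>0 int) set \<Rightarrow> 'l \<Rightarrow> ('a \<times> 'a \<Rightarrow>\<^sub>0 int) set" where
  "ract2 U l = tensor_lift AA (\<lambda>a b. elt2 a (t l \<otimes>\<^bsub>A\<^esub> b)) U"

text \<open>\<open>AA_A\<close> and \<open>A_AA\<close> are \<open>(A \<otimes>\<^sub>L A) \<otimes>\<^sub>L A\<close> and \<open>A \<otimes>\<^sub>L (A \<otimes>\<^sub>L A)\<close>.\<close>

definition AA_A where
  "AA_A = tensor (carrier L) ract2 (\<lambda>l b. s l \<otimes>\<^bsub>A\<^esub> b) AA A"

definition elt_AA_A where
  "elt_AA_A = tensor_elt (carrier L) ract2 (\<lambda>l b. s l \<otimes>\<^bsub>A\<^esub> b) AA A"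

definition A_AA where
  "A_AA = tensor (carrier L) (\<lambda>a l. t l \<otimes>\<^bsub>A\<^esub> a) lact2 A AA"

definition elt_A_AA where
  "elt_A_AA = tensor_elt (carrier L) (\<lambda>a l. t l \<otimes>\<^bsub>A\<^esub> a) lact2 A AA"

definition associator where
  "associator = tensor_lift A_AA
     (\<lambda>U c. tensor_lift A_AA (\<lambda>a b. elt_A_AA a (elt2 b c)) U)"

end

locale left_bialgebroid = bialgebroid_data +
  assumes algebra_A: "k_algebra A"
    and algebra_L: "k_algebra L"
    and s_hom: "s \<in> k_algebra_hom L A"
    and t_hom: "t \<in> k_algebra_hom (op_algebra L) A"
    and s_t_commute: "\<lbrakk>l \<in> carrier L; l' \<in> carrier L\<rbrakk> \<Longrightarrow> s l \<otimes>\<^bsub>A\<^esub> t l' = t l' \<otimes>\<^bsub>A\<^esub> s l"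
    and comult_additive: "\<Delta> \<in> hom (add_monoid A) (add_monoid AA)"
    and comult_left: "\<lbrakk>l \<in> carrier L; a \<in> carrier A\<rbrakk> \<Longrightarrow> \<Delta> (s l \<otimes>\<^bsub>A\<^esub> a) = lact2 l (\<Delta> a)"
    and comult_right: "\<lbrakk>l \<in> carrier L; a \<in> carrier A\<rbrakk> \<Longrightarrow> \<Delta> (t l \<otimes>\<^bsub>A\<^esub> a) = ract2 (\<Delta> a) l"
    and counit_additive: "\<pi> \<in> hom (add_monoid A) (add_monoid L)"
    and counit_left: "\<lbrakk>l \<in> carrier L; a \<in> carrier A\<rbrakk> \<Longrightarrow> \<pi> (s l \<otimes>\<^bsub>A\<^esub> a) = l \<otimes>\<^bsub>L\<^esub> \<pi> a"
    and counit_right: "\<lbrakk>l \<in> carrier L; a \<in> carrier A\<rbrakk> \<Longrightarrow> \<pi> (t l \<otimes>\<^bsub>A\<^esub> a) = \<pi> a \<otimes>\<^bsub>L\<^esub> l"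
    and coassociative: "a \<in> carrier A \<Longrightarrow>
      associator (tensor_lift AA_A (\<lambda>x y. elt_AA_A (\<Delta> x) y) (\<Delta> a)) =
      tensor_lift A_AA (\<lambda>x y. elt_A_AA x (\<Delta> y)) (\<Delta> a)"
    and counital_left: "a \<in> carrier A \<Longrightarrow> tensor_lift A (\<lambda>x y. s (\<pi> x) \<otimes>\<^bsub>A\<^esub> y) (\<Delta> a) = a"
    and counital_right: "a \<in> carrier A \<Longrightarrow> tensor_lift A (\<lambda>x y. t (\<pi> y) \<otimes>\<^bsub>A\<^esub> x) (\<Delta> a) = a"
    and comult_balanced: "\<lbrakk>l \<in> carrier L; a \<in> carrier A\<rbrakk> \<Longrightarrow>
      tensor_lift AA (\<lambda>x y. elt2 (x \<otimes>\<^bsub>A\<^esub> t l) y) (\<Delta> a) =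
      tensor_lift AA (\<lambda>x y. elt2 x (y \<otimes>\<^bsub>A\<^esub> s l)) (\<Delta> a)"
    and comult_one: "\<Delta> \<one>\<^bsub>A\<^esub> = elt2 \<one>\<^bsub>A\<^esub> \<one>\<^bsub>A\<^esub>"
    and comult_mult: "\<lbrakk>a \<in> carrier A; b \<in> carrier A\<rbrakk> \<Longrightarrow> \<Delta> (a \<otimes>\<^bsub>A\<^esub> b) = \<Delta> a \<otimes>\<^bsub>AA\<^esub> \<Delta> b"
    and counit_one: "\<pi> \<one>\<^bsub>A\<^esub> = \<one>\<^bsub>L\<^esub>"
    and counit_mult_s: "\<lbrakk>a \<in> carrier A; b \<in> carrier A\<rbrakk> \<Longrightarrow> \<pi> (a \<otimes>\<^bsub>A\<^esub> s (\<pi> b)) = \<pi> (a \<otimes>\<^bsub>A\<^esub> b)"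
    and counit_mult_t: "\<lbrakk>a \<in> carrier A; b \<in> carrier A\<rbrakk> \<Longrightarrow> \<pi> (a \<otimes>\<^bsub>A\<^esub> t (\<pi> b)) = \<pi> (a \<otimes>\<^bsub>A\<^esub> b)"

locale left_bialgebroid_hom =
  source: left_bialgebroid A L s t \<Delta> \<pi> + target: left_bialgebroid A' L' s' t' \<Delta>' \<pi>'
  for A :: "('k :: field, 'a) module" and L :: "('k, 'l) module" and s t \<Delta> \<pi>
    and A' :: "('k, 'b) module" and L' :: "('k, 'm) module" and s' t' \<Delta>' \<pi>' +
  fixes \<Phi> :: "'a \<Rightarrow> 'b" and \<phi> :: "'l \<Rightarrow> 'm"
  assumes total_hom: "\<Phi> \<in> k_algebra_hom A A'"
    and base_hom: "\<phi> \<in> k_algebra_hom L L'"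
    and s_compat: "l \<in> carrier L \<Longrightarrow> s' (\<phi> l) = \<Phi> (s l)"
    and t_compat: "l \<in> carrier L \<Longrightarrow> t' (\<phi> l) = \<Phi> (t l)"
    and counit_compat: "a \<in> carrier A \<Longrightarrow> \<pi>' (\<Phi> a) = \<phi> (\<pi> a)"
    and comult_compat: "a \<in> carrier A \<Longrightarrow>
      \<Delta>' (\<Phi> a) = tensor_lift target.AA (\<lambda>x y. target.elt2 (\<Phi> x) (\<Phi> y)) (\<Delta> a)"


section \<open>Maps from \<open>\<Lambda>\<close> to \<open>R\<close>\<close>

text \<open>The non-empty finite set \<open>\<Lambda>\<close> is a type \<open>'l :: finite\<close>, elements of \<open>G\<close> are its bijections.
  The finite set \<open>X\<close> and the map \<open>deg\<close> are called \<open>XX\<close> and \<open>dg\<close>, because \<open>X\<close> and \<open>deg\<close> are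
  already syntax and a constant of \<open>HOL-Algebra\<close>.\<close>

abbreviation (input) right_action :: "'l \<Rightarrow> ('l \<Rightarrow> 'l) \<Rightarrow> 'l" (infixl "\<triangleleft>" 75) where
  "l \<triangleleft> \<alpha> \<equiv> \<alpha> l"

definition map_algebra :: "('k, 'r) module \<Rightarrow> ('k, 'l :: finite \<Rightarrow> 'r) module" where
  "map_algebra R =
     \<lparr>carrier = {f. \<forall>l. f l \<in> carrier R}, monoid.mult = (\<lambda>f g l. f l \<otimes>\<^bsub>R\<^esub> g l), one = (\<lambda>l. \<one>\<^bsub>R\<^esub>),
      ring.zero = (\<lambda>l. \<zero>\<^bsub>R\<^esub>), add = (\<lambda>f g l. f l \<oplus>\<^bsub>R\<^esub> g l), module.smult = (\<lambda>c f l. c \<odot>\<^bsub>R\<^esub> f l)\<rparr>"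

definition const_map :: "'r \<Rightarrow> 'l \<Rightarrow> 'r" where
  "const_map r = (\<lambda>l. r)"

definition delta_map :: "('k, 'r) module \<Rightarrow> 'l \<Rightarrow> 'l \<Rightarrow> 'r" where
  "delta_map R l = (\<lambda>m. if l = m then \<one>\<^bsub>R\<^esub> else \<zero>\<^bsub>R\<^esub>)"

definition shift :: "('l \<Rightarrow> 'l) \<Rightarrow> ('l \<Rightarrow> 'r) \<Rightarrow> 'l \<Rightarrow> 'r" where
  "shift \<alpha> f = (\<lambda>l. f (l \<triangleleft> \<alpha>))"


section \<open>The left bialgebroid \<open>A\<^sub>\<sigma>\<close>\<close>

subsection \<open>Free algebras\<close>

definition free_algebra :: "'g set \<Rightarrow> ('k :: field, 'g list \<Rightarrow>\<^sub>0 'k) module" where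
  "free_algebra S =
     \<lparr>carrier = {f. Poly_Mapping.keys f \<subseteq> lists S},
      monoid.mult = (\<lambda>f g. \<Sum>u\<in>Poly_Mapping.keys f. \<Sum>v\<in>Poly_Mapping.keys g.
        Poly_Mapping.single (u @ v) (Poly_Mapping.lookup f u * Poly_Mapping.lookup g v)),
      one = Poly_Mapping.single [] 1, ring.zero = 0, add = (+),
      module.smult = (\<lambda>c. Poly_Mapping.map (\<lambda>d. c * d))\<rparr>"

abbreviation word :: "'g list \<Rightarrow> 'g list \<Rightarrow>\<^sub>0 ('k :: field)" where
  "word w \<equiv> Poly_Mapping.single w 1"

definition free_eval ::
    "('k :: field, 't) module \<Rightarrow> ('g \<Rightarrow> 't) \<Rightarrow> ('g list \<Rightarrow>\<^sub>0 'k) \<Rightarrow> 't" where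
  "free_eval T \<phi> f = (\<Oplus>\<^bsub>T\<^esub>w\<in>Poly_Mapping.keys f.
     Poly_Mapping.lookup f w \<odot>\<^bsub>T\<^esub> foldr (\<lambda>g x. \<phi> g \<otimes>\<^bsub>T\<^esub> x) w \<one>\<^bsub>T\<^esub>)"

subsection \<open>Generators and relations\<close>

text \<open>\<open>\<sigma> a b c d\<close> stands for \<open>\<sigma>\<close> with upper indices \<open>a b\<close> and lower indices \<open>c d\<close>.\<close>

type_synonym ('l, 'r) map_tensor = "(('l \<Rightarrow> 'r) \<times> ('l \<Rightarrow> 'r) \<Rightarrow>\<^sub>0 int) set"

datatype ('m, 'x) generator = Gen_ten 'm | Gen_L 'x 'x | Gen_Linv 'x 'x

type_synonym ('l, 'r, 'x) gen = "(('l, 'r) map_tensor, 'x) generator"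

definition MMop :: "('k, 'r) module \<Rightarrow> ('k, ('l :: finite, 'r) map_tensor) module" where
  "MMop R = tensor_algebra (map_algebra R) (op_algebra (map_algebra R))"

definition mm :: "('k, 'r) module \<Rightarrow> ('l :: finite \<Rightarrow> 'r) \<Rightarrow> ('l \<Rightarrow> 'r) \<Rightarrow> ('l, 'r) map_tensor" where
  "mm R = pure_tensor (map_algebra R) (op_algebra (map_algebra R))"

definition LambdaX :: "('k, 'r) module \<Rightarrow> 'x set \<Rightarrow> ('l :: finite, 'r, 'x) gen set" where
  "LambdaX R XX = Gen_ten ` carrier (MMop R) \<union>
     {Gen_L a b | a b. a \<in> XX \<and> b \<in> XX} \<union> {Gen_Linv a b | a b. a \<in> XX \<and> b \<in> XX}"

definition free_LambdaX ::
    "('k :: field, 'r) module \<Rightarrow> 'x set \<Rightarrow> ('k, ('l :: finite, 'r, 'x) gen list \<Rightarrow>\<^sub>0 'k) module" where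
  "free_LambdaX R XX = free_algebra (LambdaX R XX)"

definition sigma_rels ::
    "('k :: field, 'r) module \<Rightarrow> 'x set \<Rightarrow> ('x \<Rightarrow> 'l \<Rightarrow> 'l)
      \<Rightarrow> ('x \<Rightarrow> 'x \<Rightarrow> 'x \<Rightarrow> 'x \<Rightarrow> 'l :: finite \<Rightarrow> 'r) \<Rightarrow> (('l, 'r, 'x) gen list \<Rightarrow>\<^sub>0 'k) set" where
  "sigma_rels R XX dg \<sigma> =
     (let M = map_algebra R; MM = MMop R; e = \<one>\<^bsub>M\<^esub>;
          lft = (\<lambda>f. Gen_ten (mm R f e)); rgt = (\<lambda>f. Gen_ten (mm R e f)) in
      {word [Gen_ten \<xi>] + word [Gen_ten \<eta>] - word [Gen_ten (\<xi> \<oplus>\<^bsub>MM\<^esub> \<eta>)] | \<xi> \<eta>.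
         \<xi> \<in> carrier MM \<and> \<eta> \<in> carrier MM} \<union>
      {Poly_Mapping.single [Gen_ten \<xi>] c - word [Gen_ten (c \<odot>\<^bsub>MM\<^esub> \<xi>)] | c \<xi>. \<xi> \<in> carrier MM} \<union>
      {word [Gen_ten \<xi>, Gen_ten \<eta>] - word [Gen_ten (\<xi> \<otimes>\<^bsub>MM\<^esub> \<eta>)] | \<xi> \<eta>.
         \<xi> \<in> carrier MM \<and> \<eta> \<in> carrier MM} \<union>
      {(\<Sum>c\<in>XX. word [Gen_L a c, Gen_Linv c b]) - (if a = b then word [] else 0) | a b.
         a \<in> XX \<and> b \<in> XX} \<union>
      {(\<Sum>c\<in>XX. word [Gen_Linv a c, Gen_L c b]) - (if a = b then word [] else 0) | a b.
         a \<in> XX \<and> b \<in> XX} \<union>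
      {word [lft (shift (dg a) f), Gen_L a b] - word [Gen_L a b, lft f] | a b f.
         a \<in> XX \<and> b \<in> XX \<and> f \<in> carrier M} \<union>
      {word [rgt (shift (dg b) f), Gen_L a b] - word [Gen_L a b, rgt f] | a b f.
         a \<in> XX \<and> b \<in> XX \<and> f \<in> carrier M} \<union>
      {word [lft f, Gen_Linv a b] - word [Gen_Linv a b, lft (shift (dg b) f)] | a b f.
         a \<in> XX \<and> b \<in> XX \<and> f \<in> carrier M} \<union>
      {word [rgt f, Gen_Linv a b] - word [Gen_Linv a b, rgt (shift (dg a) f)] | a b f.
         a \<in> XX \<and> b \<in> XX \<and> f \<in> carrier M} \<union>
      {(\<Sum>x\<in>XX. \<Sum>y\<in>XX. word [lft (\<sigma> x y a c), Gen_L y d, Gen_L x b]) -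
       (\<Sum>x\<in>XX. \<Sum>y\<in>XX. word [rgt (\<sigma> b d x y), Gen_L c y, Gen_L a x]) | a b c d.
         a \<in> XX \<and> b \<in> XX \<and> c \<in> XX \<and> d \<in> XX} \<union>
      {word [] - word [Gen_ten (mm R e e)]})"

definition I_sigma where
  "I_sigma R XX dg \<sigma> = genideal (free_LambdaX R XX) (sigma_rels R XX dg \<sigma>)"

definition A_sigma ::
    "('k :: field, 'r) module \<Rightarrow> 'x set \<Rightarrow> ('x \<Rightarrow> 'l \<Rightarrow> 'l)
      \<Rightarrow> ('x \<Rightarrow> 'x \<Rightarrow> 'x \<Rightarrow> 'x \<Rightarrow> 'l :: finite \<Rightarrow> 'r)
      \<Rightarrow> ('k, (('l, 'r, 'x) gen list \<Rightarrow>\<^sub>0 'k) set) module" where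
  "A_sigma R XX dg \<sigma> = quot_algebra (free_LambdaX R XX) (I_sigma R XX dg \<sigma>)"

definition cls_sigma ::
    "('k :: field, 'r) module \<Rightarrow> 'x set \<Rightarrow> ('x \<Rightarrow> 'l \<Rightarrow> 'l)
      \<Rightarrow> ('x \<Rightarrow> 'x \<Rightarrow> 'x \<Rightarrow> 'x \<Rightarrow> 'l :: finite \<Rightarrow> 'r)
      \<Rightarrow> (('l, 'r, 'x) gen list \<Rightarrow>\<^sub>0 'k) \<Rightarrow> (('l, 'r, 'x) gen list \<Rightarrow>\<^sub>0 'k) set" where
  "cls_sigma R XX dg \<sigma> f = I_sigma R XX dg \<sigma> +>\<^bsub>free_LambdaX R XX\<^esub> f"

subsection \<open>Structure maps\<close>

definition s_sigma where
  "s_sigma R XX dg \<sigma> f = cls_sigma R XX dg \<sigma> (word [Gen_ten (mm R f \<one>\<^bsub>map_algebra R\<^esub>)])"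

definition t_sigma where
  "t_sigma R XX dg \<sigma> f = cls_sigma R XX dg \<sigma> (word [Gen_ten (mm R \<one>\<^bsub>map_algebra R\<^esub> f)])"

definition AA_sigma where
  "AA_sigma R XX dg \<sigma> = bialgebroid_data.AA (A_sigma R XX dg \<sigma>) (map_algebra R)
     (s_sigma R XX dg \<sigma>) (t_sigma R XX dg \<sigma>)"

definition elt2_sigma where
  "elt2_sigma R XX dg \<sigma> = bialgebroid_data.elt2 (A_sigma R XX dg \<sigma>) (map_algebra R)
     (s_sigma R XX dg \<sigma>) (t_sigma R XX dg \<sigma>)"

fun comult_sigma_gen where
  "comult_sigma_gen R XX dg \<sigma> (Gen_ten \<xi>) =
     tensor_lift (AA_sigma R XX dg \<sigma>)
       (\<lambda>f g. elt2_sigma R XX dg \<sigma> (s_sigma R XX dg \<sigma> f) (t_sigma R XX dg \<sigma> g)) \<xi>"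
| "comult_sigma_gen R XX dg \<sigma> (Gen_L a b) =
     (\<Oplus>\<^bsub>AA_sigma R XX dg \<sigma>\<^esub>c\<in>XX. elt2_sigma R XX dg \<sigma>
        (cls_sigma R XX dg \<sigma> (word [Gen_L a c])) (cls_sigma R XX dg \<sigma> (word [Gen_L c b])))"
| "comult_sigma_gen R XX dg \<sigma> (Gen_Linv a b) =
     (\<Oplus>\<^bsub>AA_sigma R XX dg \<sigma>\<^esub>c\<in>XX. elt2_sigma R XX dg \<sigma>
        (cls_sigma R XX dg \<sigma> (word [Gen_Linv c b])) (cls_sigma R XX dg \<sigma> (word [Gen_Linv a c])))"

definition comult_sigma where
  "comult_sigma R XX dg \<sigma> =
     induced (free_eval (AA_sigma R XX dg \<sigma>) (comult_sigma_gen R XX dg \<sigma>))"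

text \<open>
  \<open>chi_gen\<close> and \<open>chi\<close> give the action on \<open>M\<^sub>\<Lambda>(R)\<close> of the generators and of the elements of \<open>A\<^sub>\<sigma>\<close>
  under \<open>\<chi>\<close>; the product of endomorphisms is composition.
\<close>

fun chi_gen ::
    "('k :: field, 'r) module \<Rightarrow> ('x \<Rightarrow> 'l \<Rightarrow> 'l) \<Rightarrow> ('l :: finite, 'r, 'x) gen
      \<Rightarrow> ('l \<Rightarrow> 'r) \<Rightarrow> 'l \<Rightarrow> 'r" where
  "chi_gen R dg (Gen_ten \<xi>) h =
     tensor_lift (map_algebra R) (\<lambda>f g. f \<otimes>\<^bsub>map_algebra R\<^esub> h \<otimes>\<^bsub>map_algebra R\<^esub> g) \<xi>"
| "chi_gen R dg (Gen_L a b) h = (if a = b then shift (dg a) h else \<zero>\<^bsub>map_algebra R\<^esub>)"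
| "chi_gen R dg (Gen_Linv a b) h =
     (if a = b then shift (inv_into UNIV (dg a)) h else \<zero>\<^bsub>map_algebra R\<^esub>)"

definition chi ::
    "('k :: field, 'r) module \<Rightarrow> ('x \<Rightarrow> 'l \<Rightarrow> 'l) \<Rightarrow> (('l :: finite, 'r, 'x) gen list \<Rightarrow>\<^sub>0 'k) set
      \<Rightarrow> ('l \<Rightarrow> 'r) \<Rightarrow> 'l \<Rightarrow> 'r" where
  "chi R dg U h = induced (\<lambda>f. \<Oplus>\<^bsub>map_algebra R\<^esub>w\<in>Poly_Mapping.keys f.
     Poly_Mapping.lookup f w \<odot>\<^bsub>map_algebra R\<^esub> foldr (chi_gen R dg) w h) U"

definition counit_sigma where
  "counit_sigma R dg U = chi R dg U \<one>\<^bsub>map_algebra R\<^esub>"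


section \<open>The left bialgebroid of the quiver\<close>

subsection \<open>Paths\<close>

text \<open>
  A path of length \<open>m\<close> is a pair of its source and its list of \<open>m\<close> arrows. For \<open>m > 0\<close> the first
  component is determined by the list; for \<open>m = 0\<close> the path is the vertex given by it.
\<close>

type_synonym ('l, 'x) arrow = "'l \<times> 'x"
type_synonym ('l, 'x) path = "'l \<times> ('l, 'x) arrow list"

definition arrow_tgt :: "('x \<Rightarrow> 'l \<Rightarrow> 'l) \<Rightarrow> ('l, 'x) arrow \<Rightarrow> 'l" where
  "arrow_tgt dg q = fst q \<triangleleft> dg (snd q)"

definition arrows2 :: "'x set \<Rightarrow> ('x \<Rightarrow> 'l \<Rightarrow> 'l) \<Rightarrow> (('l, 'x) arrow \<times> ('l, 'x) arrow) set" where
  "arrows2 XX dg = {(x, y). snd x \<in> XX \<and> snd y \<in> XX \<and> arrow_tgt dg x = fst y}"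

definition paths :: "'x set \<Rightarrow> ('x \<Rightarrow> 'l \<Rightarrow> 'l) \<Rightarrow> nat \<Rightarrow> ('l, 'x) path set" where
  "paths XX dg m = {(l, qs). length qs = m \<and> set qs \<subseteq> UNIV \<times> XX \<and>
     (qs \<noteq> [] \<longrightarrow> fst (hd qs) = l) \<and>
     (\<forall>i. Suc i < m \<longrightarrow> arrow_tgt dg (qs ! i) = fst (qs ! Suc i))}"

definition path_tgt :: "('x \<Rightarrow> 'l \<Rightarrow> 'l) \<Rightarrow> ('l, 'x) path \<Rightarrow> 'l" where
  "path_tgt dg p = (if snd p = [] then fst p else arrow_tgt dg (last (snd p)))"

definition path_append :: "('l, 'x) path \<Rightarrow> ('l, 'x) path \<Rightarrow> ('l, 'x) path" where
  "path_append p p' = (fst p, snd p @ snd p')"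

definition vertex :: "'l \<Rightarrow> ('l, 'x) path" where
  "vertex l = (l, [])"

definition arrow_path :: "('l, 'x) arrow \<Rightarrow> ('l, 'x) path" where
  "arrow_path q = (fst q, [q])"

subsection \<open>The algebras\<close>

type_synonym ('l, 'x, 'k) path_vec = "('l, 'x) path \<times> ('l, 'x) path \<Rightarrow>\<^sub>0 'k"

abbreviation ee :: "('l, 'x) path \<Rightarrow> ('l, 'x) path \<Rightarrow> ('l, 'x, 'k :: field) path_vec" where
  "ee p q \<equiv> Poly_Mapping.single (p, q) 1"

definition path_algebra ::
    "'x set \<Rightarrow> ('x \<Rightarrow> 'l :: finite \<Rightarrow> 'l) \<Rightarrow> ('k :: field, ('l, 'x, 'k) path_vec) module" where
  "path_algebra XX dg =
     \<lparr>carrier = {f. Poly_Mapping.keys f \<subseteq> (\<Union>m. paths XX dg m \<times> paths XX dg m)},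
      monoid.mult = (\<lambda>f g. \<Sum>(p, q)\<in>Poly_Mapping.keys f. \<Sum>(p', q')\<in>Poly_Mapping.keys g.
        if path_tgt dg p = fst p' \<and> path_tgt dg q = fst q'
        then Poly_Mapping.single (path_append p p', path_append q q')
          (Poly_Mapping.lookup f (p, q) * Poly_Mapping.lookup g (p', q'))
        else 0),
      one = (\<Sum>l\<in>UNIV. \<Sum>m\<in>UNIV. ee (vertex l) (vertex m)), ring.zero = 0, add = (+),
      module.smult = (\<lambda>c. Poly_Mapping.map (\<lambda>d. c * d))\<rparr>"

type_synonym ('l, 'x, 'r, 'k) h_elt =
  "(('r \<times> 'r \<Rightarrow>\<^sub>0 int) set \<times> ('l, 'x, 'k) path_vec \<Rightarrow>\<^sub>0 int) set"

definition HQ ::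
    "('k :: field, 'r) module \<Rightarrow> 'x set \<Rightarrow> ('x \<Rightarrow> 'l :: finite \<Rightarrow> 'l)
      \<Rightarrow> ('k, ('l, 'x, 'r, 'k) h_elt) module" where
  "HQ R XX dg = tensor_algebra (tensor_algebra R (op_algebra R)) (path_algebra XX dg)"

definition hten ::
    "('k :: field, 'r) module \<Rightarrow> 'x set \<Rightarrow> ('x \<Rightarrow> 'l :: finite \<Rightarrow> 'l)
      \<Rightarrow> 'r \<Rightarrow> 'r \<Rightarrow> ('l, 'x, 'k) path_vec \<Rightarrow> ('l, 'x, 'r, 'k) h_elt" where
  "hten R XX dg r r' g = pure_tensor (tensor_algebra R (op_algebra R)) (path_algebra XX dg)
     (pure_tensor R (op_algebra R) r r') g"

text \<open>\<open>w_sigma R \<sigma> x y a b\<close> has upper indices \<open>x, y\<close> and lower indices \<open>a, b\<close>.\<close>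

definition w_sigma ::
    "('k, 'r) module \<Rightarrow> ('x \<Rightarrow> 'x \<Rightarrow> 'x \<Rightarrow> 'x \<Rightarrow> 'l \<Rightarrow> 'r)
      \<Rightarrow> ('l, 'x) arrow \<Rightarrow> ('l, 'x) arrow \<Rightarrow> ('l, 'x) arrow \<Rightarrow> ('l, 'x) arrow \<Rightarrow> 'r" where
  "w_sigma R \<sigma> x y a b =
     (if fst x = fst a then \<sigma> (snd y) (snd x) (snd b) (snd a) (fst x) else \<zero>\<^bsub>R\<^esub>)"

definition w_rels ::
    "('k :: field, 'r) module \<Rightarrow> 'x set \<Rightarrow> ('x \<Rightarrow> 'l \<Rightarrow> 'l)
      \<Rightarrow> ('x \<Rightarrow> 'x \<Rightarrow> 'x \<Rightarrow> 'x \<Rightarrow> 'l :: finite \<Rightarrow> 'r) \<Rightarrow> ('l, 'x, 'r, 'k) h_elt set" where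
  "w_rels R XX dg \<sigma> =
     (let H = HQ R XX dg; G = path_algebra XX dg; w = w_sigma R \<sigma>;
          E = (\<lambda>x y. ee (arrow_path x) (arrow_path y)) in
      {(\<Oplus>\<^bsub>H\<^esub>z\<in>arrows2 XX dg.
          hten R XX dg (w (fst z) (snd z) a b) \<one>\<^bsub>R\<^esub> (E (fst z) c \<otimes>\<^bsub>G\<^esub> E (snd z) d))
       \<ominus>\<^bsub>H\<^esub> (\<Oplus>\<^bsub>H\<^esub>z\<in>arrows2 XX dg.
          hten R XX dg \<one>\<^bsub>R\<^esub> (w c d (fst z) (snd z)) (E a (fst z) \<otimes>\<^bsub>G\<^esub> E b (snd z)))
       | a b c d. (a, b) \<in> arrows2 XX dg \<and> (c, d) \<in> arrows2 XX dg})"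

definition I_w where
  "I_w R XX dg \<sigma> = genideal (HQ R XX dg) (w_rels R XX dg \<sigma>)"

definition A_w ::
    "('k :: field, 'r) module \<Rightarrow> 'x set \<Rightarrow> ('x \<Rightarrow> 'l \<Rightarrow> 'l)
      \<Rightarrow> ('x \<Rightarrow> 'x \<Rightarrow> 'x \<Rightarrow> 'x \<Rightarrow> 'l :: finite \<Rightarrow> 'r)
      \<Rightarrow> ('k, ('l, 'x, 'r, 'k) h_elt set) module" where
  "A_w R XX dg \<sigma> = quot_algebra (HQ R XX dg) (I_w R XX dg \<sigma>)"

definition cls_w ::
    "('k :: field, 'r) module \<Rightarrow> 'x set \<Rightarrow> ('x \<Rightarrow> 'l \<Rightarrow> 'l)
      \<Rightarrow> ('x \<Rightarrow> 'x \<Rightarrow> 'x \<Rightarrow> 'x \<Rightarrow> 'l :: finite \<Rightarrow> 'r)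
      \<Rightarrow> ('l, 'x, 'r, 'k) h_elt \<Rightarrow> ('l, 'x, 'r, 'k) h_elt set" where
  "cls_w R XX dg \<sigma> h = I_w R XX dg \<sigma> +>\<^bsub>HQ R XX dg\<^esub> h"

subsection \<open>Structure maps\<close>

text \<open>
  \<open>HQ_lift R T v\<close> is the additive map from \<open>HQ R XX dg\<close> to \<open>T\<close> with
  \<open>hten R XX dg r r' (ee p q) \<mapsto> v r r' p q\<close>; coefficients of the third factor are moved to the first.
\<close>

definition HQ_lift ::
    "('k :: field, 'r) module \<Rightarrow> ('t, 'z) ring_scheme
      \<Rightarrow> ('r \<Rightarrow> 'r \<Rightarrow> ('l, 'x) path \<Rightarrow> ('l, 'x) path \<Rightarrow> 't) \<Rightarrow> ('l, 'x, 'r, 'k) h_elt \<Rightarrow> 't" where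
  "HQ_lift R T v =
     tensor_lift T (\<lambda>W g. tensor_lift T (\<lambda>r r'. \<Oplus>\<^bsub>T\<^esub>z\<in>Poly_Mapping.keys g.
       v (Poly_Mapping.lookup g z \<odot>\<^bsub>R\<^esub> r) r' (fst z) (snd z)) W)"

definition s_w where
  "s_w R XX dg \<sigma> f = cls_w R XX dg \<sigma>
     (\<Oplus>\<^bsub>HQ R XX dg\<^esub>l\<in>UNIV. \<Oplus>\<^bsub>HQ R XX dg\<^esub>m\<in>UNIV.
        hten R XX dg (f l) \<one>\<^bsub>R\<^esub> (ee (vertex l) (vertex m)))"

definition t_w where
  "t_w R XX dg \<sigma> f = cls_w R XX dg \<sigma>
     (\<Oplus>\<^bsub>HQ R XX dg\<^esub>l\<in>UNIV. \<Oplus>\<^bsub>HQ R XX dg\<^esub>m\<in>UNIV.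
        hten R XX dg \<one>\<^bsub>R\<^esub> (f l) (ee (vertex m) (vertex l)))"

definition AA_w where
  "AA_w R XX dg \<sigma> = bialgebroid_data.AA (A_w R XX dg \<sigma>) (map_algebra R)
     (s_w R XX dg \<sigma>) (t_w R XX dg \<sigma>)"

definition elt2_w where
  "elt2_w R XX dg \<sigma> = bialgebroid_data.elt2 (A_w R XX dg \<sigma>) (map_algebra R)
     (s_w R XX dg \<sigma>) (t_w R XX dg \<sigma>)"

definition comult_w where
  "comult_w R XX dg \<sigma> = induced (HQ_lift R (AA_w R XX dg \<sigma>)
     (\<lambda>r r' p q. \<Oplus>\<^bsub>AA_w R XX dg \<sigma>\<^esub>u\<in>paths XX dg (length (snd p)).
        elt2_w R XX dg \<sigma> (cls_w R XX dg \<sigma> (hten R XX dg r \<one>\<^bsub>R\<^esub> (ee p u)))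
          (cls_w R XX dg \<sigma> (hten R XX dg \<one>\<^bsub>R\<^esub> r' (ee u q)))))"

definition counit_w ::
    "('k :: field, 'r) module \<Rightarrow> ('l :: finite, 'x, 'r, 'k) h_elt set \<Rightarrow> 'l \<Rightarrow> 'r" where
  "counit_w R = induced (HQ_lift R (map_algebra R)
     (\<lambda>r r' p q. if p = q then const_map (r \<otimes>\<^bsub>R\<^esub> r') \<otimes>\<^bsub>map_algebra R\<^esub> delta_map R (fst q)
        else \<zero>\<^bsub>map_algebra R\<^esub>))"

end

theory Submission
  imports Defs
begin

text \<open>
  Both algebras are built from a map \<open>s\<close> and an anti-multiplicative map \<open>t\<close> on
  \<open>M\<^sub>\<Lambda>(R)\<close> with commuting images and from elements \<open>l a b\<close> with
  \<open>l a b (s f) = s (T_a f) (l a b)\<close> and \<open>l a b (t f) = t (T_b f) (l a b)\<close>. An algebra with such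
  data is said to carry matrix coefficients (locale \<open>coefficients\<close>). There may be several matrices:
  \<open>A\<^sub>\<sigma>\<close> has \<open>L\<close> and the transpose of \<open>L\<^sup>-\<^sup>1\<close>, and \<open>\<AA>(w\<^sub>\<sigma>)\<close> has one. Transposition of \<open>L\<^sup>-\<^sup>1\<close> makes both matrices comultiply by the same formula.

  The proof rests on two universal properties. An algebra with matrix coefficients that satisfy the
  quadratic relations of \<open>A\<^sub>\<sigma>\<close> receives a unique homomorphism from \<open>\<AA>(w\<^sub>\<sigma>)\<close> that respects \<open>s\<close>, \<open>t\<close> and
  \<open>l\<close>; if its matrix is invertible, it also receives one from \<open>A\<^sub>\<sigma>\<close>. For \<open>A\<^sub>\<sigma>\<close> this is its
  presentation. For \<open>\<AA>(w\<^sub>\<sigma>)\<close> it holds because \<open>\<HH>(Q)\<close> is itself spanned by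
  \<open>s f (t g) l\<dots>l\<close>: the idempotents of the paths with a given source turn \<open>R\<close> and \<open>R\<^sup>o\<^sup>p\<close> into the
  images of \<open>s\<close> and \<open>t\<close>, and \<open>l a b\<close> is the sum of all \<open>\<^bold>e\<close> of pairs of arrows with labels
  \<open>a, b\<close>. The generators of the ideal of \<open>\<AA>(w\<^sub>\<sigma>)\<close> are the products of
  \<open>s (\<delta>\<^sub>\<lambda>) t (\<delta>\<^sub>\<mu>)\<close> with the differences of the two sides of the quadratic
  relations (\<open>w_rels_eq\<close>), and summation over \<open>\<lambda>, \<mu>\<close> recovers these differences.

  Each algebra with matrix coefficients gives two more: its Takeuchi product with itself, with
  \<open>l a b \<mapsto> \<Sum>\<^sub>c l a c \<otimes> l c b\<close> (\<open>takeuchi_coefficients\<close>, \<open>takeuchi_frt\<close>, \<open>takeuchi_invertible\<close>), and the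
  endomorphisms of \<open>M\<^sub>\<Lambda>(R)\<close>, with \<open>l a b\<close> acting by \<open>\<delta>\<^sub>a\<^sub>b T_a\<close> (\<open>end_frt\<close>,
  \<open>end_invertible\<close>). The universal homomorphisms into these are the comultiplications and the
  actions that define the counits of both sides. As the algebras are spanned by words in the
  coefficients, the axioms of a left bialgebroid are checked on words
  (\<open>coefficient_bialgebroid.left_bialgebroid\<close>). The map \<open>\<Phi>\<close> is the universal homomorphism from
  \<open>\<AA>(w\<^sub>\<sigma>)\<close> to \<open>A\<^sub>\<sigma>\<close>. It respects \<open>s\<close>, \<open>t\<close> and \<open>l\<close>, and these determine comultiplication and counit
  (\<open>coefficient_bialgebroid_hom\<close>).
\<close>

abbreviation keys where "keys \<equiv> Poly_Mapping.keys"

abbreviation lookup where "lookup \<equiv> Poly_Mapping.lookup"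

section \<open>Additive maps and finite sums\<close>

abbreviation addhom :: "('a, 'c) ring_scheme \<Rightarrow> ('b, 'd) ring_scheme \<Rightarrow> ('a \<Rightarrow> 'b) set" where
  "addhom A B \<equiv> hom (add_monoid A) (add_monoid B)"

lemma addhomI:
  assumes "\<And>x. x \<in> carrier A \<Longrightarrow> f x \<in> carrier B"
    and "\<And>x y. \<lbrakk>x \<in> carrier A; y \<in> carrier A\<rbrakk> \<Longrightarrow> f (x \<oplus>\<^bsub>A\<^esub> y) = f x \<oplus>\<^bsub>B\<^esub> f y"
  shows "f \<in> addhom A B"
  using assms by (auto intro!: homI)

lemma addhom_closed: "\<lbrakk>f \<in> addhom A B; x \<in> carrier A\<rbrakk> \<Longrightarrow> f x \<in> carrier B"
  by (auto simp: hom_def)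

lemma addhom_add:
  "\<lbrakk>f \<in> addhom A B; x \<in> carrier A; y \<in> carrier A\<rbrakk> \<Longrightarrow> f (x \<oplus>\<^bsub>A\<^esub> y) = f x \<oplus>\<^bsub>B\<^esub> f y"
  by (auto simp: hom_def)

lemma addhom_group_hom:
  assumes "f \<in> addhom A B" "abelian_group A" "abelian_group B"
  shows "group_hom (add_monoid A) (add_monoid B) f"
  using assms by (simp add: group_hom_def group_hom_axioms_def abelian_group.a_group)

lemma addhom_zero:
  assumes "f \<in> addhom A B" "abelian_group A" "abelian_group B"
  shows "f \<zero>\<^bsub>A\<^esub> = \<zero>\<^bsub>B\<^esub>"
  using group_hom.hom_one[OF addhom_group_hom[OF assms]] by simp

lemma addhom_uminus:
  assumes "f \<in> addhom A B" "abelian_group A" "abelian_group B" "x \<in> carrier A"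
  shows "f (\<ominus>\<^bsub>A\<^esub> x) = \<ominus>\<^bsub>B\<^esub> f x"
  using group_hom.hom_inv[OF addhom_group_hom[OF assms(1-3)], of x] assms(4) by (simp add: a_inv_def)

lemma addhom_minus:
  assumes "f \<in> addhom A B" "abelian_group A" "abelian_group B" "x \<in> carrier A" "y \<in> carrier A"
  shows "f (x \<ominus>\<^bsub>A\<^esub> y) = f x \<ominus>\<^bsub>B\<^esub> f y"
  using assms by (simp add: a_minus_def addhom_add addhom_uminus abelian_group.a_inv_closed)

lemma addhom_comp: "\<lbrakk>f \<in> addhom A B; g \<in> addhom B C\<rbrakk> \<Longrightarrow> (\<lambda>x. g (f x)) \<in> addhom A C"
  by (auto simp: hom_def Pi_def)

lemma addhom_finsum:
  assumes f: "f \<in> addhom A B" and A: "abelian_group A" and B: "abelian_group B"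
    and g: "g \<in> I \<rightarrow> carrier A"
  shows "f (\<Oplus>\<^bsub>A\<^esub>i\<in>I. g i) = (\<Oplus>\<^bsub>B\<^esub>i\<in>I. f (g i))"
proof -
  interpret A: abelian_group A by (rule A)
  interpret B: abelian_group B by (rule B)
  show ?thesis
    using g
  proof (induction I rule: infinite_finite_induct)
    case (insert i I)
    then have "f (\<Oplus>\<^bsub>A\<^esub>i\<in>insert i I. g i) = f (g i) \<oplus>\<^bsub>B\<^esub> f (\<Oplus>\<^bsub>A\<^esub>i\<in>I. g i)"
      by (simp add: A.finsum_insert addhom_add[OF f])
    with insert show ?case
      by (subst B.finsum_insert) (auto intro!: addhom_closed[OF f])
  qed (simp_all add: addhom_zero[OF f A B] A.finsum_infinite B.finsum_infinite)
qed

lemma (in abelian_monoid) finsum_swap: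
  assumes "\<And>i j. \<lbrakk>i \<in> I; j \<in> J\<rbrakk> \<Longrightarrow> f i j \<in> carrier G"
  shows "(\<Oplus>i\<in>I. \<Oplus>j\<in>J. f i j) = (\<Oplus>j\<in>J. \<Oplus>i\<in>I. f i j)"
  using assms
proof (induction I rule: infinite_finite_induct)
  case (insert i I)
  then have "(\<Oplus>i\<in>insert i I. \<Oplus>j\<in>J. f i j) = (\<Oplus>j\<in>J. f i j) \<oplus> (\<Oplus>i\<in>I. \<Oplus>j\<in>J. f i j)"
    by (subst finsum_insert) (auto intro!: finsum_closed)
  also have "\<dots> = (\<Oplus>j\<in>J. f i j) \<oplus> (\<Oplus>j\<in>J. \<Oplus>i\<in>I. f i j)"
    using insert by simp
  also have "\<dots> = (\<Oplus>j\<in>J. f i j \<oplus> (\<Oplus>i\<in>I. f i j))"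
    using insert by (intro finsum_addf[symmetric]) (auto intro!: finsum_closed)
  also have "\<dots> = (\<Oplus>j\<in>J. \<Oplus>i\<in>insert i I. f i j)"
    using insert by (intro finsum_cong') (auto simp: finsum_insert Pi_def intro!: finsum_closed)
  finally show ?case .
qed (simp_all add: finsum_infinite finsum_zero)

lemma (in abelian_monoid) finsum_delta:
  assumes "finite I" "j \<in> I" "f j \<in> carrier G"
  shows "(\<Oplus>i\<in>I. if i = j then f i else \<zero>) = f j"
    and "(\<Oplus>i\<in>I. if j = i then f i else \<zero>) = f j"
proof -
  have *: "(\<lambda>i. if i = j then f i else \<zero>) = (\<lambda>i. if j = i then f j else \<zero>)"
    "(\<lambda>i. if j = i then f i else \<zero>) = (\<lambda>i. if j = i then f j else \<zero>)"
    by auto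
  have "(\<Oplus>i\<in>I. if j = i then f j else \<zero>) = f j"
    using add.finprod_singleton[of j I "\<lambda>_. f j"] assms by auto
  then show "(\<Oplus>i\<in>I. if i = j then f i else \<zero>) = f j"
    and "(\<Oplus>i\<in>I. if j = i then f i else \<zero>) = f j"
    by (simp_all only: *)
qed

text \<open>Passing to a smaller carrier does not change sums whose terms lie in it.\<close>

lemma finsum_subcarrier:
  assumes "abelian_group (G\<lparr>carrier := C\<rparr>)" "abelian_group G" "C \<subseteq> carrier G" "f \<in> I \<rightarrow> C"
  shows "finsum (G\<lparr>carrier := C\<rparr>) f I = finsum G f I"
  using addhom_finsum[of "\<lambda>x. x" "G\<lparr>carrier := C\<rparr>" G f I] assms by (force simp: hom_def)

text \<open>A function on basis elements and coefficients that is additive in the coefficient extends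
  additively to finitely supported families.\<close>

lemma keys_finsum_superset:
  assumes T: "abelian_group T" and g: "\<And>z c. z \<in> S \<Longrightarrow> g z c \<in> carrier T"
    and 0: "\<And>z. z \<in> S \<Longrightarrow> g z 0 = \<zero>\<^bsub>T\<^esub>"
    and "keys u \<subseteq> K" "finite K" "K \<subseteq> S"
  shows "(\<Oplus>\<^bsub>T\<^esub>z\<in>keys u. g z (lookup u z)) = (\<Oplus>\<^bsub>T\<^esub>z\<in>K. g z (lookup u z))"
proof -
  interpret T: abelian_group T by (rule T)
  show ?thesis
  proof (rule T.add.finprod_mono_neutral_cong_left)
    fix z assume "z \<in> K - keys u"
    then have "z \<in> S" "lookup u z = 0" using assms(6) by (auto simp: in_keys_iff)
    then show "g z (lookup u z) = \<zero>\<^bsub>T\<^esub>" using 0 by simp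
  qed (use assms in auto)
qed

lemma keys_finsum_add:
  fixes g :: "'z \<Rightarrow> 'c :: comm_monoid_add \<Rightarrow> 't"
  assumes T: "abelian_group T" and g: "\<And>z c. z \<in> S \<Longrightarrow> g z c \<in> carrier T"
    and add: "\<And>z c d. z \<in> S \<Longrightarrow> g z (c + d) = g z c \<oplus>\<^bsub>T\<^esub> g z d"
    and uv: "keys u \<subseteq> S" "keys v \<subseteq> S"
  shows "(\<Oplus>\<^bsub>T\<^esub>z\<in>keys (u + v). g z (lookup (u + v) z)) =
    (\<Oplus>\<^bsub>T\<^esub>z\<in>keys u. g z (lookup u z)) \<oplus>\<^bsub>T\<^esub> (\<Oplus>\<^bsub>T\<^esub>z\<in>keys v. g z (lookup v z))"
proof -
  interpret T: abelian_group T by (rule T)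
  have 0: "g z 0 = \<zero>\<^bsub>T\<^esub>" if "z \<in> S" for z
    using add[OF that, of 0 0] g[OF that, of 0] by (metis T.add.l_cancel_one' add_0)
  let ?K = "keys u \<union> keys v"
  have K: "finite ?K" "?K \<subseteq> S" "keys (u + v) \<subseteq> ?K"
    using uv keys_add[of u v] by auto
  have "(\<Oplus>\<^bsub>T\<^esub>z\<in>?K. g z (lookup (u + v) z)) =
      (\<Oplus>\<^bsub>T\<^esub>z\<in>?K. g z (lookup u z)) \<oplus>\<^bsub>T\<^esub> (\<Oplus>\<^bsub>T\<^esub>z\<in>?K. g z (lookup v z))"
    using K(2) by (subst T.finsum_addf[symmetric]) (auto simp: lookup_add g add intro!: T.finsum_cong')
  moreover have "(\<Oplus>\<^bsub>T\<^esub>z\<in>keys x. g z (lookup x z)) = (\<Oplus>\<^bsub>T\<^esub>z\<in>?K. g z (lookup x z))"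
    if "keys x \<subseteq> ?K" for x
    by (rule keys_finsum_superset[OF T, of S]) (use K that g 0 in auto)
  ultimately show ?thesis using K by simp
qed

lemma keys_finsum_single:
  assumes T: "abelian_group T" and "g z c \<in> carrier T" and "g z 0 = \<zero>\<^bsub>T\<^esub>"
  shows "(\<Oplus>\<^bsub>T\<^esub>w\<in>keys (Poly_Mapping.single z c). g w (lookup (Poly_Mapping.single z c) w)) = g z c"
proof -
  interpret T: abelian_group T by (rule T)
  show ?thesis using assms by (cases "c = 0") (simp_all add: T.finsum_insert Pi_def)
qed

lemma poly_mapping_keys_induct [consumes 1, case_names zero single add]:
  fixes f :: "'z \<Rightarrow>\<^sub>0 'c :: ab_group_add"
  assumes "keys f \<subseteq> S" "P 0" "\<And>z c. z \<in> S \<Longrightarrow> P (Poly_Mapping.single z c)"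
    and "\<And>f g. \<lbrakk>keys f \<subseteq> S; keys g \<subseteq> S; P f; P g\<rbrakk> \<Longrightarrow> P (f + g)"
  shows "P f"
  using assms(1)
proof (induction "card (keys f)" arbitrary: f)
  case 0
  then show ?case using assms(2) by simp
next
  case (Suc n)
  then obtain z where z: "z \<in> keys f" by fastforce
  let ?g = "f - Poly_Mapping.single z (lookup f z)"
  have k: "keys ?g = keys f - {z}"
    by (auto simp: in_keys_iff lookup_minus lookup_single when_def split: if_splits)
  have "P ?g"
    by (rule Suc(1)) (use k Suc(2,3) z in auto)
  then have "P (?g + Poly_Mapping.single z (lookup f z))"
    by (intro assms(4) assms(3)) (use k Suc(3) z in auto)
  then show ?case by simp
qed

lemma keys_subsetI:
  "\<lbrakk>keys u \<subseteq> K; keys v \<subseteq> K\<rbrakk> \<Longrightarrow> keys (u + v) \<subseteq> K"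
  "\<lbrakk>keys u \<subseteq> K; keys v \<subseteq> K\<rbrakk> \<Longrightarrow> keys (u - v) \<subseteq> K"
  for u v :: "'z \<Rightarrow>\<^sub>0 'c :: ab_group_add"
  using keys_add[of u v] keys_diff[of u v] by auto

section \<open>Algebras, homomorphisms and quotients\<close>

lemma field_record_simps [simp]:
  "carrier (ring_of_type_algebra :: 'k :: field ring) = UNIV"
  "add (ring_of_type_algebra :: 'k ring) = (+)"
  "monoid.mult (ring_of_type_algebra :: 'k ring) = (*)"
  "one (ring_of_type_algebra :: 'k ring) = 1"
  "ring.zero (ring_of_type_algebra :: 'k ring) = 0"
  by (simp_all add: ring_of_type_algebra_def)

lemma k_algebraI:
  fixes A :: "('k :: field, 'a) module" (structure)
  assumes "ring A"
    and "\<And>c x. x \<in> carrier A \<Longrightarrow> c \<odot> x \<in> carrier A"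
    and "\<And>c d x. x \<in> carrier A \<Longrightarrow> (c + d) \<odot> x = c \<odot> x \<oplus> d \<odot> x"
    and "\<And>c x y. \<lbrakk>x \<in> carrier A; y \<in> carrier A\<rbrakk> \<Longrightarrow> c \<odot> (x \<oplus> y) = c \<odot> x \<oplus> c \<odot> y"
    and "\<And>c d x. x \<in> carrier A \<Longrightarrow> (c * d) \<odot> x = c \<odot> (d \<odot> x)"
    and "\<And>x. x \<in> carrier A \<Longrightarrow> 1 \<odot> x = x"
    and "\<And>c x y. \<lbrakk>x \<in> carrier A; y \<in> carrier A\<rbrakk> \<Longrightarrow> (c \<odot> x) \<otimes> y = c \<odot> (x \<otimes> y)"
    and "\<And>c x y. \<lbrakk>x \<in> carrier A; y \<in> carrier A\<rbrakk> \<Longrightarrow> x \<otimes> (c \<odot> y) = c \<odot> (x \<otimes> y)"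
  shows "k_algebra A"
  using assms
  by (auto intro!: k_algebra.intro k_algebra_axioms.intro moduleI cring_from_type_algebra
      simp: ring.is_abelian_group)

context k_algebra
begin

lemma scale_closed [simp, intro]: "x \<in> carrier A \<Longrightarrow> c \<odot> x \<in> carrier A"
  using smult_closed by simp

lemma scale_add_left: "x \<in> carrier A \<Longrightarrow> (c + d) \<odot> x = c \<odot> x \<oplus> d \<odot> x"
  using smult_l_distr[of c d x] by simp

lemma scale_add_right: "\<lbrakk>x \<in> carrier A; y \<in> carrier A\<rbrakk> \<Longrightarrow> c \<odot> (x \<oplus> y) = c \<odot> x \<oplus> c \<odot> y"
  using smult_r_distr[of c x y] by simp

lemma scale_scale: "x \<in> carrier A \<Longrightarrow> c \<odot> (d \<odot> x) = (c * d) \<odot> x"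
  using smult_assoc1[of c d x] by simp

lemma scale_one [simp]: "x \<in> carrier A \<Longrightarrow> 1 \<odot> x = x"
  using smult_one[of x] by simp

lemma scale_zero_left [simp]: "x \<in> carrier A \<Longrightarrow> 0 \<odot> x = \<zero>"
  using smult_l_null[of x] by simp

lemma scale_addhom: "(\<lambda>x. c \<odot> x) \<in> addhom A A"
  by (rule addhomI) (simp_all add: scale_add_right)

lemma abelian_group: "abelian_group A"
  by (rule A.is_abelian_group)

lemma mult_addhom_left: "x \<in> carrier A \<Longrightarrow> (\<lambda>y. x \<otimes> y) \<in> addhom A A"
  by (rule addhomI) (simp_all add: A.r_distr)

lemma mult_addhom_right: "y \<in> carrier A \<Longrightarrow> (\<lambda>x. x \<otimes> y) \<in> addhom A A"
  by (rule addhomI) (simp_all add: A.l_distr)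

lemma scale_zero_right [simp]: "c \<odot> \<zero> = \<zero>"
  by (rule addhom_zero[OF scale_addhom abelian_group abelian_group])

end

lemma k_algebra_homI:
  assumes "\<And>x. x \<in> carrier A \<Longrightarrow> f x \<in> carrier B"
    and "\<And>x y. \<lbrakk>x \<in> carrier A; y \<in> carrier A\<rbrakk> \<Longrightarrow> f (x \<oplus>\<^bsub>A\<^esub> y) = f x \<oplus>\<^bsub>B\<^esub> f y"
    and "\<And>x y. \<lbrakk>x \<in> carrier A; y \<in> carrier A\<rbrakk> \<Longrightarrow> f (x \<otimes>\<^bsub>A\<^esub> y) = f x \<otimes>\<^bsub>B\<^esub> f y"
    and "f \<one>\<^bsub>A\<^esub> = \<one>\<^bsub>B\<^esub>"
    and "\<And>c x. x \<in> carrier A \<Longrightarrow> f (c \<odot>\<^bsub>A\<^esub> x) = c \<odot>\<^bsub>B\<^esub> f x"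
  shows "f \<in> k_algebra_hom A B"
  using assms by (auto simp: k_algebra_hom_def k_linear_map_def ring_hom_def hom_def)

lemma
  assumes "f \<in> k_algebra_hom A B"
  shows khom_closed: "x \<in> carrier A \<Longrightarrow> f x \<in> carrier B"
    and khom_addhom: "f \<in> addhom A B"
    and khom_add: "\<lbrakk>x \<in> carrier A; y \<in> carrier A\<rbrakk> \<Longrightarrow> f (x \<oplus>\<^bsub>A\<^esub> y) = f x \<oplus>\<^bsub>B\<^esub> f y"
    and khom_mult: "\<lbrakk>x \<in> carrier A; y \<in> carrier A\<rbrakk> \<Longrightarrow> f (x \<otimes>\<^bsub>A\<^esub> y) = f x \<otimes>\<^bsub>B\<^esub> f y"
    and khom_one: "f \<one>\<^bsub>A\<^esub> = \<one>\<^bsub>B\<^esub>"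
    and khom_scale: "x \<in> carrier A \<Longrightarrow> f (c \<odot>\<^bsub>A\<^esub> x) = c \<odot>\<^bsub>B\<^esub> f x"
  using assms by (auto simp: k_algebra_hom_def k_linear_map_def ring_hom_def hom_def)

lemma khom_comp:
  "\<lbrakk>f \<in> k_algebra_hom A B; g \<in> k_algebra_hom B C\<rbrakk> \<Longrightarrow> (\<lambda>x. g (f x)) \<in> k_algebra_hom A C"
  by (intro k_algebra_homI) (simp_all add: khom_closed khom_add khom_mult khom_one khom_scale)

lemma k_algebra_op:
  assumes "k_algebra A"
  shows "k_algebra (op_algebra A)"
proof -
  interpret A: k_algebra A by fact
  have inv: "\<exists>y\<in>carrier A. y \<oplus>\<^bsub>A\<^esub> x = \<zero>\<^bsub>A\<^esub>" if "x \<in> carrier A" for x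
    using A.M.l_neg[OF that] A.M.a_inv_closed[OF that] by blast
  have "ring (op_algebra A)"
    by (rule ringI, rule abelian_groupI; (rule monoidI)?)
      (simp_all add: op_algebra_def A.M.a_assoc A.A.m_assoc A.A.l_distr A.A.r_distr A.M.a_ac inv)
  then show ?thesis
    by (rule k_algebraI)
      (auto simp: op_algebra_def A.scale_add_left A.scale_add_right A.scale_scale
        A.smult_mult_left A.smult_mult_right)
qed

lemma op_algebra_simps [simp]:
  "carrier (op_algebra A) = carrier A" "add (op_algebra A) = add A" "one (op_algebra A) = one A"
  "ring.zero (op_algebra A) = ring.zero A" "module.smult (op_algebra A) = module.smult A"
  "x \<otimes>\<^bsub>op_algebra A\<^esub> y = y \<otimes>\<^bsub>A\<^esub> x"
  by (simp_all add: op_algebra_def)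

lemma add_monoid_op [simp]: "add_monoid (op_algebra A) = add_monoid A"
  by simp

lemma map_algebra_simps [simp]:
  "f \<in> carrier (map_algebra R) \<longleftrightarrow> (\<forall>l. f l \<in> carrier R)"
  "(f \<oplus>\<^bsub>map_algebra R\<^esub> g) l = f l \<oplus>\<^bsub>R\<^esub> g l"
  "(f \<otimes>\<^bsub>map_algebra R\<^esub> g) l = f l \<otimes>\<^bsub>R\<^esub> g l"
  "\<one>\<^bsub>map_algebra R\<^esub> l = \<one>\<^bsub>R\<^esub>"
  "\<zero>\<^bsub>map_algebra R\<^esub> l = \<zero>\<^bsub>R\<^esub>"
  "(c \<odot>\<^bsub>map_algebra R\<^esub> f) l = c \<odot>\<^bsub>R\<^esub> f l"
  by (simp_all add: map_algebra_def)

lemma k_algebra_map_algebra: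
  assumes "k_algebra R"
  shows "k_algebra (map_algebra R :: ('k :: field, 'l :: finite \<Rightarrow> 'r) module)"
proof -
  interpret R: k_algebra R by fact
  have inv: "\<exists>g\<in>carrier (map_algebra R). g \<oplus>\<^bsub>map_algebra R\<^esub> f = \<zero>\<^bsub>map_algebra R\<^esub>"
    if "f \<in> carrier (map_algebra R)" for f :: "'l \<Rightarrow> 'r"
    using that by (intro bexI[of _ "\<lambda>l. \<ominus>\<^bsub>R\<^esub> f l"]) (auto simp: fun_eq_iff R.M.l_neg)
  have "ring (map_algebra R :: ('k, 'l \<Rightarrow> 'r) module)"
    by (rule ringI, rule abelian_groupI)
      (use inv in \<open>auto simp: fun_eq_iff R.M.a_assoc R.A.m_assoc R.A.l_distr R.A.r_distr
        intro!: monoidI intro: R.M.a_comm\<close>)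
  then show ?thesis
    by (rule k_algebraI)
      (auto simp: fun_eq_iff R.scale_add_left R.scale_add_right R.scale_scale
        R.smult_mult_left R.smult_mult_right)
qed

lemma map_algebra_finsum:
  assumes "k_algebra R" "\<And>i. i \<in> I \<Longrightarrow> f i \<in> carrier (map_algebra R)"
  shows "(\<Oplus>\<^bsub>map_algebra R\<^esub>i\<in>I. f i) l = (\<Oplus>\<^bsub>R\<^esub>i\<in>I. f i l)"
  by (rule addhom_finsum[of "\<lambda>f. f l"])
    (use assms in \<open>auto intro!: addhomI k_algebra.abelian_group k_algebra_map_algebra\<close>)

lemma induced_eq:
  assumes "x \<in> U" "\<And>y. y \<in> U \<Longrightarrow> h y = h x"
  shows "induced h U = h x"
proof -
  have "h ` U = {h x}"
    unfolding set_eq_iff image_iff singleton_iff using assms by metis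
  then show ?thesis by (simp add: induced_def)
qed

locale k_algebra_quotient = k_algebra A + I: ideal I A
  for A :: "('k :: field, 'a) module" (structure) and I
begin

abbreviation "Q \<equiv> quot_algebra A I"

lemma quot_carrier: "carrier Q = (\<lambda>x. I +> x) ` carrier A"
  by (auto simp: quot_algebra_def FactRing_def A_RCOSETS_def' )

lemma scale_ideal: "x \<in> I \<Longrightarrow> c \<odot> x \<in> I"
  using I.I_l_closed[of x "c \<odot> \<one>"] I.Icarr[of x] by (simp add: smult_mult_left)

lemma quot_scale: "x \<in> carrier A \<Longrightarrow> c \<odot>\<^bsub>Q\<^esub> (I +> x) = I +> (c \<odot> x)"
proof -
  assume x: "x \<in> carrier A"
  have "I +> (c \<odot> u) = I +> (c \<odot> x)" if "u \<in> I +> x" for u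
  proof -
    from that obtain i where i: "i \<in> I" "u = i \<oplus> x" by (auto simp: a_r_coset_def')
    then have "c \<odot> u = c \<odot> i \<oplus> c \<odot> x" using x I.Icarr by (simp add: scale_add_right)
    then have "c \<odot> u \<in> I +> (c \<odot> x)" using scale_ideal[OF i(1)] by (auto simp: a_r_coset_def')
    then show ?thesis using x by (metis I.a_repr_independence' scale_closed)
  qed
  moreover have "x \<in> I +> x" using x by (rule I.a_rcos_self)
  ultimately have "(\<Union>u\<in>I +> x. I +> (c \<odot> u)) = I +> (c \<odot> x)" by blast
  then show ?thesis by (simp add: quot_algebra_def)
qed

lemma quot_proj_ring_hom: "(\<lambda>x. I +> x) \<in> ring_hom A (A Quot I)"
  by (rule I.rcos_ring_hom)

lemma quot_ring: "ring Q"
proof -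
  interpret QR: ring "A Quot I" by (rule I.quotient_is_ring)
  have inv: "\<exists>y\<in>carrier (A Quot I). y \<oplus>\<^bsub>A Quot I\<^esub> x = \<zero>\<^bsub>A Quot I\<^esub>" if "x \<in> carrier (A Quot I)" for x
    using QR.l_neg[OF that] QR.a_inv_closed[OF that] by blast
  show ?thesis
    by (rule ringI, rule abelian_groupI; (rule monoidI)?)
      (simp_all add: quot_algebra_def QR.a_assoc QR.m_assoc QR.l_distr QR.r_distr QR.a_ac inv)
qed

lemma quot_eqs:
  "\<lbrakk>x \<in> carrier A; y \<in> carrier A\<rbrakk> \<Longrightarrow> (I +> x) \<oplus>\<^bsub>Q\<^esub> (I +> y) = I +> (x \<oplus> y)"
  "\<lbrakk>x \<in> carrier A; y \<in> carrier A\<rbrakk> \<Longrightarrow> (I +> x) \<otimes>\<^bsub>Q\<^esub> (I +> y) = I +> (x \<otimes> y)"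
  "\<one>\<^bsub>Q\<^esub> = I +> \<one>" "\<zero>\<^bsub>Q\<^esub> = I"
  by (simp add: quot_algebra_def ring_hom_add[OF quot_proj_ring_hom])
    (simp add: quot_algebra_def ring_hom_mult[OF quot_proj_ring_hom],
      simp_all add: quot_algebra_def FactRing_def)

lemma k_algebra_quot: "k_algebra Q"
  by (rule k_algebraI[OF quot_ring])
    (auto simp: quot_carrier quot_scale quot_eqs scale_add_left scale_add_right scale_scale
      smult_mult_left smult_mult_right)

lemma quot_proj: "(\<lambda>x. I +> x) \<in> k_algebra_hom A Q"
  by (rule k_algebra_homI) (auto simp: quot_carrier quot_scale quot_eqs)

lemma induced_coset:
  assumes h: "h \<in> addhom A B" and B: "abelian_group B"
    and 0: "\<And>i. i \<in> I \<Longrightarrow> h i = \<zero>\<^bsub>B\<^esub>" and x: "x \<in> carrier A"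
  shows "induced h (I +> x) = h x"
proof (rule induced_eq)
  interpret B: abelian_group B by (rule B)
  show "x \<in> I +> x" using x by (rule I.a_rcos_self)
  fix y assume "y \<in> I +> x"
  then obtain i where i: "i \<in> I" "y = i \<oplus> x" by (auto simp: a_r_coset_def')
  then show "h y = h x" using x addhom_add[OF h, of i x] addhom_closed[OF h x] 0[OF i(1)] I.Icarr by simp
qed

lemma induced_khom:
  assumes h: "h \<in> k_algebra_hom A B" and B: "k_algebra B" and 0: "\<And>i. i \<in> I \<Longrightarrow> h i = \<zero>\<^bsub>B\<^esub>"
  shows "induced h \<in> k_algebra_hom Q B"
proof -
  note c = induced_coset[OF khom_addhom[OF h] k_algebra.abelian_group[OF B] 0]
  show ?thesis
    by (rule k_algebra_homI)
      (auto simp: quot_carrier quot_eqs quot_scale c khom_closed[OF h] khom_add[OF h]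
        khom_mult[OF h] khom_one[OF h] khom_scale[OF h])
qed

end

lemma khom_genideal_zero:
  assumes f: "f \<in> k_algebra_hom A B" and A: "k_algebra A" and B: "k_algebra B"
    and S: "S \<subseteq> carrier A" "\<And>x. x \<in> S \<Longrightarrow> f x = \<zero>\<^bsub>B\<^esub>"
    and x: "x \<in> genideal A S"
  shows "f x = \<zero>\<^bsub>B\<^esub>"
proof -
  interpret A: k_algebra A by (rule A)
  interpret B: k_algebra B by (rule B)
  interpret h: ring_hom_ring A B f
    by (rule ring_hom_ringI2[OF A.A.ring_axioms B.A.ring_axioms])
      (use f in \<open>simp add: k_algebra_hom_def\<close>)
  have "S \<subseteq> a_kernel A B f" unfolding a_kernel_def' using S by blast
  then have "genideal A S \<subseteq> a_kernel A B f"
    by (rule A.A.genideal_minimal[OF h.kernel_is_ideal])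
  then show ?thesis using x unfolding a_kernel_def' by blast
qed

lemma k_algebra_quotient_genideal:
  assumes "k_algebra A" "S \<subseteq> carrier A"
  shows "k_algebra_quotient A (genideal A S)"
proof -
  interpret A: k_algebra A by fact
  show ?thesis
    by (intro k_algebra_quotient.intro A.k_algebra_axioms A.A.genideal_ideal assms)
qed

section \<open>Balanced tensor products\<close>

definition balanced_map where
  "balanced_map S ra la M N T v \<longleftrightarrow>
     (\<forall>x\<in>carrier M. (\<lambda>y. v x y) \<in> addhom N T) \<and> (\<forall>y\<in>carrier N. (\<lambda>x. v x y) \<in> addhom M T) \<and>
     (\<forall>x\<in>carrier M. \<forall>l\<in>S. \<forall>y\<in>carrier N. v (ra x l) y = v x (la l y))"

locale balanced_tensor = M: abelian_group M + N: abelian_group N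
  for M :: "('k, 'm) module" and N :: "('k, 'n) module" +
  fixes S :: "'s set" and ra la
  assumes ra_closed [simp]: "\<lbrakk>x \<in> carrier M; l \<in> S\<rbrakk> \<Longrightarrow> ra x l \<in> carrier M"
    and la_closed [simp]: "\<lbrakk>l \<in> S; y \<in> carrier N\<rbrakk> \<Longrightarrow> la l y \<in> carrier N"
begin

abbreviation "T \<equiv> tensor S ra la M N"
abbreviation "el \<equiv> tensor_elt S ra la M N"
abbreviation "F \<equiv> free_Abelian_group (carrier M \<times> carrier N)"
abbreviation "Null \<equiv> balanced_null S ra la M N"

lemma rels_subset: "balanced_rels S ra la M N \<subseteq> carrier F"
proof -
  have "keys r \<subseteq> carrier M \<times> carrier N" if "r \<in> balanced_rels S ra la M N" for r
    using that unfolding balanced_rels_def by (elim UnE CollectE exE conjE; hypsubst; intro keys_subsetI) auto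
  then show ?thesis by auto
qed

lemma null_subgroup: "subgroup Null F"
  unfolding balanced_null_def
  by (rule group.generate_is_subgroup[OF group_free_Abelian_group rels_subset])

lemma null_normal: "Null \<lhd> F"
  using null_subgroup abelian_free_Abelian_group comm_group.normal_iff_subgroup by blast

lemma tensor_add_monoid:
  "carrier T = carrier (F Mod Null)" "add T = monoid.mult (F Mod Null)"
  "ring.zero T = one (F Mod Null)"
  by (simp_all add: tensor_def tensor_group_def Let_def FactGroup_def)

lemma abelian_tensor: "abelian_group T"
proof -
  interpret Q: comm_group "F Mod Null"
    by (rule comm_group.abelian_FactGroup[OF abelian_free_Abelian_group null_subgroup])
  show ?thesis
    by (rule abelian_groupI; unfold tensor_add_monoid)
      (simp_all only: Q.m_closed Q.one_closed Q.m_assoc Q.l_one Q.l_inv_ex, rule Q.m_comm)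
qed

sublocale T: abelian_group T by (rule abelian_tensor)

lemma tensor_carrier: "carrier T = (\<lambda>u. Null #>\<^bsub>F\<^esub> u) ` carrier F"
  by (simp add: tensor_def tensor_group_def Let_def carrier_FactGroup)

lemma tensor_add_coset:
  "\<lbrakk>u \<in> carrier F; v \<in> carrier F\<rbrakk> \<Longrightarrow> (Null #>\<^bsub>F\<^esub> u) \<oplus>\<^bsub>T\<^esub> (Null #>\<^bsub>F\<^esub> v) = Null #>\<^bsub>F\<^esub> (u + v)"
  using normal.rcos_sum[OF null_normal, of u v] by (simp add: tensor_def tensor_group_def Let_def)

lemma coset_eqI:
  assumes "u \<in> carrier F" "v \<in> carrier F" "u - v \<in> balanced_rels S ra la M N"
  shows "Null #>\<^bsub>F\<^esub> u = Null #>\<^bsub>F\<^esub> v"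
proof -
  have "u - v \<in> Null"
    unfolding balanced_null_def using assms(3) by (rule generate.incl)
  then have "u \<in> Null #>\<^bsub>F\<^esub> v"
    unfolding r_coset_def by (intro UN_I[of "u - v"]) simp_all
  then show ?thesis
    using group.repr_independence[OF group_free_Abelian_group _ assms(2) null_subgroup] by simp
qed

lemma el_closed [simp]: "\<lbrakk>x \<in> carrier M; y \<in> carrier N\<rbrakk> \<Longrightarrow> el x y \<in> carrier T"
  by (auto simp: tensor_carrier tensor_elt_def)

lemma el_add_left:
  assumes "x \<in> carrier M" "x' \<in> carrier M" "y \<in> carrier N"
  shows "el (x \<oplus>\<^bsub>M\<^esub> x') y = el x y \<oplus>\<^bsub>T\<^esub> el x' y"
proof -
  have "frag_of (x \<oplus>\<^bsub>M\<^esub> x', y) - frag_of (x, y) - frag_of (x', y) \<in> balanced_rels S ra la M N"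
    using assms by (auto simp: balanced_rels_def)
  then have "Null #>\<^bsub>F\<^esub> frag_of (x \<oplus>\<^bsub>M\<^esub> x', y) = Null #>\<^bsub>F\<^esub> (frag_of (x, y) + frag_of (x', y))"
    by (intro coset_eqI) (use assms in \<open>simp_all add: keys_subsetI diff_diff_eq\<close>)
  then show ?thesis using assms by (simp add: tensor_elt_def tensor_add_coset)
qed

lemma el_add_right:
  assumes "x \<in> carrier M" "y \<in> carrier N" "y' \<in> carrier N"
  shows "el x (y \<oplus>\<^bsub>N\<^esub> y') = el x y \<oplus>\<^bsub>T\<^esub> el x y'"
proof -
  have "frag_of (x, y \<oplus>\<^bsub>N\<^esub> y') - frag_of (x, y) - frag_of (x, y') \<in> balanced_rels S ra la M N"
    using assms by (auto simp: balanced_rels_def)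
  then have "Null #>\<^bsub>F\<^esub> frag_of (x, y \<oplus>\<^bsub>N\<^esub> y') = Null #>\<^bsub>F\<^esub> (frag_of (x, y) + frag_of (x, y'))"
    by (intro coset_eqI) (use assms in \<open>simp_all add: keys_subsetI diff_diff_eq\<close>)
  then show ?thesis using assms by (simp add: tensor_elt_def tensor_add_coset)
qed

lemma el_balanced:
  assumes "x \<in> carrier M" "l \<in> S" "y \<in> carrier N"
  shows "el (ra x l) y = el x (la l y)"
proof -
  have "frag_of (ra x l, y) - frag_of (x, la l y) \<in> balanced_rels S ra la M N"
    using assms by (auto simp: balanced_rels_def)
  then show ?thesis
    unfolding tensor_elt_def by (intro coset_eqI) (use assms in simp_all)
qed

lemma el_balanced_map: "balanced_map S ra la M N T el"
  by (auto simp: balanced_map_def el_add_left el_add_right el_balanced intro!: addhomI)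

lemma el_addhom_left: "y \<in> carrier N \<Longrightarrow> (\<lambda>x. el x y) \<in> addhom M T"
  and el_addhom_right: "x \<in> carrier M \<Longrightarrow> (\<lambda>y. el x y) \<in> addhom N T"
  using el_balanced_map by (auto simp: balanced_map_def)

lemma tensor_induct [consumes 1, case_names el add]:
  assumes U: "U \<in> carrier T" and el: "\<And>x y. \<lbrakk>x \<in> carrier M; y \<in> carrier N\<rbrakk> \<Longrightarrow> P (el x y)"
    and add: "\<And>U V. \<lbrakk>U \<in> carrier T; V \<in> carrier T; P U; P V\<rbrakk> \<Longrightarrow> P (U \<oplus>\<^bsub>T\<^esub> V)"
  shows "P U"
proof -
  have 0: "P \<zero>\<^bsub>T\<^esub>"
    using el[of "\<zero>\<^bsub>M\<^esub>" "\<zero>\<^bsub>N\<^esub>"]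
    by (simp add: addhom_zero[OF el_addhom_left M.abelian_group_axioms abelian_tensor])
  have "P (Null #>\<^bsub>F\<^esub> u) \<and> P (Null #>\<^bsub>F\<^esub> (- u)) \<and> keys u \<subseteq> carrier M \<times> carrier N"
    if "keys u \<subseteq> carrier M \<times> carrier N" for u
    using that
  proof (induction u rule: frag_induction)
    case zero
    have "Null #>\<^bsub>F\<^esub> 0 = \<zero>\<^bsub>T\<^esub>"
      using null_subgroup group.coset_mult_one[OF group_free_Abelian_group, of Null]
      by (simp add: tensor_add_monoid subgroup.subset)
    then show ?case using 0 by simp
  next
    case (one z)
    then obtain x y where z: "z = (x, y)" "x \<in> carrier M" "y \<in> carrier N" by auto
    have "el (\<ominus>\<^bsub>M\<^esub> x) y \<oplus>\<^bsub>T\<^esub> el x y = (Null #>\<^bsub>F\<^esub> (- frag_of (x, y))) \<oplus>\<^bsub>T\<^esub> el x y"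
    proof -
      have "el (\<ominus>\<^bsub>M\<^esub> x) y \<oplus>\<^bsub>T\<^esub> el x y = \<zero>\<^bsub>T\<^esub>"
        using z by (simp flip: el_add_left add: M.l_neg
            addhom_zero[OF el_addhom_left M.abelian_group_axioms abelian_tensor])
      also have "\<dots> = Null #>\<^bsub>F\<^esub> (- frag_of (x, y) + frag_of (x, y))"
        using null_subgroup group.coset_mult_one[OF group_free_Abelian_group, of Null]
        by (simp add: tensor_add_monoid subgroup.subset)
      also have "\<dots> = (Null #>\<^bsub>F\<^esub> (- frag_of (x, y))) \<oplus>\<^bsub>T\<^esub> el x y"
        unfolding tensor_elt_def using z by (subst tensor_add_coset) auto
      finally show ?thesis .
    qed
    moreover have "Null #>\<^bsub>F\<^esub> (- frag_of (x, y)) \<in> carrier T"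
      using z by (auto simp: tensor_carrier)
    ultimately have "Null #>\<^bsub>F\<^esub> (- frag_of z) = el (\<ominus>\<^bsub>M\<^esub> x) y"
      using z by (auto simp: T.add.m_comm)
    then show ?case
      using el[of x y] el[of "\<ominus>\<^bsub>M\<^esub> x" y] z by (auto simp: tensor_elt_def)
  next
    case (diff a b)
    have "P (Null #>\<^bsub>F\<^esub> (a + - b))" "P (Null #>\<^bsub>F\<^esub> (b + - a))"
      using diff by (simp_all only: keys_minus carrier_free_Abelian_group_iff flip: tensor_add_coset)
        (auto intro!: add simp: tensor_carrier)
    then show ?case using diff keys_diff[of a b] by auto
  qed
  then show ?thesis using U by (auto simp: tensor_carrier)
qed

lemma tensor_ext:
  assumes "f \<in> addhom T B" "g \<in> addhom T B"
    and "\<And>x y. \<lbrakk>x \<in> carrier M; y \<in> carrier N\<rbrakk> \<Longrightarrow> f (el x y) = g (el x y)"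
    and "U \<in> carrier T"
  shows "f U = g U"
  using assms(4) by (induction rule: tensor_induct)
    (simp_all add: assms(3) addhom_add[OF assms(1)] addhom_add[OF assms(2)])

context
  fixes B :: "('b, 'z) ring_scheme" and v
  assumes B: "abelian_group B" and v: "balanced_map S ra la M N B v"
begin

interpretation B: abelian_group B by (rule B)

lemma balanced_closed: "\<lbrakk>x \<in> carrier M; y \<in> carrier N\<rbrakk> \<Longrightarrow> v x y \<in> carrier B"
  using v by (auto simp: balanced_map_def hom_def)

lemma balanced_map_eqs:
  "\<lbrakk>x \<in> carrier M; x' \<in> carrier M; y \<in> carrier N\<rbrakk> \<Longrightarrow> v (x \<oplus>\<^bsub>M\<^esub> x') y = v x y \<oplus>\<^bsub>B\<^esub> v x' y"
  "\<lbrakk>x \<in> carrier M; y \<in> carrier N; y' \<in> carrier N\<rbrakk> \<Longrightarrow> v x (y \<oplus>\<^bsub>N\<^esub> y') = v x y \<oplus>\<^bsub>B\<^esub> v x y'"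
  "\<lbrakk>x \<in> carrier M; l \<in> S; y \<in> carrier N\<rbrakk> \<Longrightarrow> v (ra x l) y = v x (la l y)"
  using v addhom_add[of "\<lambda>x. v x y" M B x x'] addhom_add[of "\<lambda>y. v x y" N B y y']
  by (simp_all add: balanced_map_def)

definition "frag_lift u = (\<Oplus>\<^bsub>B\<^esub>z\<in>keys u. add_pow B (lookup u z) (v (fst z) (snd z)))"

lemma frag_lift_add:
  "\<lbrakk>u \<in> carrier F; w \<in> carrier F\<rbrakk> \<Longrightarrow> frag_lift (u + w) = frag_lift u \<oplus>\<^bsub>B\<^esub> frag_lift w"
  unfolding frag_lift_def
  by (rule keys_finsum_add[OF B, of "carrier M \<times> carrier N" "\<lambda>z c. add_pow B (c :: int) (v (fst z) (snd z))"])
    (auto intro!: balanced_closed B.add.int_pow_mult B.add.int_pow_closed)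

lemma frag_lift_closed: "u \<in> carrier F \<Longrightarrow> frag_lift u \<in> carrier B"
  unfolding frag_lift_def by (auto intro!: B.finsum_closed balanced_closed B.add.int_pow_closed)

lemma frag_lift_of:
  assumes "x \<in> carrier M" "y \<in> carrier N"
  shows "frag_lift (frag_of (x, y)) = v x y"
  unfolding frag_lift_def
  by (subst keys_finsum_single[OF B, of "\<lambda>z c. add_pow B (c :: int) (v (fst z) (snd z))" "(x, y)" 1])
    (use balanced_closed[OF assms] in \<open>auto simp: B.add.int_pow_1 add_pow_def[of B "0 :: int"]\<close>)

lemma frag_lift_null:
  assumes "u \<in> Null"
  shows "frag_lift u = \<zero>\<^bsub>B\<^esub>"
proof -
  have h: "frag_lift \<in> hom F (add_monoid B)"
    by (rule homI) (auto intro!: frag_lift_closed frag_lift_add)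
  interpret h: group_hom F "add_monoid B" frag_lift
    using h by (simp add: group_hom_def group_hom_axioms_def B.a_group)
  have diff: "frag_lift (u - w) = frag_lift u \<ominus>\<^bsub>B\<^esub> frag_lift w"
    if "u \<in> carrier F" "w \<in> carrier F" for u w
    using frag_lift_add[of u "- w"] h.hom_inv[of w] that by (simp add: a_minus_def a_inv_def)
  have "frag_lift r = \<zero>\<^bsub>B\<^esub>" if "r \<in> balanced_rels S ra la M N" for r
  proof -
    have *: "a \<oplus>\<^bsub>B\<^esub> b \<ominus>\<^bsub>B\<^esub> a \<ominus>\<^bsub>B\<^esub> b = \<zero>\<^bsub>B\<^esub>" if "a \<in> carrier B" "b \<in> carrier B" for a b
      using that B.r_neg[of "a \<oplus>\<^bsub>B\<^esub> b"] by (simp add: B.minus_eq B.minus_add B.a_assoc)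
    have **: "a \<ominus>\<^bsub>B\<^esub> a = \<zero>\<^bsub>B\<^esub>" if "a \<in> carrier B" for a
      using that by (simp add: B.minus_eq B.r_neg)
    show ?thesis
      using that unfolding balanced_rels_def
      by (elim UnE CollectE exE conjE; hypsubst)
        (simp_all add: diff frag_lift_of balanced_map_eqs balanced_closed keys_subsetI * **)
  qed
  then have "balanced_rels S ra la M N \<subseteq> kernel F (add_monoid B) frag_lift"
    using rels_subset by (auto simp: kernel_def simp del: carrier_free_Abelian_group_iff)
  then have "Null \<subseteq> kernel F (add_monoid B) frag_lift"
    unfolding balanced_null_def
    by (rule group.generate_subgroup_incl[OF group_free_Abelian_group _ h.subgroup_kernel])
  then show ?thesis using assms by (auto simp: kernel_def)
qed

lemma lift_coset:
  assumes "u \<in> carrier F"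
  shows "tensor_lift B v (Null #>\<^bsub>F\<^esub> u) = frag_lift u"
proof -
  have "induced frag_lift (Null #>\<^bsub>F\<^esub> u) = frag_lift u"
  proof (rule induced_eq)
    show "u \<in> Null #>\<^bsub>F\<^esub> u"
      by (rule group.rcos_self[OF group_free_Abelian_group assms null_subgroup])
    fix w assume "w \<in> Null #>\<^bsub>F\<^esub> u"
    then obtain r where r: "r \<in> Null" "w = r + u" by (auto simp: r_coset_def)
    then have "r \<in> carrier F" using subgroup.subset[OF null_subgroup] by blast
    with r show "frag_lift w = frag_lift u"
      using assms by (simp add: frag_lift_add frag_lift_null frag_lift_closed)
  qed
  then show ?thesis by (simp add: tensor_lift_def frag_lift_def[abs_def])
qed

lemma lift_el: "\<lbrakk>x \<in> carrier M; y \<in> carrier N\<rbrakk> \<Longrightarrow> tensor_lift B v (el x y) = v x y"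
  unfolding tensor_elt_def by (subst lift_coset) (auto simp: frag_lift_of)

lemma lift_addhom: "tensor_lift B v \<in> addhom T B"
proof (rule addhomI)
  fix U assume "U \<in> carrier T"
  then obtain u where u: "u \<in> carrier F" "U = Null #>\<^bsub>F\<^esub> u" unfolding tensor_carrier by blast
  then show "tensor_lift B v U \<in> carrier B" by (simp only: lift_coset frag_lift_closed)
  fix W assume "W \<in> carrier T"
  then obtain w where w: "w \<in> carrier F" "W = Null #>\<^bsub>F\<^esub> w" unfolding tensor_carrier by blast
  have "u + w \<in> carrier F" using u w by (simp add: keys_subsetI)
  then show "tensor_lift B v (U \<oplus>\<^bsub>T\<^esub> W) = tensor_lift B v U \<oplus>\<^bsub>B\<^esub> tensor_lift B v W"
    using u w by (simp only: tensor_add_coset lift_coset frag_lift_add)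
qed

lemma lift_unique:
  assumes "f \<in> addhom T B" "\<And>x y. \<lbrakk>x \<in> carrier M; y \<in> carrier N\<rbrakk> \<Longrightarrow> f (el x y) = v x y"
    and "U \<in> carrier T"
  shows "tensor_lift B v U = f U"
  by (rule tensor_ext[OF lift_addhom assms(1) _ assms(3)]) (simp add: lift_el assms(2))

end

text \<open>
  Where an additive map on the tensor product is at hand, the lift of its values on pure tensors
  is that map; no balancing condition has to be verified.
\<close>

lemma additive_lift:
  assumes B: "abelian_group B" and f: "f \<in> addhom T B"
    and v: "\<And>x y. \<lbrakk>x \<in> carrier M; y \<in> carrier N\<rbrakk> \<Longrightarrow> v x y = f (el x y)" and U: "U \<in> carrier T"
  shows "tensor_lift B v U = f U"
proof -
  have "balanced_map S ra la M N B v"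
    unfolding balanced_map_def
    by (auto intro!: addhomI simp: v addhom_closed[OF f] addhom_add[OF f] el_add_left el_add_right el_balanced)
  then show ?thesis by (rule lift_unique[OF B _ f _ U]) (simp add: v)
qed

end

section \<open>The Takeuchi product\<close>

lemma tensor_lift_cong_group:
  assumes "carrier A = carrier B" "add A = add B" "ring.zero A = ring.zero B"
  shows "tensor_lift A v U = tensor_lift B v U"
  using assms
  by (simp add: tensor_lift_def finsum_def finprod_def add_pow_def int_pow_def nat_pow_def m_inv_def
      cong: if_cong)

lemma tensor_lift_group:
  "tensor_lift (tensor S ra la M N) v U = tensor_lift (tensor_group S ra la M N) v U"
  by (rule tensor_lift_cong_group) (simp_all add: tensor_def Let_def)

locale bimodule_tensor = M: k_algebra M + N: k_algebra N
  for M :: "('k :: field, 'm) module" and N :: "('k, 'n) module" +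
  fixes S :: "'s set" and ra la
  assumes ra_closed: "\<lbrakk>x \<in> carrier M; l \<in> S\<rbrakk> \<Longrightarrow> ra x l \<in> carrier M"
    and la_closed: "\<lbrakk>l \<in> S; y \<in> carrier N\<rbrakk> \<Longrightarrow> la l y \<in> carrier N"
    and ra_mult: "\<lbrakk>x \<in> carrier M; x' \<in> carrier M; l \<in> S\<rbrakk> \<Longrightarrow> ra (x \<otimes>\<^bsub>M\<^esub> x') l = ra x l \<otimes>\<^bsub>M\<^esub> x'"
    and la_mult: "\<lbrakk>y \<in> carrier N; y' \<in> carrier N; l \<in> S\<rbrakk> \<Longrightarrow> la l (y \<otimes>\<^bsub>N\<^esub> y') = la l y \<otimes>\<^bsub>N\<^esub> y'"
    and ra_scale: "\<lbrakk>x \<in> carrier M; l \<in> S\<rbrakk> \<Longrightarrow> ra (c \<odot>\<^bsub>M\<^esub> x) l = c \<odot>\<^bsub>M\<^esub> ra x l"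
begin

sublocale balanced_tensor M N S ra la
  by unfold_locales (simp_all add: ra_closed la_closed)

text \<open>
  Right multiplication by a pure tensor exists on the whole tensor product because the balancing
  relations are imposed by left multiplications.
\<close>

definition rmul where
  "rmul U x' y' = tensor_lift T (\<lambda>x y. el (x \<otimes>\<^bsub>M\<^esub> x') (y \<otimes>\<^bsub>N\<^esub> y')) U"

lemma rmul_balanced:
  assumes x': "x' \<in> carrier M" and y': "y' \<in> carrier N"
  shows "balanced_map S ra la M N T (\<lambda>x y. el (x \<otimes>\<^bsub>M\<^esub> x') (y \<otimes>\<^bsub>N\<^esub> y'))"
  unfolding balanced_map_def
proof (intro conjI ballI)
  fix x l y assume "x \<in> carrier M" "l \<in> S" "y \<in> carrier N"
  then show "el (ra x l \<otimes>\<^bsub>M\<^esub> x') (y \<otimes>\<^bsub>N\<^esub> y') = el (x \<otimes>\<^bsub>M\<^esub> x') (la l y \<otimes>\<^bsub>N\<^esub> y')"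
    using x' y' el_balanced[of "x \<otimes>\<^bsub>M\<^esub> x'" l "y \<otimes>\<^bsub>N\<^esub> y'"] by (simp add: ra_mult la_mult)
next
  fix x assume x: "x \<in> carrier M"
  show "(\<lambda>y. el (x \<otimes>\<^bsub>M\<^esub> x') (y \<otimes>\<^bsub>N\<^esub> y')) \<in> addhom N T"
    by (rule addhom_comp[OF N.mult_addhom_right[OF y'] el_addhom_right]) (use x x' in simp)
next
  fix y assume y: "y \<in> carrier N"
  show "(\<lambda>x. el (x \<otimes>\<^bsub>M\<^esub> x') (y \<otimes>\<^bsub>N\<^esub> y')) \<in> addhom M T"
    by (rule addhom_comp[OF M.mult_addhom_right[OF x'] el_addhom_left]) (use y y' in simp)
qed

lemma rmul_addhom: "\<lbrakk>x' \<in> carrier M; y' \<in> carrier N\<rbrakk> \<Longrightarrow> (\<lambda>U. rmul U x' y') \<in> addhom T T"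
  unfolding rmul_def by (rule lift_addhom[OF abelian_tensor rmul_balanced])

lemma rmul_el [simp]:
  "\<lbrakk>x \<in> carrier M; y \<in> carrier N; x' \<in> carrier M; y' \<in> carrier N\<rbrakk> \<Longrightarrow>
     rmul (el x y) x' y' = el (x \<otimes>\<^bsub>M\<^esub> x') (y \<otimes>\<^bsub>N\<^esub> y')"
  unfolding rmul_def by (rule lift_el[OF abelian_tensor rmul_balanced])

lemma rmul_closed [simp]:
  "\<lbrakk>U \<in> carrier T; x \<in> carrier M; y \<in> carrier N\<rbrakk> \<Longrightarrow> rmul U x y \<in> carrier T"
  using addhom_closed[OF rmul_addhom] .

lemma rmul_add [simp]:
  "\<lbrakk>U \<in> carrier T; V \<in> carrier T; x \<in> carrier M; y \<in> carrier N\<rbrakk> \<Longrightarrow>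
     rmul (U \<oplus>\<^bsub>T\<^esub> V) x y = rmul U x y \<oplus>\<^bsub>T\<^esub> rmul V x y"
  using addhom_add[OF rmul_addhom] .

lemma rmul_add_left:
  assumes "U \<in> carrier T" "x \<in> carrier M" "x' \<in> carrier M" "y \<in> carrier N"
  shows "rmul U (x \<oplus>\<^bsub>M\<^esub> x') y = rmul U x y \<oplus>\<^bsub>T\<^esub> rmul U x' y"
  using assms(1) by (induction rule: tensor_induct)
    (use assms in \<open>simp_all add: M.A.r_distr el_add_left T.add.m_ac\<close>)

lemma rmul_add_right:
  assumes "U \<in> carrier T" "x \<in> carrier M" "y \<in> carrier N" "y' \<in> carrier N"
  shows "rmul U x (y \<oplus>\<^bsub>N\<^esub> y') = rmul U x y \<oplus>\<^bsub>T\<^esub> rmul U x y'"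
  using assms(1) by (induction rule: tensor_induct)
    (use assms in \<open>simp_all add: N.A.r_distr el_add_right T.add.m_ac\<close>)

lemma rmul_rmul:
  assumes "U \<in> carrier T" "x \<in> carrier M" "x' \<in> carrier M" "y \<in> carrier N" "y' \<in> carrier N"
  shows "rmul (rmul U x y) x' y' = rmul U (x \<otimes>\<^bsub>M\<^esub> x') (y \<otimes>\<^bsub>N\<^esub> y')"
  using assms(1) by (induction rule: tensor_induct)
    (use assms in \<open>simp_all add: M.A.m_assoc N.A.m_assoc\<close>)

lemma rmul_one: "U \<in> carrier T \<Longrightarrow> rmul U \<one>\<^bsub>M\<^esub> \<one>\<^bsub>N\<^esub> = U"
  by (induction rule: tensor_induct) simp_all

text \<open>
  The elements \<open>U\<close> for which \<open>rmul U\<close> is balanced, so that \<open>U V\<close> is defined for every \<open>V\<close>. They form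
  an algebra, although the whole tensor product does not.
\<close>

definition takeuchi where
  "takeuchi = {U \<in> carrier T. \<forall>l\<in>S. rmul U (ra \<one>\<^bsub>M\<^esub> l) \<one>\<^bsub>N\<^esub> = rmul U \<one>\<^bsub>M\<^esub> (la l \<one>\<^bsub>N\<^esub>)}"

lemma takeuchiI:
  "\<lbrakk>U \<in> carrier T; \<And>l. l \<in> S \<Longrightarrow> rmul U (ra \<one>\<^bsub>M\<^esub> l) \<one>\<^bsub>N\<^esub> = rmul U \<one>\<^bsub>M\<^esub> (la l \<one>\<^bsub>N\<^esub>)\<rbrakk> \<Longrightarrow> U \<in> takeuchi"
  unfolding takeuchi_def by blast

lemma takeuchi_rmul:
  "\<lbrakk>U \<in> takeuchi; l \<in> S\<rbrakk> \<Longrightarrow> rmul U (ra \<one>\<^bsub>M\<^esub> l) \<one>\<^bsub>N\<^esub> = rmul U \<one>\<^bsub>M\<^esub> (la l \<one>\<^bsub>N\<^esub>)"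
  unfolding takeuchi_def by blast

lemma takeuchi_subset: "takeuchi \<subseteq> carrier T"
  unfolding takeuchi_def by blast

lemma takeuchi_carrier [simp]: "U \<in> takeuchi \<Longrightarrow> U \<in> carrier T"
  unfolding takeuchi_def by blast

lemma rmul_balanced_map:
  assumes U: "U \<in> takeuchi"
  shows "balanced_map S ra la M N T (rmul U)"
  unfolding balanced_map_def
proof (intro conjI ballI)
  fix x l y assume xy: "x \<in> carrier M" "l \<in> S" "y \<in> carrier N"
  have "rmul U (ra x l) y = rmul (rmul U (ra \<one>\<^bsub>M\<^esub> l) \<one>\<^bsub>N\<^esub>) x y"
    using U xy by (simp add: rmul_rmul ra_mult[symmetric])
  also have "\<dots> = rmul (rmul U \<one>\<^bsub>M\<^esub> (la l \<one>\<^bsub>N\<^esub>)) x y"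
    using takeuchi_rmul[OF U xy(2)] by simp
  also have "\<dots> = rmul U x (la l y)"
    using U xy by (simp add: rmul_rmul la_mult[symmetric])
  finally show "rmul U (ra x l) y = rmul U x (la l y)" .
qed (use U in \<open>auto intro!: addhomI simp: rmul_add_left rmul_add_right\<close>)

lemma tensor_mult_eq: "U \<otimes>\<^bsub>T\<^esub> V = tensor_lift T (rmul U) V"
  unfolding rmul_def[abs_def] tensor_lift_group by (simp add: tensor_def[of S ra la M N] Let_def)

lemma mult_addhom_tensor: "U \<in> takeuchi \<Longrightarrow> (\<lambda>V. U \<otimes>\<^bsub>T\<^esub> V) \<in> addhom T T"
  unfolding tensor_mult_eq by (rule lift_addhom[OF abelian_tensor rmul_balanced_map])

lemma mult_el: "\<lbrakk>U \<in> takeuchi; x \<in> carrier M; y \<in> carrier N\<rbrakk> \<Longrightarrow> U \<otimes>\<^bsub>T\<^esub> el x y = rmul U x y"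
  unfolding tensor_mult_eq by (rule lift_el[OF abelian_tensor rmul_balanced_map])

lemma mult_closed: "\<lbrakk>U \<in> takeuchi; V \<in> carrier T\<rbrakk> \<Longrightarrow> U \<otimes>\<^bsub>T\<^esub> V \<in> carrier T"
  using addhom_closed[OF mult_addhom_tensor] .

lemma mult_add:
  "\<lbrakk>U \<in> takeuchi; V \<in> carrier T; W \<in> carrier T\<rbrakk> \<Longrightarrow> U \<otimes>\<^bsub>T\<^esub> (V \<oplus>\<^bsub>T\<^esub> W) = U \<otimes>\<^bsub>T\<^esub> V \<oplus>\<^bsub>T\<^esub> U \<otimes>\<^bsub>T\<^esub> W"
  using addhom_add[OF mult_addhom_tensor] .

lemma mult_rmul:
  assumes "U \<in> takeuchi" "V \<in> carrier T" "x \<in> carrier M" "y \<in> carrier N"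
  shows "rmul (U \<otimes>\<^bsub>T\<^esub> V) x y = U \<otimes>\<^bsub>T\<^esub> rmul V x y"
  using assms(2) by (induction rule: tensor_induct)
    (use assms in \<open>simp_all add: mult_el mult_add mult_closed rmul_rmul\<close>)

lemma takeuchi_mult: "\<lbrakk>U \<in> takeuchi; V \<in> takeuchi\<rbrakk> \<Longrightarrow> U \<otimes>\<^bsub>T\<^esub> V \<in> takeuchi"
  by (rule takeuchiI) (simp_all add: mult_closed mult_rmul takeuchi_rmul)

lemma takeuchi_add: "\<lbrakk>U \<in> takeuchi; V \<in> takeuchi\<rbrakk> \<Longrightarrow> U \<oplus>\<^bsub>T\<^esub> V \<in> takeuchi"
  by (intro takeuchiI) (simp_all add: takeuchi_rmul)

lemma takeuchi_zero: "\<zero>\<^bsub>T\<^esub> \<in> takeuchi"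
  using addhom_zero[OF rmul_addhom abelian_tensor abelian_tensor]
  by (intro takeuchiI) (simp_all add: takeuchi_rmul)

lemma takeuchi_uminus: "U \<in> takeuchi \<Longrightarrow> \<ominus>\<^bsub>T\<^esub> U \<in> takeuchi"
  using addhom_uminus[OF rmul_addhom abelian_tensor abelian_tensor]
  by (intro takeuchiI) (simp_all add: takeuchi_rmul)

lemma tensor_one: "\<one>\<^bsub>T\<^esub> = el \<one>\<^bsub>M\<^esub> \<one>\<^bsub>N\<^esub>"
  by (simp add: tensor_def Let_def)

lemma takeuchi_one: "\<one>\<^bsub>T\<^esub> \<in> takeuchi"
  using el_balanced[of "\<one>\<^bsub>M\<^esub>" _ "\<one>\<^bsub>N\<^esub>"] by (intro takeuchiI) (simp_all add: tensor_one)

lemma takeuchi_assoc: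
  assumes "U \<in> takeuchi" "V \<in> takeuchi" "W \<in> carrier T"
  shows "U \<otimes>\<^bsub>T\<^esub> V \<otimes>\<^bsub>T\<^esub> W = U \<otimes>\<^bsub>T\<^esub> (V \<otimes>\<^bsub>T\<^esub> W)"
  using assms(3) by (induction rule: tensor_induct)
    (use assms in \<open>simp_all add: mult_el mult_add mult_closed mult_rmul takeuchi_mult\<close>)

lemma mult_add_left:
  assumes "U \<in> takeuchi" "V \<in> takeuchi" "W \<in> carrier T"
  shows "(U \<oplus>\<^bsub>T\<^esub> V) \<otimes>\<^bsub>T\<^esub> W = U \<otimes>\<^bsub>T\<^esub> W \<oplus>\<^bsub>T\<^esub> V \<otimes>\<^bsub>T\<^esub> W"
  using assms(3) by (induction rule: tensor_induct)
    (use assms in \<open>simp_all add: mult_el mult_add mult_closed takeuchi_add T.add.m_ac\<close>)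

lemma mult_one_left: "U \<in> carrier T \<Longrightarrow> \<one>\<^bsub>T\<^esub> \<otimes>\<^bsub>T\<^esub> U = U"
  by (induction rule: tensor_induct)
    (use takeuchi_one in \<open>simp_all add: mult_el mult_add\<close>, simp add: tensor_one)

lemma mult_one_right: "U \<in> takeuchi \<Longrightarrow> U \<otimes>\<^bsub>T\<^esub> \<one>\<^bsub>T\<^esub> = U"
  by (simp add: tensor_one mult_el rmul_one)

lemma scale_balanced: "balanced_map S ra la M N T (\<lambda>x y. el (c \<odot>\<^bsub>M\<^esub> x) y)"
  by (auto simp: balanced_map_def M.scale_add_right el_add_left el_add_right el_balanced
      ra_scale[symmetric] intro!: addhomI)

lemma scale_eq: "c \<odot>\<^bsub>T\<^esub> U = tensor_lift T (\<lambda>x y. el (c \<odot>\<^bsub>M\<^esub> x) y) U"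
  unfolding tensor_lift_group by (simp add: tensor_def[of S ra la M N] Let_def)

lemma scale_el [simp]: "\<lbrakk>x \<in> carrier M; y \<in> carrier N\<rbrakk> \<Longrightarrow> c \<odot>\<^bsub>T\<^esub> el x y = el (c \<odot>\<^bsub>M\<^esub> x) y"
  unfolding scale_eq by (rule lift_el[OF abelian_tensor scale_balanced])

lemma scale_addhom: "(\<lambda>U. c \<odot>\<^bsub>T\<^esub> U) \<in> addhom T T"
  unfolding scale_eq by (rule lift_addhom[OF abelian_tensor scale_balanced])

lemma scale_closed [simp]: "U \<in> carrier T \<Longrightarrow> c \<odot>\<^bsub>T\<^esub> U \<in> carrier T"
  using addhom_closed[OF scale_addhom] .

lemma scale_add [simp]:
  "\<lbrakk>U \<in> carrier T; V \<in> carrier T\<rbrakk> \<Longrightarrow> c \<odot>\<^bsub>T\<^esub> (U \<oplus>\<^bsub>T\<^esub> V) = c \<odot>\<^bsub>T\<^esub> U \<oplus>\<^bsub>T\<^esub> c \<odot>\<^bsub>T\<^esub> V"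
  using addhom_add[OF scale_addhom] .

lemma scale_rmul:
  assumes "U \<in> carrier T" "x \<in> carrier M" "y \<in> carrier N"
  shows "rmul (c \<odot>\<^bsub>T\<^esub> U) x y = c \<odot>\<^bsub>T\<^esub> rmul U x y" "rmul U (c \<odot>\<^bsub>M\<^esub> x) y = c \<odot>\<^bsub>T\<^esub> rmul U x y"
  using assms(1) by (induction rule: tensor_induct)
    (use assms in \<open>simp_all add: M.smult_mult_left M.smult_mult_right\<close>)

lemma takeuchi_scale: "U \<in> takeuchi \<Longrightarrow> c \<odot>\<^bsub>T\<^esub> U \<in> takeuchi"
  by (intro takeuchiI) (simp_all add: scale_rmul takeuchi_rmul)

lemma scale_mult_left:
  assumes "U \<in> takeuchi" "V \<in> carrier T"
  shows "(c \<odot>\<^bsub>T\<^esub> U) \<otimes>\<^bsub>T\<^esub> V = c \<odot>\<^bsub>T\<^esub> (U \<otimes>\<^bsub>T\<^esub> V)"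
  using assms(2) by (induction rule: tensor_induct)
    (use assms in \<open>simp_all add: mult_el mult_add mult_closed takeuchi_scale scale_rmul\<close>)

lemma scale_mult_right:
  assumes "U \<in> takeuchi" "V \<in> carrier T"
  shows "U \<otimes>\<^bsub>T\<^esub> (c \<odot>\<^bsub>T\<^esub> V) = c \<odot>\<^bsub>T\<^esub> (U \<otimes>\<^bsub>T\<^esub> V)"
  using assms(2) by (induction rule: tensor_induct)
    (use assms in \<open>simp_all add: mult_el mult_add mult_closed scale_rmul\<close>)

lemma scale_add_scalar:
  "U \<in> carrier T \<Longrightarrow> (c + d) \<odot>\<^bsub>T\<^esub> U = c \<odot>\<^bsub>T\<^esub> U \<oplus>\<^bsub>T\<^esub> d \<odot>\<^bsub>T\<^esub> U"
  by (induction rule: tensor_induct) (simp_all add: M.scale_add_left el_add_left T.add.m_ac)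

lemma scale_scale_tensor: "U \<in> carrier T \<Longrightarrow> (c * d) \<odot>\<^bsub>T\<^esub> U = c \<odot>\<^bsub>T\<^esub> (d \<odot>\<^bsub>T\<^esub> U)"
  by (induction rule: tensor_induct) (simp_all add: M.scale_scale)

lemma scale_one_tensor: "U \<in> carrier T \<Longrightarrow> 1 \<odot>\<^bsub>T\<^esub> U = U"
  by (induction rule: tensor_induct) simp_all

abbreviation "TK \<equiv> T\<lparr>carrier := takeuchi\<rparr>"

lemma takeuchi_ring: "ring TK"
proof -
  have inv: "\<exists>V\<in>takeuchi. U \<oplus>\<^bsub>T\<^esub> V = \<zero>\<^bsub>T\<^esub>" if "U \<in> takeuchi" for U
    using takeuchi_uminus[OF that] T.r_neg[of U] that by (intro bexI[of _ "\<ominus>\<^bsub>T\<^esub> U"]) simp_all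
  show ?thesis
    by (rule ringI, rule abelian_groupI; (rule monoidI)?)
      (simp_all add: takeuchi_add takeuchi_zero T.add.m_ac inv takeuchi_mult takeuchi_one
        takeuchi_assoc mult_one_left mult_one_right mult_add_left mult_add)
qed

lemma k_algebra_takeuchi: "k_algebra TK"
  by (rule k_algebraI[OF takeuchi_ring])
    (simp_all add: takeuchi_scale scale_add_scalar scale_scale_tensor scale_one_tensor
      scale_mult_left scale_mult_right)

lemma takeuchi_addhom: "(\<lambda>U. U) \<in> addhom TK T"
  by (rule addhomI) simp_all

lemma el_mult_el:
  "\<lbrakk>el x y \<in> takeuchi; x \<in> carrier M; y \<in> carrier N; x' \<in> carrier M; y' \<in> carrier N\<rbrakk> \<Longrightarrow>
     el x y \<otimes>\<^bsub>T\<^esub> el x' y' = el (x \<otimes>\<^bsub>M\<^esub> x') (y \<otimes>\<^bsub>N\<^esub> y')"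
  by (simp add: mult_el)

lemma el_takeuchiI:
  assumes "x \<in> carrier M" "y \<in> carrier N"
    and "\<And>l. l \<in> S \<Longrightarrow> el (x \<otimes>\<^bsub>M\<^esub> ra \<one>\<^bsub>M\<^esub> l) y = el x (y \<otimes>\<^bsub>N\<^esub> la l \<one>\<^bsub>N\<^esub>)"
  shows "el x y \<in> takeuchi"
  using assms by (intro takeuchiI) (simp_all add: takeuchi_rmul)

end

section \<open>Tensor products of algebras\<close>

locale algebra_tensor = A: k_algebra A + B: k_algebra B
  for A :: "('k :: field, 'm) module" and B :: "('k, 'n) module"
begin

sublocale bimodule_tensor A B UNIV "\<lambda>x c. c \<odot>\<^bsub>A\<^esub> x" "\<lambda>c y. c \<odot>\<^bsub>B\<^esub> y"
  by unfold_locales (simp_all add: A.smult_mult_left B.smult_mult_left A.scale_scale mult.commute)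

text \<open>
  Scalars are central, hence over the ground field every tensor qualifies.
\<close>

lemma takeuchi_eq: "takeuchi = carrier T"
proof -
  have "U \<in> takeuchi" if "U \<in> carrier T" for U
    using that
  proof (induction rule: tensor_induct)
    case (el x y)
    then show ?case
      using el_balanced[of x _ y]
      by (intro el_takeuchiI) (simp_all add: A.smult_mult_right B.smult_mult_right)
  qed (rule takeuchi_add)
  then show ?thesis using takeuchi_subset by blast
qed

lemma T_eq: "T = tensor_algebra A B" and el_eq: "el = pure_tensor A B"
  by (simp_all add: tensor_algebra_def pure_tensor_def)

lemma k_algebra_tensor: "k_algebra (tensor_algebra A B)"
  using k_algebra_takeuchi unfolding takeuchi_eq T_eq by simp

lemma pure_mult:
  "\<lbrakk>x \<in> carrier A; y \<in> carrier B; x' \<in> carrier A; y' \<in> carrier B\<rbrakk> \<Longrightarrow>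
     pure_tensor A B x y \<otimes>\<^bsub>tensor_algebra A B\<^esub> pure_tensor A B x' y' =
     pure_tensor A B (x \<otimes>\<^bsub>A\<^esub> x') (y \<otimes>\<^bsub>B\<^esub> y')"
  using el_mult_el unfolding takeuchi_eq T_eq el_eq by (simp add: el_closed[unfolded T_eq el_eq])

lemmas pure_closed [simp] = el_closed[unfolded T_eq el_eq]
lemmas pure_add_left = el_add_left[unfolded T_eq el_eq]
lemmas pure_add_right = el_add_right[unfolded T_eq el_eq]
lemmas pure_addhom_left = el_addhom_left[unfolded T_eq el_eq]
lemmas pure_addhom_right = el_addhom_right[unfolded T_eq el_eq]
lemmas pure_scale = scale_el[unfolded T_eq el_eq]
lemmas pure_balanced = el_balanced[unfolded T_eq el_eq]
lemmas pure_one = tensor_one[unfolded T_eq el_eq]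
lemmas pure_induct [consumes 1, case_names el add] = tensor_induct[unfolded T_eq el_eq]
lemmas pure_lift = lift_el[unfolded el_eq]
lemmas pure_lift_addhom = lift_addhom[unfolded T_eq]
text \<open>Two homomorphisms with commuting images induce one on the tensor product.\<close>

lemma
  assumes C: "k_algebra C" and f: "f \<in> k_algebra_hom A C" and g: "g \<in> k_algebra_hom B C"
    and comm: "\<And>x y. \<lbrakk>x \<in> carrier A; y \<in> carrier B\<rbrakk> \<Longrightarrow> g y \<otimes>\<^bsub>C\<^esub> f x = f x \<otimes>\<^bsub>C\<^esub> g y"
  shows tensor_hom_pure: "\<lbrakk>x \<in> carrier A; y \<in> carrier B\<rbrakk> \<Longrightarrow>
      tensor_lift C (\<lambda>x y. f x \<otimes>\<^bsub>C\<^esub> g y) (pure_tensor A B x y) = f x \<otimes>\<^bsub>C\<^esub> g y"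
    and tensor_hom: "tensor_lift C (\<lambda>x y. f x \<otimes>\<^bsub>C\<^esub> g y) \<in> k_algebra_hom (tensor_algebra A B) C"
proof -
  interpret C: k_algebra C by (rule C)
  interpret TA: k_algebra "tensor_algebra A B" by (rule k_algebra_tensor)
  note fc = khom_closed[OF f] and gc = khom_closed[OF g]
  have bal: "balanced_map UNIV (\<lambda>x c. c \<odot>\<^bsub>A\<^esub> x) (\<lambda>c y. c \<odot>\<^bsub>B\<^esub> y) A B C (\<lambda>x y. f x \<otimes>\<^bsub>C\<^esub> g y)"
    unfolding balanced_map_def
    by (auto intro!: addhomI simp: fc gc khom_add[OF f] khom_add[OF g] khom_scale[OF f]
        khom_scale[OF g] C.A.l_distr C.A.r_distr C.smult_mult_left C.smult_mult_right)
  note lp = pure_lift[OF C.abelian_group bal]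
  note add = pure_lift_addhom[OF C.abelian_group bal]
  note c = addhom_closed[OF add] and a = addhom_add[OF add]
  show "tensor_lift C (\<lambda>x y. f x \<otimes>\<^bsub>C\<^esub> g y) (pure_tensor A B x y) = f x \<otimes>\<^bsub>C\<^esub> g y"
    if "x \<in> carrier A" "y \<in> carrier B" for x y using lp that .
  show "tensor_lift C (\<lambda>x y. f x \<otimes>\<^bsub>C\<^esub> g y) \<in> k_algebra_hom (tensor_algebra A B) C" (is "?h \<in> _")
  proof (rule k_algebra_homI)
    fix U V assume U: "U \<in> carrier (tensor_algebra A B)" and V: "V \<in> carrier (tensor_algebra A B)"
    show "?h U \<in> carrier C" using U by (rule c)
    show "?h (U \<oplus>\<^bsub>tensor_algebra A B\<^esub> V) = ?h U \<oplus>\<^bsub>C\<^esub> ?h V" using U V by (rule a)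
    show "?h (U \<otimes>\<^bsub>tensor_algebra A B\<^esub> V) = ?h U \<otimes>\<^bsub>C\<^esub> ?h V"
      using V
    proof (induction rule: pure_induct)
      case V: (el x' y')
      show ?case
        using U
      proof (induction rule: pure_induct)
        case (el x y)
        have "g y \<otimes>\<^bsub>C\<^esub> (f x' \<otimes>\<^bsub>C\<^esub> g y') = f x' \<otimes>\<^bsub>C\<^esub> (g y \<otimes>\<^bsub>C\<^esub> g y')"
          using el V by (simp add: fc gc comm flip: C.A.m_assoc)
        then show ?case
          using el V by (simp add: pure_mult lp khom_mult[OF f] khom_mult[OF g] fc gc C.A.m_assoc)
      next
        case (add U W)
        then show ?case using V by (simp add: TA.A.l_distr a c C.A.l_distr)
      qed
    next
      case (add V W)
      then show ?case using U by (simp add: TA.A.r_distr a c C.A.r_distr)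
    qed
  next
    show "?h \<one>\<^bsub>tensor_algebra A B\<^esub> = \<one>\<^bsub>C\<^esub>"
      by (simp add: pure_one lp khom_one[OF f] khom_one[OF g])
  next
    fix k U assume "U \<in> carrier (tensor_algebra A B)"
    then show "?h (k \<odot>\<^bsub>tensor_algebra A B\<^esub> U) = k \<odot>\<^bsub>C\<^esub> ?h U"
      by (induction rule: pure_induct)
        (simp_all add: pure_scale lp khom_scale[OF f] fc gc C.smult_mult_left
          TA.scale_add_right C.scale_add_right a c)
  qed
qed

end

section \<open>Algebras with a multiplicative basis\<close>

definition opt_single :: "'b option \<Rightarrow> 'k \<Rightarrow> ('b \<Rightarrow>\<^sub>0 'k :: zero)" where
  "opt_single w c = (case w of None \<Rightarrow> 0 | Some b \<Rightarrow> Poly_Mapping.single b c)"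

definition pm_mult ::
    "('b \<Rightarrow> 'b \<Rightarrow> 'b option) \<Rightarrow> ('b \<Rightarrow>\<^sub>0 'k :: field) \<Rightarrow> ('b \<Rightarrow>\<^sub>0 'k) \<Rightarrow> ('b \<Rightarrow>\<^sub>0 'k)" where
  "pm_mult op f g = (\<Sum>u\<in>keys f. \<Sum>v\<in>keys g. opt_single (op u v) (lookup f u * lookup g v))"

lemma opt_single_simps [simp]:
  "opt_single None c = 0" "opt_single (Some b) c = Poly_Mapping.single b c"
  by (simp_all add: opt_single_def)

lemma opt_single_add: "opt_single w (c + d) = opt_single w c + opt_single w d"
  for c d :: "'k :: field"
  by (cases w) (simp_all add: single_add)

lemma opt_single_zero [simp]: "opt_single w 0 = 0"
  by (cases w) simp_all

lemma pm_mult_add_right: "pm_mult op f (g + h) = pm_mult op f g + pm_mult op f h"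
  unfolding pm_mult_def
  by (subst setsum_keys_plus_distrib[of "\<lambda>v d. opt_single (op _ v) (_ * d)"])
    (simp_all add: ring_distribs opt_single_add sum.distrib)

lemma pm_mult_add_left: "pm_mult op (f + g) h = pm_mult op f h + pm_mult op g h"
  unfolding pm_mult_def
  by (rule setsum_keys_plus_distrib[of "\<lambda>u c. \<Sum>v\<in>keys h. opt_single (op u v) (c * lookup h v)"])
    (simp_all add: ring_distribs opt_single_add sum.distrib)

lemma pm_mult_zero [simp]: "pm_mult op 0 f = 0" "pm_mult op f 0 = 0"
  by (simp_all add: pm_mult_def)

lemma pm_mult_single [simp]:
  "pm_mult op (Poly_Mapping.single u c) (Poly_Mapping.single v d) = opt_single (op u v) (c * d)"
  by (simp add: pm_mult_def)

lemma pm_mult_sum_left: "pm_mult op (\<Sum>i\<in>I. f i) g = (\<Sum>i\<in>I. pm_mult op (f i) g)"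
  by (induction I rule: infinite_finite_induct) (simp_all add: pm_mult_add_left)

lemma pm_mult_sum_right: "pm_mult op g (\<Sum>i\<in>I. f i) = (\<Sum>i\<in>I. pm_mult op g (f i))"
  by (induction I rule: infinite_finite_induct) (simp_all add: pm_mult_add_right)

definition pm_scale :: "'k :: field \<Rightarrow> ('b \<Rightarrow>\<^sub>0 'k) \<Rightarrow> ('b \<Rightarrow>\<^sub>0 'k)" where
  "pm_scale c = Poly_Mapping.map (\<lambda>d. c * d)"

lemma lookup_pm_scale [simp]: "lookup (pm_scale c f) b = c * lookup f b"
  by (simp add: pm_scale_def map.rep_eq when_def)

lemma keys_pm_scale: "keys (pm_scale c f) \<subseteq> keys f"
  by (auto simp: in_keys_iff)

lemma pm_scale_simps [simp]:
  "pm_scale c (Poly_Mapping.single b d) = Poly_Mapping.single b (c * d)"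
  "pm_scale c (f + g) = pm_scale c f + pm_scale c g"
  "pm_scale c 0 = 0"
  by (auto intro!: poly_mapping_eqI simp: lookup_add lookup_single when_def ring_distribs)

lemma pm_scale_opt [simp]: "pm_scale c (opt_single w d) = opt_single w (c * d)"
  by (cases w) simp_all

lemma pm_scale_mult:
  "pm_mult op (pm_scale c f) g = pm_scale c (pm_mult op f g)"
  "pm_mult op f (pm_scale c g) = pm_scale c (pm_mult op f g)"
proof -
  show "pm_mult op (pm_scale c f) g = pm_scale c (pm_mult op f g)"
  proof (induction f rule: poly_mapping_keys_induct[of _ UNIV, OF subset_UNIV])
    case (2 u a)
    show ?case
      by (induction g rule: poly_mapping_keys_induct[of _ UNIV, OF subset_UNIV])
        (simp_all add: pm_mult_add_right mult.assoc)
  qed (simp_all add: pm_mult_add_left)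
  show "pm_mult op f (pm_scale c g) = pm_scale c (pm_mult op f g)"
  proof (induction f rule: poly_mapping_keys_induct[of _ UNIV, OF subset_UNIV])
    case (2 u a)
    show ?case
      by (induction g rule: poly_mapping_keys_induct[of _ UNIV, OF subset_UNIV])
        (simp_all add: pm_mult_add_right mult.left_commute)
  qed (simp_all add: pm_mult_add_left)
qed

text \<open>
  The product of two basis elements is a basis element or, where the partial operation \<open>op\<close> is
  undefined, zero. Words under concatenation and pairs of paths under composition are of this kind.
\<close>

locale basis_algebra =
  fixes A :: "('k :: field, 'b \<Rightarrow>\<^sub>0 'k) module" and S :: "'b set" and op :: "'b \<Rightarrow> 'b \<Rightarrow> 'b option"
  assumes carrier_eq: "carrier A = {f. keys f \<subseteq> S}"
    and mult_eq: "monoid.mult A = pm_mult op"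
    and zero_eq: "ring.zero A = 0" and add_eq: "add A = (+)" and smult_eq: "module.smult A = pm_scale"
    and op_closed: "\<lbrakk>u \<in> S; v \<in> S; op u v = Some w\<rbrakk> \<Longrightarrow> w \<in> S"
    and op_assoc: "\<lbrakk>u \<in> S; v \<in> S; w \<in> S\<rbrakk> \<Longrightarrow>
      Option.bind (op u v) (\<lambda>x. op x w) = Option.bind (op v w) (\<lambda>x. op u x)"
    and one_closed: "one A \<in> carrier A"
    and one_left: "u \<in> S \<Longrightarrow> pm_mult op (one A) (Poly_Mapping.single u c) = Poly_Mapping.single u c"
    and one_right: "u \<in> S \<Longrightarrow> pm_mult op (Poly_Mapping.single u c) (one A) = Poly_Mapping.single u c"
begin

lemma keys_opt_single: "\<lbrakk>u \<in> S; v \<in> S\<rbrakk> \<Longrightarrow> keys (opt_single (op u v) c) \<subseteq> S"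
  using op_closed[of u v] by (cases "op u v") auto

lemma keys_mult:
  assumes "keys f \<subseteq> S" "keys g \<subseteq> S"
  shows "keys (pm_mult op f g) \<subseteq> S"
  using assms(1)
proof (induction f rule: poly_mapping_keys_induct)
  case (single u c)
  show ?case
    using assms(2)
    by (induction g rule: poly_mapping_keys_induct)
      (use single in \<open>simp_all add: pm_mult_add_right keys_opt_single keys_subsetI\<close>)
qed (simp_all add: pm_mult_add_left keys_subsetI)

lemma mult_assoc_single:
  assumes "u \<in> S" "v \<in> S" "w \<in> S"
  shows "pm_mult op (opt_single (op u v) (a * b)) (Poly_Mapping.single w c) =
    pm_mult op (Poly_Mapping.single u a) (opt_single (op v w) (b * c))"
  using op_assoc[OF assms] by (cases "op u v"; cases "op v w") (simp_all add: mult.assoc)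

lemma mult_assoc:
  assumes "keys f \<subseteq> S" "keys g \<subseteq> S" "keys h \<subseteq> S"
  shows "pm_mult op (pm_mult op f g) h = pm_mult op f (pm_mult op g h)"
  using assms(1)
proof (induction f rule: poly_mapping_keys_induct)
  case f: (single u a)
  show ?case
    using assms(2)
  proof (induction g rule: poly_mapping_keys_induct)
    case g: (single v b)
    show ?case
      using assms(3)
      by (induction h rule: poly_mapping_keys_induct)
        (use f g in \<open>simp_all add: pm_mult_add_right mult_assoc_single\<close>)
  qed (simp_all add: pm_mult_add_right pm_mult_add_left)
qed (simp_all add: pm_mult_add_left)

lemma k_algebra: "k_algebra A"
proof -
  have inv: "\<exists>g. keys g \<subseteq> S \<and> f + g = 0" if "keys f \<subseteq> S" for f :: "'b \<Rightarrow>\<^sub>0 'k"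
    using that by (intro exI[of _ "- f"]) simp
  have l: "pm_mult op (one A) f = f" if "keys f \<subseteq> S" for f
    using that by (induction rule: poly_mapping_keys_induct) (simp_all add: pm_mult_add_right one_left)
  have r: "pm_mult op f (one A) = f" if "keys f \<subseteq> S" for f
    using that by (induction rule: poly_mapping_keys_induct) (simp_all add: pm_mult_add_left one_right)
  have one: "keys (one A) \<subseteq> S" using one_closed by (simp add: carrier_eq)
  have "ring A"
    by (rule ringI, rule abelian_groupI; (rule monoidI)?)
      (simp_all add: carrier_eq mult_eq add_eq zero_eq keys_mult mult_assoc keys_subsetI
        pm_mult_add_left pm_mult_add_right ac_simps l r one inv)
  then show ?thesis
    by (rule k_algebraI)
      (simp_all add: carrier_eq mult_eq add_eq smult_eq pm_scale_mult
        order.trans[OF keys_pm_scale], auto intro!: poly_mapping_eqI simp: lookup_add ring_distribs)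
qed

lemma single_closed: "u \<in> S \<Longrightarrow> Poly_Mapping.single u c \<in> carrier A"
  by (simp add: carrier_eq)

lemma finsum_eq: "f \<in> I \<rightarrow> carrier A \<Longrightarrow> (\<Oplus>\<^bsub>A\<^esub>i\<in>I. f i) = (\<Sum>i\<in>I. f i)"
proof (induction I rule: infinite_finite_induct)
  case (insert i I)
  interpret A: k_algebra A by (rule k_algebra)
  show ?case using insert by (simp add: A.finsum_insert Pi_def add_eq)
next
  case (infinite I)
  interpret A: k_algebra A by (rule k_algebra)
  show ?case using infinite by (simp add: A.finsum_infinite zero_eq)
next
  case empty
  interpret A: k_algebra A by (rule k_algebra)
  show ?case by (simp add: zero_eq)
qed

lemma basis_induct [consumes 1, case_names zero single add]:
  assumes "f \<in> carrier A" "P 0" "\<And>u c. u \<in> S \<Longrightarrow> P (Poly_Mapping.single u c)"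
    "\<And>f g. \<lbrakk>f \<in> carrier A; g \<in> carrier A; P f; P g\<rbrakk> \<Longrightarrow> P (f + g)"
  shows "P f"
  using poly_mapping_keys_induct[of f S P] assms by (simp add: carrier_eq)

lemma basis_ext:
  assumes "f \<in> addhom A C" "g \<in> addhom A C" "abelian_group C"
    and "\<And>u c. u \<in> S \<Longrightarrow> f (Poly_Mapping.single u c) = g (Poly_Mapping.single u c)" "x \<in> carrier A"
  shows "f x = g x"
  using assms(5)
proof (induction rule: basis_induct)
  case zero
  have "abelian_group A" by (rule k_algebra.abelian_group[OF k_algebra])
  then show ?case using addhom_zero[OF assms(1)] addhom_zero[OF assms(2)] assms(3) by (simp add: zero_eq)
next
  case (add x y)
  then show ?case
    using addhom_add[OF assms(1), of x y] addhom_add[OF assms(2), of x y] by (simp add: add_eq)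
qed (rule assms(4))

end

definition basis_extend :: "('k :: field, 't) module \<Rightarrow> ('b \<Rightarrow> 't) \<Rightarrow> ('b \<Rightarrow>\<^sub>0 'k) \<Rightarrow> 't" where
  "basis_extend C \<phi> f = (\<Oplus>\<^bsub>C\<^esub>w\<in>keys f. lookup f w \<odot>\<^bsub>C\<^esub> \<phi> w)"

lemma basis_extend_single:
  assumes "k_algebra C" "\<phi> u \<in> carrier C"
  shows "basis_extend C \<phi> (Poly_Mapping.single u c) = c \<odot>\<^bsub>C\<^esub> \<phi> u"
proof -
  interpret C: k_algebra C by fact
  show ?thesis
    unfolding basis_extend_def
    by (rule keys_finsum_single[OF C.abelian_group, of "\<lambda>w c. c \<odot>\<^bsub>C\<^esub> \<phi> w"]) (use assms in simp_all)
qed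

context basis_algebra
begin

lemma basis_extend_addhom:
  assumes "k_algebra C" "\<And>u. u \<in> S \<Longrightarrow> \<phi> u \<in> carrier C"
  shows "basis_extend C \<phi> \<in> addhom A C"
proof -
  interpret C: k_algebra C by fact
  show ?thesis
  proof (rule addhomI)
    fix f g assume f: "f \<in> carrier A" and g: "g \<in> carrier A"
    show "basis_extend C \<phi> f \<in> carrier C"
      unfolding basis_extend_def using f assms(2) by (intro C.finsum_closed) (auto simp: carrier_eq)
    show "basis_extend C \<phi> (f \<oplus>\<^bsub>A\<^esub> g) = basis_extend C \<phi> f \<oplus>\<^bsub>C\<^esub> basis_extend C \<phi> g"
      unfolding basis_extend_def add_eq
      by (rule keys_finsum_add[OF C.abelian_group, of S "\<lambda>w c. c \<odot>\<^bsub>C\<^esub> \<phi> w"])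
        (use f g assms(2) in \<open>auto simp: carrier_eq C.scale_add_left\<close>)
  qed
qed

lemma basis_extend_khom:
  assumes C: "k_algebra C" and \<phi>: "\<And>u. u \<in> S \<Longrightarrow> \<phi> u \<in> carrier C"
    and mult: "\<And>u v. \<lbrakk>u \<in> S; v \<in> S\<rbrakk> \<Longrightarrow>
      \<phi> u \<otimes>\<^bsub>C\<^esub> \<phi> v = (case op u v of None \<Rightarrow> \<zero>\<^bsub>C\<^esub> | Some w \<Rightarrow> \<phi> w)"
    and one: "basis_extend C \<phi> (one A) = \<one>\<^bsub>C\<^esub>"
  shows "basis_extend C \<phi> \<in> k_algebra_hom A C"
proof -
  interpret C: k_algebra C by (rule C)
  interpret A: k_algebra A by (rule k_algebra)
  let ?h = "basis_extend C \<phi>"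
  have h: "?h \<in> addhom A C" by (rule basis_extend_addhom[OF C]) (rule \<phi>)
  note c = addhom_closed[OF h] and a = addhom_add[OF h]
    and z = addhom_zero[OF h A.abelian_group C.abelian_group]
  have s: "?h (Poly_Mapping.single u x) = x \<odot>\<^bsub>C\<^esub> \<phi> u" if "u \<in> S" for u x
    using basis_extend_single[OF C, of \<phi> u] \<phi>[OF that] by blast
  have opt: "?h (opt_single (op u v) d) = d \<odot>\<^bsub>C\<^esub> (\<phi> u \<otimes>\<^bsub>C\<^esub> \<phi> v)" if "u \<in> S" "v \<in> S" for u v d
    using op_closed[OF that] mult[OF that] z by (cases "op u v") (simp_all add: s zero_eq)
  show ?thesis
  proof (rule k_algebra_homI)
    fix f g assume f: "f \<in> carrier A" and g: "g \<in> carrier A"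
    show "?h f \<in> carrier C" using f by (rule c)
    show "?h (f \<oplus>\<^bsub>A\<^esub> g) = ?h f \<oplus>\<^bsub>C\<^esub> ?h g" using f g by (rule a)
    show "?h (f \<otimes>\<^bsub>A\<^esub> g) = ?h f \<otimes>\<^bsub>C\<^esub> ?h g"
      using f
    proof (induction f rule: basis_induct)
      case f: (single u x)
      show ?case
        using g
      proof (induction g rule: basis_induct)
        case (single v y)
        then show ?case
          using f \<phi> by (simp add: mult_eq opt s C.smult_mult_left C.smult_mult_right C.scale_scale
              mult.commute)
      next
        case (add g g')
        then show ?case
          using f single_closed[of u x]
          by (simp add: A.A.r_distr a c C.A.r_distr flip: add_eq)
      qed (use f z single_closed[of u x] c in \<open>simp flip: zero_eq\<close>)
    next
      case (add f f')
      then show ?case using g by (simp add: A.A.l_distr a c C.A.l_distr flip: add_eq)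
    qed (use g z c in \<open>simp flip: zero_eq\<close>)
  next
    show "?h \<one>\<^bsub>A\<^esub> = \<one>\<^bsub>C\<^esub>" by (rule one)
  next
    fix k f assume "f \<in> carrier A"
    then show "?h (k \<odot>\<^bsub>A\<^esub> f) = k \<odot>\<^bsub>C\<^esub> ?h f"
    proof (induction f rule: basis_induct)
      case zero
      then show ?case using z by (simp flip: zero_eq)
    next
      case (single u x)
      then show ?case using \<phi> by (simp add: smult_eq s C.scale_scale)
    next
      case (add f g)
      then show ?case by (simp add: a c A.scale_add_right C.scale_add_right flip: add_eq)
    qed
  qed
qed

end

subsection \<open>Free algebras\<close>

lemma basis_algebra_free: "basis_algebra (free_algebra S) (lists S) (\<lambda>u v. Some (u @ v))"
  by unfold_locales
    (auto simp: free_algebra_def fun_eq_iff pm_mult_def pm_scale_def)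

lemma word_append: "word u \<otimes>\<^bsub>free_algebra S\<^esub> word v = word (u @ v)"
  by (simp add: free_algebra_def)

lemma free_eval_eq: "free_eval T \<phi> = basis_extend T (\<lambda>w. foldr (\<lambda>g x. \<phi> g \<otimes>\<^bsub>T\<^esub> x) w \<one>\<^bsub>T\<^esub>)"
  by (simp add: fun_eq_iff free_eval_def basis_extend_def)

context
  fixes T :: "('k :: field, 't) module" and S :: "'g set" and \<phi>
  assumes T: "k_algebra T" and \<phi>: "\<And>g. g \<in> S \<Longrightarrow> \<phi> g \<in> carrier T"
begin

interpretation T: k_algebra T by (rule T)

lemma foldr_mult_closed:
  "w \<in> lists S \<Longrightarrow> foldr (\<lambda>g x. \<phi> g \<otimes>\<^bsub>T\<^esub> x) w \<one>\<^bsub>T\<^esub> \<in> carrier T"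
  by (induction w) (auto simp: \<phi>)

lemma foldr_mult_append:
  "\<lbrakk>u \<in> lists S; v \<in> lists S\<rbrakk> \<Longrightarrow>
     foldr (\<lambda>g x. \<phi> g \<otimes>\<^bsub>T\<^esub> x) (u @ v) \<one>\<^bsub>T\<^esub> =
     foldr (\<lambda>g x. \<phi> g \<otimes>\<^bsub>T\<^esub> x) u \<one>\<^bsub>T\<^esub> \<otimes>\<^bsub>T\<^esub> foldr (\<lambda>g x. \<phi> g \<otimes>\<^bsub>T\<^esub> x) v \<one>\<^bsub>T\<^esub>"
proof (induction u)
  case Nil
  then show ?case using foldr_mult_closed[of v] by simp
next
  case (Cons g u)
  then show ?case
    using foldr_mult_closed[of v] foldr_mult_closed[of u] \<phi>[of g] by (simp add: T.A.m_assoc)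
qed

lemma free_eval_single:
  "w \<in> lists S \<Longrightarrow> free_eval T \<phi> (Poly_Mapping.single w c) = c \<odot>\<^bsub>T\<^esub> foldr (\<lambda>g x. \<phi> g \<otimes>\<^bsub>T\<^esub> x) w \<one>\<^bsub>T\<^esub>"
  unfolding free_eval_eq by (rule basis_extend_single[OF T]) (rule foldr_mult_closed)

lemma free_eval_word:
  "w \<in> lists S \<Longrightarrow> free_eval T \<phi> (word w) = foldr (\<lambda>g x. \<phi> g \<otimes>\<^bsub>T\<^esub> x) w \<one>\<^bsub>T\<^esub>"
  using foldr_mult_closed[of w] by (simp add: free_eval_single)

lemma free_eval_khom: "free_eval T \<phi> \<in> k_algebra_hom (free_algebra S) T"
proof -
  interpret F: basis_algebra "free_algebra S" "lists S" "\<lambda>u v. Some (u @ v)"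
    by (rule basis_algebra_free)
  show ?thesis
    unfolding free_eval_eq
    by (rule F.basis_extend_khom[OF T])
      (simp_all add: foldr_mult_closed foldr_mult_append[symmetric] basis_extend_single[OF T]
        free_algebra_def del: foldr_append)
qed

end

section \<open>Endomorphisms of a module\<close>

definition end_algebra :: "('k :: field, 'm) module \<Rightarrow> ('k, 'm \<Rightarrow> 'm) module" where
  "end_algebra M =
     \<lparr>carrier = extensional (carrier M) \<inter> k_linear_map M M,
      monoid.mult = compose (carrier M), one = (\<lambda>x\<in>carrier M. x),
      ring.zero = (\<lambda>x\<in>carrier M. \<zero>\<^bsub>M\<^esub>), add = (\<lambda>\<phi> \<psi>. \<lambda>x\<in>carrier M. \<phi> x \<oplus>\<^bsub>M\<^esub> \<psi> x),
      module.smult = (\<lambda>c \<phi>. \<lambda>x\<in>carrier M. c \<odot>\<^bsub>M\<^esub> \<phi> x)\<rparr>"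

lemma k_linear_mapI:
  assumes "\<And>x. x \<in> carrier A \<Longrightarrow> f x \<in> carrier B"
    and "\<And>x y. \<lbrakk>x \<in> carrier A; y \<in> carrier A\<rbrakk> \<Longrightarrow> f (x \<oplus>\<^bsub>A\<^esub> y) = f x \<oplus>\<^bsub>B\<^esub> f y"
    and "\<And>c x. x \<in> carrier A \<Longrightarrow> f (c \<odot>\<^bsub>A\<^esub> x) = c \<odot>\<^bsub>B\<^esub> f x"
  shows "f \<in> k_linear_map A B"
  using assms by (auto simp: k_linear_map_def hom_def)

context k_algebra
begin

abbreviation "E \<equiv> end_algebra A"

lemma end_simps:
  "\<phi> \<in> carrier E \<Longrightarrow> x \<in> carrier A \<Longrightarrow> \<phi> x \<in> carrier A"
  "\<phi> \<in> carrier E \<Longrightarrow> x \<in> carrier A \<Longrightarrow> y \<in> carrier A \<Longrightarrow> \<phi> (x \<oplus> y) = \<phi> x \<oplus> \<phi> y"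
  "\<phi> \<in> carrier E \<Longrightarrow> x \<in> carrier A \<Longrightarrow> \<phi> (c \<odot> x) = c \<odot> \<phi> x"
  "\<phi> \<in> carrier E \<Longrightarrow> x \<notin> carrier A \<Longrightarrow> \<phi> x = undefined"
  by (auto simp: end_algebra_def k_linear_map_def hom_def extensional_def)

lemma end_app:
  "x \<in> carrier A \<Longrightarrow> (\<phi> \<otimes>\<^bsub>E\<^esub> \<psi>) x = \<phi> (\<psi> x)"
  "x \<in> carrier A \<Longrightarrow> (\<phi> \<oplus>\<^bsub>E\<^esub> \<psi>) x = \<phi> x \<oplus> \<psi> x"
  "x \<in> carrier A \<Longrightarrow> (c \<odot>\<^bsub>E\<^esub> \<phi>) x = c \<odot> \<phi> x"
  "x \<in> carrier A \<Longrightarrow> \<one>\<^bsub>E\<^esub> x = x"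
  "x \<in> carrier A \<Longrightarrow> \<zero>\<^bsub>E\<^esub> x = \<zero>"
  by (auto simp: end_algebra_def compose_def)

lemma endI:
  assumes "\<And>x. x \<in> carrier A \<Longrightarrow> f x \<in> carrier A"
    and "\<And>x y. \<lbrakk>x \<in> carrier A; y \<in> carrier A\<rbrakk> \<Longrightarrow> f (x \<oplus> y) = f x \<oplus> f y"
    and "\<And>c x. x \<in> carrier A \<Longrightarrow> f (c \<odot> x) = c \<odot> f x"
  shows "(\<lambda>x\<in>carrier A. f x) \<in> carrier E"
  using assms by (auto simp: end_algebra_def intro!: k_linear_mapI)

lemma end_eqI:
  "\<lbrakk>\<phi> \<in> carrier E; \<psi> \<in> carrier E; \<And>x. x \<in> carrier A \<Longrightarrow> \<phi> x = \<psi> x\<rbrakk> \<Longrightarrow> \<phi> = \<psi>"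
  by (metis end_simps(4) ext)

lemma end_closed:
  assumes "\<phi> \<in> carrier E" "\<psi> \<in> carrier E"
  shows "\<phi> \<otimes>\<^bsub>E\<^esub> \<psi> \<in> carrier E" "\<phi> \<oplus>\<^bsub>E\<^esub> \<psi> \<in> carrier E" "c \<odot>\<^bsub>E\<^esub> \<phi> \<in> carrier E"
proof -
  have *: "\<And>x y z w. \<lbrakk>x \<in> carrier A; y \<in> carrier A; z \<in> carrier A; w \<in> carrier A\<rbrakk> \<Longrightarrow>
      (x \<oplus> y) \<oplus> (z \<oplus> w) = (x \<oplus> z) \<oplus> (y \<oplus> w)"
    by (simp add: M.a_ac)
  show "\<phi> \<otimes>\<^bsub>E\<^esub> \<psi> \<in> carrier E"
    using endI[of "\<lambda>x. \<phi> (\<psi> x)"] by (simp add: end_algebra_def[of A, THEN arg_cong, of monoid.mult] compose_def end_simps assms)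
  show "\<phi> \<oplus>\<^bsub>E\<^esub> \<psi> \<in> carrier E"
    using endI[of "\<lambda>x. \<phi> x \<oplus> \<psi> x"] by (simp add: end_algebra_def[of A, THEN arg_cong, of add] end_simps assms * scale_add_right)
  show "c \<odot>\<^bsub>E\<^esub> \<phi> \<in> carrier E"
    using endI[of "\<lambda>x. c \<odot> \<phi> x"]
    by (simp add: end_algebra_def[of A, THEN arg_cong, of module.smult] end_simps assms scale_add_right scale_scale mult.commute)
qed

lemma end_units: "\<one>\<^bsub>E\<^esub> \<in> carrier E" "\<zero>\<^bsub>E\<^esub> \<in> carrier E"
proof -
  show "\<one>\<^bsub>E\<^esub> \<in> carrier E"
    using endI[of "\<lambda>x. x"] by (simp add: end_algebra_def[of A, THEN arg_cong, of one])
  show "\<zero>\<^bsub>E\<^esub> \<in> carrier E"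
    using endI[of "\<lambda>x. \<zero>"] by (simp add: end_algebra_def[of A, THEN arg_cong, of ring.zero])
qed

lemma k_algebra_end: "k_algebra E"
proof -
  have inv: "\<exists>\<psi>\<in>carrier E. \<psi> \<oplus>\<^bsub>E\<^esub> \<phi> = \<zero>\<^bsub>E\<^esub>" if \<phi>: "\<phi> \<in> carrier E" for \<phi>
  proof (rule bexI)
    show "(-1) \<odot>\<^bsub>E\<^esub> \<phi> \<in> carrier E" using end_closed \<phi> by blast
    have "(-1) \<odot> x \<oplus> x = \<zero>" if "x \<in> carrier A" for x
      using scale_add_left[of x "-1" 1] that by simp
    then show "(-1) \<odot>\<^bsub>E\<^esub> \<phi> \<oplus>\<^bsub>E\<^esub> \<phi> = \<zero>\<^bsub>E\<^esub>"
      using \<phi> by (intro end_eqI) (simp_all add: end_closed end_units end_app end_simps)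
  qed
  have "ring E"
    by (rule ringI, rule abelian_groupI; (rule monoidI)?)
      (simp_all add: end_closed end_units inv, auto intro!: end_eqI simp: end_closed end_units end_app end_simps M.a_ac)
  then show ?thesis
    by (rule k_algebraI)
      (simp_all add: end_closed, auto intro!: end_eqI
        simp: end_closed end_app end_simps scale_add_left scale_add_right scale_scale)
qed

lemma end_eval_addhom: "x \<in> carrier A \<Longrightarrow> (\<lambda>\<phi>. \<phi> x) \<in> addhom E A"
  by (rule addhomI) (simp_all add: end_simps end_app)

end

section \<open>Matrix coefficients over \<open>M\<^sub>\<Lambda>(R)\<close>\<close>

definition tuples :: "'x set \<Rightarrow> nat \<Rightarrow> 'x list set" where
  "tuples XX n = {xs. set xs \<subseteq> XX \<and> length xs = n}"

lemma finite_tuples: "finite XX \<Longrightarrow> finite (tuples XX n)"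
  unfolding tuples_def by (rule finite_lists_length_eq)

lemma tuples_0: "tuples XX 0 = {[]}"
  by (auto simp: tuples_def)

lemma tuples_Suc: "tuples XX (Suc n) = (\<Union>x\<in>XX. (#) x ` tuples XX n)"
  by (auto simp: tuples_def length_Suc_conv)

lemma (in abelian_monoid) finsum_tuples_Suc:
  assumes XX: "finite XX" and f: "\<And>xs. xs \<in> tuples XX (Suc n) \<Longrightarrow> f xs \<in> carrier G"
  shows "(\<Oplus>xs\<in>tuples XX (Suc n). f xs) = (\<Oplus>x\<in>XX. \<Oplus>xs\<in>tuples XX n. f (x # xs))"
proof -
  have "(\<Oplus>xs\<in>tuples XX (Suc n). f xs) = (\<Oplus>x\<in>XX. \<Oplus>xs\<in>(#) x ` tuples XX n. f xs)"
    unfolding tuples_Suc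
    by (rule add.finprod_UN_disjoint)
      (use XX f in \<open>auto simp: finite_tuples pairwise_def disjnt_def tuples_Suc\<close>)
  also have "\<dots> = (\<Oplus>x\<in>XX. \<Oplus>xs\<in>tuples XX n. f (x # xs))"
    by (rule finsum_cong'; (subst finsum_reindex)?)
      (use f in \<open>auto simp: tuples_Suc intro!: finsum_closed\<close>)
  finally show ?thesis .
qed

fun coeff_word ::
    "('k, 'b) module \<Rightarrow> ('i \<Rightarrow> 'x \<Rightarrow> 'x \<Rightarrow> 'b) \<Rightarrow> 'i list \<Rightarrow> 'x list \<Rightarrow> 'x list \<Rightarrow> 'b" where
  "coeff_word B l (i # ks) (a # as) (b # bs) = l i a b \<otimes>\<^bsub>B\<^esub> coeff_word B l ks as bs"
| "coeff_word B l _ _ _ = \<one>\<^bsub>B\<^esub>"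

text \<open>
  \<open>K\<close> indexes several matrices of coefficients, and \<open>\<alpha> i a\<close> is the permutation of \<open>\<Lambda>\<close> attached to
  the label \<open>a\<close> in the matrix \<open>i\<close>.
\<close>

locale coefficients = R: k_algebra R + B: k_algebra B
  for R :: "('k :: field, 'r) module" and B :: "('k, 'b) module" +
  fixes XX :: "'x set" and s t :: "('l :: finite \<Rightarrow> 'r) \<Rightarrow> 'b" and K :: "'i set"
    and \<alpha> :: "'i \<Rightarrow> 'x \<Rightarrow> 'l \<Rightarrow> 'l" and l :: "'i \<Rightarrow> 'x \<Rightarrow> 'x \<Rightarrow> 'b"
  assumes finite_X: "finite XX"
    and s_hom: "s \<in> k_algebra_hom (map_algebra R) B"
    and t_hom: "t \<in> k_algebra_hom (op_algebra (map_algebra R)) B"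
    and s_t: "\<lbrakk>f \<in> carrier (map_algebra R); g \<in> carrier (map_algebra R)\<rbrakk> \<Longrightarrow> s f \<otimes>\<^bsub>B\<^esub> t g = t g \<otimes>\<^bsub>B\<^esub> s f"
    and l_closed: "\<lbrakk>i \<in> K; a \<in> XX; b \<in> XX\<rbrakk> \<Longrightarrow> l i a b \<in> carrier B"
    and l_s: "\<lbrakk>i \<in> K; a \<in> XX; b \<in> XX; f \<in> carrier (map_algebra R)\<rbrakk> \<Longrightarrow>
      l i a b \<otimes>\<^bsub>B\<^esub> s f = s (shift (\<alpha> i a) f) \<otimes>\<^bsub>B\<^esub> l i a b"
    and l_t: "\<lbrakk>i \<in> K; a \<in> XX; b \<in> XX; f \<in> carrier (map_algebra R)\<rbrakk> \<Longrightarrow>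
      l i a b \<otimes>\<^bsub>B\<^esub> t f = t (shift (\<alpha> i b) f) \<otimes>\<^bsub>B\<^esub> l i a b"
begin

abbreviation "M \<equiv> map_algebra R :: ('k, 'l \<Rightarrow> 'r) module"

sublocale M: k_algebra M
  by (rule k_algebra_map_algebra) (rule R.k_algebra_axioms)

abbreviation "wd \<equiv> coeff_word B l"

lemma s_closed: "f \<in> carrier M \<Longrightarrow> s f \<in> carrier B"
  by (rule khom_closed[OF s_hom])

lemma t_closed: "f \<in> carrier M \<Longrightarrow> t f \<in> carrier B"
  using khom_closed[OF t_hom] by simp

lemma s_mult: "\<lbrakk>f \<in> carrier M; g \<in> carrier M\<rbrakk> \<Longrightarrow> s f \<otimes>\<^bsub>B\<^esub> s g = s (f \<otimes>\<^bsub>M\<^esub> g)"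
  by (rule khom_mult[OF s_hom, symmetric])

lemma t_mult: "\<lbrakk>f \<in> carrier M; g \<in> carrier M\<rbrakk> \<Longrightarrow> t f \<otimes>\<^bsub>B\<^esub> t g = t (g \<otimes>\<^bsub>M\<^esub> f)"
  using khom_mult[OF t_hom, of f g] by simp

lemma s_one: "s \<one>\<^bsub>M\<^esub> = \<one>\<^bsub>B\<^esub>"
  by (rule khom_one[OF s_hom])

lemma t_one: "t \<one>\<^bsub>M\<^esub> = \<one>\<^bsub>B\<^esub>"
  using khom_one[OF t_hom] by simp

lemma s_addhom: "s \<in> addhom M B"
  by (rule khom_addhom[OF s_hom])

lemma t_addhom: "t \<in> addhom M B"
  using khom_addhom[OF t_hom] by simp

lemma shift_closed: "f \<in> carrier M \<Longrightarrow> shift \<beta> f \<in> carrier M"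
  by (simp add: shift_def)

lemma wd_closed:
  "\<lbrakk>ks \<in> lists K; as \<in> tuples XX n; bs \<in> tuples XX n\<rbrakk> \<Longrightarrow> wd ks as bs \<in> carrier B"
  by (induction ks arbitrary: as bs n; case_tac as; case_tac bs)
    (auto simp: tuples_def l_closed)

lemma wd_append:
  "\<lbrakk>ks \<in> lists K; as \<in> tuples XX (length ks); bs \<in> tuples XX (length ks);
    ks' \<in> lists K; as' \<in> tuples XX n; bs' \<in> tuples XX n\<rbrakk> \<Longrightarrow>
    wd (ks @ ks') (as @ as') (bs @ bs') = wd ks as bs \<otimes>\<^bsub>B\<^esub> wd ks' as' bs'"
proof (induction ks arbitrary: as bs)
  case Nil
  then show ?case using wd_closed[of ks' as' n bs'] by (simp add: tuples_0)
next
  case (Cons i ks)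
  from Cons.prems obtain a as2 b bs2 where *: "as = a # as2" "bs = b # bs2" "a \<in> XX" "b \<in> XX"
    "as2 \<in> tuples XX (length ks)" "bs2 \<in> tuples XX (length ks)"
    by (auto simp: tuples_Suc)
  then show ?case
    using Cons wd_closed[of ks as2 _ bs2] wd_closed[of ks' as' n bs'] by (simp add: B.A.m_assoc l_closed)
qed

text \<open>Every word of matrix coefficients can be moved to the right of \<open>s f\<close> and \<open>t f\<close>.\<close>

fun word_shift :: "'i list \<Rightarrow> 'x list \<Rightarrow> 'l \<Rightarrow> 'l" where
  "word_shift (i # ks) (a # as) = word_shift ks as \<circ> \<alpha> i a"
| "word_shift _ _ = id"

lemma wd_s:
  "\<lbrakk>ks \<in> lists K; as \<in> tuples XX (length ks); bs \<in> tuples XX (length ks); f \<in> carrier M\<rbrakk> \<Longrightarrow>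
    wd ks as bs \<otimes>\<^bsub>B\<^esub> s f = s (shift (word_shift ks as) f) \<otimes>\<^bsub>B\<^esub> wd ks as bs"
proof (induction ks arbitrary: as bs)
  case Nil
  then show ?case using s_closed[of f] by (simp add: shift_def)
next
  case (Cons i ks)
  from Cons.prems obtain a as2 b bs2 where *: "as = a # as2" "bs = b # bs2" "a \<in> XX" "b \<in> XX"
    "as2 \<in> tuples XX (length ks)" "bs2 \<in> tuples XX (length ks)"
    by (auto simp: tuples_Suc)
  have c: "i \<in> K" "ks \<in> lists K" "wd ks as2 bs2 \<in> carrier B" "l i a b \<in> carrier B"
    using Cons.prems * by (auto intro!: wd_closed l_closed)
  let ?f = "shift (word_shift ks as2) f"
  have f: "?f \<in> carrier M" "shift (\<alpha> i a) ?f \<in> carrier M" using Cons.prems shift_closed by blast+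
  have "l i a b \<otimes>\<^bsub>B\<^esub> wd ks as2 bs2 \<otimes>\<^bsub>B\<^esub> s f = l i a b \<otimes>\<^bsub>B\<^esub> s ?f \<otimes>\<^bsub>B\<^esub> wd ks as2 bs2"
    using Cons.IH[OF c(2) *(5,6)] Cons.prems(4) c f by (simp add: B.A.m_assoc s_closed)
  also have "\<dots> = s (shift (\<alpha> i a) ?f) \<otimes>\<^bsub>B\<^esub> (l i a b \<otimes>\<^bsub>B\<^esub> wd ks as2 bs2)"
    using c f * l_s[OF c(1) *(3,4) f(1)] by (simp add: B.A.m_assoc s_closed)
  also have "shift (\<alpha> i a) ?f = shift (word_shift (i # ks) as) f"
    using * by (simp add: shift_def comp_def)
  finally show ?case using * by (simp add: comp_def)
qed

lemma wd_t:
  "\<lbrakk>ks \<in> lists K; as \<in> tuples XX (length ks); bs \<in> tuples XX (length ks); f \<in> carrier M\<rbrakk> \<Longrightarrow>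
    wd ks as bs \<otimes>\<^bsub>B\<^esub> t f = t (shift (word_shift ks bs) f) \<otimes>\<^bsub>B\<^esub> wd ks as bs"
proof (induction ks arbitrary: as bs)
  case Nil
  then show ?case using t_closed[of f] by (simp add: shift_def)
next
  case (Cons i ks)
  from Cons.prems obtain a as2 b bs2 where *: "as = a # as2" "bs = b # bs2" "a \<in> XX" "b \<in> XX"
    "as2 \<in> tuples XX (length ks)" "bs2 \<in> tuples XX (length ks)"
    by (auto simp: tuples_Suc)
  have c: "i \<in> K" "ks \<in> lists K" "wd ks as2 bs2 \<in> carrier B" "l i a b \<in> carrier B"
    using Cons.prems * by (auto intro!: wd_closed l_closed)
  let ?f = "shift (word_shift ks bs2) f"
  have f: "?f \<in> carrier M" "shift (\<alpha> i b) ?f \<in> carrier M" using Cons.prems shift_closed by blast+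
  have "l i a b \<otimes>\<^bsub>B\<^esub> wd ks as2 bs2 \<otimes>\<^bsub>B\<^esub> t f = l i a b \<otimes>\<^bsub>B\<^esub> t ?f \<otimes>\<^bsub>B\<^esub> wd ks as2 bs2"
    using Cons.IH[OF c(2) *(5,6)] Cons.prems(4) c f by (simp add: B.A.m_assoc t_closed)
  also have "\<dots> = t (shift (\<alpha> i b) ?f) \<otimes>\<^bsub>B\<^esub> (l i a b \<otimes>\<^bsub>B\<^esub> wd ks as2 bs2)"
    using c f * l_t[OF c(1) *(3,4) f(1)] by (simp add: B.A.m_assoc t_closed)
  also have "shift (\<alpha> i b) ?f = shift (word_shift (i # ks) bs) f"
    using * by (simp add: shift_def comp_def)
  finally show ?case using * by (simp add: comp_def)
qed

end

text \<open>The image of matrix coefficients under a homomorphism.\<close>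

lemma khom_coeff_word:
  assumes f: "f \<in> k_algebra_hom B B'" and "k_algebra B"
    and l: "\<And>i a b. \<lbrakk>i \<in> K; a \<in> XX; b \<in> XX\<rbrakk> \<Longrightarrow> l i a b \<in> carrier B \<and> f (l i a b) = l' i a b"
  shows "\<lbrakk>ks \<in> lists K; as \<in> tuples XX n; bs \<in> tuples XX n\<rbrakk> \<Longrightarrow>
    coeff_word B l ks as bs \<in> carrier B \<and> f (coeff_word B l ks as bs) = coeff_word B' l' ks as bs"
proof (induction ks arbitrary: as bs n)
  case Nil
  interpret B: k_algebra B by fact
  show ?case by (simp add: khom_one[OF f])
next
  case (Cons i ks)
  interpret B: k_algebra B by fact
  show ?case
    using Cons by (cases as; cases bs) (auto simp: tuples_def khom_one[OF f] khom_mult[OF f] l)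
qed

lemma coefficients_image:
  assumes "coefficients R B XX s t K \<alpha> l" and f: "f \<in> k_algebra_hom B B'" and "k_algebra B'"
  shows "coefficients R B' XX (\<lambda>x. f (s x)) (\<lambda>x. f (t x)) K \<alpha> (\<lambda>i a b. f (l i a b))"
proof -
  interpret coefficients R B XX s t K \<alpha> l by fact
  interpret B': k_algebra B' by fact
  show ?thesis
  proof unfold_locales
    show "(\<lambda>x. f (s x)) \<in> k_algebra_hom M B'" by (rule khom_comp[OF s_hom f])
    show "(\<lambda>x. f (t x)) \<in> k_algebra_hom (op_algebra M) B'" by (rule khom_comp[OF t_hom f])
  qed (use finite_X in \<open>simp_all add: khom_closed[OF f] l_closed s_closed t_closed l_s l_t s_t shift_closed
      flip: khom_mult[OF f] del: map_algebra_simps(1)\<close>)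
qed

lemma (in abelian_monoid) finsum_pair:
  assumes I: "finite I" and J: "finite J"
    and f: "\<And>i j. \<lbrakk>i \<in> I; j \<in> J\<rbrakk> \<Longrightarrow> f i j \<in> carrier G"
  shows "(\<Oplus>i\<in>I. \<Oplus>j\<in>J. f i j) = (\<Oplus>z\<in>I \<times> J. f (fst z) (snd z))"
proof -
  have "(\<Oplus>z\<in>(\<Union>i\<in>I. Pair i ` J). f (fst z) (snd z)) = (\<Oplus>i\<in>I. \<Oplus>z\<in>Pair i ` J. f (fst z) (snd z))"
    by (rule add.finprod_UN_disjoint) (use I J f in \<open>auto simp: pairwise_def disjnt_def\<close>)
  also have "\<dots> = (\<Oplus>i\<in>I. \<Oplus>j\<in>J. f i j)"
    by (rule finsum_cong'; (subst finsum_reindex)?) (use f in \<open>auto simp: inj_on_def intro!: finsum_closed\<close>)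
  also have "(\<Union>i\<in>I. Pair i ` J) = I \<times> J" by auto
  finally show ?thesis by simp
qed

section \<open>Matrix coefficients in the Takeuchi product\<close>

context coefficients
begin

sublocale TT: bimodule_tensor B B "carrier M" "\<lambda>a f. t f \<otimes>\<^bsub>B\<^esub> a" "\<lambda>f b. s f \<otimes>\<^bsub>B\<^esub> b"
  by unfold_locales
    (simp_all only: t_closed s_closed B.A.m_assoc B.smult_mult_right B.A.m_closed)

sublocale TK: k_algebra TT.TK
  by (rule TT.k_algebra_takeuchi)

definition "sT f = TT.el (s f) \<one>\<^bsub>B\<^esub>"
definition "tT f = TT.el \<one>\<^bsub>B\<^esub> (t f)"
definition "lT i a b = (\<Oplus>\<^bsub>TT.TK\<^esub>c\<in>XX. TT.el (l i a c) (l i c b))"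

lemma TK_finsum: "f \<in> I \<rightarrow> TT.takeuchi \<Longrightarrow> (\<Oplus>\<^bsub>TT.TK\<^esub>i\<in>I. f i) = (\<Oplus>\<^bsub>TT.T\<^esub>i\<in>I. f i)"
  by (rule finsum_subcarrier[OF TK.abelian_group TT.abelian_tensor TT.takeuchi_subset])

lemma TK_finsum_closed: "f \<in> I \<rightarrow> TT.takeuchi \<Longrightarrow> (\<Oplus>\<^bsub>TT.TK\<^esub>i\<in>I. f i) \<in> TT.takeuchi"
  using TK.finsum_closed[of f I] by simp

lemma st_el_eqs:
  assumes "f \<in> carrier M" "x \<in> carrier B" "y \<in> carrier B"
  shows "TT.el (t f \<otimes>\<^bsub>B\<^esub> x) y = TT.el x (s f \<otimes>\<^bsub>B\<^esub> y)"
  using TT.el_balanced assms by simp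

lemma el_scale_right:
  assumes "x \<in> carrier B" "y \<in> carrier B"
  shows "TT.el x (c \<odot>\<^bsub>B\<^esub> y) = c \<odot>\<^bsub>TT.T\<^esub> TT.el x y"
proof -
  have "s (c \<odot>\<^bsub>M\<^esub> \<one>\<^bsub>M\<^esub>) = c \<odot>\<^bsub>B\<^esub> \<one>\<^bsub>B\<^esub>" "t (c \<odot>\<^bsub>M\<^esub> \<one>\<^bsub>M\<^esub>) = c \<odot>\<^bsub>B\<^esub> \<one>\<^bsub>B\<^esub>"
    using khom_scale[OF s_hom M.A.one_closed] khom_scale[OF t_hom, of "\<one>\<^bsub>M\<^esub>"] M.A.one_closed
    by (simp_all add: s_one t_one)
  then show ?thesis
    using st_el_eqs[OF M.scale_closed[OF M.A.one_closed, of c] assms] assms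
    by (simp add: B.smult_mult_left)
qed

lemma sT_takeuchi: "f \<in> carrier M \<Longrightarrow> sT f \<in> TT.takeuchi"
  unfolding sT_def
proof (rule TT.el_takeuchiI)
  fix g assume f: "f \<in> carrier M" and g: "g \<in> carrier M"
  have "TT.el (s f \<otimes>\<^bsub>B\<^esub> t g) \<one>\<^bsub>B\<^esub> = TT.el (s f) (s g \<otimes>\<^bsub>B\<^esub> \<one>\<^bsub>B\<^esub>)"
    using st_el_eqs[OF g s_closed[OF f] B.A.one_closed] s_t[OF f g] by simp
  then show "TT.el (s f \<otimes>\<^bsub>B\<^esub> (t g \<otimes>\<^bsub>B\<^esub> \<one>\<^bsub>B\<^esub>)) \<one>\<^bsub>B\<^esub> = TT.el (s f) (\<one>\<^bsub>B\<^esub> \<otimes>\<^bsub>B\<^esub> (s g \<otimes>\<^bsub>B\<^esub> \<one>\<^bsub>B\<^esub>))"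
    using f g s_closed t_closed by simp
qed (simp_all only: s_closed B.A.one_closed)

lemma tT_takeuchi: "f \<in> carrier M \<Longrightarrow> tT f \<in> TT.takeuchi"
  unfolding tT_def
proof (rule TT.el_takeuchiI)
  fix g assume f: "f \<in> carrier M" and g: "g \<in> carrier M"
  have "TT.el (t g \<otimes>\<^bsub>B\<^esub> \<one>\<^bsub>B\<^esub>) (t f) = TT.el \<one>\<^bsub>B\<^esub> (t f \<otimes>\<^bsub>B\<^esub> s g)"
    using st_el_eqs[OF g B.A.one_closed t_closed[OF f]] s_t[OF g f] by simp
  then show "TT.el (\<one>\<^bsub>B\<^esub> \<otimes>\<^bsub>B\<^esub> (t g \<otimes>\<^bsub>B\<^esub> \<one>\<^bsub>B\<^esub>)) (t f) = TT.el \<one>\<^bsub>B\<^esub> (t f \<otimes>\<^bsub>B\<^esub> (s g \<otimes>\<^bsub>B\<^esub> \<one>\<^bsub>B\<^esub>))"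
    using f g s_closed[OF g] t_closed[OF g] by simp
qed (simp_all only: t_closed B.A.one_closed)

lemma l_takeuchi:
  assumes "i \<in> K" "a \<in> XX" "b \<in> XX" "c \<in> XX"
  shows "TT.el (l i a c) (l i c b) \<in> TT.takeuchi"
proof (rule TT.el_takeuchiI)
  fix g assume g: "g \<in> carrier M"
  have g': "shift (\<alpha> i c) g \<in> carrier M" by (rule shift_closed[OF g])
  have "TT.el (l i a c \<otimes>\<^bsub>B\<^esub> t g) (l i c b) = TT.el (l i a c) (l i c b \<otimes>\<^bsub>B\<^esub> s g)"
    using st_el_eqs[OF g' l_closed l_closed, of i a c i c b] assms g by (simp only: l_t l_s)
  then show "TT.el (l i a c \<otimes>\<^bsub>B\<^esub> (t g \<otimes>\<^bsub>B\<^esub> \<one>\<^bsub>B\<^esub>)) (l i c b) =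
      TT.el (l i a c) (l i c b \<otimes>\<^bsub>B\<^esub> (s g \<otimes>\<^bsub>B\<^esub> \<one>\<^bsub>B\<^esub>))"
    using g s_closed t_closed by simp
qed (use assms l_closed in simp_all)

lemma lT_takeuchi: "\<lbrakk>i \<in> K; a \<in> XX; b \<in> XX\<rbrakk> \<Longrightarrow> lT i a b \<in> TT.takeuchi"
  using TK.finsum_closed[of "\<lambda>c. TT.el (l i a c) (l i c b)" XX] l_takeuchi by (auto simp: lT_def)

lemma lT_eq: "\<lbrakk>i \<in> K; a \<in> XX; b \<in> XX\<rbrakk> \<Longrightarrow> lT i a b = (\<Oplus>\<^bsub>TT.T\<^esub>c\<in>XX. TT.el (l i a c) (l i c b))"
  unfolding lT_def by (rule TK_finsum) (use l_takeuchi in auto)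

lemma sT_mult_el:
  "\<lbrakk>f \<in> carrier M; x \<in> carrier B; y \<in> carrier B\<rbrakk> \<Longrightarrow> sT f \<otimes>\<^bsub>TT.T\<^esub> TT.el x y = TT.el (s f \<otimes>\<^bsub>B\<^esub> x) y"
  using TT.mult_el[OF sT_takeuchi, of f x y] s_closed[of f] by (simp add: sT_def del: map_algebra_simps(1))

lemma tT_mult_el:
  "\<lbrakk>f \<in> carrier M; x \<in> carrier B; y \<in> carrier B\<rbrakk> \<Longrightarrow> tT f \<otimes>\<^bsub>TT.T\<^esub> TT.el x y = TT.el x (t f \<otimes>\<^bsub>B\<^esub> y)"
  using TT.mult_el[OF tT_takeuchi, of f x y] t_closed[of f] by (simp add: tT_def del: map_algebra_simps(1))

text \<open>The Takeuchi product of \<open>B\<close> with itself again carries matrix coefficients.\<close>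

lemma takeuchi_coefficients: "coefficients R TT.TK XX sT tT K \<alpha> lT"
proof unfold_locales
  show "finite XX" by (rule finite_X)
  show "sT \<in> k_algebra_hom M TT.TK"
  proof (rule k_algebra_homI)
    fix f g assume f: "f \<in> carrier M" and g: "g \<in> carrier M"
    show "sT f \<in> carrier TT.TK" using sT_takeuchi[OF f] by simp
    show "sT (f \<oplus>\<^bsub>M\<^esub> g) = sT f \<oplus>\<^bsub>TT.TK\<^esub> sT g"
      using f g s_closed by (simp add: sT_def khom_add[OF s_hom] TT.el_add_left del: map_algebra_simps(1))
    show "sT (f \<otimes>\<^bsub>M\<^esub> g) = sT f \<otimes>\<^bsub>TT.TK\<^esub> sT g"
      using f g s_closed sT_mult_el[of f "s g" "\<one>\<^bsub>B\<^esub>"]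
      by (simp add: sT_def khom_mult[OF s_hom] del: map_algebra_simps(1))
    show "sT (c \<odot>\<^bsub>M\<^esub> f) = c \<odot>\<^bsub>TT.TK\<^esub> sT f" for c
      using f s_closed by (simp add: sT_def khom_scale[OF s_hom] del: map_algebra_simps(1))
  qed (simp add: sT_def s_one TT.tensor_one)
  show "tT \<in> k_algebra_hom (op_algebra M) TT.TK"
  proof (rule k_algebra_homI)
    fix f g assume f: "f \<in> carrier (op_algebra M)" and g: "g \<in> carrier (op_algebra M)"
    note * = khom_add[OF t_hom f g] khom_mult[OF t_hom f g] khom_scale[OF t_hom f]
    have fg: "f \<in> carrier M" "g \<in> carrier M" using f g by simp_all
    show "tT f \<in> carrier TT.TK" using tT_takeuchi[OF fg(1)] by simp
    show "tT (f \<oplus>\<^bsub>op_algebra M\<^esub> g) = tT f \<oplus>\<^bsub>TT.TK\<^esub> tT g"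
      using fg[THEN t_closed] *(1) by (simp add: tT_def TT.el_add_right del: map_algebra_simps(1))
    show "tT (f \<otimes>\<^bsub>op_algebra M\<^esub> g) = tT f \<otimes>\<^bsub>TT.TK\<^esub> tT g"
      using fg[THEN t_closed] tT_mult_el[of f "\<one>\<^bsub>B\<^esub>" "t g"] fg *(2)
      by (simp add: tT_def del: map_algebra_simps(1))
    show "tT (c \<odot>\<^bsub>op_algebra M\<^esub> f) = c \<odot>\<^bsub>TT.TK\<^esub> tT f" for c
      using el_scale_right fg[THEN t_closed] *(3)[of c] by (simp add: tT_def del: map_algebra_simps(1))
  qed (simp add: tT_def t_one TT.tensor_one)
  fix f g :: "'l \<Rightarrow> 'r" assume f: "f \<in> carrier M" and g: "g \<in> carrier M"
  show "sT f \<otimes>\<^bsub>TT.TK\<^esub> tT g = tT g \<otimes>\<^bsub>TT.TK\<^esub> sT f"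
    using f g s_closed t_closed sT_mult_el[OF f B.A.one_closed t_closed[OF g]]
      tT_mult_el[OF g s_closed[OF f] B.A.one_closed]
    by (simp add: sT_def tT_def del: map_algebra_simps(1))
next
  fix i a b assume i: "i \<in> K" and a: "a \<in> XX" and b: "b \<in> XX"
  show "lT i a b \<in> carrier TT.TK" using lT_takeuchi[OF i a b] by simp
  fix f :: "'l \<Rightarrow> 'r" assume f: "f \<in> carrier M"
  have f1: "shift (\<alpha> i a) f \<in> carrier M" and f2: "shift (\<alpha> i b) f \<in> carrier M"
    using shift_closed[OF f] by blast+
  have el: "(\<lambda>c. TT.el (l i a c) (l i c b)) \<in> XX \<rightarrow> carrier TT.TK"
    using l_takeuchi i a b by auto
  have lc: "l i a c \<in> carrier B" "l i c b \<in> carrier B" if "c \<in> XX" for c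
    using l_closed i a b that by blast+
  have "lT i a b \<otimes>\<^bsub>TT.TK\<^esub> sT f = (\<Oplus>\<^bsub>TT.TK\<^esub>c\<in>XX. TT.el (l i a c) (l i c b) \<otimes>\<^bsub>TT.TK\<^esub> sT f)"
    unfolding lT_def using TK.A.finsum_ldistr[OF finite_X _ el] sT_takeuchi[OF f] by simp
  also have "\<dots> = (\<Oplus>\<^bsub>TT.TK\<^esub>c\<in>XX. sT (shift (\<alpha> i a) f) \<otimes>\<^bsub>TT.TK\<^esub> TT.el (l i a c) (l i c b))"
  proof (rule TK.finsum_cong')
    fix c assume c: "c \<in> XX"
    show "TT.el (l i a c) (l i c b) \<otimes>\<^bsub>TT.TK\<^esub> sT f = sT (shift (\<alpha> i a) f) \<otimes>\<^bsub>TT.TK\<^esub> TT.el (l i a c) (l i c b)"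
      using TT.mult_el[OF l_takeuchi[OF i a b c] s_closed[OF f] B.A.one_closed] lc[OF c] s_closed[OF f]
        sT_mult_el[OF f1 lc[OF c]] l_s[OF i a c f] by (simp add: sT_def)
  qed (use l_takeuchi[OF i a b] sT_takeuchi[OF f1] in \<open>auto intro!: TT.takeuchi_mult\<close>)
  also have "\<dots> = sT (shift (\<alpha> i a) f) \<otimes>\<^bsub>TT.TK\<^esub> lT i a b"
    unfolding lT_def using TK.A.finsum_rdistr[OF finite_X _ el] sT_takeuchi[OF f1] by simp
  finally show "lT i a b \<otimes>\<^bsub>TT.TK\<^esub> sT f = sT (shift (\<alpha> i a) f) \<otimes>\<^bsub>TT.TK\<^esub> lT i a b" .
  have "lT i a b \<otimes>\<^bsub>TT.TK\<^esub> tT f = (\<Oplus>\<^bsub>TT.TK\<^esub>c\<in>XX. TT.el (l i a c) (l i c b) \<otimes>\<^bsub>TT.TK\<^esub> tT f)"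
    unfolding lT_def using TK.A.finsum_ldistr[OF finite_X _ el] tT_takeuchi[OF f] by simp
  also have "\<dots> = (\<Oplus>\<^bsub>TT.TK\<^esub>c\<in>XX. tT (shift (\<alpha> i b) f) \<otimes>\<^bsub>TT.TK\<^esub> TT.el (l i a c) (l i c b))"
  proof (rule TK.finsum_cong')
    fix c assume c: "c \<in> XX"
    show "TT.el (l i a c) (l i c b) \<otimes>\<^bsub>TT.TK\<^esub> tT f = tT (shift (\<alpha> i b) f) \<otimes>\<^bsub>TT.TK\<^esub> TT.el (l i a c) (l i c b)"
      using TT.mult_el[OF l_takeuchi[OF i a b c] B.A.one_closed t_closed[OF f]] lc[OF c] t_closed[OF f]
        tT_mult_el[OF f2 lc[OF c]] l_t[OF i c b f] by (simp add: tT_def)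
  qed (use l_takeuchi[OF i a b] tT_takeuchi[OF f2] in \<open>auto intro!: TT.takeuchi_mult\<close>)
  also have "\<dots> = tT (shift (\<alpha> i b) f) \<otimes>\<^bsub>TT.TK\<^esub> lT i a b"
    unfolding lT_def using TK.A.finsum_rdistr[OF finite_X _ el] tT_takeuchi[OF f2] by simp
  finally show "lT i a b \<otimes>\<^bsub>TT.TK\<^esub> tT f = tT (shift (\<alpha> i b) f) \<otimes>\<^bsub>TT.TK\<^esub> lT i a b" .
qed

lemma wd_el_takeuchi:
  assumes "ks \<in> lists K" "as \<in> tuples XX (length ks)" "cs \<in> tuples XX (length ks)" "bs \<in> tuples XX (length ks)"
  shows "TT.el (wd ks as cs) (wd ks cs bs) \<in> TT.takeuchi"
  using assms
proof (induction ks arbitrary: as bs cs rule: list.induct)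
  case Nil
  then show ?case using TT.takeuchi_one by (simp add: TT.tensor_one)
next
  case (Cons k ks)
  have "as \<in> tuples XX (Suc (length ks))" using Cons.prems by simp
  then obtain a as2 where a: "as = a # as2" "a \<in> XX" "as2 \<in> tuples XX (length ks)"
    unfolding tuples_Suc by blast
  have "cs \<in> tuples XX (Suc (length ks))" using Cons.prems by simp
  then obtain c cs2 where c: "cs = c # cs2" "c \<in> XX" "cs2 \<in> tuples XX (length ks)"
    unfolding tuples_Suc by blast
  have "bs \<in> tuples XX (Suc (length ks))" using Cons.prems by simp
  then obtain b bs2 where b: "bs = b # bs2" "b \<in> XX" "bs2 \<in> tuples XX (length ks)"
    unfolding tuples_Suc by blast
  have "k \<in> K" "ks \<in> lists K" using Cons.prems by auto
  note * = a b c this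
  have "TT.el (l k a c) (l k c b) \<otimes>\<^bsub>TT.T\<^esub> TT.el (wd ks as2 cs2) (wd ks cs2 bs2) \<in> TT.takeuchi"
    using * Cons.IH by (intro TT.takeuchi_mult l_takeuchi) auto
  then show ?case
    using * by (simp add: TT.el_mult_el l_takeuchi l_closed wd_closed)
qed

text \<open>The comultiplication of a word is a sum over all words in the middle.\<close>

lemma takeuchi_word:
  "\<lbrakk>ks \<in> lists K; as \<in> tuples XX (length ks); bs \<in> tuples XX (length ks)\<rbrakk> \<Longrightarrow>
    coeff_word TT.TK lT ks as bs =
    (\<Oplus>\<^bsub>TT.TK\<^esub>cs\<in>tuples XX (length ks). TT.el (wd ks as cs) (wd ks cs bs))"
proof (induction ks arbitrary: as bs)
  case Nil
  then show ?case using TT.takeuchi_one by (simp add: tuples_0 TT.tensor_one TK.finsum_insert)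
next
  case (Cons k ks)
  from Cons.prems obtain a as2 b bs2 where *: "as = a # as2" "bs = b # bs2"
    "a \<in> XX" "b \<in> XX" "as2 \<in> tuples XX (length ks)" "bs2 \<in> tuples XX (length ks)"
    "k \<in> K" "ks \<in> lists K"
    by (auto simp: tuples_Suc)
  let ?C = "tuples XX (length ks)"
  have el: "TT.el (l k a c) (l k c b) \<in> carrier TT.TK" if "c \<in> XX" for c
    using l_takeuchi * that by simp
  have wdc: "TT.el (wd ks as2 cs) (wd ks cs bs2) \<in> carrier TT.TK" if "cs \<in> ?C" for cs
    using wd_el_takeuchi * that by simp
  have "coeff_word TT.TK lT (k # ks) as bs =
      lT k a b \<otimes>\<^bsub>TT.TK\<^esub> (\<Oplus>\<^bsub>TT.TK\<^esub>cs\<in>?C. TT.el (wd ks as2 cs) (wd ks cs bs2))"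
    using Cons.IH * by simp
  also have "\<dots> = (\<Oplus>\<^bsub>TT.TK\<^esub>c\<in>XX. TT.el (l k a c) (l k c b) \<otimes>\<^bsub>TT.TK\<^esub>
      (\<Oplus>\<^bsub>TT.TK\<^esub>cs\<in>?C. TT.el (wd ks as2 cs) (wd ks cs bs2)))"
    unfolding lT_def using el wdc by (intro TK.A.finsum_ldistr finite_X TK.finsum_closed) auto
  also have "\<dots> = (\<Oplus>\<^bsub>TT.TK\<^esub>c\<in>XX. \<Oplus>\<^bsub>TT.TK\<^esub>cs\<in>?C.
      TT.el (wd (k # ks) as (c # cs)) (wd (k # ks) (c # cs) bs))"
  proof (rule TK.finsum_cong')
    fix c assume c: "c \<in> XX"
    have "TT.el (l k a c) (l k c b) \<otimes>\<^bsub>TT.TK\<^esub> (\<Oplus>\<^bsub>TT.TK\<^esub>cs\<in>?C. TT.el (wd ks as2 cs) (wd ks cs bs2)) =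
      (\<Oplus>\<^bsub>TT.TK\<^esub>cs\<in>?C. TT.el (l k a c) (l k c b) \<otimes>\<^bsub>TT.TK\<^esub> TT.el (wd ks as2 cs) (wd ks cs bs2))"
      using el[OF c] wdc by (intro TK.A.finsum_rdistr finite_tuples finite_X) auto
    also have "\<dots> = (\<Oplus>\<^bsub>TT.TK\<^esub>cs\<in>?C. TT.el (wd (k # ks) as (c # cs)) (wd (k # ks) (c # cs) bs))"
    proof (rule TK.finsum_cong')
      fix cs assume cs: "cs \<in> ?C"
      show "TT.el (l k a c) (l k c b) \<otimes>\<^bsub>TT.TK\<^esub> TT.el (wd ks as2 cs) (wd ks cs bs2) =
          TT.el (wd (k # ks) as (c # cs)) (wd (k # ks) (c # cs) bs)"
        using * c cs by (simp add: TT.el_mult_el l_takeuchi l_closed wd_closed)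
    next
      show "(\<lambda>cs. TT.el (wd (k # ks) as (c # cs)) (wd (k # ks) (c # cs) bs)) \<in> ?C \<rightarrow> carrier TT.TK"
        using wd_el_takeuchi[of "k # ks" as _ bs] Cons.prems c by (auto simp: tuples_Suc)
    qed simp
    finally show "TT.el (l k a c) (l k c b) \<otimes>\<^bsub>TT.TK\<^esub> (\<Oplus>\<^bsub>TT.TK\<^esub>cs\<in>?C. TT.el (wd ks as2 cs) (wd ks cs bs2)) =
      (\<Oplus>\<^bsub>TT.TK\<^esub>cs\<in>?C. TT.el (wd (k # ks) as (c # cs)) (wd (k # ks) (c # cs) bs))" .
  next
    show "(\<lambda>c. \<Oplus>\<^bsub>TT.TK\<^esub>cs\<in>?C. TT.el (wd (k # ks) as (c # cs)) (wd (k # ks) (c # cs) bs))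
        \<in> XX \<rightarrow> carrier TT.TK"
      using wd_el_takeuchi[of "k # ks" as _ bs] Cons.prems
      by (intro funcsetI TK.finsum_closed) (auto simp: tuples_Suc)
  qed simp
  also have "\<dots> = (\<Oplus>\<^bsub>TT.TK\<^esub>cs\<in>tuples XX (length (k # ks)). TT.el (wd (k # ks) as cs) (wd (k # ks) cs bs))"
    using TK.finsum_tuples_Suc[OF finite_X, of "length ks" "\<lambda>cs. TT.el (wd (k # ks) as cs) (wd (k # ks) cs bs)"]
      wd_el_takeuchi[of "k # ks" as _ bs] Cons.prems by simp
  finally show ?case .
qed

end

section \<open>The quadratic relations\<close>

definition frt_lhs where
  "frt_lhs B XX s m \<sigma> a b c d =
     (\<Oplus>\<^bsub>B\<^esub>z\<in>XX \<times> XX. s (\<sigma> (fst z) (snd z) a c) \<otimes>\<^bsub>B\<^esub> (m (snd z) d \<otimes>\<^bsub>B\<^esub> m (fst z) b))"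

definition frt_rhs where
  "frt_rhs B XX t m \<sigma> a b c d =
     (\<Oplus>\<^bsub>B\<^esub>z\<in>XX \<times> XX. t (\<sigma> b d (fst z) (snd z)) \<otimes>\<^bsub>B\<^esub> (m c (snd z) \<otimes>\<^bsub>B\<^esub> m a (fst z)))"

locale frt_coefficients = coefficients R B XX s t K \<alpha> l
  for R :: "('k :: field, 'r) module" and B :: "('k, 'b) module" and XX :: "'x set"
    and s t :: "('l :: finite \<Rightarrow> 'r) \<Rightarrow> 'b" and K :: "'i set" and \<alpha> l +
  fixes \<sigma> :: "'x \<Rightarrow> 'x \<Rightarrow> 'x \<Rightarrow> 'x \<Rightarrow> 'l \<Rightarrow> 'r" and u :: 'i
  assumes u: "u \<in> K"
    and sigma_closed: "\<lbrakk>a \<in> XX; b \<in> XX; c \<in> XX; d \<in> XX\<rbrakk> \<Longrightarrow> \<sigma> a b c d \<in> carrier (map_algebra R)"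
    and frt: "\<lbrakk>a \<in> XX; b \<in> XX; c \<in> XX; d \<in> XX\<rbrakk> \<Longrightarrow>
      frt_lhs B XX s (l u) \<sigma> a b c d = frt_rhs B XX t (l u) \<sigma> a b c d"
begin

lemma lT_mult:
  assumes "x \<in> XX" "y \<in> XX" "b \<in> XX" "d \<in> XX"
  shows "lT u y d \<otimes>\<^bsub>TT.T\<^esub> lT u x b =
    (\<Oplus>\<^bsub>TT.T\<^esub>w\<in>XX \<times> XX. TT.el (l u y (snd w) \<otimes>\<^bsub>B\<^esub> l u x (fst w)) (l u (snd w) d \<otimes>\<^bsub>B\<^esub> l u (fst w) b))"
proof -
  have el: "TT.el (l u p q) (l u q r) \<in> carrier TT.TK" if "p \<in> XX" "q \<in> XX" "r \<in> XX" for p q r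
    using l_takeuchi[OF u] that by simp
  have ee: "TT.el (l u y p) (l u p d) \<otimes>\<^bsub>TT.T\<^esub> TT.el (l u x q) (l u q b) =
      TT.el (l u y p \<otimes>\<^bsub>B\<^esub> l u x q) (l u p d \<otimes>\<^bsub>B\<^esub> l u q b)" if "p \<in> XX" "q \<in> XX" for p q
    using that assms u by (intro TT.el_mult_el l_takeuchi l_closed) auto
  have eet: "TT.el (l u y p \<otimes>\<^bsub>B\<^esub> l u x q) (l u p d \<otimes>\<^bsub>B\<^esub> l u q b) \<in> TT.takeuchi"
    if "p \<in> XX" "q \<in> XX" for p q
    unfolding ee[OF that, symmetric] using that assms u by (intro TT.takeuchi_mult l_takeuchi) auto
  have "lT u y d \<otimes>\<^bsub>TT.TK\<^esub> lT u x b = (\<Oplus>\<^bsub>TT.TK\<^esub>q\<in>XX. lT u y d \<otimes>\<^bsub>TT.TK\<^esub> TT.el (l u x q) (l u q b))"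
    unfolding lT_def[of u x b] using el assms lT_takeuchi[OF u]
    by (intro TK.A.finsum_rdistr finite_X) auto
  also have "\<dots> = (\<Oplus>\<^bsub>TT.TK\<^esub>q\<in>XX. \<Oplus>\<^bsub>TT.TK\<^esub>p\<in>XX.
      TT.el (l u y p \<otimes>\<^bsub>B\<^esub> l u x q) (l u p d \<otimes>\<^bsub>B\<^esub> l u q b))"
  proof (rule TK.finsum_cong')
    fix q assume q: "q \<in> XX"
    have "lT u y d \<otimes>\<^bsub>TT.TK\<^esub> TT.el (l u x q) (l u q b) =
        (\<Oplus>\<^bsub>TT.TK\<^esub>p\<in>XX. TT.el (l u y p) (l u p d) \<otimes>\<^bsub>TT.TK\<^esub> TT.el (l u x q) (l u q b))"
      unfolding lT_def using el assms q by (intro TK.A.finsum_ldistr finite_X) auto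
    then show "lT u y d \<otimes>\<^bsub>TT.TK\<^esub> TT.el (l u x q) (l u q b) =
        (\<Oplus>\<^bsub>TT.TK\<^esub>p\<in>XX. TT.el (l u y p \<otimes>\<^bsub>B\<^esub> l u x q) (l u p d \<otimes>\<^bsub>B\<^esub> l u q b))"
      using q ee eet by (simp cong: TK.finsum_cong' add: TK.finsum_cong'[OF refl])
  qed (use eet in \<open>auto intro!: TK_finsum_closed\<close>)
  also have "\<dots> = (\<Oplus>\<^bsub>TT.TK\<^esub>w\<in>XX \<times> XX.
      TT.el (l u y (snd w) \<otimes>\<^bsub>B\<^esub> l u x (fst w)) (l u (snd w) d \<otimes>\<^bsub>B\<^esub> l u (fst w) b))"
    by (rule TK.finsum_pair[OF finite_X finite_X]) (use eet in auto)
  also have "\<dots> = (\<Oplus>\<^bsub>TT.T\<^esub>w\<in>XX \<times> XX.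
      TT.el (l u y (snd w) \<otimes>\<^bsub>B\<^esub> l u x (fst w)) (l u (snd w) d \<otimes>\<^bsub>B\<^esub> l u (fst w) b))"
    by (rule TK_finsum) (use eet in auto)
  finally show ?thesis by simp
qed

text \<open>
  The relation of \<open>B\<close> is used twice: in the left factor it turns \<open>s \<sigma>\<close> into \<open>t \<sigma>\<close>, the tensor product
  moves \<open>t \<sigma>\<close> to the right factor as \<open>s \<sigma>\<close>, and there it becomes \<open>t \<sigma>\<close>.
\<close>

lemma takeuchi_frt: "frt_coefficients R TT.TK XX sT tT K \<alpha> lT \<sigma> u"
proof (intro frt_coefficients.intro frt_coefficients_axioms.intro takeuchi_coefficients)
  fix a b c d assume abcd: "a \<in> XX" "b \<in> XX" "c \<in> XX" "d \<in> XX"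
  let ?P = "XX \<times> XX"
  let ?m = "l u"
  let ?S = "\<lambda>w z. \<sigma> (fst w) (snd w) (fst z) (snd z)"
  let ?E = "\<lambda>z. ?m c (snd z) \<otimes>\<^bsub>B\<^esub> ?m a (fst z)"
  let ?D = "\<lambda>w. ?m (snd w) d \<otimes>\<^bsub>B\<^esub> ?m (fst w) b"
  let ?N = "\<lambda>z w. ?m (snd z) (snd w) \<otimes>\<^bsub>B\<^esub> ?m (fst z) (fst w)"
  note uc = l_closed[OF u]
  have S: "?S w z \<in> carrier M" if "w \<in> ?P" "z \<in> ?P" for w z
    using sigma_closed that by (auto simp del: map_algebra_simps(1))
  have s: "s (?S w z) \<in> carrier B" and t: "t (?S w z) \<in> carrier B" if "w \<in> ?P" "z \<in> ?P" for w z
    using s_closed[OF S[OF that]] t_closed[OF S[OF that]] by auto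
  have E: "?E z \<in> carrier B" and D: "?D z \<in> carrier B" if "z \<in> ?P" for z
    using uc abcd that by auto
  have N: "?N z w \<in> carrier B" if "w \<in> ?P" "z \<in> ?P" for w z
    using uc that by auto
  have ac: "(a, c) \<in> ?P" and bd: "(b, d) \<in> ?P" using abcd by auto
  have elf1: "TT.el (\<Oplus>\<^bsub>B\<^esub>z\<in>?P. f z) y = (\<Oplus>\<^bsub>TT.T\<^esub>z\<in>?P. TT.el (f z) y)"
    if "y \<in> carrier B" "f \<in> ?P \<rightarrow> carrier B" for f y
    using addhom_finsum[OF TT.el_addhom_left B.abelian_group TT.abelian_tensor] that by auto
  have elf2: "TT.el x (\<Oplus>\<^bsub>B\<^esub>z\<in>?P. f z) = (\<Oplus>\<^bsub>TT.T\<^esub>z\<in>?P. TT.el x (f z))"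
    if "x \<in> carrier B" "f \<in> ?P \<rightarrow> carrier B" for f x
    using addhom_finsum[OF TT.el_addhom_right B.abelian_group TT.abelian_tensor] that by auto
  have m1: "V \<otimes>\<^bsub>TT.T\<^esub> (\<Oplus>\<^bsub>TT.T\<^esub>z\<in>?P. f z) = (\<Oplus>\<^bsub>TT.T\<^esub>z\<in>?P. V \<otimes>\<^bsub>TT.T\<^esub> f z)"
    if "V \<in> TT.takeuchi" "f \<in> ?P \<rightarrow> carrier TT.T" for V f
    using addhom_finsum[OF TT.mult_addhom_tensor TT.abelian_tensor TT.abelian_tensor] that by auto
  have "frt_lhs TT.TK XX sT (lT u) \<sigma> a b c d =
      (\<Oplus>\<^bsub>TT.T\<^esub>z\<in>?P. sT (?S z (a, c)) \<otimes>\<^bsub>TT.T\<^esub> (lT u (snd z) d \<otimes>\<^bsub>TT.T\<^esub> lT u (fst z) b))"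
    unfolding frt_lhs_def
    by (subst TK_finsum) (use S[OF _ ac] abcd lT_takeuchi[OF u] in \<open>auto intro!: TT.takeuchi_mult sT_takeuchi\<close>)
  also have "\<dots> = (\<Oplus>\<^bsub>TT.T\<^esub>z\<in>?P. \<Oplus>\<^bsub>TT.T\<^esub>w\<in>?P. TT.el (s (?S z (a, c)) \<otimes>\<^bsub>B\<^esub>
      (?m (snd z) (snd w) \<otimes>\<^bsub>B\<^esub> ?m (fst z) (fst w))) (?D w))"
  proof (rule TT.T.finsum_cong')
    fix z assume z: "z \<in> ?P"
    then have z': "fst z \<in> XX" "snd z \<in> XX" by auto
    have "sT (?S z (a, c)) \<otimes>\<^bsub>TT.T\<^esub> (lT u (snd z) d \<otimes>\<^bsub>TT.T\<^esub> lT u (fst z) b) =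
        (\<Oplus>\<^bsub>TT.T\<^esub>w\<in>?P. sT (?S z (a, c)) \<otimes>\<^bsub>TT.T\<^esub> TT.el (?N z w) (?D w))"
      unfolding lT_mult[OF z' abcd(2,4)]
      by (rule m1[OF sT_takeuchi[OF S[OF z ac]]]) (use N z D in auto)
    also have "\<dots> = (\<Oplus>\<^bsub>TT.T\<^esub>w\<in>?P. TT.el (s (?S z (a, c)) \<otimes>\<^bsub>B\<^esub> ?N z w) (?D w))"
      by (rule TT.T.finsum_cong'[OF refl])
        (use s[OF z ac] N D z sT_mult_el[OF S[OF z ac]] in auto)
    finally show "sT (?S z (a, c)) \<otimes>\<^bsub>TT.T\<^esub> (lT u (snd z) d \<otimes>\<^bsub>TT.T\<^esub> lT u (fst z) b) =
        (\<Oplus>\<^bsub>TT.T\<^esub>w\<in>?P. TT.el (s (?S z (a, c)) \<otimes>\<^bsub>B\<^esub> ?N z w) (?D w))" .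
  qed (use s[OF _ ac] N D in \<open>auto intro!: TT.T.finsum_closed\<close>)
  also have "\<dots> = (\<Oplus>\<^bsub>TT.T\<^esub>w\<in>?P. \<Oplus>\<^bsub>TT.T\<^esub>z\<in>?P. TT.el (s (?S z (a, c)) \<otimes>\<^bsub>B\<^esub> ?N z w) (?D w))"
    by (rule TT.T.finsum_swap) (use s[OF _ ac] N D in auto)
  also have "\<dots> = (\<Oplus>\<^bsub>TT.T\<^esub>w\<in>?P. TT.el (frt_lhs B XX s ?m \<sigma> a (fst w) c (snd w)) (?D w))"
    unfolding frt_lhs_def
    by (rule TT.T.finsum_cong'[OF refl])
      (use s[OF _ ac] N D elf1 in \<open>auto intro!: TT.el_closed B.finsum_closed\<close>)
  also have "\<dots> = (\<Oplus>\<^bsub>TT.T\<^esub>w\<in>?P. \<Oplus>\<^bsub>TT.T\<^esub>z\<in>?P. TT.el (?E z) (s (?S w z) \<otimes>\<^bsub>B\<^esub> ?D w))"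
  proof (rule TT.T.finsum_cong')
    fix w assume w: "w \<in> ?P"
    have "TT.el (frt_lhs B XX s ?m \<sigma> a (fst w) c (snd w)) (?D w) =
        TT.el (\<Oplus>\<^bsub>B\<^esub>z\<in>?P. t (?S w z) \<otimes>\<^bsub>B\<^esub> ?E z) (?D w)"
      using frt[of a "fst w" c "snd w"] abcd w by (auto simp: frt_rhs_def)
    also have "\<dots> = (\<Oplus>\<^bsub>TT.T\<^esub>z\<in>?P. TT.el (t (?S w z) \<otimes>\<^bsub>B\<^esub> ?E z) (?D w))"
      by (rule elf1[OF D[OF w]]) (use t[OF w] E in auto)
    also have "\<dots> = (\<Oplus>\<^bsub>TT.T\<^esub>z\<in>?P. TT.el (?E z) (s (?S w z) \<otimes>\<^bsub>B\<^esub> ?D w))"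
      by (rule TT.T.finsum_cong'[OF refl])
        (use s[OF w] E D[OF w] st_el_eqs[OF S[OF w] E D[OF w]] in auto)
    finally show "TT.el (frt_lhs B XX s ?m \<sigma> a (fst w) c (snd w)) (?D w) =
        (\<Oplus>\<^bsub>TT.T\<^esub>z\<in>?P. TT.el (?E z) (s (?S w z) \<otimes>\<^bsub>B\<^esub> ?D w))" .
  qed (use s E D in \<open>auto intro!: TT.T.finsum_closed\<close>)
  also have "\<dots> = (\<Oplus>\<^bsub>TT.T\<^esub>z\<in>?P. \<Oplus>\<^bsub>TT.T\<^esub>w\<in>?P. TT.el (?E z) (s (?S w z) \<otimes>\<^bsub>B\<^esub> ?D w))"
    by (rule TT.T.finsum_swap) (use s E D in auto)
  also have "\<dots> = (\<Oplus>\<^bsub>TT.T\<^esub>z\<in>?P. \<Oplus>\<^bsub>TT.T\<^esub>v\<in>?P. TT.el (?E z) (t (?S (b, d) v) \<otimes>\<^bsub>B\<^esub> ?N z v))"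
  proof (rule TT.T.finsum_cong')
    fix z assume z: "z \<in> ?P"
    have "(\<Oplus>\<^bsub>TT.T\<^esub>w\<in>?P. TT.el (?E z) (s (?S w z) \<otimes>\<^bsub>B\<^esub> ?D w)) =
        TT.el (?E z) (frt_lhs B XX s ?m \<sigma> (fst z) b (snd z) d)"
      unfolding frt_lhs_def by (rule elf2[OF E[OF z], symmetric]) (use s[OF _ z] D in auto)
    also have "\<dots> = TT.el (?E z) (\<Oplus>\<^bsub>B\<^esub>v\<in>?P. t (?S (b, d) v) \<otimes>\<^bsub>B\<^esub> ?N z v)"
      using frt[of "fst z" b "snd z" d] abcd z by (auto simp: frt_rhs_def)
    also have "\<dots> = (\<Oplus>\<^bsub>TT.T\<^esub>v\<in>?P. TT.el (?E z) (t (?S (b, d) v) \<otimes>\<^bsub>B\<^esub> ?N z v))"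
      by (rule elf2[OF E[OF z]]) (use t[OF bd] N z in auto)
    finally show "(\<Oplus>\<^bsub>TT.T\<^esub>w\<in>?P. TT.el (?E z) (s (?S w z) \<otimes>\<^bsub>B\<^esub> ?D w)) =
        (\<Oplus>\<^bsub>TT.T\<^esub>v\<in>?P. TT.el (?E z) (t (?S (b, d) v) \<otimes>\<^bsub>B\<^esub> ?N z v))" .
  qed (use t[OF bd] E N in \<open>auto intro!: TT.T.finsum_closed\<close>)
  also have "\<dots> = (\<Oplus>\<^bsub>TT.T\<^esub>v\<in>?P. \<Oplus>\<^bsub>TT.T\<^esub>z\<in>?P. TT.el (?E z) (t (?S (b, d) v) \<otimes>\<^bsub>B\<^esub> ?N z v))"
    by (rule TT.T.finsum_swap) (use t[OF bd] N E in auto)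
  also have "\<dots> = (\<Oplus>\<^bsub>TT.T\<^esub>v\<in>?P. tT (?S (b, d) v) \<otimes>\<^bsub>TT.T\<^esub> (lT u c (snd v) \<otimes>\<^bsub>TT.T\<^esub> lT u a (fst v)))"
  proof (rule TT.T.finsum_cong')
    fix v assume v: "v \<in> ?P"
    then have v': "fst v \<in> XX" "snd v \<in> XX" by auto
    have "tT (?S (b, d) v) \<otimes>\<^bsub>TT.T\<^esub> (lT u c (snd v) \<otimes>\<^bsub>TT.T\<^esub> lT u a (fst v)) =
        (\<Oplus>\<^bsub>TT.T\<^esub>z\<in>?P. tT (?S (b, d) v) \<otimes>\<^bsub>TT.T\<^esub> TT.el (?E z) (?N z v))"
      unfolding lT_mult[OF abcd(1,3) v']
      by (rule m1[OF tT_takeuchi[OF S[OF bd v]]]) (use N v E in auto)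
    also have "\<dots> = (\<Oplus>\<^bsub>TT.T\<^esub>z\<in>?P. TT.el (?E z) (t (?S (b, d) v) \<otimes>\<^bsub>B\<^esub> ?N z v))"
      by (rule TT.T.finsum_cong'[OF refl])
        (use t[OF bd v] N E v tT_mult_el[OF S[OF bd v]] in auto)
    finally show "(\<Oplus>\<^bsub>TT.T\<^esub>z\<in>?P. TT.el (?E z) (t (?S (b, d) v) \<otimes>\<^bsub>B\<^esub> ?N z v)) =
        tT (?S (b, d) v) \<otimes>\<^bsub>TT.T\<^esub> (lT u c (snd v) \<otimes>\<^bsub>TT.T\<^esub> lT u a (fst v))" by (rule sym)
  qed (use S[OF bd] abcd lT_takeuchi[OF u] in \<open>auto intro!: TT.takeuchi_carrier TT.takeuchi_mult tT_takeuchi\<close>)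
  also have "\<dots> = frt_rhs TT.TK XX tT (lT u) \<sigma> a b c d"
    unfolding frt_rhs_def
    by (subst TK_finsum) (use S[OF bd] abcd lT_takeuchi[OF u] in \<open>auto intro!: TT.takeuchi_mult tT_takeuchi\<close>)
  finally show "frt_lhs TT.TK XX sT (lT u) \<sigma> a b c d = frt_rhs TT.TK XX tT (lT u) \<sigma> a b c d" .
qed (use u sigma_closed in auto)

end

section \<open>The action on \<open>M\<^sub>\<Lambda>(R)\<close>\<close>

definition end_s :: "('k :: field, 'r) module \<Rightarrow> ('l :: finite \<Rightarrow> 'r) \<Rightarrow> ('l \<Rightarrow> 'r) \<Rightarrow> 'l \<Rightarrow> 'r" where
  "end_s R f = (\<lambda>h\<in>carrier (map_algebra R). f \<otimes>\<^bsub>map_algebra R\<^esub> h)"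

definition end_t :: "('k :: field, 'r) module \<Rightarrow> ('l :: finite \<Rightarrow> 'r) \<Rightarrow> ('l \<Rightarrow> 'r) \<Rightarrow> 'l \<Rightarrow> 'r" where
  "end_t R f = (\<lambda>h\<in>carrier (map_algebra R). h \<otimes>\<^bsub>map_algebra R\<^esub> f)"

definition end_l ::
    "('k :: field, 'r) module \<Rightarrow> ('i \<Rightarrow> 'x \<Rightarrow> 'l \<Rightarrow> 'l) \<Rightarrow> 'i \<Rightarrow> 'x \<Rightarrow> 'x \<Rightarrow> ('l :: finite \<Rightarrow> 'r) \<Rightarrow> 'l \<Rightarrow> 'r" where
  "end_l R \<alpha> i a b = (\<lambda>h\<in>carrier (map_algebra R). if a = b then shift (\<alpha> i a) h else \<zero>\<^bsub>map_algebra R\<^esub>)"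

context k_algebra
begin

abbreviation "MA \<equiv> map_algebra A"

lemma end_st_closed:
  assumes "f \<in> carrier (map_algebra A)"
  shows "end_s A f \<in> carrier (end_algebra (map_algebra A))"
    "end_t A f \<in> carrier (end_algebra (map_algebra A))"
proof -
  interpret MM: k_algebra "map_algebra A" by (rule k_algebra_map_algebra[OF k_algebra_axioms])
  show "end_s A f \<in> carrier (end_algebra (map_algebra A))"
    unfolding end_s_def using assms
    by (intro MM.endI) (simp_all only: MM.A.m_closed MM.A.r_distr MM.smult_mult_right)
  show "end_t A f \<in> carrier (end_algebra (map_algebra A))"
    unfolding end_t_def using assms
    by (intro MM.endI) (simp_all only: MM.A.m_closed MM.A.l_distr MM.smult_mult_left)
qed

lemma end_l_closed: "end_l A \<alpha> i a b \<in> carrier (end_algebra (map_algebra A))"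
proof -
  interpret MM: k_algebra "map_algebra A" by (rule k_algebra_map_algebra[OF k_algebra_axioms])
  show ?thesis
    unfolding end_l_def by (intro MM.endI) (auto simp: shift_def fun_eq_iff)
qed

lemma end_coefficients:
  fixes \<alpha> :: "'i \<Rightarrow> 'x \<Rightarrow> 'l :: finite \<Rightarrow> 'l"
  assumes "finite XX"
  shows "coefficients A (end_algebra (map_algebra A)) XX (end_s A) (end_t A) K \<alpha> (end_l A \<alpha>)"
proof -
  interpret MM: k_algebra "map_algebra A" by (rule k_algebra_map_algebra[OF k_algebra_axioms])
  interpret E: k_algebra "end_algebra (map_algebra A)" by (rule MM.k_algebra_end)
  note c = end_st_closed end_l_closed MM.end_closed MM.end_units
  note p = MM.end_app end_s_def end_t_def end_l_def shift_def A.l_distr A.r_distr A.m_assoc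
    smult_mult_left smult_mult_right
  show ?thesis
  proof unfold_locales
    show "end_s A \<in> k_algebra_hom (map_algebra A) (end_algebra (map_algebra A))"
      by (rule k_algebra_homI; (rule MM.end_eqI)?) (simp_all add: c, auto simp: p fun_eq_iff)
    show "end_t A \<in> k_algebra_hom (op_algebra (map_algebra A)) (end_algebra (map_algebra A))"
      by (rule k_algebra_homI; (rule MM.end_eqI)?) (simp_all add: c, auto simp: p fun_eq_iff)
    fix f g :: "'l \<Rightarrow> 'a" assume "f \<in> carrier (map_algebra A)" "g \<in> carrier (map_algebra A)"
    then show "end_s A f \<otimes>\<^bsub>end_algebra (map_algebra A)\<^esub> end_t A g = end_t A g \<otimes>\<^bsub>end_algebra (map_algebra A)\<^esub> end_s A f"
      by (intro MM.end_eqI) (simp_all add: c, auto simp: p fun_eq_iff)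
  next
    fix i a b and f :: "'l \<Rightarrow> 'a" assume "f \<in> carrier (map_algebra A)"
    then show "end_l A \<alpha> i a b \<otimes>\<^bsub>end_algebra (map_algebra A)\<^esub> end_s A f =
        end_s A (shift (\<alpha> i a) f) \<otimes>\<^bsub>end_algebra (map_algebra A)\<^esub> end_l A \<alpha> i a b"
      and "end_l A \<alpha> i a b \<otimes>\<^bsub>end_algebra (map_algebra A)\<^esub> end_t A f =
        end_t A (shift (\<alpha> i b) f) \<otimes>\<^bsub>end_algebra (map_algebra A)\<^esub> end_l A \<alpha> i a b"
      by (intro MM.end_eqI; simp add: c shift_def; auto simp: p fun_eq_iff)+
  qed (use assms end_l_closed in auto)
qed

text \<open>
  The quadratic relations hold for the action because the values of \<open>\<sigma>\<close> are central and vanish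
  where the two shifts involved differ.
\<close>

lemma end_frt:
  fixes \<sigma> :: "'x \<Rightarrow> 'x \<Rightarrow> 'x \<Rightarrow> 'x \<Rightarrow> 'l :: finite \<Rightarrow> 'a" and \<alpha> :: "'i \<Rightarrow> 'x \<Rightarrow> 'l \<Rightarrow> 'l"
  assumes XX: "finite XX" and u: "u \<in> K"
    and \<sigma>: "\<And>a b c d. \<lbrakk>a \<in> XX; b \<in> XX; c \<in> XX; d \<in> XX\<rbrakk> \<Longrightarrow> \<sigma> a b c d \<in> carrier (map_algebra A)"
    and central: "\<And>a b c d l. \<lbrakk>a \<in> XX; b \<in> XX; c \<in> XX; d \<in> XX\<rbrakk> \<Longrightarrow> \<sigma> a b c d l \<in> center A"
    and degree: "\<And>a b c d l. \<lbrakk>a \<in> XX; b \<in> XX; c \<in> XX; d \<in> XX;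
      \<alpha> u b (\<alpha> u d l) \<noteq> \<alpha> u a (\<alpha> u c l)\<rbrakk> \<Longrightarrow> \<sigma> b d a c l = \<zero>"
  shows "frt_coefficients A (end_algebra (map_algebra A)) XX (end_s A) (end_t A) K \<alpha> (end_l A \<alpha>) \<sigma> u"
proof (intro frt_coefficients.intro frt_coefficients_axioms.intro end_coefficients XX)
  interpret MM: k_algebra "map_algebra A" by (rule k_algebra_map_algebra[OF k_algebra_axioms])
  interpret E: k_algebra "end_algebra (map_algebra A)" by (rule MM.k_algebra_end)
  let ?E = "end_algebra (map_algebra A)"
  let ?l = "end_l A \<alpha> u"
  note c = end_st_closed end_l_closed MM.end_closed MM.end_units
  note p = MM.end_app end_s_def end_t_def end_l_def shift_def
  fix a b c d assume abcd: "a \<in> XX" "b \<in> XX" "c \<in> XX" "d \<in> XX"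
  have lhs: "end_s A (\<sigma> (fst z) (snd z) a c) \<otimes>\<^bsub>?E\<^esub> (?l (snd z) d \<otimes>\<^bsub>?E\<^esub> ?l (fst z) b) \<in> carrier ?E"
    if "z \<in> XX \<times> XX" for z using that abcd \<sigma> by (auto intro!: c simp del: map_algebra_simps(1))
  have rhs: "end_t A (\<sigma> b d (fst z) (snd z)) \<otimes>\<^bsub>?E\<^esub> (?l c (snd z) \<otimes>\<^bsub>?E\<^esub> ?l a (fst z)) \<in> carrier ?E"
    if "z \<in> XX \<times> XX" for z using that abcd \<sigma> by (auto intro!: c simp del: map_algebra_simps(1))
  have bd: "(b, d) \<in> XX \<times> XX" and ac: "(a, c) \<in> XX \<times> XX" using abcd by auto
  show "frt_lhs ?E XX (end_s A) ?l \<sigma> a b c d = frt_rhs ?E XX (end_t A) ?l \<sigma> a b c d"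
  proof (rule MM.end_eqI)
    show "frt_lhs ?E XX (end_s A) ?l \<sigma> a b c d \<in> carrier ?E"
      unfolding frt_lhs_def using lhs by (intro E.finsum_closed) auto
    show "frt_rhs ?E XX (end_t A) ?l \<sigma> a b c d \<in> carrier ?E"
      unfolding frt_rhs_def using rhs by (intro E.finsum_closed) auto
    fix h :: "'l \<Rightarrow> 'a" assume h: "h \<in> carrier (map_algebra A)"
    note ev = addhom_finsum[OF MM.end_eval_addhom[OF h] E.abelian_group MM.abelian_group]
    let ?L = "\<lambda>z. \<lambda>l. \<sigma> b d a c l \<otimes> h (\<alpha> u b (\<alpha> u d l))"
    let ?R = "\<lambda>z. \<lambda>l. h (\<alpha> u a (\<alpha> u c l)) \<otimes> \<sigma> b d a c l"
    have sc: "\<sigma> b d a c l \<in> carrier A" for l using \<sigma>[of b d a c] abcd by simp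
    have sc': "\<sigma> x y z w l \<in> carrier A" if "x \<in> XX" "y \<in> XX" "z \<in> XX" "w \<in> XX" for x y z w l
      using \<sigma>[OF that] by simp
    have "frt_lhs ?E XX (end_s A) ?l \<sigma> a b c d h =
        (\<Oplus>\<^bsub>map_algebra A\<^esub>z\<in>XX \<times> XX. if z = (b, d) then ?L z else \<zero>\<^bsub>map_algebra A\<^esub>)"
      unfolding frt_lhs_def
    proof (subst ev)
      show "(\<Oplus>\<^bsub>map_algebra A\<^esub>z\<in>XX \<times> XX.
          (end_s A (\<sigma> (fst z) (snd z) a c) \<otimes>\<^bsub>?E\<^esub> (?l (snd z) d \<otimes>\<^bsub>?E\<^esub> ?l (fst z) b)) h) =
        (\<Oplus>\<^bsub>map_algebra A\<^esub>z\<in>XX \<times> XX. if z = (b, d) then ?L z else \<zero>\<^bsub>map_algebra A\<^esub>)"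
        by (rule MM.finsum_cong'[OF refl]) (use h abcd sc sc' in \<open>auto simp: p fun_eq_iff\<close>)
    qed (use lhs in auto)
    also have "\<dots> = ?L (b, d)"
      by (rule MM.finsum_delta(1)) (use XX bd h sc in auto)
    also have "\<dots> = ?R (a, c)"
    proof
      fix l
      show "\<sigma> b d a c l \<otimes> h (\<alpha> u b (\<alpha> u d l)) = h (\<alpha> u a (\<alpha> u c l)) \<otimes> \<sigma> b d a c l"
      proof (cases "\<alpha> u b (\<alpha> u d l) = \<alpha> u a (\<alpha> u c l)")
        case True
        then show ?thesis using central[of b d a c l] abcd h by (auto simp: center_def)
      next
        case False
        then show ?thesis using degree[OF abcd(1,2,3,4) False] h by simp
      qed
    qed
    also have "\<dots> = (\<Oplus>\<^bsub>map_algebra A\<^esub>z\<in>XX \<times> XX. if z = (a, c) then ?R z else \<zero>\<^bsub>map_algebra A\<^esub>)"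
      by (rule MM.finsum_delta(1)[symmetric]) (use XX ac h sc in auto)
    also have "\<dots> = frt_rhs ?E XX (end_t A) ?l \<sigma> a b c d h"
      unfolding frt_rhs_def
    proof (subst ev)
      show "(\<Oplus>\<^bsub>map_algebra A\<^esub>z\<in>XX \<times> XX. if z = (a, c) then ?R z else \<zero>\<^bsub>map_algebra A\<^esub>) =
        (\<Oplus>\<^bsub>map_algebra A\<^esub>z\<in>XX \<times> XX.
          (end_t A (\<sigma> b d (fst z) (snd z)) \<otimes>\<^bsub>?E\<^esub> (?l c (snd z) \<otimes>\<^bsub>?E\<^esub> ?l a (fst z))) h)"
        by (rule MM.finsum_cong'[OF refl]) (use h abcd sc sc' in \<open>auto simp: p fun_eq_iff\<close>)
    qed (use rhs in auto)
    finally show "frt_lhs ?E XX (end_s A) ?l \<sigma> a b c d h = frt_rhs ?E XX (end_t A) ?l \<sigma> a b c d h" .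
  qed
qed (use u \<sigma> in auto)

end

section \<open>Left bialgebroids spanned by matrix coefficients\<close>

text \<open>
  The commutation rules move every product of \<open>s f\<close>, \<open>t g\<close> and coefficients into this form.
\<close>

inductive_set (in coefficients) coeff_span :: "'b set" where
  base: "\<lbrakk>f \<in> carrier M; g \<in> carrier M; ks \<in> lists K; as \<in> tuples XX (length ks);
    bs \<in> tuples XX (length ks)\<rbrakk> \<Longrightarrow> s f \<otimes>\<^bsub>B\<^esub> (t g \<otimes>\<^bsub>B\<^esub> wd ks as bs) \<in> coeff_span"
| add: "\<lbrakk>x \<in> coeff_span; y \<in> coeff_span\<rbrakk> \<Longrightarrow> x \<oplus>\<^bsub>B\<^esub> y \<in> coeff_span"

text \<open>
  \<open>\<chi>\<close> is the action on \<open>M\<^sub>\<Lambda>(R)\<close> with \<open>\<pi> x = \<chi> x 1\<close>. It is kept as a parameter because, unlike the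
  counit, it is multiplicative.
\<close>

locale coefficient_bialgebroid = coefficients R B XX s t K \<alpha> l
  for R :: "('k :: field, 'r) module" and B :: "('k, 'b) module" and XX :: "'x set"
    and s t :: "('l :: finite \<Rightarrow> 'r) \<Rightarrow> 'b" and K :: "'i set" and \<alpha> l +
  fixes \<Delta> :: "'b \<Rightarrow> ('b \<times> 'b \<Rightarrow>\<^sub>0 int) set" and \<pi> :: "'b \<Rightarrow> 'l \<Rightarrow> 'r"
    and \<chi> :: "'b \<Rightarrow> ('l \<Rightarrow> 'r) \<Rightarrow> 'l \<Rightarrow> 'r"
  assumes spanned: "carrier B \<subseteq> coeff_span"
    and \<Delta>_hom: "\<Delta> \<in> k_algebra_hom B TT.TK"
    and \<Delta>_s: "f \<in> carrier M \<Longrightarrow> \<Delta> (s f) = sT f"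
    and \<Delta>_t: "f \<in> carrier M \<Longrightarrow> \<Delta> (t f) = tT f"
    and \<Delta>_l: "\<lbrakk>i \<in> K; a \<in> XX; b \<in> XX\<rbrakk> \<Longrightarrow> \<Delta> (l i a b) = lT i a b"
    and \<chi>_hom: "\<chi> \<in> k_algebra_hom B (end_algebra (map_algebra R))"
    and \<chi>_s: "f \<in> carrier M \<Longrightarrow> \<chi> (s f) = end_s R f"
    and \<chi>_t: "f \<in> carrier M \<Longrightarrow> \<chi> (t f) = end_t R f"
    and \<chi>_l: "\<lbrakk>i \<in> K; a \<in> XX; b \<in> XX\<rbrakk> \<Longrightarrow> \<chi> (l i a b) = end_l R \<alpha> i a b"
    and \<pi>_eq: "x \<in> carrier B \<Longrightarrow> \<pi> x = \<chi> x \<one>\<^bsub>map_algebra R\<^esub>"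
begin

abbreviation "U ks \<equiv> tuples XX (length ks)"

lemma finite_U: "finite (U ks)"
  by (rule finite_tuples[OF finite_X])

lemma span_induct [consumes 1, case_names base add]:
  assumes "x \<in> carrier B"
    and "\<And>f g ks as bs. \<lbrakk>f \<in> carrier M; g \<in> carrier M; ks \<in> lists K; as \<in> U ks; bs \<in> U ks\<rbrakk> \<Longrightarrow>
      P (s f \<otimes>\<^bsub>B\<^esub> (t g \<otimes>\<^bsub>B\<^esub> wd ks as bs))"
    and "\<And>x y. \<lbrakk>x \<in> carrier B; y \<in> carrier B; P x; P y\<rbrakk> \<Longrightarrow> P (x \<oplus>\<^bsub>B\<^esub> y)"
  shows "P x"
proof -
  have "x \<in> coeff_span" using spanned assms(1) by blast
  then have "x \<in> carrier B \<and> P x"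
    by induction (use assms(2,3) s_closed t_closed wd_closed in auto)
  then show ?thesis ..
qed

lemma span_ext:
  assumes "f \<in> addhom B C" "g \<in> addhom B C"
    and "\<And>f' g' ks as bs. \<lbrakk>f' \<in> carrier M; g' \<in> carrier M; ks \<in> lists K; as \<in> U ks; bs \<in> U ks\<rbrakk> \<Longrightarrow>
      f (s f' \<otimes>\<^bsub>B\<^esub> (t g' \<otimes>\<^bsub>B\<^esub> wd ks as bs)) = g (s f' \<otimes>\<^bsub>B\<^esub> (t g' \<otimes>\<^bsub>B\<^esub> wd ks as bs))"
    and "x \<in> carrier B"
  shows "f x = g x"
  using assms(4)
  by (induction rule: span_induct) (simp_all only: assms(3) addhom_add[OF assms(1)] addhom_add[OF assms(2)])

lemma \<Delta>_addhom: "\<Delta> \<in> addhom B TT.T"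
  using addhom_comp[OF khom_addhom[OF \<Delta>_hom] TT.takeuchi_addhom] .

lemma \<Delta>_takeuchi: "x \<in> carrier B \<Longrightarrow> \<Delta> x \<in> TT.takeuchi"
  using khom_closed[OF \<Delta>_hom, of x] by simp

lemma \<Delta>_mult: "\<lbrakk>x \<in> carrier B; y \<in> carrier B\<rbrakk> \<Longrightarrow> \<Delta> (x \<otimes>\<^bsub>B\<^esub> y) = \<Delta> x \<otimes>\<^bsub>TT.T\<^esub> \<Delta> y"
  using khom_mult[OF \<Delta>_hom, of x y] by simp

lemma wd_U_closed [simp]: "\<lbrakk>ks \<in> lists K; as \<in> U ks; bs \<in> U ks\<rbrakk> \<Longrightarrow> wd ks as bs \<in> carrier B"
  by (rule wd_closed)

lemma \<Delta>_wd:
  assumes "ks \<in> lists K" "as \<in> U ks" "bs \<in> U ks"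
  shows "\<Delta> (wd ks as bs) = (\<Oplus>\<^bsub>TT.T\<^esub>cs\<in>U ks. TT.el (wd ks as cs) (wd ks cs bs))"
proof -
  have "\<Delta> (wd ks as bs) = coeff_word TT.TK lT ks as bs"
    using khom_coeff_word[OF \<Delta>_hom B.k_algebra_axioms, of K XX l lT ks as "length ks" bs] assms \<Delta>_l l_closed by auto
  then show ?thesis using takeuchi_word[OF assms] TK_finsum[of _ "U ks"] wd_el_takeuchi assms by auto
qed

lemma \<Delta>_s_mult: "\<lbrakk>f \<in> carrier M; x \<in> carrier B\<rbrakk> \<Longrightarrow> \<Delta> (s f \<otimes>\<^bsub>B\<^esub> x) = sT f \<otimes>\<^bsub>TT.T\<^esub> \<Delta> x"
  using \<Delta>_mult[of "s f" x] s_closed[of f] \<Delta>_s[of f] by simp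

lemma \<Delta>_t_mult: "\<lbrakk>f \<in> carrier M; x \<in> carrier B\<rbrakk> \<Longrightarrow> \<Delta> (t f \<otimes>\<^bsub>B\<^esub> x) = tT f \<otimes>\<^bsub>TT.T\<^esub> \<Delta> x"
  using \<Delta>_mult[of "t f" x] t_closed[of f] \<Delta>_t[of f] by simp

lemma mult_finsum:
  "\<lbrakk>V \<in> TT.takeuchi; f \<in> I \<rightarrow> carrier TT.T\<rbrakk> \<Longrightarrow>
    V \<otimes>\<^bsub>TT.T\<^esub> (\<Oplus>\<^bsub>TT.T\<^esub>z\<in>I. f z) = (\<Oplus>\<^bsub>TT.T\<^esub>z\<in>I. V \<otimes>\<^bsub>TT.T\<^esub> f z)"
  by (rule addhom_finsum[OF TT.mult_addhom_tensor TT.abelian_tensor TT.abelian_tensor])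

lemma \<Delta>_s_wd:
  assumes "f \<in> carrier M" "ks \<in> lists K" "as \<in> U ks" "bs \<in> U ks"
  shows "\<Delta> (s f \<otimes>\<^bsub>B\<^esub> wd ks as bs) = (\<Oplus>\<^bsub>TT.T\<^esub>cs\<in>U ks. TT.el (s f \<otimes>\<^bsub>B\<^esub> wd ks as cs) (wd ks cs bs))"
proof -
  have "\<Delta> (s f \<otimes>\<^bsub>B\<^esub> wd ks as bs) = (\<Oplus>\<^bsub>TT.T\<^esub>cs\<in>U ks. sT f \<otimes>\<^bsub>TT.T\<^esub> TT.el (wd ks as cs) (wd ks cs bs))"
    using assms \<Delta>_s_mult[OF assms(1), of "wd ks as bs"] by (simp only: \<Delta>_wd wd_U_closed) (intro mult_finsum sT_takeuchi; auto)
  also have "\<dots> = (\<Oplus>\<^bsub>TT.T\<^esub>cs\<in>U ks. TT.el (s f \<otimes>\<^bsub>B\<^esub> wd ks as cs) (wd ks cs bs))"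
    using assms s_closed[OF assms(1)] by (intro TT.T.finsum_cong') (auto simp: sT_mult_el simp del: map_algebra_simps(1))
  finally show ?thesis .
qed

lemma \<Delta>_t_wd:
  assumes "f \<in> carrier M" "ks \<in> lists K" "as \<in> U ks" "bs \<in> U ks"
  shows "\<Delta> (t f \<otimes>\<^bsub>B\<^esub> wd ks as bs) = (\<Oplus>\<^bsub>TT.T\<^esub>cs\<in>U ks. TT.el (wd ks as cs) (t f \<otimes>\<^bsub>B\<^esub> wd ks cs bs))"
proof -
  have "\<Delta> (t f \<otimes>\<^bsub>B\<^esub> wd ks as bs) = (\<Oplus>\<^bsub>TT.T\<^esub>cs\<in>U ks. tT f \<otimes>\<^bsub>TT.T\<^esub> TT.el (wd ks as cs) (wd ks cs bs))"
    using assms \<Delta>_t_mult[OF assms(1), of "wd ks as bs"] by (simp only: \<Delta>_wd wd_U_closed) (intro mult_finsum tT_takeuchi; auto)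
  also have "\<dots> = (\<Oplus>\<^bsub>TT.T\<^esub>cs\<in>U ks. TT.el (wd ks as cs) (t f \<otimes>\<^bsub>B\<^esub> wd ks cs bs))"
    using assms t_closed[OF assms(1)] by (intro TT.T.finsum_cong') (auto simp: tT_mult_el simp del: map_algebra_simps(1))
  finally show ?thesis .
qed

lemma \<Delta>_st_wd:
  assumes "f \<in> carrier M" "g \<in> carrier M" "ks \<in> lists K" "as \<in> U ks" "bs \<in> U ks"
  shows "\<Delta> (s f \<otimes>\<^bsub>B\<^esub> (t g \<otimes>\<^bsub>B\<^esub> wd ks as bs)) =
    (\<Oplus>\<^bsub>TT.T\<^esub>cs\<in>U ks. TT.el (s f \<otimes>\<^bsub>B\<^esub> wd ks as cs) (t g \<otimes>\<^bsub>B\<^esub> wd ks cs bs))"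
proof -
  note st = s_closed[OF assms(1)] t_closed[OF assms(2)]
  have "\<Delta> (s f \<otimes>\<^bsub>B\<^esub> (t g \<otimes>\<^bsub>B\<^esub> wd ks as bs)) =
      (\<Oplus>\<^bsub>TT.T\<^esub>cs\<in>U ks. sT f \<otimes>\<^bsub>TT.T\<^esub> TT.el (wd ks as cs) (t g \<otimes>\<^bsub>B\<^esub> wd ks cs bs))"
    using assms st \<Delta>_s_mult[OF assms(1), of "t g \<otimes>\<^bsub>B\<^esub> wd ks as bs"] \<Delta>_t_wd[OF assms(2-5)]
    by (simp only: wd_U_closed B.A.m_closed) (intro mult_finsum sT_takeuchi; auto)
  also have "\<dots> = (\<Oplus>\<^bsub>TT.T\<^esub>cs\<in>U ks. TT.el (s f \<otimes>\<^bsub>B\<^esub> wd ks as cs) (t g \<otimes>\<^bsub>B\<^esub> wd ks cs bs))"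
    using assms st by (intro TT.T.finsum_cong') (auto simp: sT_mult_el simp del: map_algebra_simps(1))
  finally show ?thesis .
qed

lemma \<chi>_closed: "\<lbrakk>x \<in> carrier B; h \<in> carrier M\<rbrakk> \<Longrightarrow> \<chi> x h \<in> carrier M"
  using M.end_simps(1)[OF khom_closed[OF \<chi>_hom]] by blast

lemma \<chi>_mult: "\<lbrakk>x \<in> carrier B; y \<in> carrier B; h \<in> carrier M\<rbrakk> \<Longrightarrow> \<chi> (x \<otimes>\<^bsub>B\<^esub> y) h = \<chi> x (\<chi> y h)"
  using khom_mult[OF \<chi>_hom, of x y] M.end_app(1)[of h "\<chi> x" "\<chi> y"] by simp

lemma \<chi>_s_mult: "\<lbrakk>f \<in> carrier M; y \<in> carrier B; h \<in> carrier M\<rbrakk> \<Longrightarrow> \<chi> (s f \<otimes>\<^bsub>B\<^esub> y) h = f \<otimes>\<^bsub>M\<^esub> \<chi> y h"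
  using \<chi>_mult[of "s f" y h] s_closed[of f] \<chi>_s[of f] \<chi>_closed[of y h] by (simp add: end_s_def)

lemma \<chi>_t_mult: "\<lbrakk>f \<in> carrier M; y \<in> carrier B; h \<in> carrier M\<rbrakk> \<Longrightarrow> \<chi> (t f \<otimes>\<^bsub>B\<^esub> y) h = \<chi> y h \<otimes>\<^bsub>M\<^esub> f"
  using \<chi>_mult[of "t f" y h] t_closed[of f] \<chi>_t[of f] \<chi>_closed[of y h] by (simp add: end_t_def)

lemma \<pi>_closed: "x \<in> carrier B \<Longrightarrow> \<pi> x \<in> carrier M"
  using \<chi>_closed[of x "\<one>\<^bsub>M\<^esub>"] M.A.one_closed by (simp only: \<pi>_eq)

lemma \<pi>_addhom: "\<pi> \<in> addhom B M"
proof (rule addhomI)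
  fix x y assume "x \<in> carrier B" "y \<in> carrier B"
  then show "\<pi> (x \<oplus>\<^bsub>B\<^esub> y) = \<pi> x \<oplus>\<^bsub>M\<^esub> \<pi> y"
    using khom_add[OF \<chi>_hom, of x y] M.end_app(2)[OF M.A.one_closed, of "\<chi> x" "\<chi> y"] by (simp add: \<pi>_eq)
qed (rule \<pi>_closed)

lemma \<pi>_s_mult: "\<lbrakk>f \<in> carrier M; x \<in> carrier B\<rbrakk> \<Longrightarrow> \<pi> (s f \<otimes>\<^bsub>B\<^esub> x) = f \<otimes>\<^bsub>M\<^esub> \<pi> x"
  using \<chi>_s_mult[OF _ _ M.A.one_closed] s_closed[of f] by (simp add: \<pi>_eq)

lemma \<pi>_t_mult: "\<lbrakk>f \<in> carrier M; x \<in> carrier B\<rbrakk> \<Longrightarrow> \<pi> (t f \<otimes>\<^bsub>B\<^esub> x) = \<pi> x \<otimes>\<^bsub>M\<^esub> f"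
  using \<chi>_t_mult[OF _ _ M.A.one_closed] t_closed[of f] by (simp add: \<pi>_eq)

lemma \<pi>_one: "\<pi> \<one>\<^bsub>B\<^esub> = \<one>\<^bsub>M\<^esub>"
  using khom_one[OF \<chi>_hom] M.end_app(4)[OF M.A.one_closed] by (simp add: \<pi>_eq)

lemma \<pi>_wd: "\<lbrakk>ks \<in> lists K; as \<in> U ks; bs \<in> U ks\<rbrakk> \<Longrightarrow> \<pi> (wd ks as bs) = (if as = bs then \<one>\<^bsub>M\<^esub> else \<zero>\<^bsub>M\<^esub>)"
proof (induction ks arbitrary: as bs rule: list.induct)
  case Nil
  then show ?case by (simp add: tuples_0 \<pi>_one)
next
  case (Cons k ks)
  from Cons.prems have "as \<in> tuples XX (Suc (length ks))" "bs \<in> tuples XX (Suc (length ks))" by auto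
  then obtain a as2 b bs2 where *: "as = a # as2" "bs = b # bs2" "a \<in> XX" "b \<in> XX" "as2 \<in> U ks" "bs2 \<in> U ks"
    unfolding tuples_Suc by blast
  have k: "k \<in> K" "ks \<in> lists K" using Cons.prems by auto
  have "\<pi> (wd (k # ks) as bs) = end_l R \<alpha> k a b (\<pi> (wd ks as2 bs2))"
    using \<chi>_mult[OF l_closed[OF k(1) *(3,4)] _ M.A.one_closed, of "wd ks as2 bs2"] * k \<chi>_l[OF k(1) *(3,4)]
      l_closed[OF k(1) *(3,4)] by (simp add: \<pi>_eq)
  then show ?case
    using Cons.IH[OF k(2) *(5,6)] * by (auto simp: end_l_def shift_def fun_eq_iff split: if_splits)
qed

lemma AA_eq: "bialgebroid_data.AA B M s t = TT.T"
  by (simp add: bialgebroid_data.AA_def)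

lemma elt2_eq: "bialgebroid_data.elt2 B M s t = TT.el"
  by (simp add: bialgebroid_data.elt2_def)

lemma lact2_eq:
  assumes "f \<in> carrier M" "V \<in> carrier TT.T"
  shows "bialgebroid_data.lact2 B M s t f V = sT f \<otimes>\<^bsub>TT.T\<^esub> V"
  unfolding bialgebroid_data.lact2_def AA_eq elt2_eq
  by (rule TT.additive_lift[OF TT.abelian_tensor TT.mult_addhom_tensor[OF sT_takeuchi[OF assms(1)]] _ assms(2)])
    (simp only: sT_mult_el[OF assms(1)])

lemma ract2_eq:
  assumes "f \<in> carrier M" "V \<in> carrier TT.T"
  shows "bialgebroid_data.ract2 B M s t V f = tT f \<otimes>\<^bsub>TT.T\<^esub> V"
  unfolding bialgebroid_data.ract2_def AA_eq elt2_eq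
  by (rule TT.additive_lift[OF TT.abelian_tensor TT.mult_addhom_tensor[OF tT_takeuchi[OF assms(1)]] _ assms(2)])
    (simp only: tT_mult_el[OF assms(1)])

end

context coefficient_bialgebroid
begin

abbreviation "lact \<equiv> bialgebroid_data.lact2 B M s t"
abbreviation "ract \<equiv> bialgebroid_data.ract2 B M s t"

lemma balanced_tensor_left: "balanced_tensor TT.T B (carrier M) ract (\<lambda>f b. s f \<otimes>\<^bsub>B\<^esub> b)"
  by (intro balanced_tensor.intro balanced_tensor_axioms.intro TT.abelian_tensor B.abelian_group)
    (simp_all only: ract2_eq TT.mult_closed tT_takeuchi s_closed B.A.m_closed)

lemma balanced_tensor_right: "balanced_tensor B TT.T (carrier M) (\<lambda>a f. t f \<otimes>\<^bsub>B\<^esub> a) lact"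
  by (intro balanced_tensor.intro balanced_tensor_axioms.intro TT.abelian_tensor B.abelian_group)
    (simp_all only: lact2_eq TT.mult_closed sT_takeuchi t_closed B.A.m_closed)

text \<open>
  Both ways of comultiplying a word twice give the sum over all pairs of words in the middle.
\<close>

lemma coassociative:
  assumes x: "x \<in> carrier B"
  shows "bialgebroid_data.associator B M s t
      (tensor_lift (bialgebroid_data.AA_A B M s t) (\<lambda>x y. bialgebroid_data.elt_AA_A B M s t (\<Delta> x) y) (\<Delta> x)) =
    tensor_lift (bialgebroid_data.A_AA B M s t) (\<lambda>x y. bialgebroid_data.elt_A_AA B M s t x (\<Delta> y)) (\<Delta> x)"
proof -
  interpret TL: balanced_tensor TT.T B "carrier M" ract "\<lambda>f b. s f \<otimes>\<^bsub>B\<^esub> b"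
    by (rule balanced_tensor_left)
  interpret TR: balanced_tensor B TT.T "carrier M" "\<lambda>a f. t f \<otimes>\<^bsub>B\<^esub> a" lact
    by (rule balanced_tensor_right)
  let ?L = "tensor_lift TL.T (\<lambda>x y. TL.el (\<Delta> x) y)"
  let ?R = "tensor_lift TR.T (\<lambda>x y. TR.el x (\<Delta> y))"
  let ?inner = "\<lambda>c. tensor_lift TR.T (\<lambda>a b. TR.el a (TT.el b c))"
  let ?assoc = "tensor_lift TR.T (\<lambda>V c. ?inner c V)"
  note \<Delta>c = addhom_closed[OF \<Delta>_addhom] and \<Delta>a = addhom_add[OF \<Delta>_addhom]
  have L: "balanced_map (carrier M) (\<lambda>a f. t f \<otimes>\<^bsub>B\<^esub> a) (\<lambda>f b. s f \<otimes>\<^bsub>B\<^esub> b) B B TL.T (\<lambda>x y. TL.el (\<Delta> x) y)"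
    unfolding balanced_map_def
  proof (intro conjI ballI addhomI)
    fix x f y assume *: "x \<in> carrier B" "f \<in> carrier M" "y \<in> carrier B"
    show "TL.el (\<Delta> (t f \<otimes>\<^bsub>B\<^esub> x)) y = TL.el (\<Delta> x) (s f \<otimes>\<^bsub>B\<^esub> y)"
      using TL.el_balanced[of "\<Delta> x" f y] ract2_eq[of f "\<Delta> x"] \<Delta>_t_mult[of f x] * \<Delta>c by simp
  qed (simp_all add: \<Delta>c \<Delta>a TL.el_add_left TL.el_add_right)
  have R: "balanced_map (carrier M) (\<lambda>a f. t f \<otimes>\<^bsub>B\<^esub> a) (\<lambda>f b. s f \<otimes>\<^bsub>B\<^esub> b) B B TR.T (\<lambda>x y. TR.el x (\<Delta> y))"
    unfolding balanced_map_def
  proof (intro conjI ballI addhomI)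
    fix x f y assume *: "x \<in> carrier B" "f \<in> carrier M" "y \<in> carrier B"
    show "TR.el (t f \<otimes>\<^bsub>B\<^esub> x) (\<Delta> y) = TR.el x (\<Delta> (s f \<otimes>\<^bsub>B\<^esub> y))"
      using TR.el_balanced[of x f "\<Delta> y"] lact2_eq[of f "\<Delta> y"] \<Delta>_s_mult[of f y] * \<Delta>c by simp
  qed (simp_all add: \<Delta>c \<Delta>a TR.el_add_left TR.el_add_right)
  have I: "balanced_map (carrier M) (\<lambda>a f. t f \<otimes>\<^bsub>B\<^esub> a) (\<lambda>f b. s f \<otimes>\<^bsub>B\<^esub> b) B B TR.T (\<lambda>a b. TR.el a (TT.el b c))"
    if c: "c \<in> carrier B" for c
    unfolding balanced_map_def
  proof (intro conjI ballI addhomI)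
    fix a f b assume *: "a \<in> carrier B" "f \<in> carrier M" "b \<in> carrier B"
    show "TR.el (t f \<otimes>\<^bsub>B\<^esub> a) (TT.el b c) = TR.el a (TT.el (s f \<otimes>\<^bsub>B\<^esub> b) c)"
      using TR.el_balanced[of a f "TT.el b c"] lact2_eq[of f "TT.el b c"] sT_mult_el[of f b c] * c by simp
  qed (use c in \<open>simp_all add: TR.el_add_left TR.el_add_right TT.el_add_left\<close>)
  note Iel = TT.lift_el[OF TR.abelian_tensor I]
  note Iadd = TT.lift_addhom[OF TR.abelian_tensor I]
  note Ic = addhom_closed[OF Iadd] and Ia = addhom_add[OF Iadd]
  have Iadd2: "?inner (c \<oplus>\<^bsub>B\<^esub> c') V = ?inner c V \<oplus>\<^bsub>TR.T\<^esub> ?inner c' V"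
    if "V \<in> carrier TT.T" "c \<in> carrier B" "c' \<in> carrier B" for V c c'
    using that(1)
  proof (induction rule: TT.tensor_induct)
    case (el a b)
    then show ?case using that by (simp add: Iel TR.el_add_right TT.el_add_right)
  next
    case (add V W)
    then show ?case using that by (simp add: Ia Ic TR.T.a_ac)
  qed
  have Ibal: "?inner c (ract V f) = ?inner (s f \<otimes>\<^bsub>B\<^esub> c) V"
    if "V \<in> carrier TT.T" "c \<in> carrier B" and f: "f \<in> carrier M" for V c f
    using that(1)
  proof (induction rule: TT.tensor_induct)
    case (el a b)
    have "ract (TT.el a b) f = TT.el a (t f \<otimes>\<^bsub>B\<^esub> b)"
      using ract2_eq[OF f] tT_mult_el[OF f] el by simp
    moreover have "TT.el (t f \<otimes>\<^bsub>B\<^esub> b) c = TT.el b (s f \<otimes>\<^bsub>B\<^esub> c)"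
      using st_el_eqs[OF f] el that by simp
    ultimately show ?case
      using el that s_closed[OF f] t_closed[OF f] by (simp add: Iel)
  next
    case (add V W)
    have "ract (V \<oplus>\<^bsub>TT.T\<^esub> W) f = ract V f \<oplus>\<^bsub>TT.T\<^esub> ract W f"
      using add ract2_eq[OF f] TT.mult_add[OF tT_takeuchi[OF f]] by simp
    moreover have "ract V f \<in> carrier TT.T" "ract W f \<in> carrier TT.T"
      using add ract2_eq[OF f] TT.mult_closed[OF tT_takeuchi[OF f]] by simp_all
    ultimately show ?case using add that s_closed[OF f] by (simp add: Ia)
  qed
  have A: "balanced_map (carrier M) ract (\<lambda>f b. s f \<otimes>\<^bsub>B\<^esub> b) TT.T B TR.T (\<lambda>V c. ?inner c V)"
    unfolding balanced_map_def
  proof (intro conjI ballI)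
    fix V f c assume *: "V \<in> carrier TT.T" "f \<in> carrier M" "c \<in> carrier B"
    show "?inner c (ract V f) = ?inner (s f \<otimes>\<^bsub>B\<^esub> c) V" using Ibal * by blast
  next
    fix V assume "V \<in> carrier TT.T"
    then show "(\<lambda>c. ?inner c V) \<in> addhom B TR.T" by (intro addhomI) (simp_all add: Ic Iadd2)
  next
    fix c assume "c \<in> carrier B"
    then show "(\<lambda>V. ?inner c V) \<in> addhom TT.T TR.T" by (rule Iadd)
  qed
  note Lel = TT.lift_el[OF TL.abelian_tensor L] and Ladd = TT.lift_addhom[OF TL.abelian_tensor L]
  note Rel = TT.lift_el[OF TR.abelian_tensor R] and Radd = TT.lift_addhom[OF TR.abelian_tensor R]
  note Ael = TL.lift_el[OF TR.abelian_tensor A] and Aadd = TL.lift_addhom[OF TR.abelian_tensor A]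
  have "?assoc (?L (\<Delta> x)) = ?R (\<Delta> x)"
  proof (rule span_ext[OF _ _ _ x])
    show "(\<lambda>x. ?assoc (?L (\<Delta> x))) \<in> addhom B TR.T"
      by (rule addhom_comp[OF addhom_comp[OF \<Delta>_addhom Ladd] Aadd])
    show "(\<lambda>x. ?R (\<Delta> x)) \<in> addhom B TR.T"
      by (rule addhom_comp[OF \<Delta>_addhom Radd])
    fix f g ks as bs
    assume f: "f \<in> carrier M" and g: "g \<in> carrier M" and ks: "ks \<in> lists K"
      and as: "as \<in> U ks" and bs: "bs \<in> U ks"
    let ?X = "\<lambda>cs. s f \<otimes>\<^bsub>B\<^esub> wd ks as cs" and ?Y = "\<lambda>cs. t g \<otimes>\<^bsub>B\<^esub> wd ks cs bs"
    let ?Z = "\<lambda>ds cs. TR.el (?X ds) (TT.el (wd ks ds cs) (?Y cs))"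
    have X: "?X cs \<in> carrier B" and Y: "?Y cs \<in> carrier B" if "cs \<in> U ks" for cs
      using s_closed[OF f] t_closed[OF g] ks as bs that by auto
    have W: "wd ks ds cs \<in> carrier B" if "ds \<in> U ks" "cs \<in> U ks" for ds cs
      using ks that by simp
    have Z: "?Z ds cs \<in> carrier TR.T" if "ds \<in> U ks" "cs \<in> U ks" for ds cs
      using X Y W that by simp
    note \<Delta>_eq = \<Delta>_st_wd[OF f g ks as bs]
    have el: "(\<lambda>cs. TT.el (?X cs) (?Y cs)) \<in> U ks \<rightarrow> carrier TT.T" using X Y by simp
    have l: "(\<lambda>cs. TL.el (\<Delta> (?X cs)) (?Y cs)) \<in> U ks \<rightarrow> carrier TL.T" using X Y \<Delta>c by simp
    have "?assoc (?L (\<Delta> (s f \<otimes>\<^bsub>B\<^esub> (t g \<otimes>\<^bsub>B\<^esub> wd ks as bs)))) =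
        ?assoc (\<Oplus>\<^bsub>TL.T\<^esub>cs\<in>U ks. ?L (TT.el (?X cs) (?Y cs)))"
      unfolding \<Delta>_eq by (subst addhom_finsum[OF Ladd TT.abelian_tensor TL.abelian_tensor el]) simp
    also have "\<dots> = ?assoc (\<Oplus>\<^bsub>TL.T\<^esub>cs\<in>U ks. TL.el (\<Delta> (?X cs)) (?Y cs))"
      by (rule arg_cong[of _ _ ?assoc], rule TL.T.finsum_cong') (use l X Y Lel in auto)
    also have "\<dots> = (\<Oplus>\<^bsub>TR.T\<^esub>cs\<in>U ks. ?assoc (TL.el (\<Delta> (?X cs)) (?Y cs)))"
      by (rule addhom_finsum[OF Aadd TL.abelian_tensor TR.abelian_tensor l])
    also have "\<dots> = (\<Oplus>\<^bsub>TR.T\<^esub>cs\<in>U ks. \<Oplus>\<^bsub>TR.T\<^esub>ds\<in>U ks. ?Z ds cs)"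
    proof (rule TR.T.finsum_cong')
      fix cs assume cs: "cs \<in> U ks"
      have e: "(\<lambda>ds. TT.el (?X ds) (wd ks ds cs)) \<in> U ks \<rightarrow> carrier TT.T" using X W cs by simp
      have "?assoc (TL.el (\<Delta> (?X cs)) (?Y cs)) =
          ?inner (?Y cs) (\<Oplus>\<^bsub>TT.T\<^esub>ds\<in>U ks. TT.el (?X ds) (wd ks ds cs))"
        using Ael[OF \<Delta>c[OF X[OF cs]] Y[OF cs]] \<Delta>_s_wd[OF f ks as cs] by simp
      also have "\<dots> = (\<Oplus>\<^bsub>TR.T\<^esub>ds\<in>U ks. ?inner (?Y cs) (TT.el (?X ds) (wd ks ds cs)))"
        by (rule addhom_finsum[OF Iadd[OF Y[OF cs]] TT.abelian_tensor TR.abelian_tensor e])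
      also have "\<dots> = (\<Oplus>\<^bsub>TR.T\<^esub>ds\<in>U ks. ?Z ds cs)"
        by (rule TR.T.finsum_cong') (use Z X Y W cs Iel in auto)
      finally show "?assoc (TL.el (\<Delta> (?X cs)) (?Y cs)) = (\<Oplus>\<^bsub>TR.T\<^esub>ds\<in>U ks. ?Z ds cs)" .
    qed (use Z in \<open>auto intro!: TR.T.finsum_closed\<close>)
    also have "\<dots> = (\<Oplus>\<^bsub>TR.T\<^esub>ds\<in>U ks. \<Oplus>\<^bsub>TR.T\<^esub>cs\<in>U ks. ?Z ds cs)"
      by (rule TR.T.finsum_swap) (use Z in auto)
    also have "\<dots> = (\<Oplus>\<^bsub>TR.T\<^esub>ds\<in>U ks. ?R (TT.el (?X ds) (?Y ds)))"
    proof (rule TR.T.finsum_cong')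
      fix ds assume ds: "ds \<in> U ks"
      have e: "(\<lambda>cs. TT.el (wd ks ds cs) (?Y cs)) \<in> U ks \<rightarrow> carrier TT.T" using Y W ds by simp
      show "(\<Oplus>\<^bsub>TR.T\<^esub>cs\<in>U ks. ?Z ds cs) = ?R (TT.el (?X ds) (?Y ds))"
        unfolding Rel[OF X[OF ds] Y[OF ds]] \<Delta>_t_wd[OF g ks ds bs]
        by (rule addhom_finsum[OF TR.el_addhom_right[OF X[OF ds]] TT.abelian_tensor TR.abelian_tensor e, symmetric])
    qed (use addhom_closed[OF Radd] X Y in auto)
    also have "\<dots> = ?R (\<Delta> (s f \<otimes>\<^bsub>B\<^esub> (t g \<otimes>\<^bsub>B\<^esub> wd ks as bs)))"
      unfolding \<Delta>_eq by (rule addhom_finsum[OF Radd TT.abelian_tensor TR.abelian_tensor el, symmetric])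
    finally show "?assoc (?L (\<Delta> (s f \<otimes>\<^bsub>B\<^esub> (t g \<otimes>\<^bsub>B\<^esub> wd ks as bs)))) =
        ?R (\<Delta> (s f \<otimes>\<^bsub>B\<^esub> (t g \<otimes>\<^bsub>B\<^esub> wd ks as bs)))" .
  qed
  then show ?thesis
    by (simp add: bialgebroid_data.associator_def bialgebroid_data.AA_A_def bialgebroid_data.A_AA_def
        bialgebroid_data.elt_AA_A_def bialgebroid_data.elt_A_AA_def AA_eq elt2_eq)
qed

lemma counital_left:
  assumes x: "x \<in> carrier B"
  shows "tensor_lift B (\<lambda>x y. s (\<pi> x) \<otimes>\<^bsub>B\<^esub> y) (\<Delta> x) = x"
proof -
  have bal: "balanced_map (carrier M) (\<lambda>a f. t f \<otimes>\<^bsub>B\<^esub> a) (\<lambda>f b. s f \<otimes>\<^bsub>B\<^esub> b) B B B (\<lambda>x y. s (\<pi> x) \<otimes>\<^bsub>B\<^esub> y)"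
    unfolding balanced_map_def
  proof (intro conjI ballI addhomI)
    fix x f y assume *: "x \<in> carrier B" "f \<in> carrier M" "y \<in> carrier B"
    show "s (\<pi> (t f \<otimes>\<^bsub>B\<^esub> x)) \<otimes>\<^bsub>B\<^esub> y = s (\<pi> x) \<otimes>\<^bsub>B\<^esub> (s f \<otimes>\<^bsub>B\<^esub> y)"
      using * \<pi>_t_mult[OF *(2,1)] s_mult[OF \<pi>_closed[OF *(1)] *(2)] s_closed[OF *(2)] s_closed[OF \<pi>_closed[OF *(1)]]
      by (simp flip: B.A.m_assoc)
  qed (simp_all add: s_closed[OF \<pi>_closed] B.A.r_distr addhom_add[OF \<pi>_addhom]
      addhom_add[OF s_addhom \<pi>_closed \<pi>_closed] B.A.l_distr)
  note el = TT.lift_el[OF B.abelian_group bal] and add = TT.lift_addhom[OF B.abelian_group bal]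
  let ?v = "tensor_lift B (\<lambda>x y. s (\<pi> x) \<otimes>\<^bsub>B\<^esub> y)"
  show ?thesis
  proof (rule span_ext[OF addhom_comp[OF \<Delta>_addhom add] _ _ x])
    show "(\<lambda>x. x) \<in> addhom B B" by (rule addhomI) simp_all
    fix f g ks as bs
    assume f: "f \<in> carrier M" and g: "g \<in> carrier M" and ks: "ks \<in> lists K"
      and as: "as \<in> U ks" and bs: "bs \<in> U ks"
    have W: "wd ks ds cs \<in> carrier B" if "ds \<in> U ks" "cs \<in> U ks" for ds cs
      using ks that by simp
    let ?X = "\<lambda>cs. s f \<otimes>\<^bsub>B\<^esub> wd ks as cs" and ?Y = "\<lambda>cs. t g \<otimes>\<^bsub>B\<^esub> wd ks cs bs"
    have X: "?X cs \<in> carrier B" and Y: "?Y cs \<in> carrier B" if "cs \<in> U ks" for cs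
      using s_closed[OF f] t_closed[OF g] W as bs that by auto
    have 0: "s \<zero>\<^bsub>M\<^esub> = \<zero>\<^bsub>B\<^esub>" by (rule addhom_zero[OF s_addhom M.abelian_group B.abelian_group])
    have "?v (\<Delta> (s f \<otimes>\<^bsub>B\<^esub> (t g \<otimes>\<^bsub>B\<^esub> wd ks as bs))) = (\<Oplus>\<^bsub>B\<^esub>cs\<in>U ks. ?v (TT.el (?X cs) (?Y cs)))"
      unfolding \<Delta>_st_wd[OF f g ks as bs]
      by (rule addhom_finsum[OF add TT.abelian_tensor B.abelian_group]) (use X Y in auto)
    also have "\<dots> = (\<Oplus>\<^bsub>B\<^esub>cs\<in>U ks. if as = cs then s f \<otimes>\<^bsub>B\<^esub> ?Y cs else \<zero>\<^bsub>B\<^esub>)"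
    proof (rule B.finsum_cong')
      fix cs assume cs: "cs \<in> U ks"
      have "\<pi> (?X cs) = (if as = cs then f else \<zero>\<^bsub>M\<^esub>)"
        using \<pi>_s_mult[OF f W[OF as cs]] \<pi>_wd[OF ks as cs] M.A.r_one[OF f] M.A.r_null[OF f] by simp
      then show "?v (TT.el (?X cs) (?Y cs)) = (if as = cs then s f \<otimes>\<^bsub>B\<^esub> ?Y cs else \<zero>\<^bsub>B\<^esub>)"
        using el[OF X[OF cs] Y[OF cs]] Y[OF cs] 0 by simp
    qed (use s_closed[OF f] Y in auto)
    also have "\<dots> = s f \<otimes>\<^bsub>B\<^esub> ?Y as"
      by (rule B.finsum_delta(2)[OF finite_U as]) (use s_closed[OF f] Y as in auto)
    finally show "?v (\<Delta> (s f \<otimes>\<^bsub>B\<^esub> (t g \<otimes>\<^bsub>B\<^esub> wd ks as bs))) = s f \<otimes>\<^bsub>B\<^esub> (t g \<otimes>\<^bsub>B\<^esub> wd ks as bs)" .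
  qed
qed

lemma counital_right:
  assumes x: "x \<in> carrier B"
  shows "tensor_lift B (\<lambda>x y. t (\<pi> y) \<otimes>\<^bsub>B\<^esub> x) (\<Delta> x) = x"
proof -
  have bal: "balanced_map (carrier M) (\<lambda>a f. t f \<otimes>\<^bsub>B\<^esub> a) (\<lambda>f b. s f \<otimes>\<^bsub>B\<^esub> b) B B B (\<lambda>x y. t (\<pi> y) \<otimes>\<^bsub>B\<^esub> x)"
    unfolding balanced_map_def
  proof (intro conjI ballI addhomI)
    fix x f y assume *: "x \<in> carrier B" "f \<in> carrier M" "y \<in> carrier B"
    show "t (\<pi> y) \<otimes>\<^bsub>B\<^esub> (t f \<otimes>\<^bsub>B\<^esub> x) = t (\<pi> (s f \<otimes>\<^bsub>B\<^esub> y)) \<otimes>\<^bsub>B\<^esub> x"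
      using * \<pi>_s_mult[OF *(2,3)] t_mult[OF \<pi>_closed[OF *(3)] *(2)] t_closed[OF *(2)] t_closed[OF \<pi>_closed[OF *(3)]]
      by (simp flip: B.A.m_assoc)
  qed (simp_all add: t_closed[OF \<pi>_closed] B.A.r_distr addhom_add[OF \<pi>_addhom]
      addhom_add[OF t_addhom \<pi>_closed \<pi>_closed] B.A.l_distr)
  note el = TT.lift_el[OF B.abelian_group bal] and add = TT.lift_addhom[OF B.abelian_group bal]
  let ?v = "tensor_lift B (\<lambda>x y. t (\<pi> y) \<otimes>\<^bsub>B\<^esub> x)"
  show ?thesis
  proof (rule span_ext[OF addhom_comp[OF \<Delta>_addhom add] _ _ x])
    show "(\<lambda>x. x) \<in> addhom B B" by (rule addhomI) simp_all
    fix f g ks as bs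
    assume f: "f \<in> carrier M" and g: "g \<in> carrier M" and ks: "ks \<in> lists K"
      and as: "as \<in> U ks" and bs: "bs \<in> U ks"
    have W: "wd ks ds cs \<in> carrier B" if "ds \<in> U ks" "cs \<in> U ks" for ds cs
      using ks that by simp
    let ?X = "\<lambda>cs. s f \<otimes>\<^bsub>B\<^esub> wd ks as cs" and ?Y = "\<lambda>cs. t g \<otimes>\<^bsub>B\<^esub> wd ks cs bs"
    have X: "?X cs \<in> carrier B" and Y: "?Y cs \<in> carrier B" if "cs \<in> U ks" for cs
      using s_closed[OF f] t_closed[OF g] W as bs that by auto
    have 0: "t \<zero>\<^bsub>M\<^esub> = \<zero>\<^bsub>B\<^esub>" by (rule addhom_zero[OF t_addhom M.abelian_group B.abelian_group])
    have "?v (\<Delta> (s f \<otimes>\<^bsub>B\<^esub> (t g \<otimes>\<^bsub>B\<^esub> wd ks as bs))) = (\<Oplus>\<^bsub>B\<^esub>cs\<in>U ks. ?v (TT.el (?X cs) (?Y cs)))"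
      unfolding \<Delta>_st_wd[OF f g ks as bs]
      by (rule addhom_finsum[OF add TT.abelian_tensor B.abelian_group]) (use X Y in auto)
    also have "\<dots> = (\<Oplus>\<^bsub>B\<^esub>cs\<in>U ks. if cs = bs then t g \<otimes>\<^bsub>B\<^esub> ?X cs else \<zero>\<^bsub>B\<^esub>)"
    proof (rule B.finsum_cong')
      fix cs assume cs: "cs \<in> U ks"
      have "\<pi> (?Y cs) = (if cs = bs then g else \<zero>\<^bsub>M\<^esub>)"
        using \<pi>_t_mult[OF g W[OF cs bs]] \<pi>_wd[OF ks cs bs] M.A.l_one[OF g] M.A.l_null[OF g] by simp
      then show "?v (TT.el (?X cs) (?Y cs)) = (if cs = bs then t g \<otimes>\<^bsub>B\<^esub> ?X cs else \<zero>\<^bsub>B\<^esub>)"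
        using el[OF X[OF cs] Y[OF cs]] X[OF cs] 0 by simp
    qed (use t_closed[OF g] X in auto)
    also have "\<dots> = t g \<otimes>\<^bsub>B\<^esub> ?X bs"
      by (rule B.finsum_delta(1)[OF finite_U bs]) (use t_closed[OF g] X bs in auto)
    also have "\<dots> = s f \<otimes>\<^bsub>B\<^esub> (t g \<otimes>\<^bsub>B\<^esub> wd ks as bs)"
      using s_t[OF f g] s_closed[OF f] t_closed[OF g] W[OF as bs] by (simp flip: B.A.m_assoc)
    finally show "?v (\<Delta> (s f \<otimes>\<^bsub>B\<^esub> (t g \<otimes>\<^bsub>B\<^esub> wd ks as bs))) = s f \<otimes>\<^bsub>B\<^esub> (t g \<otimes>\<^bsub>B\<^esub> wd ks as bs)" .
  qed
qed

lemma comult_balanced: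
  assumes f: "f \<in> carrier M" and x: "x \<in> carrier B"
  shows "tensor_lift TT.T (\<lambda>x y. TT.el (x \<otimes>\<^bsub>B\<^esub> t f) y) (\<Delta> x) =
    tensor_lift TT.T (\<lambda>x y. TT.el x (y \<otimes>\<^bsub>B\<^esub> s f)) (\<Delta> x)"
proof -
  note \<Delta>x = addhom_closed[OF \<Delta>_addhom x]
  have "tensor_lift TT.T (\<lambda>x y. TT.el (x \<otimes>\<^bsub>B\<^esub> t f) y) (\<Delta> x) = TT.rmul (\<Delta> x) (t f) \<one>\<^bsub>B\<^esub>"
    by (rule TT.additive_lift[OF TT.abelian_tensor TT.rmul_addhom[OF t_closed[OF f] B.A.one_closed] _ \<Delta>x])
      (use t_closed[OF f] in simp)
  also have "\<dots> = TT.rmul (\<Delta> x) \<one>\<^bsub>B\<^esub> (s f)"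
    using TT.takeuchi_rmul[OF \<Delta>_takeuchi[OF x] f] t_closed[OF f] s_closed[OF f] by simp
  also have "\<dots> = tensor_lift TT.T (\<lambda>x y. TT.el x (y \<otimes>\<^bsub>B\<^esub> s f)) (\<Delta> x)"
    by (rule TT.additive_lift[OF TT.abelian_tensor TT.rmul_addhom[OF B.A.one_closed s_closed[OF f]] _ \<Delta>x, symmetric])
      (use s_closed[OF f] in simp)
  finally show ?thesis .
qed

lemma counit_mult:
  assumes "x \<in> carrier B" "y \<in> carrier B"
  shows "\<pi> (x \<otimes>\<^bsub>B\<^esub> s (\<pi> y)) = \<pi> (x \<otimes>\<^bsub>B\<^esub> y)" "\<pi> (x \<otimes>\<^bsub>B\<^esub> t (\<pi> y)) = \<pi> (x \<otimes>\<^bsub>B\<^esub> y)"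
proof -
  note \<pi>y = \<pi>_closed[OF assms(2)] and one = M.A.one_closed
  have "\<chi> (s (\<pi> y)) \<one>\<^bsub>M\<^esub> = \<pi> y" "\<chi> (t (\<pi> y)) \<one>\<^bsub>M\<^esub> = \<pi> y"
    using \<chi>_s[OF \<pi>y] \<chi>_t[OF \<pi>y] one M.A.r_one[OF \<pi>y] M.A.l_one[OF \<pi>y] by (simp_all add: end_s_def end_t_def)
  moreover have "\<pi> (x \<otimes>\<^bsub>B\<^esub> z) = \<chi> x (\<chi> z \<one>\<^bsub>M\<^esub>)" if "z \<in> carrier B" for z
    using assms that \<chi>_mult[OF assms(1) that one] by (simp add: \<pi>_eq)
  ultimately show "\<pi> (x \<otimes>\<^bsub>B\<^esub> s (\<pi> y)) = \<pi> (x \<otimes>\<^bsub>B\<^esub> y)" "\<pi> (x \<otimes>\<^bsub>B\<^esub> t (\<pi> y)) = \<pi> (x \<otimes>\<^bsub>B\<^esub> y)"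
    using assms(2) s_closed[OF \<pi>y] t_closed[OF \<pi>y] by (simp_all add: \<pi>_eq[symmetric])
qed

theorem left_bialgebroid: "left_bialgebroid B M s t \<Delta> \<pi>"
proof (rule left_bialgebroid.intro, unfold AA_eq elt2_eq)
  show "k_algebra B" "k_algebra M" by (rule B.k_algebra_axioms M.k_algebra_axioms)+
  show "s \<in> k_algebra_hom M B" "t \<in> k_algebra_hom (op_algebra M) B" by (rule s_hom t_hom)+
  show "\<Delta> \<in> addhom B TT.T" "\<pi> \<in> addhom B M" by (rule \<Delta>_addhom \<pi>_addhom)+
  show "\<Delta> \<one>\<^bsub>B\<^esub> = TT.el \<one>\<^bsub>B\<^esub> \<one>\<^bsub>B\<^esub>" using khom_one[OF \<Delta>_hom] by (simp add: TT.tensor_one)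
  show "\<pi> \<one>\<^bsub>B\<^esub> = \<one>\<^bsub>M\<^esub>" by (rule \<pi>_one)
next
  fix f x assume f: "f \<in> carrier M" and x: "x \<in> carrier B"
  show "\<Delta> (s f \<otimes>\<^bsub>B\<^esub> x) = lact f (\<Delta> x)"
    using \<Delta>_s_mult[OF f x] lact2_eq[OF f addhom_closed[OF \<Delta>_addhom x]] by simp
  show "\<Delta> (t f \<otimes>\<^bsub>B\<^esub> x) = ract (\<Delta> x) f"
    using \<Delta>_t_mult[OF f x] ract2_eq[OF f addhom_closed[OF \<Delta>_addhom x]] by simp
  show "\<pi> (s f \<otimes>\<^bsub>B\<^esub> x) = f \<otimes>\<^bsub>M\<^esub> \<pi> x" by (rule \<pi>_s_mult[OF f x])
  show "\<pi> (t f \<otimes>\<^bsub>B\<^esub> x) = \<pi> x \<otimes>\<^bsub>M\<^esub> f" by (rule \<pi>_t_mult[OF f x])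
  show "tensor_lift TT.T (\<lambda>x y. TT.el (x \<otimes>\<^bsub>B\<^esub> t f) y) (\<Delta> x) =
    tensor_lift TT.T (\<lambda>x y. TT.el x (y \<otimes>\<^bsub>B\<^esub> s f)) (\<Delta> x)"
    by (rule comult_balanced[OF f x])
next
  fix x y assume x: "x \<in> carrier B" and y: "y \<in> carrier B"
  show "\<Delta> (x \<otimes>\<^bsub>B\<^esub> y) = \<Delta> x \<otimes>\<^bsub>TT.T\<^esub> \<Delta> y" by (rule \<Delta>_mult[OF x y])
  show "\<pi> (x \<otimes>\<^bsub>B\<^esub> s (\<pi> y)) = \<pi> (x \<otimes>\<^bsub>B\<^esub> y)" "\<pi> (x \<otimes>\<^bsub>B\<^esub> t (\<pi> y)) = \<pi> (x \<otimes>\<^bsub>B\<^esub> y)"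
    by (rule counit_mult[OF x y])+
qed (rule s_t coassociative[unfolded AA_eq elt2_eq] counital_left counital_right; assumption)+

end

text \<open>
  A homomorphism that respects the coefficients respects comultiplication and counit, because these
  are determined by their values on the coefficients.
\<close>

lemma coefficient_bialgebroid_hom:
  fixes s t :: "('l :: finite \<Rightarrow> 'r) \<Rightarrow> 'b" and s' t' :: "('l \<Rightarrow> 'r) \<Rightarrow> 'c"
  assumes "coefficient_bialgebroid R B XX s t K \<alpha> l \<Delta> \<pi> \<chi>"
    and "coefficient_bialgebroid R B' XX s' t' K' \<alpha> l' \<Delta>' \<pi>' \<chi>'"
    and \<Phi>: "\<Phi> \<in> k_algebra_hom B B'" and K: "K \<subseteq> K'"
    and \<Phi>_s: "\<And>f. f \<in> carrier (map_algebra R) \<Longrightarrow> \<Phi> (s f) = s' f"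
    and \<Phi>_t: "\<And>f. f \<in> carrier (map_algebra R) \<Longrightarrow> \<Phi> (t f) = t' f"
    and \<Phi>_l: "\<And>i a b. \<lbrakk>i \<in> K; a \<in> XX; b \<in> XX\<rbrakk> \<Longrightarrow> \<Phi> (l i a b) = l' i a b"
  shows "left_bialgebroid_hom B (map_algebra R) s t \<Delta> \<pi> B' (map_algebra R) s' t' \<Delta>' \<pi>' \<Phi> id"
proof -
  interpret S: coefficient_bialgebroid R B XX s t K \<alpha> l \<Delta> \<pi> \<chi> by fact
  interpret T: coefficient_bialgebroid R B' XX s' t' K' \<alpha> l' \<Delta>' \<pi>' \<chi>' by fact
  note \<Phi>c = khom_closed[OF \<Phi>]
  have \<Phi>_wd: "\<Phi> (S.wd ks as bs) = T.wd ks as bs" if "ks \<in> lists K" "as \<in> S.U ks" "bs \<in> S.U ks" for ks as bs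
    using khom_coeff_word[OF \<Phi> S.B.k_algebra_axioms, of K XX l l' ks as "length ks" bs] S.l_closed \<Phi>_l that by auto
  have K': "ks \<in> lists K'" if "ks \<in> lists K" for ks using K that by auto
  have \<Phi>_st_wd: "\<Phi> (s f \<otimes>\<^bsub>B\<^esub> (t g \<otimes>\<^bsub>B\<^esub> S.wd ks as bs)) = s' f \<otimes>\<^bsub>B'\<^esub> (t' g \<otimes>\<^bsub>B'\<^esub> T.wd ks as bs)"
    "\<Phi> (s f \<otimes>\<^bsub>B\<^esub> S.wd ks as bs) = s' f \<otimes>\<^bsub>B'\<^esub> T.wd ks as bs"
    "\<Phi> (t g \<otimes>\<^bsub>B\<^esub> S.wd ks as bs) = t' g \<otimes>\<^bsub>B'\<^esub> T.wd ks as bs"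
    if "f \<in> carrier (map_algebra R)" "g \<in> carrier (map_algebra R)"
      "ks \<in> lists K" "as \<in> S.U ks" "bs \<in> S.U ks" for f g ks as bs
    using that \<Phi>_s[OF that(1)] \<Phi>_t[OF that(2)] \<Phi>_wd[OF that(3-5)] S.s_closed[OF that(1)] S.t_closed[OF that(2)]
    by (simp_all add: khom_mult[OF \<Phi>])
  have \<pi>: "\<pi>' (\<Phi> x) = \<pi> x" if x: "x \<in> carrier B" for x
  proof (rule S.span_ext[OF addhom_comp[OF khom_addhom[OF \<Phi>] T.\<pi>_addhom] S.\<pi>_addhom _ x])
    fix f g :: "'l \<Rightarrow> 'r" and ks as bs
    assume *: "f \<in> carrier (map_algebra R)" "g \<in> carrier (map_algebra R)"
      "ks \<in> lists K" "as \<in> S.U ks" "bs \<in> S.U ks"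
    note k = K'[OF *(3)]
    show "\<pi>' (\<Phi> (s f \<otimes>\<^bsub>B\<^esub> (t g \<otimes>\<^bsub>B\<^esub> S.wd ks as bs))) = \<pi> (s f \<otimes>\<^bsub>B\<^esub> (t g \<otimes>\<^bsub>B\<^esub> S.wd ks as bs))"
      unfolding \<Phi>_st_wd(1)[OF *]
      using * k S.s_closed[OF *(1)] S.t_closed[OF *(2)] T.s_closed[OF *(1)] T.t_closed[OF *(2)]
      by (simp add: S.\<pi>_s_mult S.\<pi>_t_mult T.\<pi>_s_mult T.\<pi>_t_mult S.\<pi>_wd T.\<pi>_wd del: map_algebra_simps(1))
  qed
  have bal: "balanced_map (carrier S.M) (\<lambda>a f. t f \<otimes>\<^bsub>B\<^esub> a) (\<lambda>f b. s f \<otimes>\<^bsub>B\<^esub> b) B B T.TT.T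
      (\<lambda>x y. T.TT.el (\<Phi> x) (\<Phi> y))"
    unfolding balanced_map_def
  proof (intro conjI ballI addhomI)
    fix x f y assume *: "x \<in> carrier B" "f \<in> carrier S.M" "y \<in> carrier B"
    show "T.TT.el (\<Phi> (t f \<otimes>\<^bsub>B\<^esub> x)) (\<Phi> y) = T.TT.el (\<Phi> x) (\<Phi> (s f \<otimes>\<^bsub>B\<^esub> y))"
      using T.st_el_eqs[OF *(2) \<Phi>c[OF *(1)] \<Phi>c[OF *(3)]] * \<Phi>_s[OF *(2)] \<Phi>_t[OF *(2)]
        S.s_closed[OF *(2)] S.t_closed[OF *(2)] by (simp add: khom_mult[OF \<Phi>])
  qed (simp_all add: \<Phi>c khom_add[OF \<Phi>] T.TT.el_add_left T.TT.el_add_right)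
  note el = S.TT.lift_el[OF T.TT.abelian_tensor bal] and add = S.TT.lift_addhom[OF T.TT.abelian_tensor bal]
  let ?v = "tensor_lift T.TT.T (\<lambda>x y. T.TT.el (\<Phi> x) (\<Phi> y))"
  have \<Delta>: "\<Delta>' (\<Phi> x) = ?v (\<Delta> x)" if x: "x \<in> carrier B" for x
  proof (rule S.span_ext[OF addhom_comp[OF khom_addhom[OF \<Phi>] T.\<Delta>_addhom] addhom_comp[OF S.\<Delta>_addhom add] _ x])
    fix f g :: "'l \<Rightarrow> 'r" and ks as bs
    assume *: "f \<in> carrier (map_algebra R)" "g \<in> carrier (map_algebra R)"
      "ks \<in> lists K" "as \<in> S.U ks" "bs \<in> S.U ks"
    note k = K'[OF *(3)]
    have c: "s f \<otimes>\<^bsub>B\<^esub> S.wd ks as cs \<in> carrier B" "t g \<otimes>\<^bsub>B\<^esub> S.wd ks cs bs \<in> carrier B"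
      "s' f \<otimes>\<^bsub>B'\<^esub> T.wd ks as cs \<in> carrier B'" "t' g \<otimes>\<^bsub>B'\<^esub> T.wd ks cs bs \<in> carrier B'" if "cs \<in> S.U ks" for cs
      using * k that S.s_closed[OF *(1)] S.t_closed[OF *(2)] T.s_closed[OF *(1)] T.t_closed[OF *(2)] by auto
    have "?v (\<Delta> (s f \<otimes>\<^bsub>B\<^esub> (t g \<otimes>\<^bsub>B\<^esub> S.wd ks as bs))) =
        (\<Oplus>\<^bsub>T.TT.T\<^esub>cs\<in>S.U ks. ?v (S.TT.el (s f \<otimes>\<^bsub>B\<^esub> S.wd ks as cs) (t g \<otimes>\<^bsub>B\<^esub> S.wd ks cs bs)))"
      unfolding S.\<Delta>_st_wd[OF *]
      by (rule addhom_finsum[OF add S.TT.abelian_tensor T.TT.abelian_tensor]) (use c in auto)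
    also have "\<dots> = (\<Oplus>\<^bsub>T.TT.T\<^esub>cs\<in>S.U ks. T.TT.el (s' f \<otimes>\<^bsub>B'\<^esub> T.wd ks as cs) (t' g \<otimes>\<^bsub>B'\<^esub> T.wd ks cs bs))"
    proof (rule T.TT.T.finsum_cong')
      fix cs assume cs: "cs \<in> S.U ks"
      show "?v (S.TT.el (s f \<otimes>\<^bsub>B\<^esub> S.wd ks as cs) (t g \<otimes>\<^bsub>B\<^esub> S.wd ks cs bs)) =
          T.TT.el (s' f \<otimes>\<^bsub>B'\<^esub> T.wd ks as cs) (t' g \<otimes>\<^bsub>B'\<^esub> T.wd ks cs bs)"
        using el[OF c(1,2)[OF cs]] \<Phi>_st_wd(2)[OF *(1-4) cs] \<Phi>_st_wd(3)[OF *(1-3) cs *(5)] by simp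
    qed (use c in auto)
    also have "\<dots> = \<Delta>' (s' f \<otimes>\<^bsub>B'\<^esub> (t' g \<otimes>\<^bsub>B'\<^esub> T.wd ks as bs))"
      by (rule T.\<Delta>_st_wd[OF *(1,2) k *(4,5), symmetric])
    finally show "\<Delta>' (\<Phi> (s f \<otimes>\<^bsub>B\<^esub> (t g \<otimes>\<^bsub>B\<^esub> S.wd ks as bs))) = ?v (\<Delta> (s f \<otimes>\<^bsub>B\<^esub> (t g \<otimes>\<^bsub>B\<^esub> S.wd ks as bs)))"
      unfolding \<Phi>_st_wd(1)[OF *] by (rule sym)
  qed
  show ?thesis
    by (intro left_bialgebroid_hom.intro left_bialgebroid_hom_axioms.intro S.left_bialgebroid T.left_bialgebroid)
      (use \<Phi> \<Phi>_s \<Phi>_t \<pi> \<Delta> in \<open>auto simp: T.AA_eq T.elt2_eq simp del: map_algebra_simps(1)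
        intro!: k_algebra_homI\<close>)
qed

context basis_algebra
begin

lemma sum_closed: "(\<And>i. i \<in> I \<Longrightarrow> f i \<in> carrier A) \<Longrightarrow> (\<Sum>i\<in>I. f i) \<in> carrier A"
  by (induction I rule: infinite_finite_induct) (simp_all add: carrier_eq keys_subsetI)

lemma diff_closed: "\<lbrakk>x \<in> carrier A; y \<in> carrier A\<rbrakk> \<Longrightarrow> x - y \<in> carrier A"
  by (simp add: carrier_eq keys_subsetI)

lemma addhom_sum:
  assumes f: "f \<in> addhom A C" and C: "abelian_group C" and g: "\<And>i. i \<in> I \<Longrightarrow> g i \<in> carrier A"
  shows "f (\<Sum>i\<in>I. g i) = (\<Oplus>\<^bsub>C\<^esub>i\<in>I. f (g i))"
  using addhom_finsum[OF f k_algebra.abelian_group[OF k_algebra] C, of g I] finsum_eq[of g I] g by auto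

lemma addhom_diff:
  assumes f: "f \<in> addhom A C" and C: "abelian_group C" and x: "x \<in> carrier A" and y: "y \<in> carrier A"
  shows "f (x - y) = f x \<ominus>\<^bsub>C\<^esub> f y"
proof -
  interpret C: abelian_group C by (rule C)
  have "f x = f (x - y) \<oplus>\<^bsub>C\<^esub> f y"
    using addhom_add[OF f diff_closed[OF x y] y] by (simp add: add_eq)
  then show ?thesis
    using addhom_closed[OF f x] addhom_closed[OF f y] addhom_closed[OF f diff_closed[OF x y]]
    by (simp add: C.minus_eq C.a_assoc C.r_neg)
qed

end

lemma (in abelian_group) minus_eq_zeroD: "\<lbrakk>x \<in> carrier G; y \<in> carrier G; x \<ominus> y = \<zero>\<rbrakk> \<Longrightarrow> x = y"
  by (metis a_inv_closed minus_eq minus_equality minus_minus)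

lemma (in abelian_group) minus_self: "x \<in> carrier G \<Longrightarrow> x \<ominus> x = \<zero>"
  by (simp add: minus_eq r_neg)

section \<open>Invertible matrices of coefficients\<close>

definition signed_shift :: "('x \<Rightarrow> 'l \<Rightarrow> 'l) \<Rightarrow> bool \<Rightarrow> 'x \<Rightarrow> 'l \<Rightarrow> 'l" where
  "signed_shift dg k a = (if k then dg a else inv_into UNIV (dg a))"

locale invertible_coefficients =
  frt_coefficients R B XX s t "UNIV :: bool set" "signed_shift dg" l \<sigma> True
  for R :: "('k :: field, 'r) module" and B :: "('k, 'b) module" and XX :: "'x set"
    and s t :: "('l :: finite \<Rightarrow> 'r) \<Rightarrow> 'b" and dg :: "'x \<Rightarrow> 'l \<Rightarrow> 'l" and l \<sigma> +
  assumes bij_dg: "x \<in> XX \<Longrightarrow> bij (dg x)"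
    and inverse_right: "\<lbrakk>a \<in> XX; b \<in> XX\<rbrakk> \<Longrightarrow>
      (\<Oplus>\<^bsub>B\<^esub>c\<in>XX. l True a c \<otimes>\<^bsub>B\<^esub> l False b c) = (if a = b then \<one>\<^bsub>B\<^esub> else \<zero>\<^bsub>B\<^esub>)"
    and inverse_left: "\<lbrakk>a \<in> XX; b \<in> XX\<rbrakk> \<Longrightarrow>
      (\<Oplus>\<^bsub>B\<^esub>c\<in>XX. l False c a \<otimes>\<^bsub>B\<^esub> l True c b) = (if a = b then \<one>\<^bsub>B\<^esub> else \<zero>\<^bsub>B\<^esub>)"
begin

lemma lT_mult_mixed:
  assumes "a \<in> XX" "b \<in> XX" "c \<in> XX" "d \<in> XX"
  shows "lT i a b \<otimes>\<^bsub>TT.T\<^esub> lT j c d =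
    (\<Oplus>\<^bsub>TT.T\<^esub>w\<in>XX \<times> XX. TT.el (l i a (fst w) \<otimes>\<^bsub>B\<^esub> l j c (snd w)) (l i (fst w) b \<otimes>\<^bsub>B\<^esub> l j (snd w) d))"
proof -
  have lc: "l i p q \<in> carrier B" if "p \<in> XX" "q \<in> XX" for i p q using l_closed that by simp
  have tk: "TT.el (l i p q) (l i q r) \<in> TT.takeuchi" if "p \<in> XX" "q \<in> XX" "r \<in> XX" for i p q r
    using l_takeuchi that by simp
  have e: "lT i a b \<otimes>\<^bsub>TT.T\<^esub> TT.el (l j c q) (l j q d) = (\<Oplus>\<^bsub>TT.T\<^esub>p\<in>XX.
      TT.el (l i a p \<otimes>\<^bsub>B\<^esub> l j c q) (l i p b \<otimes>\<^bsub>B\<^esub> l j q d))" if q: "q \<in> XX" for q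
  proof -
    have "lT i a b \<otimes>\<^bsub>TT.TK\<^esub> TT.el (l j c q) (l j q d) =
        (\<Oplus>\<^bsub>TT.TK\<^esub>p\<in>XX. TT.el (l i a p) (l i p b) \<otimes>\<^bsub>TT.TK\<^esub> TT.el (l j c q) (l j q d))"
      unfolding lT_def using tk assms q by (intro TK.A.finsum_ldistr finite_X) auto
    also have "\<dots> = (\<Oplus>\<^bsub>TT.T\<^esub>p\<in>XX. TT.el (l i a p) (l i p b) \<otimes>\<^bsub>TT.T\<^esub> TT.el (l j c q) (l j q d))"
      by (subst TK_finsum) (use tk assms q TT.takeuchi_mult in auto)
    also have "\<dots> = (\<Oplus>\<^bsub>TT.T\<^esub>p\<in>XX. TT.el (l i a p \<otimes>\<^bsub>B\<^esub> l j c q) (l i p b \<otimes>\<^bsub>B\<^esub> l j q d))"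
      by (rule TT.T.finsum_cong') (use tk assms q lc in \<open>auto simp: TT.el_mult_el\<close>)
    finally show ?thesis by simp
  qed
  have lTj: "lT j c d = (\<Oplus>\<^bsub>TT.T\<^esub>q\<in>XX. TT.el (l j c q) (l j q d))" using lT_eq assms by simp
  have "lT i a b \<otimes>\<^bsub>TT.T\<^esub> lT j c d =
      (\<Oplus>\<^bsub>TT.T\<^esub>q\<in>XX. lT i a b \<otimes>\<^bsub>TT.T\<^esub> TT.el (l j c q) (l j q d))"
    unfolding lTj
    by (rule addhom_finsum[OF TT.mult_addhom_tensor TT.abelian_tensor TT.abelian_tensor])
      (use lT_takeuchi tk assms lc in auto)
  also have "\<dots> = (\<Oplus>\<^bsub>TT.T\<^esub>q\<in>XX. \<Oplus>\<^bsub>TT.T\<^esub>p\<in>XX.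
      TT.el (l i a p \<otimes>\<^bsub>B\<^esub> l j c q) (l i p b \<otimes>\<^bsub>B\<^esub> l j q d))"
    by (rule TT.T.finsum_cong') (use e lc assms in \<open>auto intro!: TT.T.finsum_closed\<close>)
  also have "\<dots> = (\<Oplus>\<^bsub>TT.T\<^esub>p\<in>XX. \<Oplus>\<^bsub>TT.T\<^esub>q\<in>XX.
      TT.el (l i a p \<otimes>\<^bsub>B\<^esub> l j c q) (l i p b \<otimes>\<^bsub>B\<^esub> l j q d))"
    by (rule TT.T.finsum_swap) (use lc assms in auto)
  also have "\<dots> = (\<Oplus>\<^bsub>TT.T\<^esub>w\<in>XX \<times> XX.
      TT.el (l i a (fst w) \<otimes>\<^bsub>B\<^esub> l j c (snd w)) (l i (fst w) b \<otimes>\<^bsub>B\<^esub> l j (snd w) d))"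
    by (rule TT.T.finsum_pair) (use lc assms finite_X in auto)
  finally show ?thesis .
qed

lemma finsum_diagonal:
  assumes "abelian_group G" "\<And>p. p \<in> XX \<Longrightarrow> f p \<in> carrier G"
  shows "(\<Oplus>\<^bsub>G\<^esub>w\<in>XX \<times> XX. if fst w = snd w then f (fst w) else \<zero>\<^bsub>G\<^esub>) = (\<Oplus>\<^bsub>G\<^esub>p\<in>XX. f p)"
proof -
  interpret G: abelian_group G by fact
  have "(\<Oplus>\<^bsub>G\<^esub>w\<in>XX \<times> XX. if fst w = snd w then f (fst w) else \<zero>\<^bsub>G\<^esub>) =
      (\<Oplus>\<^bsub>G\<^esub>p\<in>XX. \<Oplus>\<^bsub>G\<^esub>q\<in>XX. if p = q then f p else \<zero>\<^bsub>G\<^esub>)"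
    by (rule G.finsum_pair[symmetric, OF finite_X finite_X]) (use assms in auto)
  also have "\<dots> = (\<Oplus>\<^bsub>G\<^esub>p\<in>XX. f p)"
  proof (rule G.finsum_cong')
    fix p assume p: "p \<in> XX"
    show "(\<Oplus>\<^bsub>G\<^esub>q\<in>XX. if p = q then f p else \<zero>\<^bsub>G\<^esub>) = f p"
      using G.finsum_delta(2)[OF finite_X p, of "\<lambda>_. f p"] assms p by simp
  qed (use assms in auto)
  finally show ?thesis .
qed

text \<open>
  The index \<open>False\<close> stands for the transpose of the inverse matrix. With this convention both
  matrices comultiply by the formula of \<open>lT\<close>, and the inverse of \<open>lT True\<close> is \<open>lT False\<close>.
\<close>

lemma takeuchi_invertible: "invertible_coefficients R TT.TK XX sT tT dg lT \<sigma>"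
proof (intro invertible_coefficients.intro invertible_coefficients_axioms.intro takeuchi_frt bij_dg)
  let ?P = "XX \<times> XX"
  fix a b assume a: "a \<in> XX" and b: "b \<in> XX"
  have lc: "l i p q \<in> carrier B" if "p \<in> XX" "q \<in> XX" for i p q using l_closed that by simp
  have one: "TT.el (if a = b then \<one>\<^bsub>B\<^esub> else \<zero>\<^bsub>B\<^esub>) \<one>\<^bsub>B\<^esub> = (if a = b then \<one>\<^bsub>TT.TK\<^esub> else \<zero>\<^bsub>TT.TK\<^esub>)"
    "TT.el \<one>\<^bsub>B\<^esub> (if a = b then \<one>\<^bsub>B\<^esub> else \<zero>\<^bsub>B\<^esub>) = (if a = b then \<one>\<^bsub>TT.TK\<^esub> else \<zero>\<^bsub>TT.TK\<^esub>)"
    using addhom_zero[OF TT.el_addhom_left B.abelian_group TT.abelian_tensor, of "\<one>\<^bsub>B\<^esub>"]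
      addhom_zero[OF TT.el_addhom_right B.abelian_group TT.abelian_tensor, of "\<one>\<^bsub>B\<^esub>"]
    by (simp_all add: TT.tensor_one)
  have z: "TT.el x \<zero>\<^bsub>B\<^esub> = \<zero>\<^bsub>TT.T\<^esub>" "TT.el \<zero>\<^bsub>B\<^esub> x = \<zero>\<^bsub>TT.T\<^esub>" if "x \<in> carrier B" for x
    using addhom_zero[OF TT.el_addhom_left B.abelian_group TT.abelian_tensor, of x]
      addhom_zero[OF TT.el_addhom_right B.abelian_group TT.abelian_tensor, of x] that by simp_all
  let ?f = "\<lambda>c w. TT.el (l True a (fst w) \<otimes>\<^bsub>B\<^esub> l False b (snd w)) (l True (fst w) c \<otimes>\<^bsub>B\<^esub> l False (snd w) c)"
  have "(\<Oplus>\<^bsub>TT.TK\<^esub>c\<in>XX. lT True a c \<otimes>\<^bsub>TT.TK\<^esub> lT False b c) = (\<Oplus>\<^bsub>TT.T\<^esub>c\<in>XX. lT True a c \<otimes>\<^bsub>TT.T\<^esub> lT False b c)"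
    using TK_finsum[of "\<lambda>c. lT True a c \<otimes>\<^bsub>TT.T\<^esub> lT False b c" XX] a b lT_takeuchi TT.takeuchi_mult by auto
  also have "\<dots> = (\<Oplus>\<^bsub>TT.T\<^esub>c\<in>XX. \<Oplus>\<^bsub>TT.T\<^esub>w\<in>?P. ?f c w)"
    by (rule TT.T.finsum_cong'[OF refl])
      (use a b lc in \<open>auto simp: lT_mult_mixed intro!: TT.T.finsum_closed\<close>)
  also have "\<dots> = (\<Oplus>\<^bsub>TT.T\<^esub>w\<in>?P. \<Oplus>\<^bsub>TT.T\<^esub>c\<in>XX. ?f c w)"
    by (rule TT.T.finsum_swap) (use lc a b in auto)
  also have "\<dots> = (\<Oplus>\<^bsub>TT.T\<^esub>w\<in>?P. if fst w = snd w then TT.el (l True a (fst w) \<otimes>\<^bsub>B\<^esub> l False b (fst w)) \<one>\<^bsub>B\<^esub> else \<zero>\<^bsub>TT.T\<^esub>)"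
  proof (rule TT.T.finsum_cong')
    fix w assume w: "w \<in> ?P"
    have "(\<Oplus>\<^bsub>TT.T\<^esub>c\<in>XX. ?f c w) = TT.el (l True a (fst w) \<otimes>\<^bsub>B\<^esub> l False b (snd w))
        (\<Oplus>\<^bsub>B\<^esub>c\<in>XX. l True (fst w) c \<otimes>\<^bsub>B\<^esub> l False (snd w) c)"
      by (rule addhom_finsum[OF TT.el_addhom_right B.abelian_group TT.abelian_tensor, symmetric])
        (use w lc a b in auto)
    also have "\<dots> = (if fst w = snd w then TT.el (l True a (fst w) \<otimes>\<^bsub>B\<^esub> l False b (fst w)) \<one>\<^bsub>B\<^esub> else \<zero>\<^bsub>TT.T\<^esub>)"
      using inverse_right[of "fst w" "snd w"] w lc a b z by auto
    finally show "(\<Oplus>\<^bsub>TT.T\<^esub>c\<in>XX. ?f c w) =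
      (if fst w = snd w then TT.el (l True a (fst w) \<otimes>\<^bsub>B\<^esub> l False b (fst w)) \<one>\<^bsub>B\<^esub> else \<zero>\<^bsub>TT.T\<^esub>)" .
  qed (use lc a b in auto)
  also have "\<dots> = (\<Oplus>\<^bsub>TT.T\<^esub>p\<in>XX. TT.el (l True a p \<otimes>\<^bsub>B\<^esub> l False b p) \<one>\<^bsub>B\<^esub>)"
    by (rule finsum_diagonal[OF TT.abelian_tensor, of "\<lambda>p. TT.el (l True a p \<otimes>\<^bsub>B\<^esub> l False b p) \<one>\<^bsub>B\<^esub>"])
      (use lc a b in auto)
  also have "\<dots> = TT.el (\<Oplus>\<^bsub>B\<^esub>p\<in>XX. l True a p \<otimes>\<^bsub>B\<^esub> l False b p) \<one>\<^bsub>B\<^esub>"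
    by (rule addhom_finsum[OF TT.el_addhom_left B.abelian_group TT.abelian_tensor, symmetric])
      (use lc a b in auto)
  finally show "(\<Oplus>\<^bsub>TT.TK\<^esub>c\<in>XX. lT True a c \<otimes>\<^bsub>TT.TK\<^esub> lT False b c) = (if a = b then \<one>\<^bsub>TT.TK\<^esub> else \<zero>\<^bsub>TT.TK\<^esub>)"
    using inverse_right[OF a b] one(1) by simp
  let ?g = "\<lambda>c w. TT.el (l False c (fst w) \<otimes>\<^bsub>B\<^esub> l True c (snd w)) (l False (fst w) a \<otimes>\<^bsub>B\<^esub> l True (snd w) b)"
  have "(\<Oplus>\<^bsub>TT.TK\<^esub>c\<in>XX. lT False c a \<otimes>\<^bsub>TT.TK\<^esub> lT True c b) = (\<Oplus>\<^bsub>TT.T\<^esub>c\<in>XX. lT False c a \<otimes>\<^bsub>TT.T\<^esub> lT True c b)"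
    using TK_finsum[of "\<lambda>c. lT False c a \<otimes>\<^bsub>TT.T\<^esub> lT True c b" XX] a b lT_takeuchi TT.takeuchi_mult by auto
  also have "\<dots> = (\<Oplus>\<^bsub>TT.T\<^esub>c\<in>XX. \<Oplus>\<^bsub>TT.T\<^esub>w\<in>?P. ?g c w)"
    by (rule TT.T.finsum_cong'[OF refl])
      (use a b lc in \<open>auto simp: lT_mult_mixed intro!: TT.T.finsum_closed\<close>)
  also have "\<dots> = (\<Oplus>\<^bsub>TT.T\<^esub>w\<in>?P. \<Oplus>\<^bsub>TT.T\<^esub>c\<in>XX. ?g c w)"
    by (rule TT.T.finsum_swap) (use lc a b in auto)
  also have "\<dots> = (\<Oplus>\<^bsub>TT.T\<^esub>w\<in>?P. if fst w = snd w then TT.el \<one>\<^bsub>B\<^esub> (l False (fst w) a \<otimes>\<^bsub>B\<^esub> l True (fst w) b) else \<zero>\<^bsub>TT.T\<^esub>)"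
  proof (rule TT.T.finsum_cong')
    fix w assume w: "w \<in> ?P"
    have "(\<Oplus>\<^bsub>TT.T\<^esub>c\<in>XX. ?g c w) = TT.el (\<Oplus>\<^bsub>B\<^esub>c\<in>XX. l False c (fst w) \<otimes>\<^bsub>B\<^esub> l True c (snd w))
        (l False (fst w) a \<otimes>\<^bsub>B\<^esub> l True (snd w) b)"
      by (rule addhom_finsum[OF TT.el_addhom_left B.abelian_group TT.abelian_tensor, symmetric])
        (use w lc a b in auto)
    also have "\<dots> = (if fst w = snd w then TT.el \<one>\<^bsub>B\<^esub> (l False (fst w) a \<otimes>\<^bsub>B\<^esub> l True (fst w) b) else \<zero>\<^bsub>TT.T\<^esub>)"
      using inverse_left[of "fst w" "snd w"] w lc a b z by auto
    finally show "(\<Oplus>\<^bsub>TT.T\<^esub>c\<in>XX. ?g c w) =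
      (if fst w = snd w then TT.el \<one>\<^bsub>B\<^esub> (l False (fst w) a \<otimes>\<^bsub>B\<^esub> l True (fst w) b) else \<zero>\<^bsub>TT.T\<^esub>)" .
  qed (use lc a b in auto)
  also have "\<dots> = (\<Oplus>\<^bsub>TT.T\<^esub>p\<in>XX. TT.el \<one>\<^bsub>B\<^esub> (l False p a \<otimes>\<^bsub>B\<^esub> l True p b))"
    by (rule finsum_diagonal[OF TT.abelian_tensor, of "\<lambda>p. TT.el \<one>\<^bsub>B\<^esub> (l False p a \<otimes>\<^bsub>B\<^esub> l True p b)"])
      (use lc a b in auto)
  also have "\<dots> = TT.el \<one>\<^bsub>B\<^esub> (\<Oplus>\<^bsub>B\<^esub>p\<in>XX. l False p a \<otimes>\<^bsub>B\<^esub> l True p b)"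
    by (rule addhom_finsum[OF TT.el_addhom_right B.abelian_group TT.abelian_tensor, symmetric])
      (use lc a b in auto)
  finally show "(\<Oplus>\<^bsub>TT.TK\<^esub>c\<in>XX. lT False c a \<otimes>\<^bsub>TT.TK\<^esub> lT True c b) = (if a = b then \<one>\<^bsub>TT.TK\<^esub> else \<zero>\<^bsub>TT.TK\<^esub>)"
    using inverse_left[OF a b] one(2) by simp
qed

end

text \<open>
  Inverse permutations of \<open>\<Lambda>\<close> act by inverse shifts.
\<close>

lemma (in k_algebra) end_invertible:
  fixes \<sigma> :: "'x \<Rightarrow> 'x \<Rightarrow> 'x \<Rightarrow> 'x \<Rightarrow> 'l :: finite \<Rightarrow> 'a" and dg :: "'x \<Rightarrow> 'l \<Rightarrow> 'l"
  assumes XX: "finite XX" and bij: "\<And>x. x \<in> XX \<Longrightarrow> bij (dg x)"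
    and \<sigma>: "\<And>a b c d. \<lbrakk>a \<in> XX; b \<in> XX; c \<in> XX; d \<in> XX\<rbrakk> \<Longrightarrow> \<sigma> a b c d \<in> carrier (map_algebra A)"
    and central: "\<And>a b c d l. \<lbrakk>a \<in> XX; b \<in> XX; c \<in> XX; d \<in> XX\<rbrakk> \<Longrightarrow> \<sigma> a b c d l \<in> center A"
    and degree: "\<And>a b c d l. \<lbrakk>a \<in> XX; b \<in> XX; c \<in> XX; d \<in> XX;
      dg b (dg d l) \<noteq> dg a (dg c l)\<rbrakk> \<Longrightarrow> \<sigma> b d a c l = \<zero>"
  shows "invertible_coefficients A (end_algebra (map_algebra A)) XX (end_s A) (end_t A) dg
    (end_l A (signed_shift dg)) \<sigma>"
proof (intro invertible_coefficients.intro invertible_coefficients_axioms.intro bij end_frt XX \<sigma>)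
  interpret MM: k_algebra "map_algebra A" by (rule k_algebra_map_algebra[OF k_algebra_axioms])
  interpret E: k_algebra "end_algebra (map_algebra A)" by (rule MM.k_algebra_end)
  let ?E = "end_algebra (map_algebra A)"
  let ?l = "end_l A (signed_shift dg)"
  note c = end_l_closed MM.end_closed MM.end_units
  fix a b assume a: "a \<in> XX" and b: "b \<in> XX"
  have id: "?l True p p \<otimes>\<^bsub>?E\<^esub> ?l False p p = \<one>\<^bsub>?E\<^esub>" "?l False p p \<otimes>\<^bsub>?E\<^esub> ?l True p p = \<one>\<^bsub>?E\<^esub>" if "p \<in> XX" for p
    using bij[OF that]
    by (intro MM.end_eqI; simp add: c; auto simp: MM.end_app end_l_def signed_shift_def shift_def
        fun_eq_iff bij_is_surj bij_is_inj surj_f_inv_f)+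
  have off: "?l i p q \<otimes>\<^bsub>?E\<^esub> ?l j p' q' = \<zero>\<^bsub>?E\<^esub>" if "p \<noteq> q \<or> p' \<noteq> q'" for i j p q p' q'
    using that by (intro MM.end_eqI; simp add: c; auto simp: MM.end_app end_l_def shift_def fun_eq_iff)
  have "(\<Oplus>\<^bsub>?E\<^esub>c\<in>XX. ?l True a c \<otimes>\<^bsub>?E\<^esub> ?l False b c) =
      (\<Oplus>\<^bsub>?E\<^esub>c\<in>XX. if a = c then if a = b then \<one>\<^bsub>?E\<^esub> else \<zero>\<^bsub>?E\<^esub> else \<zero>\<^bsub>?E\<^esub>)"
    by (rule E.finsum_cong') (use c id off a b in auto)
  also have "\<dots> = (if a = b then \<one>\<^bsub>?E\<^esub> else \<zero>\<^bsub>?E\<^esub>)"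
    by (rule E.finsum_delta(2)[OF XX a]) (use c in auto)
  finally show "(\<Oplus>\<^bsub>?E\<^esub>c\<in>XX. ?l True a c \<otimes>\<^bsub>?E\<^esub> ?l False b c) = (if a = b then \<one>\<^bsub>?E\<^esub> else \<zero>\<^bsub>?E\<^esub>)" .
  have "(\<Oplus>\<^bsub>?E\<^esub>c\<in>XX. ?l False c a \<otimes>\<^bsub>?E\<^esub> ?l True c b) =
      (\<Oplus>\<^bsub>?E\<^esub>c\<in>XX. if a = c then if a = b then \<one>\<^bsub>?E\<^esub> else \<zero>\<^bsub>?E\<^esub> else \<zero>\<^bsub>?E\<^esub>)"
    by (rule E.finsum_cong') (use c id off a b in auto)
  also have "\<dots> = (if a = b then \<one>\<^bsub>?E\<^esub> else \<zero>\<^bsub>?E\<^esub>)"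
    by (rule E.finsum_delta(2)[OF XX a]) (use c in auto)
  finally show "(\<Oplus>\<^bsub>?E\<^esub>c\<in>XX. ?l False c a \<otimes>\<^bsub>?E\<^esub> ?l True c b) = (if a = b then \<one>\<^bsub>?E\<^esub> else \<zero>\<^bsub>?E\<^esub>)" .
qed (use central degree in \<open>auto simp: signed_shift_def\<close>)

context algebra_tensor
begin

lemma pure_scale_right:
  "\<lbrakk>x \<in> carrier A; y \<in> carrier B\<rbrakk> \<Longrightarrow>
    pure_tensor A B x (c \<odot>\<^bsub>B\<^esub> y) = c \<odot>\<^bsub>tensor_algebra A B\<^esub> pure_tensor A B x y"
  using pure_balanced[of x c y] pure_scale[of x y c] by simp

lemma pure_left_hom: "(\<lambda>x. pure_tensor A B x \<one>\<^bsub>B\<^esub>) \<in> k_algebra_hom A (tensor_algebra A B)"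
  by (rule k_algebra_homI) (simp_all add: pure_add_left pure_mult pure_one pure_scale)

lemma pure_right_hom: "(\<lambda>y. pure_tensor A B \<one>\<^bsub>A\<^esub> y) \<in> k_algebra_hom B (tensor_algebra A B)"
  by (rule k_algebra_homI) (simp_all add: pure_add_right pure_mult pure_one pure_scale_right)

end

section \<open>The presentation of \<open>A\<^sub>\<sigma>\<close>\<close>

locale sigma_data = R: k_algebra R for R :: "('k :: field, 'r) module" +
  fixes XX :: "'x set" and dg :: "'x \<Rightarrow> 'l :: finite \<Rightarrow> 'l" and \<sigma> :: "'x \<Rightarrow> 'x \<Rightarrow> 'x \<Rightarrow> 'x \<Rightarrow> 'l \<Rightarrow> 'r"
  assumes finite_XX: "finite XX" and bij_deg: "x \<in> XX \<Longrightarrow> bij (dg x)"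
    and \<sigma>_closed: "\<lbrakk>a \<in> XX; b \<in> XX; c \<in> XX; d \<in> XX\<rbrakk> \<Longrightarrow> \<sigma> a b c d \<in> carrier (map_algebra R)"
begin

abbreviation "M \<equiv> map_algebra R :: ('k, 'l \<Rightarrow> 'r) module"
abbreviation "S \<equiv> LambdaX R XX :: ('l, 'r, 'x) gen set"
abbreviation "F \<equiv> free_algebra S :: ('k, ('l, 'r, 'x) gen list \<Rightarrow>\<^sub>0 'k) module"
abbreviation "rels \<equiv> sigma_rels R XX dg \<sigma>"

sublocale M: k_algebra M
  by (rule k_algebra_map_algebra) (rule R.k_algebra_axioms)

sublocale MT: algebra_tensor M "op_algebra M"
  by (intro algebra_tensor.intro M.k_algebra_axioms k_algebra_op)

lemma MMop_eq: "MMop R = tensor_algebra M (op_algebra M)" and mm_eq: "mm R = pure_tensor M (op_algebra M)"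
  by (simp_all add: MMop_def mm_def)

lemma mm_closed [simp]: "\<lbrakk>f \<in> carrier M; g \<in> carrier M\<rbrakk> \<Longrightarrow> mm R f g \<in> carrier (MMop R)"
  unfolding MMop_eq mm_eq by (rule MT.pure_closed) simp_all

sublocale MM: k_algebra "MMop R :: ('k, ('l, 'r) map_tensor) module"
  unfolding MMop_eq by (rule MT.k_algebra_tensor)

sublocale F: basis_algebra F "lists S" "\<lambda>u v. Some (u @ v)"
  by (rule basis_algebra_free)

sublocale FA: k_algebra F
  by (rule F.k_algebra)

lemma gen_in [simp]:
  "Gen_ten \<xi> \<in> S \<longleftrightarrow> \<xi> \<in> carrier (MMop R)"
  "Gen_L a b \<in> S \<longleftrightarrow> a \<in> XX \<and> b \<in> XX" "Gen_Linv a b \<in> S \<longleftrightarrow> a \<in> XX \<and> b \<in> XX"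
  by (auto simp: LambdaX_def)

lemma shift_closed [simp]: "f \<in> carrier M \<Longrightarrow> shift \<beta> f \<in> carrier M"
  by (simp add: shift_def)

lemma word_closed: "w \<in> lists S \<Longrightarrow> Poly_Mapping.single w c \<in> carrier F"
  by (rule F.single_closed)

lemma diff_word_closed: "\<lbrakk>x \<in> carrier F; y \<in> carrier F\<rbrakk> \<Longrightarrow> x - y \<in> carrier F"
  by (rule F.diff_closed)

lemma add_word_closed: "\<lbrakk>x \<in> carrier F; y \<in> carrier F\<rbrakk> \<Longrightarrow> x + y \<in> carrier F"
  using FA.M.a_closed[of x y] by (simp add: F.add_eq)

lemma zero_word_closed: "0 \<in> carrier F"
  using FA.M.zero_closed by (simp add: F.zero_eq)

lemma if_word_closed: "(if P then word [] else 0) \<in> carrier F"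
  by (simp add: word_closed zero_word_closed)

lemma rels_subset: "rels \<subseteq> carrier F"
proof
  fix x assume "x \<in> rels"
  then show "x \<in> carrier F"
    unfolding sigma_rels_def Let_def
    by (elim UnE CollectE exE conjE singletonE; hypsubst;
        intro diff_word_closed add_word_closed F.sum_closed if_word_closed word_closed)
      (use M.A.one_closed \<sigma>_closed in \<open>simp_all del: map_algebra_simps(1)\<close>)
qed

lemma hom_word_append:
  assumes h: "h \<in> k_algebra_hom F C" and "u \<in> lists S" "v \<in> lists S"
  shows "h (word (u @ v)) = h (word u) \<otimes>\<^bsub>C\<^esub> h (word v)"
  using khom_mult[OF h word_closed word_closed, of u v 1 1] assms(2,3) by (simp add: word_append)

lemma hom_word2:
  assumes h: "h \<in> k_algebra_hom F C" and g: "g \<in> S" "g' \<in> S"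
  shows "h (word [g, g']) = h (word [g]) \<otimes>\<^bsub>C\<^esub> h (word [g'])"
  using hom_word_append[OF h, of "[g]" "[g']"] g by simp

lemma hom_word3:
  assumes h: "h \<in> k_algebra_hom F C" and g: "g \<in> S" "g' \<in> S" "g'' \<in> S"
  shows "h (word [g, g', g'']) = h (word [g]) \<otimes>\<^bsub>C\<^esub> (h (word [g']) \<otimes>\<^bsub>C\<^esub> h (word [g'']))"
  using hom_word_append[OF h, of "[g]" "[g', g'']"] hom_word2[OF h g(2,3)] g by simp

lemma hom_double_sum:
  assumes h: "h \<in> k_algebra_hom F C" and C: "k_algebra C"
    and W: "\<And>x y. \<lbrakk>x \<in> XX; y \<in> XX\<rbrakk> \<Longrightarrow> W x y \<in> lists S"
  shows "h (\<Sum>x\<in>XX. \<Sum>y\<in>XX. word (W x y)) = (\<Oplus>\<^bsub>C\<^esub>z\<in>XX \<times> XX. h (word (W (fst z) (snd z))))"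
proof -
  interpret C: k_algebra C by (rule C)
  have "h (\<Sum>x\<in>XX. \<Sum>y\<in>XX. word (W x y)) = h (\<Sum>z\<in>XX \<times> XX. word (W (fst z) (snd z)))"
    by (simp add: sum.cartesian_product case_prod_unfold)
  also have "\<dots> = (\<Oplus>\<^bsub>C\<^esub>z\<in>XX \<times> XX. h (word (W (fst z) (snd z))))"
    by (rule F.addhom_sum[OF khom_addhom[OF h] C.abelian_group], rule word_closed, rule W) auto
  finally show ?thesis .
qed

lemma hom_frt:
  assumes h: "h \<in> k_algebra_hom F C" and C: "k_algebra C"
    and abcd: "a \<in> XX" "b \<in> XX" "c \<in> XX" "d \<in> XX"
    and s: "\<And>f. f \<in> carrier M \<Longrightarrow> h (word [Gen_ten (mm R f \<one>\<^bsub>M\<^esub>)]) = s f"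
    and t: "\<And>f. f \<in> carrier M \<Longrightarrow> h (word [Gen_ten (mm R \<one>\<^bsub>M\<^esub> f)]) = t f"
    and m: "\<And>a b. \<lbrakk>a \<in> XX; b \<in> XX\<rbrakk> \<Longrightarrow> h (word [Gen_L a b]) = m a b"
  shows "h (\<Sum>x\<in>XX. \<Sum>y\<in>XX. word [Gen_ten (mm R (\<sigma> x y a c) \<one>\<^bsub>M\<^esub>), Gen_L y d, Gen_L x b]) =
      frt_lhs C XX s m \<sigma> a b c d"
    and "h (\<Sum>x\<in>XX. \<Sum>y\<in>XX. word [Gen_ten (mm R \<one>\<^bsub>M\<^esub> (\<sigma> b d x y)), Gen_L c y, Gen_L a x]) =
      frt_rhs C XX t m \<sigma> a b c d"
proof -
  interpret C: k_algebra C by (rule C)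
  note mc = M.A.one_closed \<sigma>_closed mm_closed
  have in1: "Gen_ten (mm R (\<sigma> x y a c) \<one>\<^bsub>M\<^esub>) \<in> S" and in2: "Gen_ten (mm R \<one>\<^bsub>M\<^esub> (\<sigma> b d x y)) \<in> S"
    if "x \<in> XX" "y \<in> XX" for x y
    using mm_closed[OF \<sigma>_closed[of x y a c] M.A.one_closed] mm_closed[OF M.A.one_closed \<sigma>_closed[of b d x y]]
      abcd that by simp_all
  have hc: "h (word [g]) \<in> carrier C" if "g \<in> S" for g
    by (rule khom_closed[OF h word_closed]) (use that in simp)
  have mcl: "m x y \<in> carrier C" if "x \<in> XX" "y \<in> XX" for x y
    using hc[of "Gen_L x y"] m[OF that] that by simp
  have s': "h (word [Gen_ten (mm R (\<sigma> x y a c) \<one>\<^bsub>M\<^esub>)]) = s (\<sigma> x y a c)"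
    and t': "h (word [Gen_ten (mm R \<one>\<^bsub>M\<^esub> (\<sigma> b d x y))]) = t (\<sigma> b d x y)" if "x \<in> XX" "y \<in> XX" for x y
    by (rule s t, use \<sigma>_closed abcd that in blast)+
  have scl: "s (\<sigma> x y a c) \<in> carrier C" "t (\<sigma> b d x y) \<in> carrier C" if "x \<in> XX" "y \<in> XX" for x y
    using hc[OF in1[OF that]] hc[OF in2[OF that]] s'[OF that] t'[OF that] by simp_all
  have v1: "h (word [Gen_ten (mm R (\<sigma> x y a c) \<one>\<^bsub>M\<^esub>), Gen_L y d, Gen_L x b]) =
      s (\<sigma> x y a c) \<otimes>\<^bsub>C\<^esub> (m y d \<otimes>\<^bsub>C\<^esub> m x b)"
    and v2: "h (word [Gen_ten (mm R \<one>\<^bsub>M\<^esub> (\<sigma> b d x y)), Gen_L c y, Gen_L a x]) =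
      t (\<sigma> b d x y) \<otimes>\<^bsub>C\<^esub> (m c y \<otimes>\<^bsub>C\<^esub> m a x)" if "x \<in> XX" "y \<in> XX" for x y
    using hom_word3[OF h in1[OF that]] hom_word3[OF h in2[OF that]] that abcd
      s'[OF that] t'[OF that] m by simp_all
  show "h (\<Sum>x\<in>XX. \<Sum>y\<in>XX. word [Gen_ten (mm R (\<sigma> x y a c) \<one>\<^bsub>M\<^esub>), Gen_L y d, Gen_L x b]) =
      frt_lhs C XX s m \<sigma> a b c d"
    unfolding frt_lhs_def
    by (subst hom_double_sum[OF h C]; (rule C.finsum_cong'[OF refl])?)
      (use in1 v1 scl mcl abcd in auto)
  show "h (\<Sum>x\<in>XX. \<Sum>y\<in>XX. word [Gen_ten (mm R \<one>\<^bsub>M\<^esub> (\<sigma> b d x y)), Gen_L c y, Gen_L a x]) =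
      frt_rhs C XX t m \<sigma> a b c d"
    unfolding frt_rhs_def
    by (subst hom_double_sum[OF h C]; (rule C.finsum_cong'[OF refl])?)
      (use in2 v2 scl mcl abcd in auto)
qed

text \<open>The value of a generator in an algebra with an invertible matrix of coefficients.\<close>

fun gen_value where
  "gen_value B s t l (Gen_ten \<xi>) = tensor_lift B (\<lambda>f g. s f \<otimes>\<^bsub>B\<^esub> t g) \<xi>"
| "gen_value B s t l (Gen_L a b) = l True a b"
| "gen_value B s t l (Gen_Linv a b) = l False b a"

lemma gen_value_ten:
  assumes "coefficients R B XX s t K \<alpha> l"
  shows "(\<lambda>\<xi>. gen_value B s t l (Gen_ten \<xi>)) \<in> k_algebra_hom (MMop R) B"
    and "\<lbrakk>f \<in> carrier M; g \<in> carrier M\<rbrakk> \<Longrightarrow> gen_value B s t l (Gen_ten (mm R f g)) = s f \<otimes>\<^bsub>B\<^esub> t g"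
proof -
  interpret C: coefficients R B XX s t K \<alpha> l by fact
  have comm: "t g \<otimes>\<^bsub>B\<^esub> s f = s f \<otimes>\<^bsub>B\<^esub> t g" if "f \<in> carrier M" "g \<in> carrier (op_algebra M)" for f g
    using C.s_t that by simp
  show "(\<lambda>\<xi>. gen_value B s t l (Gen_ten \<xi>)) \<in> k_algebra_hom (MMop R) B"
    using MT.tensor_hom[OF C.B.k_algebra_axioms C.s_hom C.t_hom comm] by (simp add: MMop_eq)
  show "gen_value B s t l (Gen_ten (mm R f g)) = s f \<otimes>\<^bsub>B\<^esub> t g" if "f \<in> carrier M" "g \<in> carrier M"
    using MT.tensor_hom_pure[OF C.B.k_algebra_axioms C.s_hom C.t_hom comm, of f g] that by (simp add: mm_eq)
qed

context
  fixes B :: "('k, 'b) module" and s t l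
  assumes inv: "invertible_coefficients R B XX s t dg l \<sigma>"
begin

interpretation C: invertible_coefficients R B XX s t dg l \<sigma> by (rule inv)

abbreviation "\<phi> \<equiv> gen_value B s t l"
abbreviation "ev \<equiv> free_eval B \<phi>"

lemmas ten_hom = gen_value_ten(1)[OF C.coefficients_axioms]
lemmas ten_mm = gen_value_ten(2)[OF C.coefficients_axioms]

lemma gen_value_closed: "g \<in> S \<Longrightarrow> \<phi> g \<in> carrier B"
proof -
  assume g: "g \<in> S"
  show ?thesis
  proof (cases g)
    case (Gen_ten \<xi>)
    then have "\<xi> \<in> carrier (MMop R)" using g by simp
    then show ?thesis using khom_closed[OF ten_hom] Gen_ten by blast
  qed (use g C.l_closed in auto)
qed

lemma ev_khom: "ev \<in> k_algebra_hom F B"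
  by (rule free_eval_khom[OF C.B.k_algebra_axioms gen_value_closed])

lemma ev_word: "w \<in> lists S \<Longrightarrow> ev (word w) = foldr (\<lambda>g x. \<phi> g \<otimes>\<^bsub>B\<^esub> x) w \<one>\<^bsub>B\<^esub>"
  by (rule free_eval_word[OF C.B.k_algebra_axioms gen_value_closed])

lemma ev_words:
  "g \<in> S \<Longrightarrow> ev (word [g]) = \<phi> g"
  "\<lbrakk>g \<in> S; h \<in> S\<rbrakk> \<Longrightarrow> ev (word [g, h]) = \<phi> g \<otimes>\<^bsub>B\<^esub> \<phi> h"
  "\<lbrakk>g \<in> S; h \<in> S; k \<in> S\<rbrakk> \<Longrightarrow> ev (word [g, h, k]) = \<phi> g \<otimes>\<^bsub>B\<^esub> (\<phi> h \<otimes>\<^bsub>B\<^esub> \<phi> k)"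
  "ev (word []) = \<one>\<^bsub>B\<^esub>"
  by (simp_all add: ev_word gen_value_closed)

lemma \<phi>_lft: "f \<in> carrier M \<Longrightarrow> \<phi> (Gen_ten (mm R f \<one>\<^bsub>M\<^esub>)) = s f"
  using ten_mm[OF _ M.A.one_closed, of f] C.s_closed[of f] by (simp add: C.t_one del: gen_value.simps)

lemma \<phi>_rgt: "f \<in> carrier M \<Longrightarrow> \<phi> (Gen_ten (mm R \<one>\<^bsub>M\<^esub> f)) = t f"
  using ten_mm[OF M.A.one_closed, of f] C.t_closed[of f] by (simp add: C.s_one del: gen_value.simps)

lemma ev_sum: "(\<And>i. i \<in> I \<Longrightarrow> g i \<in> carrier F) \<Longrightarrow> ev (\<Sum>i\<in>I. g i) = (\<Oplus>\<^bsub>B\<^esub>i\<in>I. ev (g i))"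
  by (rule F.addhom_sum[OF khom_addhom[OF ev_khom] C.B.abelian_group])

lemma ev_eqs:
  "\<lbrakk>x \<in> carrier F; y \<in> carrier F\<rbrakk> \<Longrightarrow> ev (x - y) = ev x \<ominus>\<^bsub>B\<^esub> ev y"
  "\<lbrakk>x \<in> carrier F; y \<in> carrier F\<rbrakk> \<Longrightarrow> ev (x + y) = ev x \<oplus>\<^bsub>B\<^esub> ev y"
  "ev 0 = \<zero>\<^bsub>B\<^esub>"
  using F.addhom_diff[OF khom_addhom[OF ev_khom] C.B.abelian_group] khom_add[OF ev_khom, of x y]
    addhom_zero[OF khom_addhom[OF ev_khom] FA.abelian_group C.B.abelian_group]
  by (simp_all add: F.add_eq F.zero_eq)

lemma shift_inverse:
  assumes "a \<in> XX"
  shows "shift (dg a) (shift (signed_shift dg False a) f) = f"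
    "shift (signed_shift dg False a) (shift (dg a) f) = f"
  using bij_deg[OF assms]
  by (auto simp: shift_def signed_shift_def fun_eq_iff bij_is_inj bij_is_surj surj_f_inv_f)

text \<open>
  Each family of relations of \<open>A\<^sub>\<sigma>\<close> is one of the axioms of invertible coefficients, which gives the
  universal property of \<open>A\<^sub>\<sigma>\<close>.
\<close>

lemma ev_rels:
  assumes "x \<in> rels"
  shows "ev x = \<zero>\<^bsub>B\<^esub>"
proof -
  note mc = M.A.one_closed \<sigma>_closed shift_closed mm_closed
  note lc = C.l_closed[OF UNIV_I]
  show ?thesis
    using assms unfolding sigma_rels_def Let_def
  proof (elim UnE CollectE exE conjE, goal_cases)
    case (1 \<xi> \<eta>)
    have c: "\<phi> (Gen_ten \<xi>) \<oplus>\<^bsub>B\<^esub> \<phi> (Gen_ten \<eta>) \<in> carrier B"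
      using 1 gen_value_closed[of "Gen_ten \<xi>"] gen_value_closed[of "Gen_ten \<eta>"] by simp
    show ?case
      using 1 c khom_add[OF ten_hom 1(2,3)]
      by (simp add: ev_eqs ev_words word_closed add_word_closed C.B.minus_self del: gen_value.simps)
  next
    case (2 c \<xi>)
    have "Poly_Mapping.single [Gen_ten \<xi>] c = c \<odot>\<^bsub>F\<^esub> word [Gen_ten \<xi>]"
      by (simp add: F.smult_eq)
    then have "ev (Poly_Mapping.single [Gen_ten \<xi>] c) = c \<odot>\<^bsub>B\<^esub> \<phi> (Gen_ten \<xi>)"
      using khom_scale[OF ev_khom word_closed, of "[Gen_ten \<xi>]" c 1] 2 by (simp add: ev_words del: gen_value.simps)
    then show ?case
      using 2 khom_scale[OF ten_hom 2(2), of c] gen_value_closed[of "Gen_ten \<xi>"]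
      by (simp add: ev_eqs ev_words word_closed C.B.minus_self del: gen_value.simps)
  next
    case (3 \<xi> \<eta>)
    have c: "\<phi> (Gen_ten \<xi>) \<otimes>\<^bsub>B\<^esub> \<phi> (Gen_ten \<eta>) \<in> carrier B"
      using 3 gen_value_closed[of "Gen_ten \<xi>"] gen_value_closed[of "Gen_ten \<eta>"] by simp
    show ?case
      using 3 c khom_mult[OF ten_hom 3(2,3)]
      by (simp add: ev_eqs ev_words word_closed C.B.minus_self del: gen_value.simps)
  next
    case (4 a b)
    have "(\<Oplus>\<^bsub>B\<^esub>c\<in>XX. ev (word [Gen_L a c, Gen_Linv c b])) = (\<Oplus>\<^bsub>B\<^esub>c\<in>XX. l True a c \<otimes>\<^bsub>B\<^esub> l False b c)"
      by (rule C.B.finsum_cong') (use 4 lc in \<open>auto simp: ev_words\<close>)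
    then show ?case
      using 4 C.inverse_right[of a b]
      by (simp add: ev_eqs ev_sum ev_words word_closed zero_word_closed F.sum_closed C.B.minus_self)
  next
    case (5 a b)
    have "(\<Oplus>\<^bsub>B\<^esub>c\<in>XX. ev (word [Gen_Linv a c, Gen_L c b])) = (\<Oplus>\<^bsub>B\<^esub>c\<in>XX. l False c a \<otimes>\<^bsub>B\<^esub> l True c b)"
      by (rule C.B.finsum_cong') (use 5 lc in \<open>auto simp: ev_words\<close>)
    then show ?case
      using 5 C.inverse_left[of a b]
      by (simp add: ev_eqs ev_sum ev_words word_closed zero_word_closed F.sum_closed C.B.minus_self)
  next
    case (6 a b f)
    then show ?case
      using C.l_s[of True a b f] lc[of a b True] C.s_closed[OF shift_closed[OF 6(4), of "dg a"]] mc
      by (simp add: ev_eqs ev_words word_closed C.B.minus_self \<phi>_lft signed_shift_def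
          del: gen_value.simps(1) map_algebra_simps(1))
  next
    case (7 a b f)
    then show ?case
      using C.l_t[of True a b f] lc[of a b True] C.t_closed[OF shift_closed[OF 7(4), of "dg b"]] mc
      by (simp add: ev_eqs ev_words word_closed C.B.minus_self \<phi>_rgt signed_shift_def
          del: gen_value.simps(1) map_algebra_simps(1))
  next
    case (8 a b f)
    then show ?case
      using C.l_s[of False b a "shift (dg b) f"] lc[of b a False] C.s_closed[OF 8(4)] mc
      by (simp add: ev_eqs ev_words word_closed C.B.minus_self \<phi>_lft shift_inverse
          del: gen_value.simps(1) map_algebra_simps(1))
  next
    case (9 a b f)
    then show ?case
      using C.l_t[of False b a "shift (dg a) f"] lc[of b a False] C.t_closed[OF 9(4)] mc
      by (simp add: ev_eqs ev_words word_closed C.B.minus_self \<phi>_rgt shift_inverse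
          del: gen_value.simps(1) map_algebra_simps(1))
  next
    case (10 a b c d)
    have sc: "s (\<sigma> x y a c) \<in> carrier B" "t (\<sigma> b d x y) \<in> carrier B" if "x \<in> XX" "y \<in> XX" for x y
      using C.s_closed[OF \<sigma>_closed[of x y a c]] C.t_closed[OF \<sigma>_closed[of b d x y]] 10 that by simp_all
    have w1: "word [Gen_ten (mm R (\<sigma> x y a c) \<one>\<^bsub>M\<^esub>), Gen_L y d, Gen_L x b] \<in> carrier F"
      and w2: "word [Gen_ten (mm R \<one>\<^bsub>M\<^esub> (\<sigma> b d x y)), Gen_L c y, Gen_L a x] \<in> carrier F"
      if "x \<in> XX" "y \<in> XX" for x y
      by (rule word_closed; use 10 that mc in \<open>simp del: map_algebra_simps(1)\<close>)+
    note e = hom_frt[OF ev_khom C.B.k_algebra_axioms 10(2-5), of s t "l True"]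
    have e1: "ev (\<Sum>x\<in>XX. \<Sum>y\<in>XX. word [Gen_ten (mm R (\<sigma> x y a c) \<one>\<^bsub>M\<^esub>), Gen_L y d, Gen_L x b]) =
        frt_lhs B XX s (l True) \<sigma> a b c d"
      by (rule e(1); subst ev_words)
        (use mm_closed M.A.one_closed in \<open>simp_all add: \<phi>_lft \<phi>_rgt del: map_algebra_simps(1) gen_value.simps(1)\<close>)
    have e2: "ev (\<Sum>x\<in>XX. \<Sum>y\<in>XX. word [Gen_ten (mm R \<one>\<^bsub>M\<^esub> (\<sigma> b d x y)), Gen_L c y, Gen_L a x]) =
        frt_rhs B XX t (l True) \<sigma> a b c d"
      by (rule e(2); subst ev_words)
        (use mm_closed M.A.one_closed in \<open>simp_all add: \<phi>_lft \<phi>_rgt del: map_algebra_simps(1) gen_value.simps(1)\<close>)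
    have "frt_rhs B XX t (l True) \<sigma> a b c d \<in> carrier B"
      unfolding frt_rhs_def using 10 sc lc by (intro C.B.finsum_closed) auto
    moreover have "(\<Sum>x\<in>XX. \<Sum>y\<in>XX. word [Gen_ten (mm R (\<sigma> x y a c) \<one>\<^bsub>M\<^esub>), Gen_L y d, Gen_L x b]) \<in> carrier F" "(\<Sum>x\<in>XX. \<Sum>y\<in>XX. word [Gen_ten (mm R \<one>\<^bsub>M\<^esub> (\<sigma> b d x y)), Gen_L c y, Gen_L a x]) \<in> carrier F"
      by (intro F.sum_closed w1 w2; assumption)+
    ultimately show ?case
      unfolding 10(1) using e1 e2 C.frt[of a b c d] 10(2-) by (simp only: ev_eqs(1) C.B.minus_self)
  next
    case 11
    then show ?case
      using \<phi>_lft[OF M.A.one_closed] mc(1)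
      by (simp add: ev_eqs ev_words word_closed C.s_one C.B.minus_self del: map_algebra_simps(1) gen_value.simps(1))
  qed
qed

end

section \<open>The left bialgebroid \<open>A\<^sub>\<sigma>\<close>\<close>

abbreviation "I \<equiv> I_sigma R XX dg \<sigma>"
abbreviation "A \<equiv> A_sigma R XX dg \<sigma>"
abbreviation "cls \<equiv> cls_sigma R XX dg \<sigma>"
abbreviation "s_A \<equiv> s_sigma R XX dg \<sigma>"
abbreviation "t_A \<equiv> t_sigma R XX dg \<sigma>"
abbreviation "l_A k a b \<equiv> cls (word [if k then Gen_L a b else Gen_Linv b a])"

sublocale QI: k_algebra_quotient F I
  unfolding I_sigma_def free_LambdaX_def
  by (rule k_algebra_quotient_genideal[OF FA.k_algebra_axioms rels_subset])

lemma A_eq: "A = QI.Q" and cls_eq: "cls = (\<lambda>x. I +>\<^bsub>F\<^esub> x)"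
  by (simp_all add: A_sigma_def cls_sigma_def fun_eq_iff free_LambdaX_def)

sublocale A: k_algebra A
  unfolding A_eq by (rule QI.k_algebra_quot)

lemma cls_khom: "cls \<in> k_algebra_hom F A"
  unfolding A_eq cls_eq by (rule QI.quot_proj)

lemma A_carrierE:
  assumes "x \<in> carrier A" obtains y where "y \<in> carrier F" "x = cls y"
  using assms unfolding A_eq cls_eq QI.quot_carrier by blast

lemma cls_rel:
  assumes "x - y \<in> rels" "x \<in> carrier F" "y \<in> carrier F"
  shows "cls x = cls y"
proof -
  have "x - y \<in> I"
    unfolding I_sigma_def free_LambdaX_def using FA.A.genideal_self[OF rels_subset] assms(1) by blast
  then have "cls (x - y) = \<zero>\<^bsub>A\<^esub>"
    unfolding A_eq cls_eq QI.quot_eqs(4) by (rule QI.I.a_rcos_const)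
  then have "cls x \<ominus>\<^bsub>A\<^esub> cls y = \<zero>\<^bsub>A\<^esub>"
    using F.addhom_diff[OF khom_addhom[OF cls_khom] A.abelian_group assms(2,3)] by simp
  then show ?thesis
    by (rule A.minus_eq_zeroD[OF khom_closed[OF cls_khom assms(2)] khom_closed[OF cls_khom assms(3)]])
qed

lemma
  assumes inv: "invertible_coefficients R B XX s t dg l \<sigma>"
  shows induced_ev_khom: "induced (free_eval B (gen_value B s t l)) \<in> k_algebra_hom A B"
    and induced_ev_cls: "x \<in> carrier F \<Longrightarrow>
      induced (free_eval B (gen_value B s t l)) (cls x) = free_eval B (gen_value B s t l) x"
proof -
  interpret C: invertible_coefficients R B XX s t dg l \<sigma> by (rule inv)
  have 0: "free_eval B (gen_value B s t l) i = \<zero>\<^bsub>B\<^esub>" if "i \<in> I" for i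
    by (rule khom_genideal_zero[OF ev_khom[OF inv] FA.k_algebra_axioms C.B.k_algebra_axioms rels_subset ev_rels[OF inv]])
      (use that in \<open>simp_all add: I_sigma_def free_LambdaX_def\<close>)
  show "induced (free_eval B (gen_value B s t l)) \<in> k_algebra_hom A B"
    unfolding A_eq by (rule QI.induced_khom[OF ev_khom[OF inv] C.B.k_algebra_axioms 0])
  show "induced (free_eval B (gen_value B s t l)) (cls x) = free_eval B (gen_value B s t l) x" if "x \<in> carrier F"
    unfolding cls_eq by (rule QI.induced_coset[OF khom_addhom[OF ev_khom[OF inv]] C.B.abelian_group 0 that])
qed

text \<open>The relations of \<open>A\<^sub>\<sigma>\<close> say that its generators form an invertible matrix of coefficients.\<close>

lemma cls_ten_khom: "(\<lambda>\<xi>. cls (word [Gen_ten \<xi>])) \<in> k_algebra_hom (MMop R) A"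
proof (rule k_algebra_homI)
  fix \<xi> \<eta> :: "('l, 'r) map_tensor" assume *: "\<xi> \<in> carrier (MMop R)" "\<eta> \<in> carrier (MMop R)"
  have w: "word w \<in> carrier F" if "w \<in> lists S" for w using that by (rule word_closed)
  show "cls (word [Gen_ten \<xi>]) \<in> carrier A" by (rule khom_closed[OF cls_khom w]) (use * in simp)
  have "word [Gen_ten \<xi>] + word [Gen_ten \<eta>] - word [Gen_ten (\<xi> \<oplus>\<^bsub>MMop R\<^esub> \<eta>)] \<in> rels"
    unfolding sigma_rels_def Let_def using * by blast
  then have "cls (word [Gen_ten \<xi>] + word [Gen_ten \<eta>]) = cls (word [Gen_ten (\<xi> \<oplus>\<^bsub>MMop R\<^esub> \<eta>)])"
    by (rule cls_rel) (use * in \<open>simp_all add: w add_word_closed\<close>)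
  then show "cls (word [Gen_ten (\<xi> \<oplus>\<^bsub>MMop R\<^esub> \<eta>)]) = cls (word [Gen_ten \<xi>]) \<oplus>\<^bsub>A\<^esub> cls (word [Gen_ten \<eta>])"
    using khom_add[OF cls_khom, of "word [Gen_ten \<xi>]" "word [Gen_ten \<eta>]"] * w by (simp add: F.add_eq)
  have "word [Gen_ten \<xi>, Gen_ten \<eta>] - word [Gen_ten (\<xi> \<otimes>\<^bsub>MMop R\<^esub> \<eta>)] \<in> rels"
    unfolding sigma_rels_def Let_def using * by blast
  then have "cls (word [Gen_ten \<xi>, Gen_ten \<eta>]) = cls (word [Gen_ten (\<xi> \<otimes>\<^bsub>MMop R\<^esub> \<eta>)])"
    by (rule cls_rel) (use * in \<open>simp_all add: w\<close>)
  then show "cls (word [Gen_ten (\<xi> \<otimes>\<^bsub>MMop R\<^esub> \<eta>)]) = cls (word [Gen_ten \<xi>]) \<otimes>\<^bsub>A\<^esub> cls (word [Gen_ten \<eta>])"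
    using hom_word2[OF cls_khom, of "Gen_ten \<xi>" "Gen_ten \<eta>"] * by simp
next
  have "word [] - word [Gen_ten (mm R \<one>\<^bsub>M\<^esub> \<one>\<^bsub>M\<^esub>)] \<in> rels"
    unfolding sigma_rels_def Let_def by blast
  moreover have "mm R \<one>\<^bsub>M\<^esub> \<one>\<^bsub>M\<^esub> = \<one>\<^bsub>MMop R\<^esub>" using MT.pure_one by (simp add: mm_eq MMop_eq)
  ultimately have "cls (word []) = cls (word [Gen_ten \<one>\<^bsub>MMop R\<^esub>])"
    by (intro cls_rel word_closed) (use MM.A.one_closed in simp_all)
  then show "cls (word [Gen_ten \<one>\<^bsub>MMop R\<^esub>]) = \<one>\<^bsub>A\<^esub>"
    using khom_one[OF cls_khom] by (simp add: free_algebra_def)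
next
  fix c and \<xi> :: "('l, 'r) map_tensor" assume *: "\<xi> \<in> carrier (MMop R)"
  have "Poly_Mapping.single [Gen_ten \<xi>] c - word [Gen_ten (c \<odot>\<^bsub>MMop R\<^esub> \<xi>)] \<in> rels"
    unfolding sigma_rels_def Let_def using * by blast
  then have "cls (Poly_Mapping.single [Gen_ten \<xi>] c) = cls (word [Gen_ten (c \<odot>\<^bsub>MMop R\<^esub> \<xi>)])"
    by (intro cls_rel word_closed) (use * in simp_all)
  then show "cls (word [Gen_ten (c \<odot>\<^bsub>MMop R\<^esub> \<xi>)]) = c \<odot>\<^bsub>A\<^esub> cls (word [Gen_ten \<xi>])"
    using khom_scale[OF cls_khom word_closed, of "[Gen_ten \<xi>]" c 1] * by (simp add: F.smult_eq)
qed

lemma A_invertible: "invertible_coefficients R A XX s_A t_A dg l_A \<sigma>"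
proof (intro invertible_coefficients.intro frt_coefficients.intro frt_coefficients_axioms.intro
    invertible_coefficients_axioms.intro)
  have one: "\<one>\<^bsub>M\<^esub> \<in> carrier M" by (rule M.A.one_closed)
  have w: "word w \<in> carrier F" if "w \<in> lists S" for w using that by (rule word_closed)
  note c2 = hom_word2[OF cls_khom]
  have g: "Gen_ten (mm R f \<one>\<^bsub>M\<^esub>) \<in> S" "Gen_ten (mm R \<one>\<^bsub>M\<^esub> f) \<in> S" if "f \<in> carrier M" for f
    using mm_closed[OF that one] mm_closed[OF one that] by simp_all
  have rel3:
    "s_A (shift (dg a) f) \<otimes>\<^bsub>A\<^esub> cls (word [Gen_L a b]) = cls (word [Gen_L a b]) \<otimes>\<^bsub>A\<^esub> s_A f"
    "t_A (shift (dg b) f) \<otimes>\<^bsub>A\<^esub> cls (word [Gen_L a b]) = cls (word [Gen_L a b]) \<otimes>\<^bsub>A\<^esub> t_A f"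
    "s_A f \<otimes>\<^bsub>A\<^esub> cls (word [Gen_Linv a b]) = cls (word [Gen_Linv a b]) \<otimes>\<^bsub>A\<^esub> s_A (shift (dg b) f)"
    "t_A f \<otimes>\<^bsub>A\<^esub> cls (word [Gen_Linv a b]) = cls (word [Gen_Linv a b]) \<otimes>\<^bsub>A\<^esub> t_A (shift (dg a) f)"
    if a: "a \<in> XX" and b: "b \<in> XX" and f: "f \<in> carrier M" for a b f
  proof -
    note sh = shift_closed[OF f]
    have 1: "word [Gen_ten (mm R (shift (dg a) f) \<one>\<^bsub>M\<^esub>), Gen_L a b] - word [Gen_L a b, Gen_ten (mm R f \<one>\<^bsub>M\<^esub>)] \<in> rels"
      unfolding sigma_rels_def Let_def using a b f by blast
    have 2: "word [Gen_ten (mm R \<one>\<^bsub>M\<^esub> (shift (dg b) f)), Gen_L a b] - word [Gen_L a b, Gen_ten (mm R \<one>\<^bsub>M\<^esub> f)] \<in> rels"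
      unfolding sigma_rels_def Let_def using a b f by blast
    have 3: "word [Gen_ten (mm R f \<one>\<^bsub>M\<^esub>), Gen_Linv a b] - word [Gen_Linv a b, Gen_ten (mm R (shift (dg b) f) \<one>\<^bsub>M\<^esub>)] \<in> rels"
      unfolding sigma_rels_def Let_def using a b f by blast
    have 4: "word [Gen_ten (mm R \<one>\<^bsub>M\<^esub> f), Gen_Linv a b] - word [Gen_Linv a b, Gen_ten (mm R \<one>\<^bsub>M\<^esub> (shift (dg a) f))] \<in> rels"
      unfolding sigma_rels_def Let_def using a b f by blast
    show "s_A (shift (dg a) f) \<otimes>\<^bsub>A\<^esub> cls (word [Gen_L a b]) = cls (word [Gen_L a b]) \<otimes>\<^bsub>A\<^esub> s_A f"
      using cls_rel[OF 1 w w] g[OF f] g[OF sh] a b by (simp add: c2 s_sigma_def del: gen_in(1))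
    show "t_A (shift (dg b) f) \<otimes>\<^bsub>A\<^esub> cls (word [Gen_L a b]) = cls (word [Gen_L a b]) \<otimes>\<^bsub>A\<^esub> t_A f"
      using cls_rel[OF 2 w w] g[OF f] g[OF sh] a b by (simp add: c2 t_sigma_def del: gen_in(1))
    show "s_A f \<otimes>\<^bsub>A\<^esub> cls (word [Gen_Linv a b]) = cls (word [Gen_Linv a b]) \<otimes>\<^bsub>A\<^esub> s_A (shift (dg b) f)"
      using cls_rel[OF 3 w w] g[OF f] g[OF sh] a b by (simp add: c2 s_sigma_def del: gen_in(1))
    show "t_A f \<otimes>\<^bsub>A\<^esub> cls (word [Gen_Linv a b]) = cls (word [Gen_Linv a b]) \<otimes>\<^bsub>A\<^esub> t_A (shift (dg a) f)"
      using cls_rel[OF 4 w w] g[OF f] g[OF sh] a b by (simp add: c2 t_sigma_def del: gen_in(1))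
  qed
  show "coefficients R A XX s_A t_A UNIV (signed_shift dg) l_A"
  proof unfold_locales
    show "finite XX" by (rule finite_XX)
    show "s_A \<in> k_algebra_hom M A"
      using khom_comp[OF MT.pure_left_hom cls_ten_khom[unfolded MMop_eq]]
      by (simp add: s_sigma_def[abs_def] mm_eq)
    show "t_A \<in> k_algebra_hom (op_algebra M) A"
      using khom_comp[OF MT.pure_right_hom cls_ten_khom[unfolded MMop_eq]]
      by (simp add: t_sigma_def[abs_def] mm_eq)
  next
    fix f h :: "'l \<Rightarrow> 'r" assume f: "f \<in> carrier M" and h: "h \<in> carrier M"
    have "mm R f \<one>\<^bsub>M\<^esub> \<otimes>\<^bsub>MMop R\<^esub> mm R \<one>\<^bsub>M\<^esub> h = mm R \<one>\<^bsub>M\<^esub> h \<otimes>\<^bsub>MMop R\<^esub> mm R f \<one>\<^bsub>M\<^esub>"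
      unfolding mm_eq MMop_eq using f h one by (simp add: MT.pure_mult del: map_algebra_simps(1))
    then show "s_A f \<otimes>\<^bsub>A\<^esub> t_A h = t_A h \<otimes>\<^bsub>A\<^esub> s_A f"
      unfolding s_sigma_def t_sigma_def
      using khom_mult[OF cls_ten_khom mm_closed[OF f one] mm_closed[OF one h]]
        khom_mult[OF cls_ten_khom mm_closed[OF one h] mm_closed[OF f one]] by simp
  next
    fix i a b assume a: "a \<in> XX" and b: "b \<in> XX"
    show "l_A i a b \<in> carrier A" by (rule khom_closed[OF cls_khom w]) (use a b in simp)
    fix f :: "'l \<Rightarrow> 'r" assume f: "f \<in> carrier M"
    have f': "shift (signed_shift dg False p) f \<in> carrier M" for p by (rule shift_closed[OF f])
    have sh: "shift (dg p) (shift (signed_shift dg False p) f) = f" if "p \<in> XX" for p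
      using bij_deg[OF that] by (simp add: shift_def signed_shift_def bij_is_inj fun_eq_iff)
    show "l_A i a b \<otimes>\<^bsub>A\<^esub> s_A f = s_A (shift (signed_shift dg i a) f) \<otimes>\<^bsub>A\<^esub> l_A i a b"
      using rel3(1)[OF a b f] rel3(3)[OF b a f'[of a]] sh[OF a] by (cases i) (simp_all add: signed_shift_def)
    show "l_A i a b \<otimes>\<^bsub>A\<^esub> t_A f = t_A (shift (signed_shift dg i b) f) \<otimes>\<^bsub>A\<^esub> l_A i a b"
      using rel3(2)[OF a b f] rel3(4)[OF b a f'[of b]] sh[OF b] by (cases i) (simp_all add: signed_shift_def)
  qed
  fix a b assume a: "a \<in> XX" and b: "b \<in> XX"
  have d: "cls (if a = b then word [] else 0) = (if a = b then \<one>\<^bsub>A\<^esub> else \<zero>\<^bsub>A\<^esub>)"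
    using khom_one[OF cls_khom] addhom_zero[OF khom_addhom[OF cls_khom] FA.abelian_group A.abelian_group]
    by (simp add: F.zero_eq) (simp add: free_algebra_def)
  have gc: "cls (word [g]) \<in> carrier A" if "g \<in> S" for g
    by (rule khom_closed[OF cls_khom w]) (use that in simp)
  have "(\<Sum>c\<in>XX. word [Gen_L a c, Gen_Linv c b]) - (if a = b then word [] else 0) \<in> rels"
    unfolding sigma_rels_def Let_def using a b by blast
  then have "cls (\<Sum>c\<in>XX. word [Gen_L a c, Gen_Linv c b]) = cls (if a = b then word [] else 0)"
    by (rule cls_rel) (use a b in \<open>auto intro!: F.sum_closed word_closed zero_word_closed\<close>)
  also have "cls (\<Sum>c\<in>XX. word [Gen_L a c, Gen_Linv c b]) = (\<Oplus>\<^bsub>A\<^esub>c\<in>XX. cls (word [Gen_L a c, Gen_Linv c b]))"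
    by (rule F.addhom_sum[OF khom_addhom[OF cls_khom] A.abelian_group]) (use a b in \<open>simp add: w\<close>)
  also have "\<dots> = (\<Oplus>\<^bsub>A\<^esub>c\<in>XX. l_A True a c \<otimes>\<^bsub>A\<^esub> l_A False b c)"
    by (rule A.finsum_cong') (use a b c2 gc in auto)
  finally show "(\<Oplus>\<^bsub>A\<^esub>c\<in>XX. l_A True a c \<otimes>\<^bsub>A\<^esub> l_A False b c) = (if a = b then \<one>\<^bsub>A\<^esub> else \<zero>\<^bsub>A\<^esub>)"
    unfolding d .
  have "(\<Sum>c\<in>XX. word [Gen_Linv a c, Gen_L c b]) - (if a = b then word [] else 0) \<in> rels"
    unfolding sigma_rels_def Let_def using a b by blast
  then have "cls (\<Sum>c\<in>XX. word [Gen_Linv a c, Gen_L c b]) = cls (if a = b then word [] else 0)"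
    by (rule cls_rel) (use a b in \<open>auto intro!: F.sum_closed word_closed zero_word_closed\<close>)
  also have "cls (\<Sum>c\<in>XX. word [Gen_Linv a c, Gen_L c b]) = (\<Oplus>\<^bsub>A\<^esub>c\<in>XX. cls (word [Gen_Linv a c, Gen_L c b]))"
    by (rule F.addhom_sum[OF khom_addhom[OF cls_khom] A.abelian_group]) (use a b in \<open>simp add: w\<close>)
  also have "\<dots> = (\<Oplus>\<^bsub>A\<^esub>c\<in>XX. l_A False c a \<otimes>\<^bsub>A\<^esub> l_A True c b)"
    by (rule A.finsum_cong') (use a b c2 gc in auto)
  finally show "(\<Oplus>\<^bsub>A\<^esub>c\<in>XX. l_A False c a \<otimes>\<^bsub>A\<^esub> l_A True c b) = (if a = b then \<one>\<^bsub>A\<^esub> else \<zero>\<^bsub>A\<^esub>)"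
    unfolding d .
next
  fix a b c d assume abcd: "a \<in> XX" "b \<in> XX" "c \<in> XX" "d \<in> XX"
  let ?W1 = "\<Sum>x\<in>XX. \<Sum>y\<in>XX. word [Gen_ten (mm R (\<sigma> x y a c) \<one>\<^bsub>M\<^esub>), Gen_L y d, Gen_L x b]"
  let ?W2 = "\<Sum>x\<in>XX. \<Sum>y\<in>XX. word [Gen_ten (mm R \<one>\<^bsub>M\<^esub> (\<sigma> b d x y)), Gen_L c y, Gen_L a x]"
  have m: "Gen_ten (mm R (\<sigma> x y a c) \<one>\<^bsub>M\<^esub>) \<in> S" "Gen_ten (mm R \<one>\<^bsub>M\<^esub> (\<sigma> b d x y)) \<in> S"
    if "x \<in> XX" "y \<in> XX" for x y
    using mm_closed[OF \<sigma>_closed[of x y a c] M.A.one_closed] mm_closed[OF M.A.one_closed \<sigma>_closed[of b d x y]]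
      abcd that by simp_all
  have W: "?W1 \<in> carrier F" "?W2 \<in> carrier F"
    by (intro F.sum_closed word_closed; use abcd m in \<open>simp del: gen_in(1)\<close>)+
  have "?W1 - ?W2 \<in> rels"
    unfolding sigma_rels_def Let_def using abcd by blast
  then have "cls ?W1 = cls ?W2" by (rule cls_rel[OF _ W])
  then show "frt_lhs A XX s_A (l_A True) \<sigma> a b c d = frt_rhs A XX t_A (l_A True) \<sigma> a b c d"
    using hom_frt[OF cls_khom A.k_algebra_axioms abcd, of s_A t_A "l_A True"] by (simp add: s_sigma_def t_sigma_def)
qed (use bij_deg \<sigma>_closed in auto)

end

context coefficients
begin

lemma coeff_span_closed: "x \<in> coeff_span \<Longrightarrow> x \<in> carrier B"
proof (induction rule: coeff_span.induct)
  case (base f g ks as bs)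
  then show ?case using s_closed[OF base(1)] t_closed[OF base(2)] wd_closed[OF base(3-5)] by simp
qed simp

lemma span_s:
  assumes f: "f \<in> carrier M" and "x \<in> coeff_span"
  shows "s f \<otimes>\<^bsub>B\<^esub> x \<in> coeff_span"
  using assms(2)
proof (induction rule: coeff_span.induct)
  case (base f' g ks as bs)
  have c: "t g \<otimes>\<^bsub>B\<^esub> wd ks as bs \<in> carrier B" using base by (auto intro!: t_closed wd_closed)
  have "s f \<otimes>\<^bsub>B\<^esub> (s f' \<otimes>\<^bsub>B\<^esub> (t g \<otimes>\<^bsub>B\<^esub> wd ks as bs)) = s (f \<otimes>\<^bsub>M\<^esub> f') \<otimes>\<^bsub>B\<^esub> (t g \<otimes>\<^bsub>B\<^esub> wd ks as bs)"
    using s_closed[OF f] s_closed[OF base(1)] c s_mult[OF f base(1)] by (simp flip: B.A.m_assoc)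
  then show ?case using coeff_span.base[OF M.A.m_closed[OF f base(1)] base(2-5)] by simp
next
  case (add x y)
  then show ?case
    using s_closed[OF f] coeff_span_closed coeff_span.add by (simp add: B.A.r_distr)
qed

lemma span_t:
  assumes f: "f \<in> carrier M" and "x \<in> coeff_span"
  shows "t f \<otimes>\<^bsub>B\<^esub> x \<in> coeff_span"
  using assms(2)
proof (induction rule: coeff_span.induct)
  case (base f' g ks as bs)
  have w: "wd ks as bs \<in> carrier B" using base by (auto intro!: wd_closed)
  note cl = s_closed[OF base(1)] t_closed[OF f] t_closed[OF base(2)] w
  have "t f \<otimes>\<^bsub>B\<^esub> (s f' \<otimes>\<^bsub>B\<^esub> (t g \<otimes>\<^bsub>B\<^esub> wd ks as bs)) = (t f \<otimes>\<^bsub>B\<^esub> s f') \<otimes>\<^bsub>B\<^esub> (t g \<otimes>\<^bsub>B\<^esub> wd ks as bs)"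
    using cl by (simp add: B.A.m_assoc)
  also have "\<dots> = s f' \<otimes>\<^bsub>B\<^esub> ((t f \<otimes>\<^bsub>B\<^esub> t g) \<otimes>\<^bsub>B\<^esub> wd ks as bs)"
    using cl s_t[OF base(1) f] by (simp add: B.A.m_assoc flip: s_t[OF base(1) f])
  finally show ?case
    using coeff_span.base[OF base(1) M.A.m_closed[OF base(2) f] base(3-5)] t_mult[OF f base(2)] by simp
next
  case (add x y)
  then show ?case
    using t_closed[OF f] coeff_span_closed coeff_span.add by (simp add: B.A.r_distr)
qed

lemma span_l:
  assumes i: "i \<in> K" "a \<in> XX" "b \<in> XX" and "x \<in> coeff_span"
  shows "l i a b \<otimes>\<^bsub>B\<^esub> x \<in> coeff_span"
  using assms(4)
proof (induction rule: coeff_span.induct)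
  case (base f g ks as bs)
  have w: "wd ks as bs \<in> carrier B" using base by (auto intro!: wd_closed)
  have f: "shift (\<alpha> i a) f \<in> carrier M" and g: "shift (\<alpha> i b) g \<in> carrier M"
    using base shift_closed by blast+
  note cl = s_closed[OF base(1)] t_closed[OF base(2)] s_closed[OF f] t_closed[OF g] w l_closed[OF i]
  have "l i a b \<otimes>\<^bsub>B\<^esub> (s f \<otimes>\<^bsub>B\<^esub> (t g \<otimes>\<^bsub>B\<^esub> wd ks as bs)) =
      (l i a b \<otimes>\<^bsub>B\<^esub> s f) \<otimes>\<^bsub>B\<^esub> (t g \<otimes>\<^bsub>B\<^esub> wd ks as bs)"
    using cl by (simp add: B.A.m_assoc)
  also have "\<dots> = s (shift (\<alpha> i a) f) \<otimes>\<^bsub>B\<^esub> ((l i a b \<otimes>\<^bsub>B\<^esub> t g) \<otimes>\<^bsub>B\<^esub> wd ks as bs)"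
    unfolding l_s[OF i base(1)] using cl by (simp add: B.A.m_assoc)
  also have "\<dots> = s (shift (\<alpha> i a) f) \<otimes>\<^bsub>B\<^esub> (t (shift (\<alpha> i b) g) \<otimes>\<^bsub>B\<^esub> wd (i # ks) (a # as) (b # bs))"
    unfolding l_t[OF i base(2)] using cl by (simp add: B.A.m_assoc)
  finally show ?case
    using coeff_span.base[OF f g, of "i # ks" "a # as" "b # bs"] i base(3-5) by (simp add: tuples_def)
next
  case (add x y)
  then show ?case
    using l_closed[OF i] coeff_span_closed coeff_span.add by (simp add: B.A.r_distr)
qed

lemma span_one: "\<one>\<^bsub>B\<^esub> \<in> coeff_span"
  using coeff_span.base[OF M.A.one_closed M.A.one_closed, of "[]" "[]" "[]"]
  by (simp add: s_one t_one tuples_0)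

lemma span_scale: "x \<in> coeff_span \<Longrightarrow> c \<odot>\<^bsub>B\<^esub> x \<in> coeff_span"
  using span_s[OF M.scale_closed[OF M.A.one_closed], of x c] coeff_span_closed[of x]
    khom_scale[OF s_hom M.A.one_closed, of c] by (simp add: s_one B.smult_mult_left)

lemma span_zero: "\<zero>\<^bsub>B\<^esub> \<in> coeff_span"
  using span_scale[OF span_one, of 0] by simp

end

lemma induced_cong: "(\<And>x. x \<in> U \<Longrightarrow> f x = g x) \<Longrightarrow> induced f U = induced g U"
  unfolding induced_def by (rule arg_cong[of _ _ the_elem], rule image_cong) auto

lemma khom_cong:
  assumes "f \<in> k_algebra_hom A B" "ring A" "\<And>c x. x \<in> carrier A \<Longrightarrow> c \<odot>\<^bsub>A\<^esub> x \<in> carrier A"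
    and "\<And>x. x \<in> carrier A \<Longrightarrow> g x = f x"
  shows "g \<in> k_algebra_hom A B"
proof -
  interpret A: ring A by fact
  show ?thesis
    by (rule k_algebra_homI)
      (simp_all add: assms khom_closed[OF assms(1)] khom_add[OF assms(1)] khom_mult[OF assms(1)]
        khom_one[OF assms(1)] khom_scale[OF assms(1)])
qed

locale sigma_bialgebroid = sigma_data +
  assumes \<sigma>_central: "\<lbrakk>a \<in> XX; b \<in> XX; c \<in> XX; d \<in> XX\<rbrakk> \<Longrightarrow> \<sigma> a b c d l \<in> center R"
    and \<sigma>_degree: "\<lbrakk>a \<in> XX; b \<in> XX; c \<in> XX; d \<in> XX; dg b (dg d l) \<noteq> dg a (dg c l)\<rbrakk> \<Longrightarrow>
      \<sigma> b d a c l = \<zero>\<^bsub>R\<^esub>"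
begin

sublocale AI: invertible_coefficients R A XX s_A t_A dg l_A \<sigma>
  by (rule A_invertible)

lemma A_spanned: "carrier A \<subseteq> AI.coeff_span"
proof
  fix x assume "x \<in> carrier A"
  then obtain y where y: "y \<in> carrier F" "x = cls y" by (rule A_carrierE)
  have ten: "cls (word [Gen_ten \<xi>]) \<otimes>\<^bsub>A\<^esub> z \<in> AI.coeff_span"
    if \<xi>: "\<xi> \<in> carrier (MMop R)" and z: "z \<in> AI.coeff_span" for \<xi> z
    using \<xi>[unfolded MMop_eq]
  proof (induction rule: MT.pure_induct)
    case (el f g)
    then have fg: "f \<in> carrier M" "g \<in> carrier M" by simp_all
    have one: "\<one>\<^bsub>M\<^esub> \<in> carrier M" by (rule M.A.one_closed)
    have "mm R f g = mm R f \<one>\<^bsub>M\<^esub> \<otimes>\<^bsub>MMop R\<^esub> mm R \<one>\<^bsub>M\<^esub> g"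
      unfolding mm_eq MMop_eq using fg one by (simp add: MT.pure_mult del: map_algebra_simps(1))
    then have "cls (word [Gen_ten (mm R f g)]) = s_A f \<otimes>\<^bsub>A\<^esub> t_A g"
      using khom_mult[OF cls_ten_khom mm_closed[OF fg(1) one] mm_closed[OF one fg(2)]]
      by (simp add: s_sigma_def t_sigma_def)
    then show ?case
      using AI.span_s[OF fg(1) AI.span_t[OF fg(2) z]] AI.s_closed[OF fg(1)] AI.t_closed[OF fg(2)]
        AI.coeff_span_closed[OF z] by (simp add: mm_eq A.A.m_assoc)
  next
    case (add U V)
    then have UV: "U \<in> carrier (MMop R)" "V \<in> carrier (MMop R)" by (simp_all add: MMop_eq)
    show ?case
      using AI.coeff_span.add[OF add(3,4)] khom_add[OF cls_ten_khom UV] khom_closed[OF cls_ten_khom UV(1)]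
        khom_closed[OF cls_ten_khom UV(2)] AI.coeff_span_closed[OF z]
      by (simp add: A.A.l_distr MMop_eq)
  qed
  have w: "cls (word w) \<in> AI.coeff_span" if "w \<in> lists S" for w
    using that
  proof (induction w rule: list.induct)
    case Nil
    then show ?case using AI.span_one khom_one[OF cls_khom] by (simp add: free_algebra_def)
  next
    case (Cons g w)
    then have g: "g \<in> S" and w: "w \<in> lists S" by auto
    have "cls (word (g # w)) = cls (word [g]) \<otimes>\<^bsub>A\<^esub> cls (word w)"
      using hom_word_append[OF cls_khom, of "[g]" w] g w by simp
    moreover have "cls (word [g]) \<otimes>\<^bsub>A\<^esub> cls (word w) \<in> AI.coeff_span"
    proof (cases g)
      case (Gen_ten \<xi>)
      then have "\<xi> \<in> carrier (MMop R)" using g by simp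
      then show ?thesis using ten Cons.IH[OF w] Gen_ten by blast
    next
      case (Gen_L a b)
      then show ?thesis using AI.span_l[of True a b "cls (word w)"] Cons.IH[OF w] g by simp
    next
      case (Gen_Linv a b)
      then show ?thesis using AI.span_l[of False b a "cls (word w)"] Cons.IH[OF w] g by simp
    qed
    ultimately show ?case by simp
  qed
  have "cls y \<in> AI.coeff_span"
    using y(1)
  proof (induction rule: F.basis_induct)
    case zero
    then show ?case
      using AI.span_zero addhom_zero[OF khom_addhom[OF cls_khom] FA.abelian_group A.abelian_group]
      by (simp add: F.zero_eq)
  next
    case (single u c)
    then show ?case
      using AI.span_scale[OF w, of u c] khom_scale[OF cls_khom word_closed, of u c 1] by (simp add: F.smult_eq)
  next
    case (add f g)
    then show ?case using AI.coeff_span.add khom_add[OF cls_khom, of f g] by (simp add: F.add_eq)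
  qed
  then show "x \<in> AI.coeff_span" using y by simp
qed

lemma coset_closed: "\<lbrakk>y \<in> carrier F; u \<in> cls y\<rbrakk> \<Longrightarrow> u \<in> carrier F"
  unfolding cls_eq a_r_coset_def' using QI.I.Icarr FA.M.a_closed by auto

lemma AA_sigma_eq: "AA_sigma R XX dg \<sigma> = AI.TT.T" and elt2_sigma_eq: "elt2_sigma R XX dg \<sigma> = AI.TT.el"
  by (simp_all add: AA_sigma_def elt2_sigma_def bialgebroid_data.AA_def bialgebroid_data.elt2_def)

abbreviation "gen_TK \<equiv> gen_value AI.TT.TK AI.sT AI.tT AI.lT"

lemma comult_gen_eq:
  assumes "g \<in> S"
  shows "comult_sigma_gen R XX dg \<sigma> g = gen_TK g"
proof (cases g)
  case (Gen_ten \<xi>)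
  have \<xi>: "\<xi> \<in> carrier MT.T"
    using assms Gen_ten unfolding MT.T_eq by (simp add: MMop_eq)
  note inv = AI.takeuchi_invertible
  interpret C: invertible_coefficients R AI.TT.TK XX AI.sT AI.tT dg AI.lT \<sigma> by (rule inv)
  have h: "(\<lambda>\<xi>. gen_TK (Gen_ten \<xi>)) \<in> addhom MT.T AI.TT.T"
    using addhom_comp[OF khom_addhom[OF ten_hom[OF inv]] AI.TT.takeuchi_addhom] unfolding MMop_eq MT.T_eq .
  have "tensor_lift AI.TT.T (\<lambda>f g. AI.TT.el (s_A f) (t_A g)) \<xi> = gen_TK (Gen_ten \<xi>)"
  proof (rule MT.additive_lift[OF AI.TT.abelian_tensor h _ \<xi>])
    fix f g assume "f \<in> carrier M" "g \<in> carrier (op_algebra M)"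
    then have fg: "f \<in> carrier M" "g \<in> carrier M" by simp_all
    have "gen_TK (Gen_ten (mm R f g)) = AI.sT f \<otimes>\<^bsub>AI.TT.T\<^esub> AI.tT g" using ten_mm[OF inv fg] by simp
    also have "\<dots> = AI.TT.el (s_A f) (t_A g)"
      using AI.sT_mult_el[OF fg(1) A.A.one_closed AI.t_closed[OF fg(2)]] AI.s_closed[OF fg(1)] by (simp add: AI.tT_def)
    finally have e: "gen_TK (Gen_ten (mm R f g)) = AI.TT.el (s_A f) (t_A g)" .
    show "AI.TT.el (s_A f) (t_A g) = gen_TK (Gen_ten (MT.el f g))"
      unfolding MT.el_eq by (rule e[unfolded mm_eq, symmetric])
  qed
  then show ?thesis by (simp add: Gen_ten AA_sigma_eq elt2_sigma_eq)
next
  case (Gen_L a b)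
  then show ?thesis using AI.lT_eq[of True a b] assms by (simp add: AA_sigma_eq elt2_sigma_eq)
next
  case (Gen_Linv a b)
  then show ?thesis using AI.lT_eq[of False b a] assms by (simp add: AA_sigma_eq elt2_sigma_eq)
qed

text \<open>
  The comultiplication takes values in the Takeuchi product, where it is the homomorphism given by
  the universal property.
\<close>

lemma comult_sigma_eq:
  assumes "x \<in> carrier A"
  shows "comult_sigma R XX dg \<sigma> x = induced (free_eval AI.TT.TK gen_TK) x"
proof -
  note inv = AI.takeuchi_invertible
  note TKa = AI.TT.k_algebra_takeuchi
  obtain y where y: "y \<in> carrier F" "x = cls y" using assms by (rule A_carrierE)
  have f: "foldr (\<lambda>g x. comult_sigma_gen R XX dg \<sigma> g \<otimes>\<^bsub>AI.TT.T\<^esub> x) w \<one>\<^bsub>AI.TT.T\<^esub> =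
      foldr (\<lambda>g x. gen_TK g \<otimes>\<^bsub>AI.TT.TK\<^esub> x) w \<one>\<^bsub>AI.TT.TK\<^esub>" if "w \<in> lists S" for w
    using that by (induction w rule: list.induct) (simp_all add: comult_gen_eq)
  have "free_eval AI.TT.T (comult_sigma_gen R XX dg \<sigma>) u = free_eval AI.TT.TK gen_TK u" if u: "u \<in> carrier F" for u
  proof -
    have k: "keys u \<subseteq> lists S" using u by (simp add: F.carrier_eq)
    have c: "lookup u w \<odot>\<^bsub>AI.TT.T\<^esub> foldr (\<lambda>g x. gen_TK g \<otimes>\<^bsub>AI.TT.TK\<^esub> x) w \<one>\<^bsub>AI.TT.TK\<^esub> \<in> AI.TT.takeuchi"
      if "w \<in> keys u" for w
    proof -
      have "foldr (\<lambda>g x. gen_TK g \<otimes>\<^bsub>AI.TT.TK\<^esub> x) w \<one>\<^bsub>AI.TT.TK\<^esub> \<in> carrier AI.TT.TK"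
        by (rule foldr_mult_closed[OF TKa gen_value_closed[OF inv]]) (use k that in auto)
      then show ?thesis by (intro AI.TT.takeuchi_scale) simp
    qed
    have "free_eval AI.TT.T (comult_sigma_gen R XX dg \<sigma>) u = (\<Oplus>\<^bsub>AI.TT.T\<^esub>w\<in>keys u. lookup u w \<odot>\<^bsub>AI.TT.T\<^esub>
        foldr (\<lambda>g x. gen_TK g \<otimes>\<^bsub>AI.TT.TK\<^esub> x) w \<one>\<^bsub>AI.TT.TK\<^esub>)"
      unfolding free_eval_def
    proof (rule AI.TT.T.finsum_cong'[OF refl])
      show "(\<lambda>w. lookup u w \<odot>\<^bsub>AI.TT.T\<^esub> foldr (\<lambda>g x. gen_TK g \<otimes>\<^bsub>AI.TT.TK\<^esub> x) w \<one>\<^bsub>AI.TT.TK\<^esub>)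
          \<in> keys u \<rightarrow> carrier AI.TT.T"
        using c AI.TT.takeuchi_carrier by blast
      fix w assume "w \<in> keys u"
      then have "w \<in> lists S" using k by blast
      then show "lookup u w \<odot>\<^bsub>AI.TT.T\<^esub> foldr (\<lambda>g x. comult_sigma_gen R XX dg \<sigma> g \<otimes>\<^bsub>AI.TT.T\<^esub> x) w \<one>\<^bsub>AI.TT.T\<^esub> =
          lookup u w \<odot>\<^bsub>AI.TT.T\<^esub> foldr (\<lambda>g x. gen_TK g \<otimes>\<^bsub>AI.TT.TK\<^esub> x) w \<one>\<^bsub>AI.TT.TK\<^esub>"
        by (simp only: f)
    qed
    also have "\<dots> = free_eval AI.TT.TK gen_TK u"
      unfolding free_eval_def using AI.TK_finsum[of _ "keys u"] c by auto
    finally show ?thesis .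
  qed
  then show ?thesis
    unfolding comult_sigma_def AA_sigma_eq y by (intro induced_cong) (use coset_closed[OF y(1)] in blast)
qed

abbreviation "gen_E \<equiv> gen_value (end_algebra M) (end_s R) (end_t R) (end_l R (signed_shift dg))"

lemma end_inv: "invertible_coefficients R (end_algebra M) XX (end_s R) (end_t R) dg (end_l R (signed_shift dg)) \<sigma>"
  by (rule R.end_invertible[OF finite_XX bij_deg \<sigma>_closed \<sigma>_central \<sigma>_degree])

lemma chi_gen_eq:
  assumes "g \<in> S" and h: "h \<in> carrier M"
  shows "chi_gen R dg g h = gen_E g h"
proof (cases g)
  case (Gen_ten \<xi>)
  have \<xi>: "\<xi> \<in> carrier MT.T"
    using assms Gen_ten unfolding MT.T_eq by (simp add: MMop_eq)
  have E: "(\<lambda>\<xi>. gen_E (Gen_ten \<xi>) h) \<in> addhom MT.T M"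
    using addhom_comp[OF khom_addhom[OF ten_hom[OF end_inv]] M.end_eval_addhom[OF h]]
    unfolding MMop_eq MT.T_eq .
  have "tensor_lift M (\<lambda>f g. f \<otimes>\<^bsub>M\<^esub> h \<otimes>\<^bsub>M\<^esub> g) \<xi> = gen_E (Gen_ten \<xi>) h"
  proof (rule MT.additive_lift[OF M.abelian_group E _ \<xi>])
    fix f g assume "f \<in> carrier M" "g \<in> carrier (op_algebra M)"
    then have fg: "f \<in> carrier M" "g \<in> carrier M" by simp_all
    have "gen_E (Gen_ten (mm R f g)) h = end_s R f (end_t R g h)"
      by (simp only: ten_mm[OF end_inv fg] M.end_app(1)[OF h])
    also have "\<dots> = f \<otimes>\<^bsub>M\<^esub> (h \<otimes>\<^bsub>M\<^esub> g)"
      by (simp only: end_s_def end_t_def restrict_apply' h M.A.m_closed[OF h fg(2)])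
    also have "\<dots> = f \<otimes>\<^bsub>M\<^esub> h \<otimes>\<^bsub>M\<^esub> g" by (rule M.A.m_assoc[OF fg(1) h fg(2), symmetric])
    finally have e: "gen_E (Gen_ten (mm R f g)) h = f \<otimes>\<^bsub>M\<^esub> h \<otimes>\<^bsub>M\<^esub> g" .
    show "f \<otimes>\<^bsub>M\<^esub> h \<otimes>\<^bsub>M\<^esub> g = gen_E (Gen_ten (MT.el f g)) h"
      unfolding MT.el_eq by (rule e[unfolded mm_eq, symmetric])
  qed
  then show ?thesis by (simp add: Gen_ten)
qed (use h in \<open>auto simp: end_l_def signed_shift_def\<close>)

lemma counit_sigma_eq:
  assumes "x \<in> carrier A"
  shows "counit_sigma R dg x = induced (free_eval (end_algebra M) gen_E) x \<one>\<^bsub>M\<^esub>"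
proof -
  note Ea = M.k_algebra_end and one = M.A.one_closed
  interpret E: k_algebra "end_algebra M" by (rule Ea)
  obtain y where y: "y \<in> carrier F" "x = cls y" using assms by (rule A_carrierE)
  have f: "foldr (chi_gen R dg) w \<one>\<^bsub>M\<^esub> = foldr (\<lambda>g x. gen_E g \<otimes>\<^bsub>end_algebra M\<^esub> x) w \<one>\<^bsub>end_algebra M\<^esub> \<one>\<^bsub>M\<^esub>"
    if "w \<in> lists S" for w
    using that
  proof (induction w rule: list.induct)
    case Nil
    show ?case using M.end_app(4)[OF one] by (simp only: foldr.simps id_apply)
  next
    case (Cons g w)
    then have g: "g \<in> S" and w: "w \<in> lists S" by auto
    have c: "foldr (\<lambda>g x. gen_E g \<otimes>\<^bsub>end_algebra M\<^esub> x) w \<one>\<^bsub>end_algebra M\<^esub> \<one>\<^bsub>M\<^esub> \<in> carrier M"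
      by (rule M.end_simps(1)[OF foldr_mult_closed[OF Ea gen_value_closed[OF end_inv] w] one])
    show ?case
      by (simp only: foldr.simps comp_apply Cons.IH[OF w] chi_gen_eq[OF g c] M.end_app(1)[OF one])
  qed
  have "(\<Oplus>\<^bsub>M\<^esub>w\<in>keys u. lookup u w \<odot>\<^bsub>M\<^esub> foldr (chi_gen R dg) w \<one>\<^bsub>M\<^esub>) =
      free_eval (end_algebra M) gen_E u \<one>\<^bsub>M\<^esub>" if u: "u \<in> carrier F" for u
  proof -
    have k: "keys u \<subseteq> lists S" using u by (simp add: F.carrier_eq)
    have c: "foldr (\<lambda>g x. gen_E g \<otimes>\<^bsub>end_algebra M\<^esub> x) w \<one>\<^bsub>end_algebra M\<^esub> \<in> carrier (end_algebra M)"
      if "w \<in> keys u" for w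
      by (rule foldr_mult_closed[OF Ea gen_value_closed[OF end_inv]]) (use k that in auto)
    have "free_eval (end_algebra M) gen_E u \<one>\<^bsub>M\<^esub> = (\<Oplus>\<^bsub>M\<^esub>w\<in>keys u. (lookup u w \<odot>\<^bsub>end_algebra M\<^esub>
        foldr (\<lambda>g x. gen_E g \<otimes>\<^bsub>end_algebra M\<^esub> x) w \<one>\<^bsub>end_algebra M\<^esub>) \<one>\<^bsub>M\<^esub>)"
      unfolding free_eval_def
      by (rule addhom_finsum[OF M.end_eval_addhom[OF one] E.abelian_group M.abelian_group]) (use c in auto)
    also have "\<dots> = (\<Oplus>\<^bsub>M\<^esub>w\<in>keys u. lookup u w \<odot>\<^bsub>M\<^esub> foldr (chi_gen R dg) w \<one>\<^bsub>M\<^esub>)"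
      by (rule M.finsum_cong')
        (use c f[OF subsetD[OF k]] M.end_app(3)[OF one] M.end_simps(1)[OF _ one] in
          \<open>auto simp del: map_algebra_simps(1)\<close>)
    finally show ?thesis by (rule sym)
  qed
  then have "counit_sigma R dg x = induced (\<lambda>u. free_eval (end_algebra M) gen_E u \<one>\<^bsub>M\<^esub>) x"
    unfolding counit_sigma_def chi_def y by (intro induced_cong) (use coset_closed[OF y(1)] in blast)
  also have "\<dots> = free_eval (end_algebra M) gen_E y \<one>\<^bsub>M\<^esub>"
  proof -
    have 0: "free_eval (end_algebra M) gen_E i \<one>\<^bsub>M\<^esub> = \<zero>\<^bsub>M\<^esub>" if "i \<in> I" for i
    proof -
      have "free_eval (end_algebra M) gen_E i = \<zero>\<^bsub>end_algebra M\<^esub>"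
        by (rule khom_genideal_zero[OF ev_khom[OF end_inv] FA.k_algebra_axioms Ea rels_subset ev_rels[OF end_inv]])
          (use that in \<open>simp_all add: I_sigma_def free_LambdaX_def\<close>)
      then show ?thesis using M.end_app(5)[OF one] by simp
    qed
    show ?thesis
      unfolding y cls_eq
      by (rule QI.induced_coset[OF addhom_comp[OF khom_addhom[OF ev_khom[OF end_inv]] M.end_eval_addhom[OF one]]
            M.abelian_group 0 y(1)])
  qed
  finally show ?thesis using induced_ev_cls[OF end_inv y(1)] y(2) by simp
qed

lemma induced_values:
  assumes inv: "invertible_coefficients R B XX s t dg l \<sigma>"
  shows "f \<in> carrier M \<Longrightarrow> induced (free_eval B (gen_value B s t l)) (s_A f) = s f"
    and "f \<in> carrier M \<Longrightarrow> induced (free_eval B (gen_value B s t l)) (t_A f) = t f"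
    and "\<lbrakk>a \<in> XX; b \<in> XX\<rbrakk> \<Longrightarrow> induced (free_eval B (gen_value B s t l)) (l_A i a b) = l i a b"
proof -
  have g: "Gen_ten (mm R f \<one>\<^bsub>M\<^esub>) \<in> S" "Gen_ten (mm R \<one>\<^bsub>M\<^esub> f) \<in> S" if "f \<in> carrier M" for f
    using mm_closed[OF that M.A.one_closed] mm_closed[OF M.A.one_closed that] by simp_all
  have e: "induced (free_eval B (gen_value B s t l)) (cls (word [g])) = gen_value B s t l g" if "g \<in> S" for g
    using induced_ev_cls[OF inv word_closed, of "[g]" 1] ev_words(1)[OF inv that] that by simp
  show "induced (free_eval B (gen_value B s t l)) (s_A f) = s f" if "f \<in> carrier M"
    unfolding s_sigma_def e[OF g(1)[OF that]] by (rule \<phi>_lft[OF inv that])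
  show "induced (free_eval B (gen_value B s t l)) (t_A f) = t f" if "f \<in> carrier M"
    unfolding t_sigma_def e[OF g(2)[OF that]] by (rule \<phi>_rgt[OF inv that])
  show "induced (free_eval B (gen_value B s t l)) (l_A i a b) = l i a b" if "a \<in> XX" "b \<in> XX"
    by (subst e) (use that in auto)
qed

theorem A_sigma_bialgebroid:
  "coefficient_bialgebroid R A XX s_A t_A UNIV (signed_shift dg) l_A (comult_sigma R XX dg \<sigma>)
    (counit_sigma R dg) (induced (free_eval (end_algebra M) gen_E))"
proof (intro coefficient_bialgebroid.intro coefficient_bialgebroid_axioms.intro AI.coefficients_axioms A_spanned)
  note inv = AI.takeuchi_invertible
  show "comult_sigma R XX dg \<sigma> \<in> k_algebra_hom A AI.TT.TK"
    by (rule khom_cong[OF induced_ev_khom[OF inv] A.A.ring_axioms _ comult_sigma_eq]) simp_all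
  show "induced (free_eval (end_algebra M) gen_E) \<in> k_algebra_hom A (end_algebra M)"
    by (rule induced_ev_khom[OF end_inv])
  show "comult_sigma R XX dg \<sigma> (s_A f) = AI.sT f" "comult_sigma R XX dg \<sigma> (t_A f) = AI.tT f"
    "induced (free_eval (end_algebra M) gen_E) (s_A f) = end_s R f"
    "induced (free_eval (end_algebra M) gen_E) (t_A f) = end_t R f" if "f \<in> carrier M" for f
    using comult_sigma_eq[OF AI.s_closed[OF that]] comult_sigma_eq[OF AI.t_closed[OF that]]
      induced_values(1,2)[OF inv that] induced_values(1,2)[OF end_inv that] by simp_all
  show "comult_sigma R XX dg \<sigma> (l_A i a b) = AI.lT i a b"
    "induced (free_eval (end_algebra M) gen_E) (l_A i a b) = end_l R (signed_shift dg) i a b"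
    if "a \<in> XX" "b \<in> XX" for i a b
    using comult_sigma_eq[OF AI.l_closed[OF UNIV_I that]] induced_values(3)[OF inv that]
      induced_values(3)[OF end_inv that] by simp_all
qed (rule counit_sigma_eq)

end

section \<open>Paths and the path algebra\<close>

fun arrows_from :: "('x \<Rightarrow> 'l \<Rightarrow> 'l) \<Rightarrow> 'l \<Rightarrow> 'x list \<Rightarrow> ('l, 'x) arrow list" where
  "arrows_from dg l [] = []"
| "arrows_from dg l (x # xs) = (l, x) # arrows_from dg (dg x l) xs"

fun walk :: "('x \<Rightarrow> 'l \<Rightarrow> 'l) \<Rightarrow> 'l \<Rightarrow> 'x list \<Rightarrow> 'l" where
  "walk dg l [] = l"
| "walk dg l (x # xs) = walk dg (dg x l) xs"

definition path_from :: "('x \<Rightarrow> 'l \<Rightarrow> 'l) \<Rightarrow> 'l \<Rightarrow> 'x list \<Rightarrow> ('l, 'x) path" where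
  "path_from dg l xs = (l, arrows_from dg l xs)"

lemma arrows_from_simps [simp]:
  "map snd (arrows_from dg l xs) = xs" "length (arrows_from dg l xs) = length xs"
  "arrows_from dg l xs = [] \<longleftrightarrow> xs = []"
  by (induction xs arbitrary: l) auto

lemma arrows_from_append: "arrows_from dg l (xs @ ys) = arrows_from dg l xs @ arrows_from dg (walk dg l xs) ys"
  by (induction xs arbitrary: l) auto

lemma last_arrows_from: "xs \<noteq> [] \<Longrightarrow> arrow_tgt dg (last (arrows_from dg l xs)) = walk dg l xs"
proof (induction xs arbitrary: l rule: list.induct)
  case (Cons x xs)
  then show ?case by (cases xs) (auto simp: arrow_tgt_def)
qed simp

lemma path_from_simps [simp]:
  "fst (path_from dg l xs) = l" "map snd (snd (path_from dg l xs)) = xs"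
  "length (snd (path_from dg l xs)) = length xs"
  "path_tgt dg (path_from dg l xs) = walk dg l xs"
  "path_append (path_from dg l xs) (path_from dg (walk dg l xs) ys) = path_from dg l (xs @ ys)"
  "path_from dg l [] = vertex l"
  by (auto simp: path_from_def path_tgt_def last_arrows_from path_append_def arrows_from_append vertex_def)

lemma path_from_inject [simp]: "path_from dg l xs = path_from dg l' xs' \<longleftrightarrow> l = l' \<and> xs = xs'"
  by (metis path_from_simps(1,2))

lemma arrows_fromI:
  assumes "qs \<noteq> [] \<Longrightarrow> fst (hd qs) = l" "\<And>i. Suc i < length qs \<Longrightarrow> arrow_tgt dg (qs ! i) = fst (qs ! Suc i)"
  shows "arrows_from dg l (map snd qs) = qs"
  using assms
proof (induction qs arbitrary: l)
  case (Cons q qs)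
  have "arrows_from dg (dg (snd q) l) (map snd qs) = qs"
  proof (rule Cons.IH)
    show "fst (hd qs) = dg (snd q) l" if "qs \<noteq> []"
      using Cons.prems(1) Cons.prems(2)[of 0] that by (cases qs) (auto simp: arrow_tgt_def)
    show "arrow_tgt dg (qs ! i) = fst (qs ! Suc i)" if "Suc i < length qs" for i
      using Cons.prems(2)[of "Suc i"] that by simp
  qed
  then show ?case using Cons.prems(1) by (cases q) auto
qed simp

lemma arrows_from_step:
  "Suc i < length xs \<Longrightarrow> arrow_tgt dg (arrows_from dg l xs ! i) = fst (arrows_from dg l xs ! Suc i)"
proof (induction xs arbitrary: l i)
  case (Cons x xs)
  show ?case
  proof (cases i)
    case 0
    then show ?thesis using Cons.prems by (cases xs) (auto simp: arrow_tgt_def)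
  next
    case (Suc j)
    then show ?thesis using Cons by simp
  qed
qed simp

lemma set_arrows_from: "set (arrows_from dg l xs) \<subseteq> UNIV \<times> XX \<longleftrightarrow> set xs \<subseteq> XX"
  by (induction xs arbitrary: l) auto

lemma paths_eq: "paths XX dg m = (\<lambda>(l, xs). path_from dg l xs) ` (UNIV \<times> tuples XX m)"
proof (intro equalityI subsetI)
  fix p assume "p \<in> paths XX dg m"
  then obtain l qs where p: "p = (l, qs)" "length qs = m" "set qs \<subseteq> UNIV \<times> XX"
      "arrows_from dg l (map snd qs) = qs"
    by (auto simp: paths_def intro!: arrows_fromI)
  then have "p = path_from dg l (map snd qs)" "map snd qs \<in> tuples XX m"
    by (auto simp: path_from_def tuples_def)
  then show "p \<in> (\<lambda>(l, xs). path_from dg l xs) ` (UNIV \<times> tuples XX m)"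
    by (intro image_eqI[of _ _ "(l, map snd qs)"]) simp_all
next
  fix p assume "p \<in> (\<lambda>(l, xs). path_from dg l xs) ` (UNIV \<times> tuples XX m)"
  then obtain l xs where p: "p = path_from dg l xs" "xs \<in> tuples XX m" by auto
  then have "xs \<noteq> [] \<Longrightarrow> fst (hd (arrows_from dg l xs)) = l" by (cases xs) auto
  then show "p \<in> paths XX dg m"
    using p arrows_from_step[of _ xs dg l] set_arrows_from[of dg l xs XX]
    by (auto simp: paths_def path_from_def tuples_def)
qed

lemma path_from_paths: "xs \<in> tuples XX m \<Longrightarrow> path_from dg l xs \<in> paths XX dg m"
  by (auto simp: paths_eq)

lemma pathsE:
  assumes "p \<in> paths XX dg m"
  obtains l xs where "p = path_from dg l xs" "xs \<in> tuples XX m"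
  using assms by (auto simp: paths_eq)

text \<open>
  Pairs of paths are composed simultaneously; the composition is undefined when one of the two
  components cannot be composed.
\<close>

fun path_op where
  "path_op dg (p, q) (p', q') =
     (if path_tgt dg p = fst p' \<and> path_tgt dg q = fst q'
      then Some (path_append p p', path_append q q') else None)"

definition path_pairs where "path_pairs XX dg = (\<Union>m. paths XX dg m \<times> paths XX dg m)"

lemma path_pairsE:
  assumes "u \<in> path_pairs XX dg"
  obtains m l xs l' xs' where "u = (path_from dg l xs, path_from dg l' xs')"
    "xs \<in> tuples XX m" "xs' \<in> tuples XX m"
  using assms unfolding path_pairs_def by (auto elim!: pathsE)

lemma path_pairsI:
  "\<lbrakk>xs \<in> tuples XX m; xs' \<in> tuples XX m\<rbrakk> \<Longrightarrow> (path_from dg l xs, path_from dg l' xs') \<in> path_pairs XX dg"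
  by (auto simp: path_pairs_def intro!: path_from_paths)

lemma tuples_append: "\<lbrakk>xs \<in> tuples XX m; ys \<in> tuples XX n\<rbrakk> \<Longrightarrow> xs @ ys \<in> tuples XX (m + n)"
  by (auto simp: tuples_def)

lemma vertex_eq: "vertex l = path_from dg l []"
  by simp

lemma path_append_simps:
  "path_tgt dg p = fst p' \<Longrightarrow> path_tgt dg (path_append p p') = path_tgt dg p'"
  "fst (path_append p p') = fst p" "path_append (path_append p p') p'' = path_append p (path_append p' p'')"
  by (auto simp: path_tgt_def path_append_def)

lemma vertex_facts [simp]: "path_tgt dg (vertex l) = l" "fst (vertex l) = l"
  "path_append (vertex (fst p)) p = p" "path_append p (vertex l) = p"
  by (auto simp: vertex_def path_tgt_def path_append_def)

lemma vertex_append_path [simp]: "path_append (vertex l) (path_from dg l xs) = path_from dg l xs"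
  by (simp add: vertex_def path_append_def path_from_def)

lemma sum_if_const: "(\<Sum>i\<in>I. if P then f i else 0) = (if P then \<Sum>i\<in>I. f i else 0)"
  by simp

lemma opt_single_if: "opt_single (if P then w else None) c = (if P then opt_single w c else 0)"
  by simp

lemma sum_delta2:
  fixes f :: "'l :: finite \<Rightarrow> 'm :: finite \<Rightarrow> 'a :: comm_monoid_add"
  shows "(\<Sum>l\<in>UNIV. \<Sum>m\<in>UNIV. if l = a \<and> m = b then f l m else 0) = f a b"
    and "(\<Sum>l\<in>UNIV. \<Sum>m\<in>UNIV. if a = l \<and> b = m then f l m else 0) = f a b"
proof -
  have "(\<Sum>m\<in>UNIV. if l = a \<and> m = b then f l m else 0) = (if l = a then f a b else 0)" for l
    by (cases "l = a") simp_all
  then show "(\<Sum>l\<in>UNIV. \<Sum>m\<in>UNIV. if l = a \<and> m = b then f l m else 0) = f a b" by simp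
  then show "(\<Sum>l\<in>UNIV. \<Sum>m\<in>UNIV. if a = l \<and> b = m then f l m else 0) = f a b"
    by (simp add: eq_commute)
qed

lemma basis_algebra_path:
  "basis_algebra (path_algebra XX dg :: ('k :: field, ('l :: finite, 'x, 'k) path_vec) module)
    (path_pairs XX dg) (path_op dg)"
proof
  let ?G = "path_algebra XX dg :: ('k, ('l, 'x, 'k) path_vec) module"
  show "carrier ?G = {f. keys f \<subseteq> path_pairs XX dg}"
    by (simp add: path_algebra_def path_pairs_def)
  show "monoid.mult ?G = pm_mult (path_op dg)"
    by (auto simp: path_algebra_def pm_mult_def fun_eq_iff split_def opt_single_def intro!: sum.cong)
  show "ring.zero ?G = 0" "add ?G = (+)" "module.smult ?G = pm_scale"
    by (simp_all add: path_algebra_def pm_scale_def fun_eq_iff)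
next
  fix u v w :: "('l, 'x) path \<times> ('l, 'x) path"
  assume "u \<in> path_pairs XX dg" "v \<in> path_pairs XX dg" "path_op dg u v = Some w"
  then show "w \<in> path_pairs XX dg"
    by (auto elim!: path_pairsE split: if_splits intro!: path_pairsI[OF tuples_append tuples_append])
next
  fix u v w :: "('l, 'x) path \<times> ('l, 'x) path"
  obtain p q p' q' p'' q'' where "u = (p, q)" "v = (p', q')" "w = (p'', q'')"
    by (metis surj_pair)
  then show "Option.bind (path_op dg u v) (\<lambda>x. path_op dg x w) = Option.bind (path_op dg v w) (path_op dg u)"
    by (simp add: path_append_simps)
next
  let ?G = "path_algebra XX dg :: ('k, ('l, 'x, 'k) path_vec) module"
  have one: "one ?G = (\<Sum>l\<in>UNIV. \<Sum>m\<in>UNIV. ee (vertex l) (vertex m))"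
    by (simp add: path_algebra_def)
  have sum: "keys (\<Sum>i\<in>I. f i) \<subseteq> S" if "\<And>i. i \<in> I \<Longrightarrow> keys (f i) \<subseteq> S"
    for I and f :: "'l \<Rightarrow> ('l, 'x, 'k) path_vec" and S
    using that by (induction I rule: infinite_finite_induct) (simp_all add: keys_subsetI)
  have "(vertex l, vertex m) \<in> path_pairs XX dg" for l m
    using path_pairsI[of "[]" XX 0 "[]" dg l m] by (simp add: tuples_0)
  then show "one ?G \<in> carrier ?G"
    unfolding one by (auto simp: path_algebra_def path_pairs_def[symmetric] intro!: sum)
  fix u :: "('l, 'x) path \<times> ('l, 'x) path" and c :: 'k
  obtain p q where u: "u = (p, q)" by (cases u)
  have "pm_mult (path_op dg) (one ?G) (Poly_Mapping.single u c) =
      (\<Sum>l\<in>UNIV. \<Sum>m\<in>UNIV. if l = fst p \<and> m = fst q then Poly_Mapping.single (path_append (vertex l) p, path_append (vertex m) q) c else 0)"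
    unfolding one u by (simp add: pm_mult_sum_left opt_single_if cong: if_cong)
  then show "pm_mult (path_op dg) (one ?G) (Poly_Mapping.single u c) = Poly_Mapping.single u c"
    by (simp add: sum_delta2 u)
  have "pm_mult (path_op dg) (Poly_Mapping.single u c) (one ?G) =
      (\<Sum>l\<in>UNIV. \<Sum>m\<in>UNIV. if path_tgt dg p = l \<and> path_tgt dg q = m then Poly_Mapping.single (p, q) c else 0)"
    unfolding one u by (simp add: pm_mult_sum_right opt_single_if cong: if_cong)
  then show "pm_mult (path_op dg) (Poly_Mapping.single u c) (one ?G) = Poly_Mapping.single u c"
    by (simp add: sum_delta2 u)
qed

text \<open>
  \<open>row l\<close> and \<open>col m\<close> are the idempotents cutting out paths that start at \<open>(l, _)\<close> and \<open>(_, m)\<close>,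
  \<open>pword xs ys\<close> is the sum of all pairs of paths that follow the labels \<open>xs\<close> and \<open>ys\<close>.
\<close>

definition row :: "'l \<Rightarrow> ('l :: finite, 'x, 'k :: field) path_vec" where
  "row l = (\<Sum>m\<in>UNIV. ee (vertex l) (vertex m))"

definition col :: "'l \<Rightarrow> ('l :: finite, 'x, 'k :: field) path_vec" where
  "col m = (\<Sum>l\<in>UNIV. ee (vertex l) (vertex m))"

definition pword :: "('x \<Rightarrow> 'l \<Rightarrow> 'l) \<Rightarrow> 'x list \<Rightarrow> 'x list \<Rightarrow> ('l :: finite, 'x, 'k :: field) path_vec" where
  "pword dg xs ys = (\<Sum>l\<in>UNIV. \<Sum>m\<in>UNIV. ee (path_from dg l xs) (path_from dg m ys))"

lemma ee_mult:
  "pm_mult (path_op dg) (ee p q) (ee p' q') = (if path_tgt dg p = fst p' then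
     if path_tgt dg q = fst q' then ee (path_append p p') (path_append q q') else 0 else 0)"
  by simp

lemmas path_sums = pm_mult_sum_right ee_mult sum_if_const

lemma row_mult_ee: "pm_mult (path_op dg) (row l) (ee (path_from dg l' xs) q) =
    (if l = l' then ee (path_from dg l' xs) q else 0)"
  and col_mult_ee: "pm_mult (path_op dg) (col m) (ee q (path_from dg m' xs)) =
    (if m = m' then ee q (path_from dg m' xs) else 0)"
  unfolding row_def col_def pm_mult_sum_left
  by (simp_all add: path_sums del: pm_mult_single cong: if_cong)

lemma row_mult_row: "pm_mult (path_op dg) (row l) (row l') = (if l = l' then row l else 0)"
  and col_mult_row: "pm_mult (path_op dg) (col m) (row l') = ee (vertex l') (vertex m)"
  unfolding row_def[of l'] vertex_eq[of _ dg] pm_mult_sum_right row_mult_ee col_mult_ee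
  by (simp_all add: sum_if_const row_def)

lemma col_mult_col: "pm_mult (path_op dg) (col m) (col m') = (if m = m' then col m else 0)"
  and row_mult_col: "pm_mult (path_op dg) (row l) (col m') = ee (vertex l) (vertex m')"
  unfolding col_def[of m'] vertex_eq[of _ dg] pm_mult_sum_right row_mult_ee col_mult_ee
  by (simp_all add: sum_if_const col_def)

lemma sum_row: "(\<Sum>l\<in>UNIV. row l) = (\<Sum>l\<in>UNIV. \<Sum>m\<in>UNIV. ee (vertex l) (vertex m))"
  by (simp add: row_def)

lemma sum_col: "(\<Sum>m\<in>UNIV. col m) = (\<Sum>l\<in>UNIV. \<Sum>m\<in>UNIV. ee (vertex l) (vertex m))"
  unfolding col_def by (rule sum.swap)

lemma pword_append: "pm_mult (path_op dg) (pword dg xs ys) (pword dg xs' ys') = pword dg (xs @ xs') (ys @ ys')"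
  unfolding pword_def pm_mult_sum_left by (simp add: path_sums del: pm_mult_single cong: if_cong)

lemma row_col_pword:
  "pm_mult (path_op dg) (row l) (pm_mult (path_op dg) (col m) (pword dg xs ys)) =
    ee (path_from dg l xs) (path_from dg m ys)"
  unfolding pword_def
  by (simp add: pm_mult_sum_right row_mult_ee col_mult_ee)

lemma pword_row:
  assumes "inj (dg a)"
  shows "pm_mult (path_op dg) (pword dg [a] [b]) (row (dg a l)) = pm_mult (path_op dg) (row l) (pword dg [a] [b])"
  unfolding pword_def row_def[of "dg a l"] pm_mult_sum_left
  unfolding pm_mult_sum_right row_mult_ee
  by (simp add: path_sums inj_eq[OF assms] del: pm_mult_single cong: if_cong)

lemma pword_col:
  assumes "inj (dg b)"
  shows "pm_mult (path_op dg) (pword dg [a] [b]) (col (dg b m)) = pm_mult (path_op dg) (col m) (pword dg [a] [b])"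
  unfolding pword_def col_def[of "dg b m"] pm_mult_sum_left
  unfolding pm_mult_sum_right col_mult_ee
  by (simp add: path_sums inj_eq[OF assms] del: pm_mult_single cong: if_cong)

section \<open>Idempotents and algebras of maps\<close>

text \<open>
  Orthogonal idempotents indexed by \<open>\<Lambda>\<close> that sum to one and commute with the image of \<open>i\<close> extend \<open>i\<close>
  from constant maps to all maps \<open>\<Lambda> \<rightarrow> R\<close>.
\<close>

locale idempotents = R: k_algebra R + H: k_algebra H
  for R :: "('k :: field, 'r) module" and H :: "('k, 'h) module" +
  fixes i :: "'r \<Rightarrow> 'h" and e :: "'l :: finite \<Rightarrow> 'h"
  assumes i_hom: "i \<in> k_algebra_hom R H"
    and e_closed [simp]: "e l \<in> carrier H"
    and e_i: "r \<in> carrier R \<Longrightarrow> e l \<otimes>\<^bsub>H\<^esub> i r = i r \<otimes>\<^bsub>H\<^esub> e l"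
    and e_e: "e l \<otimes>\<^bsub>H\<^esub> e m = (if l = m then e l else \<zero>\<^bsub>H\<^esub>)"
    and e_sum: "(\<Oplus>\<^bsub>H\<^esub>l\<in>UNIV. e l) = \<one>\<^bsub>H\<^esub>"
begin

definition "map_ext f = (\<Oplus>\<^bsub>H\<^esub>l\<in>UNIV. i (f l) \<otimes>\<^bsub>H\<^esub> e l)"

lemma i_closed [simp]: "r \<in> carrier R \<Longrightarrow> i r \<in> carrier H"
  by (rule khom_closed[OF i_hom])

lemma i_zero: "i \<zero>\<^bsub>R\<^esub> = \<zero>\<^bsub>H\<^esub>"
  by (rule addhom_zero[OF khom_addhom[OF i_hom] R.abelian_group H.abelian_group])

lemma map_ext_mult_e:
  assumes f: "\<And>l. f l \<in> carrier R"
  shows "map_ext f \<otimes>\<^bsub>H\<^esub> e m = i (f m) \<otimes>\<^bsub>H\<^esub> e m"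
proof -
  have "map_ext f \<otimes>\<^bsub>H\<^esub> e m = (\<Oplus>\<^bsub>H\<^esub>l\<in>UNIV. i (f l) \<otimes>\<^bsub>H\<^esub> e l \<otimes>\<^bsub>H\<^esub> e m)"
    unfolding map_ext_def by (rule H.A.finsum_ldistr) (use f in auto)
  also have "\<dots> = (\<Oplus>\<^bsub>H\<^esub>l\<in>UNIV. if l = m then i (f l) \<otimes>\<^bsub>H\<^esub> e l else \<zero>\<^bsub>H\<^esub>)"
    by (rule H.finsum_cong') (use f in \<open>auto simp: H.A.m_assoc e_e\<close>)
  also have "\<dots> = i (f m) \<otimes>\<^bsub>H\<^esub> e m" by (rule H.finsum_delta) (use f in auto)
  finally show ?thesis .
qed

lemma map_ext_closed: "(\<And>l. f l \<in> carrier R) \<Longrightarrow> map_ext f \<in> carrier H"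
  unfolding map_ext_def by (rule H.finsum_closed) auto

lemma map_ext_hom: "map_ext \<in> k_algebra_hom (map_algebra R) H"
proof (rule k_algebra_homI)
  fix f g :: "'l \<Rightarrow> 'r"
  assume "f \<in> carrier (map_algebra R)" "g \<in> carrier (map_algebra R)"
  then have fg: "f l \<in> carrier R" "g l \<in> carrier R" for l by auto
  show "map_ext f \<in> carrier H" by (rule map_ext_closed) (rule fg)
  show "map_ext (f \<oplus>\<^bsub>map_algebra R\<^esub> g) = map_ext f \<oplus>\<^bsub>H\<^esub> map_ext g"
    unfolding map_ext_def map_algebra_simps
    by (subst H.finsum_addf[symmetric]) (use fg in \<open>auto simp: khom_add[OF i_hom] H.A.l_distr intro!: H.finsum_cong'\<close>)
  have "map_ext f \<otimes>\<^bsub>H\<^esub> map_ext g = (\<Oplus>\<^bsub>H\<^esub>l\<in>UNIV. map_ext f \<otimes>\<^bsub>H\<^esub> (i (g l) \<otimes>\<^bsub>H\<^esub> e l))"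
    unfolding map_ext_def[of g] by (rule H.A.finsum_rdistr) (use fg map_ext_closed[of f] in auto)
  also have "\<dots> = (\<Oplus>\<^bsub>H\<^esub>l\<in>UNIV. i (f l \<otimes>\<^bsub>R\<^esub> g l) \<otimes>\<^bsub>H\<^esub> e l)"
  proof (rule H.finsum_cong')
    fix l
    have "map_ext f \<otimes>\<^bsub>H\<^esub> (i (g l) \<otimes>\<^bsub>H\<^esub> e l) = map_ext f \<otimes>\<^bsub>H\<^esub> e l \<otimes>\<^bsub>H\<^esub> i (g l)"
      using fg map_ext_closed[of f] by (simp add: H.A.m_assoc e_i)
    also have "\<dots> = i (f l) \<otimes>\<^bsub>H\<^esub> (e l \<otimes>\<^bsub>H\<^esub> i (g l))" using fg by (simp add: H.A.m_assoc map_ext_mult_e)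
    finally show "map_ext f \<otimes>\<^bsub>H\<^esub> (i (g l) \<otimes>\<^bsub>H\<^esub> e l) = i (f l \<otimes>\<^bsub>R\<^esub> g l) \<otimes>\<^bsub>H\<^esub> e l"
      using fg by (simp add: khom_mult[OF i_hom] e_i H.A.m_assoc)
  qed (use fg in auto)
  finally show "map_ext (f \<otimes>\<^bsub>map_algebra R\<^esub> g) = map_ext f \<otimes>\<^bsub>H\<^esub> map_ext g"
    by (simp add: map_ext_def)
next
  show "map_ext \<one>\<^bsub>map_algebra R\<^esub> = \<one>\<^bsub>H\<^esub>"
    unfolding map_ext_def e_sum[symmetric]
    by (rule H.finsum_cong') (auto simp: khom_one[OF i_hom])
next
  fix c and f :: "'l \<Rightarrow> 'r" assume "f \<in> carrier (map_algebra R)"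
  then have f: "f l \<in> carrier R" for l by auto
  have "c \<odot>\<^bsub>H\<^esub> map_ext f = (\<Oplus>\<^bsub>H\<^esub>l\<in>UNIV. c \<odot>\<^bsub>H\<^esub> (i (f l) \<otimes>\<^bsub>H\<^esub> e l))"
    unfolding map_ext_def
    by (rule addhom_finsum[OF H.scale_addhom H.abelian_group H.abelian_group]) (use f in auto)
  then show "map_ext (c \<odot>\<^bsub>map_algebra R\<^esub> f) = c \<odot>\<^bsub>H\<^esub> map_ext f"
    using f by (simp add: map_ext_def khom_scale[OF i_hom] H.smult_mult_left)
qed

lemma map_ext_single:
  assumes "r \<in> carrier R"
  shows "map_ext (const_map r \<otimes>\<^bsub>map_algebra R\<^esub> delta_map R m) = i r \<otimes>\<^bsub>H\<^esub> e m"
proof -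
  have "map_ext (const_map r \<otimes>\<^bsub>map_algebra R\<^esub> delta_map R m) =
      (\<Oplus>\<^bsub>H\<^esub>l\<in>UNIV. if m = l then i r \<otimes>\<^bsub>H\<^esub> e l else \<zero>\<^bsub>H\<^esub>)"
    unfolding map_ext_def
    by (rule H.finsum_cong') (use assms in \<open>auto simp: const_map_def delta_map_def i_zero\<close>)
  also have "\<dots> = i r \<otimes>\<^bsub>H\<^esub> e m" by (rule H.finsum_delta) (use assms in auto)
  finally show ?thesis .
qed

text \<open>
  An element that permutes the idempotents permutes the arguments of the maps. This is the source
  of the shifts in the commutation rules of the coefficients.
\<close>

lemma map_ext_shift:
  assumes v: "v \<in> carrier H" and v_i: "\<And>r. r \<in> carrier R \<Longrightarrow> v \<otimes>\<^bsub>H\<^esub> i r = i r \<otimes>\<^bsub>H\<^esub> v"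
    and v_e: "\<And>m. v \<otimes>\<^bsub>H\<^esub> e (\<beta> m) = e m \<otimes>\<^bsub>H\<^esub> v" and \<beta>: "bij \<beta>"
    and "f \<in> carrier (map_algebra R)"
  shows "v \<otimes>\<^bsub>H\<^esub> map_ext f = map_ext (shift \<beta> f) \<otimes>\<^bsub>H\<^esub> v"
proof -
  have f: "f l \<in> carrier R" for l using assms(5) by auto
  have "map_ext f = (\<Oplus>\<^bsub>H\<^esub>l\<in>\<beta> ` UNIV. i (f l) \<otimes>\<^bsub>H\<^esub> e l)"
    using \<beta> by (simp add: map_ext_def bij_is_surj)
  also have "\<dots> = (\<Oplus>\<^bsub>H\<^esub>m\<in>UNIV. i (f (\<beta> m)) \<otimes>\<^bsub>H\<^esub> e (\<beta> m))"
    by (rule H.finsum_reindex) (use f bij_is_inj[OF \<beta>] in auto)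
  finally have "v \<otimes>\<^bsub>H\<^esub> map_ext f = (\<Oplus>\<^bsub>H\<^esub>m\<in>UNIV. v \<otimes>\<^bsub>H\<^esub> (i (f (\<beta> m)) \<otimes>\<^bsub>H\<^esub> e (\<beta> m)))"
    using f v by (simp add: H.A.finsum_rdistr Pi_iff)
  also have "\<dots> = (\<Oplus>\<^bsub>H\<^esub>m\<in>UNIV. i (f (\<beta> m)) \<otimes>\<^bsub>H\<^esub> e m \<otimes>\<^bsub>H\<^esub> v)"
  proof (rule H.finsum_cong')
    fix m
    have "v \<otimes>\<^bsub>H\<^esub> (i (f (\<beta> m)) \<otimes>\<^bsub>H\<^esub> e (\<beta> m)) = i (f (\<beta> m)) \<otimes>\<^bsub>H\<^esub> (v \<otimes>\<^bsub>H\<^esub> e (\<beta> m))"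
      using f v by (simp add: H.A.m_assoc[symmetric] v_i)
    then show "v \<otimes>\<^bsub>H\<^esub> (i (f (\<beta> m)) \<otimes>\<^bsub>H\<^esub> e (\<beta> m)) = i (f (\<beta> m)) \<otimes>\<^bsub>H\<^esub> e m \<otimes>\<^bsub>H\<^esub> v"
      using f v by (simp add: v_e H.A.m_assoc)
  qed (use f v in auto)
  also have "\<dots> = map_ext (shift \<beta> f) \<otimes>\<^bsub>H\<^esub> v"
    unfolding map_ext_def by (subst H.A.finsum_ldistr) (use f v in \<open>auto simp: shift_def\<close>)
  finally show ?thesis .
qed

end

lemma map_algebra_op: "map_algebra (op_algebra R) = op_algebra (map_algebra R)"
  by (simp add: map_algebra_def op_algebra_def)

section \<open>Coefficients in \<open>\<HH>(Q)\<close>\<close>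

locale quiver_data = R: k_algebra R for R :: "('k :: field, 'r) module" +
  fixes XX :: "'x set" and dg :: "'x \<Rightarrow> 'l :: finite \<Rightarrow> 'l"
  assumes finite_XX: "finite XX" and bij_deg: "x \<in> XX \<Longrightarrow> bij (dg x)"
begin

abbreviation "M \<equiv> map_algebra R :: ('k, 'l \<Rightarrow> 'r) module"
abbreviation "G \<equiv> path_algebra XX dg :: ('k, ('l, 'x, 'k) path_vec) module"
abbreviation "RR \<equiv> tensor_algebra R (op_algebra R)"
abbreviation "H \<equiv> HQ R XX dg"
abbreviation "ht \<equiv> hten R XX dg"

sublocale M: k_algebra M
  by (rule k_algebra_map_algebra) (rule R.k_algebra_axioms)

sublocale G: basis_algebra G "path_pairs XX dg" "path_op dg"
  by (rule basis_algebra_path)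

sublocale GA: k_algebra G
  by (rule G.k_algebra)

sublocale RT: algebra_tensor R "op_algebra R"
  by (intro algebra_tensor.intro R.k_algebra_axioms k_algebra_op)

sublocale RR: k_algebra RR
  by (rule RT.k_algebra_tensor)

sublocale HT: algebra_tensor RR G
  by (intro algebra_tensor.intro RR.k_algebra_axioms GA.k_algebra_axioms)

sublocale H: k_algebra H
  unfolding HQ_def by (rule HT.k_algebra_tensor)

lemma ht_closed [simp]: "\<lbrakk>r \<in> carrier R; r' \<in> carrier R; g \<in> carrier G\<rbrakk> \<Longrightarrow> ht r r' g \<in> carrier H"
  unfolding hten_def HQ_def by (intro HT.pure_closed RT.pure_closed) simp_all

lemma ht_mult:
  "\<lbrakk>r \<in> carrier R; r' \<in> carrier R; g \<in> carrier G; u \<in> carrier R; u' \<in> carrier R; h \<in> carrier G\<rbrakk> \<Longrightarrow>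
    ht r r' g \<otimes>\<^bsub>H\<^esub> ht u u' h = ht (r \<otimes>\<^bsub>R\<^esub> u) (u' \<otimes>\<^bsub>R\<^esub> r') (g \<otimes>\<^bsub>G\<^esub> h)"
  unfolding hten_def HQ_def by (simp add: HT.pure_mult RT.pure_mult)

lemma ht_coeff:
  assumes "r \<in> carrier R" "r' \<in> carrier R" "u \<in> path_pairs XX dg"
  shows "ht r r' (Poly_Mapping.single u c) = ht (c \<odot>\<^bsub>R\<^esub> r) r' (Poly_Mapping.single u 1)"
proof -
  have "Poly_Mapping.single u c = c \<odot>\<^bsub>G\<^esub> Poly_Mapping.single u 1" by (simp add: G.smult_eq)
  then show ?thesis
    unfolding hten_def using assms HT.pure_balanced[of "pure_tensor R (op_algebra R) r r'" c "Poly_Mapping.single u 1"]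
    by (simp add: RT.pure_scale G.single_closed)
qed

definition "\<iota> r = ht r \<one>\<^bsub>R\<^esub> \<one>\<^bsub>G\<^esub>"
definition "\<iota>' r = ht \<one>\<^bsub>R\<^esub> r \<one>\<^bsub>G\<^esub>"
definition "jj g = ht \<one>\<^bsub>R\<^esub> \<one>\<^bsub>R\<^esub> g"

lemma \<iota>_hom: "\<iota> \<in> k_algebra_hom R H"
  using khom_comp[OF RT.pure_left_hom HT.pure_left_hom]
  unfolding \<iota>_def[abs_def] hten_def HQ_def by simp

lemma \<iota>'_hom: "\<iota>' \<in> k_algebra_hom (op_algebra R) H"
  using khom_comp[OF RT.pure_right_hom HT.pure_left_hom]
  unfolding \<iota>'_def[abs_def] hten_def HQ_def by simp

lemma jj_hom: "jj \<in> k_algebra_hom G H"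
  using HT.pure_right_hom RT.pure_one
  unfolding jj_def[abs_def] hten_def HQ_def by simp

lemma ht_closeds [simp]:
  "r \<in> carrier R \<Longrightarrow> \<iota> r \<in> carrier H" "r \<in> carrier R \<Longrightarrow> \<iota>' r \<in> carrier H" "g \<in> carrier G \<Longrightarrow> jj g \<in> carrier H"
  by (simp_all add: \<iota>_def \<iota>'_def jj_def)

lemma ht_commute:
  "\<lbrakk>r \<in> carrier R; r' \<in> carrier R\<rbrakk> \<Longrightarrow> \<iota>' r' \<otimes>\<^bsub>H\<^esub> \<iota> r = \<iota> r \<otimes>\<^bsub>H\<^esub> \<iota>' r'"
  "\<lbrakk>r \<in> carrier R; g \<in> carrier G\<rbrakk> \<Longrightarrow> jj g \<otimes>\<^bsub>H\<^esub> \<iota> r = \<iota> r \<otimes>\<^bsub>H\<^esub> jj g"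
  "\<lbrakk>r' \<in> carrier R; g \<in> carrier G\<rbrakk> \<Longrightarrow> jj g \<otimes>\<^bsub>H\<^esub> \<iota>' r' = \<iota>' r' \<otimes>\<^bsub>H\<^esub> jj g"
  by (simp_all add: \<iota>_def \<iota>'_def jj_def ht_mult)

lemma ht_eq: "\<lbrakk>r \<in> carrier R; r' \<in> carrier R; g \<in> carrier G\<rbrakk> \<Longrightarrow> ht r r' g = \<iota> r \<otimes>\<^bsub>H\<^esub> (\<iota>' r' \<otimes>\<^bsub>H\<^esub> jj g)"
  by (simp add: \<iota>_def \<iota>'_def jj_def ht_mult)

lemma vertex_closed: "ee (vertex l) (vertex m) \<in> carrier G"
  using path_pairsI[of "[]" XX 0 "[]" dg l m] by (intro G.single_closed) (simp add: tuples_0)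

lemma row_closed [simp]: "row l \<in> carrier G" and col_closed [simp]: "col l \<in> carrier G"
  unfolding row_def col_def by (intro G.sum_closed vertex_closed)+

lemma pword_closed [simp]: "\<lbrakk>xs \<in> tuples XX n; ys \<in> tuples XX n\<rbrakk> \<Longrightarrow> pword dg xs ys \<in> carrier G"
  unfolding pword_def by (intro G.sum_closed G.single_closed path_pairsI)

lemma G_one: "\<one>\<^bsub>G\<^esub> = (\<Sum>l\<in>UNIV. \<Sum>m\<in>UNIV. ee (vertex l) (vertex m))"
  by (simp add: path_algebra_def)

lemma jj_sum: "(\<And>i. i \<in> I \<Longrightarrow> g i \<in> carrier G) \<Longrightarrow> jj (\<Sum>i\<in>I. g i) = (\<Oplus>\<^bsub>H\<^esub>i\<in>I. jj (g i))"
  by (rule G.addhom_sum[OF khom_addhom[OF jj_hom] H.abelian_group])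

lemma jj_mult: "\<lbrakk>g \<in> carrier G; h \<in> carrier G\<rbrakk> \<Longrightarrow> jj g \<otimes>\<^bsub>H\<^esub> jj h = jj (pm_mult (path_op dg) g h)"
  using khom_mult[OF jj_hom] by (simp add: G.mult_eq)

lemma jj_zero: "jj 0 = \<zero>\<^bsub>H\<^esub>"
  using addhom_zero[OF khom_addhom[OF jj_hom] GA.abelian_group H.abelian_group] by (simp add: G.zero_eq)

sublocale sH: idempotents R H \<iota> "\<lambda>l. jj (row l)"
proof (intro idempotents.intro R.k_algebra_axioms H.k_algebra_axioms idempotents_axioms.intro \<iota>_hom)
  show "(\<Oplus>\<^bsub>H\<^esub>l\<in>UNIV. jj (row l)) = \<one>\<^bsub>H\<^esub>"
    using jj_sum[of UNIV row] khom_one[OF jj_hom] by (simp add: sum_row G_one)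
qed (simp_all add: ht_commute jj_mult row_mult_row jj_zero)

sublocale tH: idempotents "op_algebra R" H \<iota>' "\<lambda>l. jj (col l)"
proof (intro idempotents.intro k_algebra_op R.k_algebra_axioms H.k_algebra_axioms idempotents_axioms.intro \<iota>'_hom)
  show "(\<Oplus>\<^bsub>H\<^esub>l\<in>UNIV. jj (col l)) = \<one>\<^bsub>H\<^esub>"
    using jj_sum[of UNIV col] khom_one[OF jj_hom] by (simp add: sum_col G_one)
qed (simp_all add: ht_commute jj_mult col_mult_col jj_zero)

abbreviation "s_H \<equiv> sH.map_ext"
abbreviation "t_H \<equiv> tH.map_ext"
abbreviation "l_H (k :: bool) a b \<equiv> jj (pword dg [a] [b])"

lemma in_tuples1: "a \<in> XX \<Longrightarrow> [a] \<in> tuples XX 1"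
  by (simp add: tuples_def)

lemma pword1_closed [simp]: "\<lbrakk>a \<in> XX; b \<in> XX\<rbrakk> \<Longrightarrow> pword dg [a] [b] \<in> carrier G"
  by (rule pword_closed[OF in_tuples1 in_tuples1])

sublocale HC: coefficients R H XX s_H t_H "{True}" "signed_shift dg" l_H
proof (intro coefficients.intro coefficients_axioms.intro R.k_algebra_axioms H.k_algebra_axioms finite_XX sH.map_ext_hom)
  show "t_H \<in> k_algebra_hom (op_algebra M) H"
    using tH.map_ext_hom by (simp add: map_algebra_op)
  fix f g :: "'l \<Rightarrow> 'r" assume f: "f \<in> carrier M" and g: "g \<in> carrier M"
  then have fg: "f l \<in> carrier R" "g l \<in> carrier R" for l by auto
  have "s_H f \<otimes>\<^bsub>H\<^esub> t_H g = t_H (shift id g) \<otimes>\<^bsub>H\<^esub> s_H f"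
  proof (rule tH.map_ext_shift)
    show "s_H f \<otimes>\<^bsub>H\<^esub> \<iota>' r = \<iota>' r \<otimes>\<^bsub>H\<^esub> s_H f" if "r \<in> carrier (op_algebra R)" for r
    proof -
      have "\<iota>' r \<otimes>\<^bsub>H\<^esub> s_H f = s_H (shift id f) \<otimes>\<^bsub>H\<^esub> \<iota>' r"
        by (rule sH.map_ext_shift) (use that f in \<open>simp_all add: ht_commute del: map_algebra_simps(1)\<close>)
      then show ?thesis by (simp add: shift_def)
    qed
    show "s_H f \<otimes>\<^bsub>H\<^esub> jj (col (id m)) = jj (col m) \<otimes>\<^bsub>H\<^esub> s_H f" for m
    proof -
      have "jj (col m) \<otimes>\<^bsub>H\<^esub> s_H f = s_H (shift id f) \<otimes>\<^bsub>H\<^esub> jj (col m)"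
        by (rule sH.map_ext_shift)
          (use f in \<open>simp_all add: ht_commute jj_mult row_mult_col col_mult_row del: map_algebra_simps(1)\<close>)
      then show ?thesis by (simp add: shift_def)
    qed
  qed (use fg in \<open>simp_all add: sH.map_ext_closed\<close>)
  then show "s_H f \<otimes>\<^bsub>H\<^esub> t_H g = t_H g \<otimes>\<^bsub>H\<^esub> s_H f" by (simp add: shift_def)
next
  fix k a b assume *: "k \<in> {True}" "a \<in> XX" "b \<in> XX"
  show "jj (pword dg [a] [b]) \<in> carrier H" using * by simp
  fix f :: "'l \<Rightarrow> 'r" assume f: "f \<in> carrier M"
  show "jj (pword dg [a] [b]) \<otimes>\<^bsub>H\<^esub> s_H f = s_H (shift (signed_shift dg k a) f) \<otimes>\<^bsub>H\<^esub> jj (pword dg [a] [b])"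
    by (rule sH.map_ext_shift)
      (use * f bij_deg in \<open>simp_all add: ht_commute jj_mult signed_shift_def pword_row bij_is_inj del: map_algebra_simps(1)\<close>)
  show "jj (pword dg [a] [b]) \<otimes>\<^bsub>H\<^esub> t_H f = t_H (shift (signed_shift dg k b) f) \<otimes>\<^bsub>H\<^esub> jj (pword dg [a] [b])"
    by (rule tH.map_ext_shift)
      (use * f bij_deg in \<open>simp_all add: ht_commute jj_mult signed_shift_def pword_col bij_is_inj\<close>)
qed

lemma pword_Nil: "pword dg [] [] = \<one>\<^bsub>G\<^esub>"
  by (simp add: pword_def G_one)

lemma HC_word: "\<lbrakk>xs \<in> tuples XX n; ys \<in> tuples XX n\<rbrakk> \<Longrightarrow> HC.wd (replicate n True) xs ys = jj (pword dg xs ys)"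
proof (induction n arbitrary: xs ys)
  case 0
  then show ?case using khom_one[OF jj_hom] by (simp add: tuples_0 pword_Nil)
next
  case (Suc n)
  obtain a xs' b ys' where e: "xs = a # xs'" "ys = b # ys'" "a \<in> XX" "b \<in> XX" "xs' \<in> tuples XX n" "ys' \<in> tuples XX n"
    using Suc.prems by (auto simp: tuples_Suc)
  then show ?case
    using Suc.IH[OF e(5,6)] jj_mult[OF pword1_closed pword_closed, of a b xs' n ys'] by (simp add: pword_append)
qed

lemma delta_closed [simp]: "delta_map R l \<in> carrier M" and const_closed [simp]: "r \<in> carrier R \<Longrightarrow> const_map r \<in> carrier M"
  by (auto simp: delta_map_def const_map_def)

text \<open>
  The basis elements of \<open>\<HH>(Q)\<close> in terms of its coefficients: \<open>s\<close> and \<open>t\<close> of a point mass select the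
  sources of the two paths, the word prescribes their labels.
\<close>

lemma ht_single_eq:
  assumes r: "r \<in> carrier R" "r' \<in> carrier R" and xs: "xs \<in> tuples XX n" "ys \<in> tuples XX n"
  shows "ht r r' (ee (path_from dg l xs) (path_from dg m ys)) =
    s_H (const_map r \<otimes>\<^bsub>M\<^esub> delta_map R l) \<otimes>\<^bsub>H\<^esub>
      (t_H (delta_map R m \<otimes>\<^bsub>M\<^esub> const_map r') \<otimes>\<^bsub>H\<^esub> HC.wd (replicate n True) xs ys)"
proof -
  have t: "t_H (delta_map R m \<otimes>\<^bsub>M\<^esub> const_map r') = \<iota>' r' \<otimes>\<^bsub>H\<^esub> jj (col m)"
  proof -
    have "delta_map (op_algebra R) m = delta_map R m" by (simp add: delta_map_def fun_eq_iff)
    then show ?thesis using tH.map_ext_single[of r' m] r by (simp add: map_algebra_op)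
  qed
  have "ht r r' (ee (path_from dg l xs) (path_from dg m ys)) =
      \<iota> r \<otimes>\<^bsub>H\<^esub> (\<iota>' r' \<otimes>\<^bsub>H\<^esub> (jj (row l) \<otimes>\<^bsub>H\<^esub> (jj (col m) \<otimes>\<^bsub>H\<^esub> jj (pword dg xs ys))))"
  proof -
    have c: "pm_mult (path_op dg) (col m) (pword dg xs ys) \<in> carrier G"
      using GA.A.m_closed[OF col_closed pword_closed[OF xs]] by (simp add: G.mult_eq)
    have "ee (path_from dg l xs) (path_from dg m ys) \<in> carrier G"
      by (rule G.single_closed[OF path_pairsI[OF xs]])
    then show ?thesis using r c pword_closed[OF xs] by (simp add: ht_eq jj_mult row_col_pword)
  qed
  also have "\<dots> = \<iota> r \<otimes>\<^bsub>H\<^esub> jj (row l) \<otimes>\<^bsub>H\<^esub> (\<iota>' r' \<otimes>\<^bsub>H\<^esub> jj (col m) \<otimes>\<^bsub>H\<^esub> jj (pword dg xs ys))"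
    using r pword_closed[OF xs] ht_commute(3)[OF r(2) row_closed[of l]]
    by (simp add: H.A.m_assoc) (simp add: H.A.m_assoc[symmetric])
  finally show ?thesis using HC_word[OF xs] sH.map_ext_single[OF r(1), of l] by (simp add: t)
qed

lemma ht_add:
  "\<lbrakk>r \<in> carrier R; r' \<in> carrier R; g \<in> carrier G; h \<in> carrier G\<rbrakk> \<Longrightarrow> ht r r' (g + h) = ht r r' g \<oplus>\<^bsub>H\<^esub> ht r r' h"
  using HT.pure_add_right[of "pure_tensor R (op_algebra R) r r'" g h]
  by (simp add: hten_def HQ_def G.add_eq)

lemma H_induct [consumes 1, case_names base add]:
  assumes x: "x \<in> carrier H"
    and base: "\<And>r r' p q. \<lbrakk>r \<in> carrier R; r' \<in> carrier R; (p, q) \<in> path_pairs XX dg\<rbrakk> \<Longrightarrow> P (ht r r' (ee p q))"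
    and add: "\<And>x y. \<lbrakk>x \<in> carrier H; y \<in> carrier H; P x; P y\<rbrakk> \<Longrightarrow> P (x \<oplus>\<^bsub>H\<^esub> y)"
  shows "P x"
proof -
  have ht_0: "P (ht r r' 0)" if "r \<in> carrier R" "r' \<in> carrier R" for r r'
  proof -
    have v: "(vertex l, vertex m) \<in> path_pairs XX dg" for l m :: 'l
      using path_pairsI[of "[]" XX 0 "[]" dg l m] by (simp add: tuples_0)
    obtain l :: 'l where True by simp
    have "ht r r' 0 = ht \<zero>\<^bsub>R\<^esub> r' (ee (vertex l) (vertex l))"
      using ht_coeff[OF that v, of l l 0] that by simp
    then show ?thesis using base[of "\<zero>\<^bsub>R\<^esub>" r' "vertex l" "vertex l"] v that by simp
  qed
  have 1: "P (ht r r' g)" if r: "r \<in> carrier R" "r' \<in> carrier R" and g: "g \<in> carrier G" for r r' g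
    using g
  proof (induction rule: G.basis_induct)
    case zero
    then show ?case by (rule ht_0[OF r])
  next
    case (single u c)
    then show ?case using ht_coeff[OF r single, of c] base[of "c \<odot>\<^bsub>R\<^esub> r" r' "fst u" "snd u"] r by simp
  next
    case (add f g)
    then show ?case using assms(3)[of "ht r r' f" "ht r r' g"] r by (simp add: ht_add)
  qed
  have 2: "P (pure_tensor RR G W g)" if W: "W \<in> carrier RR" and g: "g \<in> carrier G" for W g
    using W
  proof (induction rule: RT.pure_induct)
    case (el r r')
    then show ?case using 1[of r r' g] g by (simp add: hten_def)
  next
    case (add U V)
    then show ?case
      using assms(3)[of "pure_tensor RR G U g" "pure_tensor RR G V g"] g HT.pure_closed[of U g] HT.pure_closed[of V g]
      by (simp add: HT.pure_add_left HQ_def)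
  qed
  show ?thesis
    using x unfolding HQ_def
  proof (induction rule: HT.pure_induct)
    case (el W g)
    then show ?case by (rule 2)
  next
    case (add U V)
    then show ?case using assms(3)[of U V] by (simp add: HQ_def)
  qed
qed

lemma replicate_True [simp]: "replicate n True \<in> lists {True}"
  by (induction n) simp_all

lemma HC_spanned: "carrier H \<subseteq> HC.coeff_span"
proof
  fix x assume "x \<in> carrier H"
  then show "x \<in> HC.coeff_span"
  proof (induction rule: H_induct)
    case (base r r' p q)
    obtain n l xs m ys where pq: "p = path_from dg l xs" "q = path_from dg m ys" "xs \<in> tuples XX n" "ys \<in> tuples XX n"
      using base(3) by (auto elim: path_pairsE)
    show ?case
      unfolding pq(1,2) ht_single_eq[OF base(1,2) pq(3,4)]
      by (rule HC.coeff_span.base) (use base pq M.A.m_closed[OF const_closed delta_closed, of r l]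
        M.A.m_closed[OF delta_closed const_closed, of r' m] in \<open>simp_all del: map_algebra_simps\<close>)
  next
    case (add x y)
    then show ?case using HC.coeff_span.add by blast
  qed
qed

end

context coefficients
begin

lemma normal_form_mult:
  assumes f: "f \<in> carrier M" "g \<in> carrier M" "f' \<in> carrier M" "g' \<in> carrier M"
    and w: "ks \<in> lists K" "as \<in> tuples XX (length ks)" "bs \<in> tuples XX (length ks)"
    and w': "ks' \<in> lists K" "as' \<in> tuples XX (length ks')" "bs' \<in> tuples XX (length ks')"
  shows "(s f \<otimes>\<^bsub>B\<^esub> (t g \<otimes>\<^bsub>B\<^esub> wd ks as bs)) \<otimes>\<^bsub>B\<^esub> (s f' \<otimes>\<^bsub>B\<^esub> (t g' \<otimes>\<^bsub>B\<^esub> wd ks' as' bs')) =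
    s (f \<otimes>\<^bsub>M\<^esub> shift (word_shift ks as) f') \<otimes>\<^bsub>B\<^esub>
      (t (shift (word_shift ks bs) g' \<otimes>\<^bsub>M\<^esub> g) \<otimes>\<^bsub>B\<^esub> wd (ks @ ks') (as @ as') (bs @ bs'))"
proof -
  let ?W = "wd ks as bs" and ?W' = "wd ks' as' bs'"
  let ?f = "shift (word_shift ks as) f'" and ?g = "shift (word_shift ks bs) g'"
  note W = wd_closed[OF w] and W' = wd_closed[OF w']
  note c = f[THEN s_closed] f[THEN t_closed] s_closed[OF shift_closed[OF f(3), of "word_shift ks as"]]
    t_closed[OF shift_closed[OF f(4), of "word_shift ks bs"]]
    s_closed[OF M.A.m_closed[OF f(1) shift_closed[OF f(3), of "word_shift ks as"]]]
    t_closed[OF M.A.m_closed[OF shift_closed[OF f(4), of "word_shift ks bs"] f(2)]] W W'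
  have 1: "?W \<otimes>\<^bsub>B\<^esub> (s f' \<otimes>\<^bsub>B\<^esub> x) = s ?f \<otimes>\<^bsub>B\<^esub> (?W \<otimes>\<^bsub>B\<^esub> x)" if "x \<in> carrier B" for x
    using that c wd_s[OF w f(3)] by (simp add: B.A.m_assoc[symmetric])
  have 2: "?W \<otimes>\<^bsub>B\<^esub> (t g' \<otimes>\<^bsub>B\<^esub> x) = t ?g \<otimes>\<^bsub>B\<^esub> (?W \<otimes>\<^bsub>B\<^esub> x)" if "x \<in> carrier B" for x
    using that c wd_t[OF w f(4)] by (simp add: B.A.m_assoc[symmetric])
  have 3: "t g \<otimes>\<^bsub>B\<^esub> (s ?f \<otimes>\<^bsub>B\<^esub> x) = s ?f \<otimes>\<^bsub>B\<^esub> (t g \<otimes>\<^bsub>B\<^esub> x)" if "x \<in> carrier B" for x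
    using that c s_t[OF shift_closed[OF f(3), of "word_shift ks as"] f(2)] by (simp add: B.A.m_assoc[symmetric])
  have 4: "s f \<otimes>\<^bsub>B\<^esub> (s ?f \<otimes>\<^bsub>B\<^esub> x) = s (f \<otimes>\<^bsub>M\<^esub> ?f) \<otimes>\<^bsub>B\<^esub> x"
    "t g \<otimes>\<^bsub>B\<^esub> (t ?g \<otimes>\<^bsub>B\<^esub> x) = t (?g \<otimes>\<^bsub>M\<^esub> g) \<otimes>\<^bsub>B\<^esub> x" if "x \<in> carrier B" for x
    using that c s_mult[OF f(1) shift_closed[OF f(3), of "word_shift ks as"]]
      t_mult[OF f(2) shift_closed[OF f(4), of "word_shift ks bs"]] by (simp_all add: B.A.m_assoc[symmetric])
  show ?thesis
    unfolding wd_append[OF w w'] using c by (simp add: B.A.m_assoc 1 2 3 4)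
qed

end

section \<open>The universal property of \<open>\<HH>(Q)\<close>\<close>

context quiver_data
begin

lemma const_one: "const_map \<one>\<^bsub>R\<^esub> = \<one>\<^bsub>M\<^esub>"
  by (simp add: const_map_def map_algebra_def)

lemma const_hom: "const_map \<in> k_algebra_hom R M"
  by (rule k_algebra_homI) (auto simp: const_map_def map_algebra_def)

lemma const_op_hom: "const_map \<in> k_algebra_hom (op_algebra R) (op_algebra M)"
  by (rule k_algebra_homI) (auto simp: const_map_def map_algebra_def op_algebra_def)

lemma delta_commute: "f \<in> carrier M \<Longrightarrow> delta_map R l \<otimes>\<^bsub>M\<^esub> f = f \<otimes>\<^bsub>M\<^esub> delta_map R l"
  by (auto simp: fun_eq_iff delta_map_def)

lemma const_delta: "f \<in> carrier M \<Longrightarrow> const_map (f l) \<otimes>\<^bsub>M\<^esub> delta_map R l = f \<otimes>\<^bsub>M\<^esub> delta_map R l"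
  by (auto simp: fun_eq_iff delta_map_def const_map_def)

lemma delta_shift: "delta_map R l \<otimes>\<^bsub>M\<^esub> shift \<beta> (delta_map R m) = (if \<beta> l = m then delta_map R l else \<zero>\<^bsub>M\<^esub>)"
  by (auto simp: fun_eq_iff delta_map_def shift_def)

lemma shift_const: "shift \<beta> (const_map r) = const_map r"
  by (simp add: shift_def const_map_def)

lemma sum_delta:
  assumes f: "f \<in> carrier M"
  shows "(\<Oplus>\<^bsub>M\<^esub>l\<in>UNIV. f \<otimes>\<^bsub>M\<^esub> delta_map R l) = f"
proof
  fix m
  have "(\<Oplus>\<^bsub>M\<^esub>l\<in>UNIV. f \<otimes>\<^bsub>M\<^esub> delta_map R l) m = (\<Oplus>\<^bsub>R\<^esub>l\<in>UNIV. (f \<otimes>\<^bsub>M\<^esub> delta_map R l) m)"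
    by (rule map_algebra_finsum[OF R.k_algebra_axioms]) (rule M.A.m_closed[OF f delta_closed])
  also have "\<dots> = (\<Oplus>\<^bsub>R\<^esub>l\<in>UNIV. if l = m then f m else \<zero>\<^bsub>R\<^esub>)"
    by (rule R.finsum_cong') (use f in \<open>auto simp: delta_map_def\<close>)
  also have "\<dots> = f m" by (rule R.finsum_delta) (use f in auto)
  finally show "(\<Oplus>\<^bsub>M\<^esub>l\<in>UNIV. f \<otimes>\<^bsub>M\<^esub> delta_map R l) m = f m" .
qed

context
  fixes B :: "('k, 'b) module" and s t K l
  assumes BC: "coefficients R B XX s t K (signed_shift dg) l" and TK: "True \<in> K"
begin

interpretation B: coefficients R B XX s t K "signed_shift dg" l by (rule BC)

lemma replicate_K: "replicate n True \<in> lists K"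
  using TK by (induction n) simp_all

lemma word_shift_walk: "xs \<in> tuples XX n \<Longrightarrow> B.word_shift (replicate n True) xs m = walk dg m xs"
  by (induction n arbitrary: xs m) (auto simp: tuples_0 tuples_Suc signed_shift_def)

text \<open>
  The images of the pairs of paths are forced by the normal form of the basis elements, in which
  \<open>s\<close>, \<open>t\<close> and the words are now those of \<open>B\<close>.
\<close>

definition path_val where
  "path_val u = s (delta_map R (fst (fst u))) \<otimes>\<^bsub>B\<^esub> (t (delta_map R (fst (snd u))) \<otimes>\<^bsub>B\<^esub>
    coeff_word B l (replicate (length (snd (fst u))) True) (map snd (snd (fst u))) (map snd (snd (snd u))))"

lemma path_val_eq: "xs \<in> tuples XX n \<Longrightarrow> path_val (path_from dg m xs, path_from dg m' ys) =
    s (delta_map R m) \<otimes>\<^bsub>B\<^esub> (t (delta_map R m') \<otimes>\<^bsub>B\<^esub> B.wd (replicate n True) xs ys)"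
  by (simp add: path_val_def tuples_def)

lemma path_val_closed: "u \<in> path_pairs XX dg \<Longrightarrow> path_val u \<in> carrier B"
  by (elim path_pairsE)
    (simp add: path_val_eq B.s_closed B.t_closed B.wd_closed[OF replicate_K] B.B.A.m_closed del: path_from_simps map_algebra_simps(1))

lemma wd_append_replicate:
  assumes "xs \<in> tuples XX n" "ys \<in> tuples XX n" "xs' \<in> tuples XX n'" "ys' \<in> tuples XX n'"
    "f \<in> carrier M" "g \<in> carrier M" "f' \<in> carrier M" "g' \<in> carrier M"
  shows "(s f \<otimes>\<^bsub>B\<^esub> (t g \<otimes>\<^bsub>B\<^esub> B.wd (replicate n True) xs ys)) \<otimes>\<^bsub>B\<^esub>
      (s f' \<otimes>\<^bsub>B\<^esub> (t g' \<otimes>\<^bsub>B\<^esub> B.wd (replicate n' True) xs' ys')) =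
    s (f \<otimes>\<^bsub>M\<^esub> shift (\<lambda>m. walk dg m xs) f') \<otimes>\<^bsub>B\<^esub>
      (t (shift (\<lambda>m. walk dg m ys) g' \<otimes>\<^bsub>M\<^esub> g) \<otimes>\<^bsub>B\<^esub> B.wd (replicate (n + n') True) (xs @ xs') (ys @ ys'))"
proof -
  have "B.word_shift (replicate n True) xs = (\<lambda>m. walk dg m xs)" "B.word_shift (replicate n True) ys = (\<lambda>m. walk dg m ys)"
    using word_shift_walk assms by blast+
  then show ?thesis
    using B.normal_form_mult[OF assms(5-8) replicate_K[of n] _ _ replicate_K[of n'], of xs ys xs' ys'] assms(1-4)
    by (simp add: replicate_add)
qed

lemma s_zero: "s \<zero>\<^bsub>M\<^esub> = \<zero>\<^bsub>B\<^esub>" and t_zero: "t \<zero>\<^bsub>M\<^esub> = \<zero>\<^bsub>B\<^esub>"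
  using addhom_zero[OF B.s_addhom M.abelian_group B.B.abelian_group]
    addhom_zero[OF B.t_addhom M.abelian_group B.B.abelian_group] by simp_all

lemma sum_s: "x \<in> carrier B \<Longrightarrow> (\<Oplus>\<^bsub>B\<^esub>m\<in>UNIV. s (delta_map R m) \<otimes>\<^bsub>B\<^esub> x) = x"
  and sum_t: "x \<in> carrier B \<Longrightarrow> (\<Oplus>\<^bsub>B\<^esub>m\<in>UNIV. t (delta_map R m) \<otimes>\<^bsub>B\<^esub> x) = x"
proof -
  assume x: "x \<in> carrier B"
  have one: "(\<Oplus>\<^bsub>M\<^esub>l\<in>UNIV. delta_map R l) = \<one>\<^bsub>M\<^esub>"
    using sum_delta[OF M.A.one_closed] M.A.l_one[OF delta_closed] by (simp del: map_algebra_simps)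
  have s: "(\<Oplus>\<^bsub>B\<^esub>m\<in>UNIV. s (delta_map R m)) = \<one>\<^bsub>B\<^esub>" and t: "(\<Oplus>\<^bsub>B\<^esub>m\<in>UNIV. t (delta_map R m)) = \<one>\<^bsub>B\<^esub>"
    using addhom_finsum[OF B.s_addhom M.abelian_group B.B.abelian_group, of "delta_map R" UNIV]
      addhom_finsum[OF B.t_addhom M.abelian_group B.B.abelian_group, of "delta_map R" UNIV] one B.s_one B.t_one
    by (simp_all add: Pi_iff del: map_algebra_simps)
  show "(\<Oplus>\<^bsub>B\<^esub>m\<in>UNIV. s (delta_map R m) \<otimes>\<^bsub>B\<^esub> x) = x"
    by (subst B.B.A.finsum_ldistr[symmetric]) (use x s B.s_closed[OF delta_closed] in auto)
  show "(\<Oplus>\<^bsub>B\<^esub>m\<in>UNIV. t (delta_map R m) \<otimes>\<^bsub>B\<^esub> x) = x"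
    by (subst B.B.A.finsum_ldistr[symmetric]) (use x t B.t_closed[OF delta_closed] in auto)
qed

definition "path_hom = basis_extend B path_val"

lemma path_hom_addhom: "path_hom \<in> addhom G B"
  unfolding path_hom_def by (rule G.basis_extend_addhom[OF B.B.k_algebra_axioms path_val_closed])

lemma path_hom_single: "u \<in> path_pairs XX dg \<Longrightarrow> path_hom (Poly_Mapping.single u c) = c \<odot>\<^bsub>B\<^esub> path_val u"
  unfolding path_hom_def by (rule basis_extend_single[OF B.B.k_algebra_axioms]) (rule path_val_closed)

lemma path_hom_ee:
  assumes xs: "xs \<in> tuples XX n" "ys \<in> tuples XX n"
  shows "path_hom (ee (path_from dg m xs) (path_from dg m' ys)) =
    s (delta_map R m) \<otimes>\<^bsub>B\<^esub> (t (delta_map R m') \<otimes>\<^bsub>B\<^esub> B.wd (replicate n True) xs ys)"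
  using path_hom_single[OF path_pairsI[OF xs], of m m' 1] path_val_closed[OF path_pairsI[OF xs], of m m']
  by (simp add: path_val_eq[OF xs(1)])

lemma path_hom_sum: "(\<And>i. i \<in> I \<Longrightarrow> g i \<in> carrier G) \<Longrightarrow> path_hom (\<Sum>i\<in>I. g i) = (\<Oplus>\<^bsub>B\<^esub>i\<in>I. path_hom (g i))"
  by (rule G.addhom_sum[OF path_hom_addhom B.B.abelian_group])

text \<open>
  Point masses sum to one, so the restriction on the sources disappears in the sum over them.
\<close>

lemma path_hom_pword:
  assumes xs: "xs \<in> tuples XX n" "ys \<in> tuples XX n"
  shows "path_hom (pword dg xs ys) = B.wd (replicate n True) xs ys"
proof -
  note c = G.single_closed[OF path_pairsI[OF xs]]
  note W = B.wd_closed[OF replicate_K xs]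
  have tc: "t (delta_map R m) \<otimes>\<^bsub>B\<^esub> B.wd (replicate n True) xs ys \<in> carrier B" for m
    using B.t_closed[OF delta_closed] W by simp
  have "path_hom (pword dg xs ys) = (\<Oplus>\<^bsub>B\<^esub>m\<in>UNIV. \<Oplus>\<^bsub>B\<^esub>m'\<in>UNIV.
      s (delta_map R m) \<otimes>\<^bsub>B\<^esub> (t (delta_map R m') \<otimes>\<^bsub>B\<^esub> B.wd (replicate n True) xs ys))"
    unfolding pword_def by (simp add: path_hom_sum c G.sum_closed path_hom_ee[OF xs])
  also have "\<dots> = (\<Oplus>\<^bsub>B\<^esub>m\<in>UNIV. s (delta_map R m) \<otimes>\<^bsub>B\<^esub> B.wd (replicate n True) xs ys)"
    by (subst B.B.A.finsum_rdistr[symmetric])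
      (use tc W B.s_closed[OF delta_closed] in \<open>auto simp: sum_t[OF W] simp del: map_algebra_simps(1)\<close>)
  also have "\<dots> = B.wd (replicate n True) xs ys" by (rule sum_s[OF W])
  finally show ?thesis .
qed

lemma path_hom_one: "path_hom \<one>\<^bsub>G\<^esub> = \<one>\<^bsub>B\<^esub>"
  using path_hom_pword[of "[]" 0 "[]"] by (simp add: tuples_0 pword_Nil)

lemma path_hom_row: "path_hom (row m) = s (delta_map R m)"
  and path_hom_col: "path_hom (col m) = t (delta_map R m)"
proof -
  have v: "path_hom (ee (vertex m) (vertex m')) = s (delta_map R m) \<otimes>\<^bsub>B\<^esub> t (delta_map R m')" for m m'
    using path_hom_ee[of "[]" 0 "[]" m m'] B.t_closed[OF delta_closed, of m'] by (simp add: tuples_0)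
  have c: "s (delta_map R m) \<in> carrier B" "t (delta_map R m) \<in> carrier B" for m
    by (rule B.s_closed B.t_closed, rule delta_closed)+
  have comm: "s (delta_map R m) \<otimes>\<^bsub>B\<^esub> t (delta_map R m') = t (delta_map R m') \<otimes>\<^bsub>B\<^esub> s (delta_map R m)" for m m'
    by (rule B.s_t) (rule delta_closed)+
  show "path_hom (row m) = s (delta_map R m)"
    unfolding row_def using sum_t[OF c(1), of m] by (simp add: path_hom_sum vertex_closed v comm)
  show "path_hom (col m) = t (delta_map R m)"
    unfolding col_def using sum_s[OF c(2), of m] by (simp add: path_hom_sum vertex_closed v)
qed

text \<open>
  When two words are multiplied, the point mass of the second source is moved through the first
  word and becomes the condition that the first path ends where the second one starts.
\<close>

lemma path_hom_hom: "path_hom \<in> k_algebra_hom G B"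
proof -
  have "path_val u \<otimes>\<^bsub>B\<^esub> path_val v = (case path_op dg u v of None \<Rightarrow> \<zero>\<^bsub>B\<^esub> | Some w \<Rightarrow> path_val w)"
    if u: "u \<in> path_pairs XX dg" and v: "v \<in> path_pairs XX dg" for u v
  proof -
    obtain n m xs m' ys where u: "u = (path_from dg m xs, path_from dg m' ys)" and xs: "xs \<in> tuples XX n" "ys \<in> tuples XX n"
      using u by (rule path_pairsE)
    obtain k h us h' vs where v: "v = (path_from dg h us, path_from dg h' vs)" and us: "us \<in> tuples XX k" "vs \<in> tuples XX k"
      using v by (rule path_pairsE)
    note W = B.wd_closed[OF replicate_K tuples_append[OF xs(1) us(1)] tuples_append[OF xs(2) us(2)]]
    have tc: "t (delta_map R m') \<otimes>\<^bsub>B\<^esub> B.wd (replicate (n + k) True) (xs @ us) (ys @ vs) \<in> carrier B"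
      "s (delta_map R m) \<in> carrier B"
      using B.t_closed[OF delta_closed] B.s_closed[OF delta_closed] W by simp_all
    have "path_val u \<otimes>\<^bsub>B\<^esub> path_val v =
        s (if walk dg m xs = h then delta_map R m else \<zero>\<^bsub>M\<^esub>) \<otimes>\<^bsub>B\<^esub>
          (t (if walk dg m' ys = h' then delta_map R m' else \<zero>\<^bsub>M\<^esub>) \<otimes>\<^bsub>B\<^esub> B.wd (replicate (n + k) True) (xs @ us) (ys @ vs))"
      unfolding u v path_val_eq[OF xs(1)] path_val_eq[OF us(1)]
        wd_append_replicate[OF xs us delta_closed delta_closed delta_closed delta_closed]
        delta_shift delta_commute[OF B.shift_closed[OF delta_closed], symmetric] ..
    also have "\<dots> = (case path_op dg u v of None \<Rightarrow> \<zero>\<^bsub>B\<^esub> | Some w \<Rightarrow> path_val w)"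
      using W tc path_val_eq[OF tuples_append[OF xs(1) us(1)], of m m' "ys @ vs"]
      by (auto simp: u v s_zero t_zero simp del: replicate_add map_algebra_simps)
    finally show ?thesis .
  qed
  note mult = this
  show ?thesis
    unfolding path_hom_def
  proof (rule G.basis_extend_khom[OF B.B.k_algebra_axioms])
    show "basis_extend B path_val \<one>\<^bsub>G\<^esub> = \<one>\<^bsub>B\<^esub>" using path_hom_one by (simp add: path_hom_def)
  qed (rule path_val_closed mult; assumption)+
qed

definition "base_hom = tensor_lift B (\<lambda>r r'. s (const_map r) \<otimes>\<^bsub>B\<^esub> t (const_map r'))"
definition "quiver_hom = tensor_lift B (\<lambda>W g. base_hom W \<otimes>\<^bsub>B\<^esub> path_hom g)"

lemma base_hom_hom: "base_hom \<in> k_algebra_hom RR B"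
  and base_hom_pure: "\<lbrakk>r \<in> carrier R; r' \<in> carrier R\<rbrakk> \<Longrightarrow>
    base_hom (pure_tensor R (op_algebra R) r r') = s (const_map r) \<otimes>\<^bsub>B\<^esub> t (const_map r')"
proof -
  have comm: "t (const_map y) \<otimes>\<^bsub>B\<^esub> s (const_map x) = s (const_map x) \<otimes>\<^bsub>B\<^esub> t (const_map y)"
    if "x \<in> carrier R" "y \<in> carrier (op_algebra R)" for x y
    using B.s_t[OF const_closed const_closed, of x y] that by simp
  note h = khom_comp[OF const_hom B.s_hom] khom_comp[OF const_op_hom B.t_hom]
  show "base_hom \<in> k_algebra_hom RR B"
    unfolding base_hom_def by (rule RT.tensor_hom[OF B.B.k_algebra_axioms h comm])
  show "base_hom (pure_tensor R (op_algebra R) r r') = s (const_map r) \<otimes>\<^bsub>B\<^esub> t (const_map r')"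
    if "r \<in> carrier R" "r' \<in> carrier R"
    unfolding base_hom_def by (rule RT.tensor_hom_pure[OF B.B.k_algebra_axioms h comm]) (use that in simp_all)
qed

lemma path_base_commute:
  assumes W: "W \<in> carrier RR" and g: "g \<in> carrier G"
  shows "path_hom g \<otimes>\<^bsub>B\<^esub> base_hom W = base_hom W \<otimes>\<^bsub>B\<^esub> path_hom g"
  using W
proof (induction rule: RT.pure_induct)
  case (el r r')
  then have r: "const_map r \<in> carrier M" "const_map r' \<in> carrier M"
    by (simp_all only: const_closed op_algebra_simps)
  let ?x = "s (const_map r) \<otimes>\<^bsub>B\<^esub> t (const_map r')"
  have x: "?x \<in> carrier B" using B.s_closed[OF r(1)] B.t_closed[OF r(2)] by simp
  have "path_hom g \<otimes>\<^bsub>B\<^esub> ?x = ?x \<otimes>\<^bsub>B\<^esub> path_hom g"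
  proof (rule G.basis_ext[OF addhom_comp[OF path_hom_addhom B.B.mult_addhom_right[OF x]]
        addhom_comp[OF path_hom_addhom B.B.mult_addhom_left[OF x]] B.B.abelian_group _ g])
    fix u :: "('l, 'x) path \<times> ('l, 'x) path" and c :: 'k
    assume u': "u \<in> path_pairs XX dg"
    then obtain n m xs m' ys where u: "u = (path_from dg m xs, path_from dg m' ys)" and xs: "xs \<in> tuples XX n" "ys \<in> tuples XX n"
      by (rule path_pairsE)
    have nil: "[] \<in> tuples XX 0" by (simp add: tuples_0)
    have x_eq: "?x = s (const_map r) \<otimes>\<^bsub>B\<^esub> (t (const_map r') \<otimes>\<^bsub>B\<^esub> B.wd (replicate 0 True) [] [])"
      using B.t_closed[OF r(2)] by simp
    have sid: "shift (\<lambda>m. walk dg m []) f = f" for f :: "'l \<Rightarrow> 'r" by (simp add: shift_def)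
    have "path_val u \<otimes>\<^bsub>B\<^esub> ?x = ?x \<otimes>\<^bsub>B\<^esub> path_val u"
      unfolding u path_val_eq[OF xs(1)] x_eq wd_append_replicate[OF xs nil nil delta_closed delta_closed r]
        wd_append_replicate[OF nil nil xs r delta_closed delta_closed] shift_const sid
        delta_commute[OF r(1)] delta_commute[OF r(2)] by simp
    then show "path_hom (Poly_Mapping.single u c) \<otimes>\<^bsub>B\<^esub> ?x = ?x \<otimes>\<^bsub>B\<^esub> path_hom (Poly_Mapping.single u c)"
      using x path_val_closed[OF u'] by (simp add: path_hom_single[OF u'] B.B.smult_mult_left B.B.smult_mult_right)
  qed
  then show ?case using el by (simp add: base_hom_pure)
next
  case (add U V)
  then show ?case
    using khom_closed[OF base_hom_hom] addhom_closed[OF path_hom_addhom g]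
    by (simp add: khom_add[OF base_hom_hom] B.B.A.l_distr B.B.A.r_distr)
qed

lemma quiver_hom_hom: "quiver_hom \<in> k_algebra_hom H B"
  unfolding quiver_hom_def HQ_def
  by (rule HT.tensor_hom[OF B.B.k_algebra_axioms base_hom_hom path_hom_hom path_base_commute])

lemma quiver_hom_ht:
  "\<lbrakk>r \<in> carrier R; r' \<in> carrier R; g \<in> carrier G\<rbrakk> \<Longrightarrow>
    quiver_hom (ht r r' g) = s (const_map r) \<otimes>\<^bsub>B\<^esub> t (const_map r') \<otimes>\<^bsub>B\<^esub> path_hom g"
  unfolding quiver_hom_def hten_def
  by (subst HT.tensor_hom_pure[OF B.B.k_algebra_axioms base_hom_hom path_hom_hom path_base_commute])
    (simp_all add: base_hom_pure)

lemma quiver_hom_parts: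
  "r \<in> carrier R \<Longrightarrow> quiver_hom (\<iota> r) = s (const_map r)"
  "r \<in> carrier R \<Longrightarrow> quiver_hom (\<iota>' r) = t (const_map r)"
  "g \<in> carrier G \<Longrightarrow> quiver_hom (jj g) = path_hom g"
  using B.s_closed[OF const_closed, of r] B.t_closed[OF const_closed, of r] addhom_closed[OF path_hom_addhom, of g]
  by (simp_all add: \<iota>_def \<iota>'_def jj_def quiver_hom_ht path_hom_one const_one B.s_one B.t_one del: map_algebra_simps)

lemma quiver_hom_s: "f \<in> carrier M \<Longrightarrow> quiver_hom (s_H f) = s f"
  and quiver_hom_t: "f \<in> carrier M \<Longrightarrow> quiver_hom (t_H f) = t f"
proof -
  assume f: "f \<in> carrier M"
  then have fl: "f m \<in> carrier R" for m by simp
  have fd: "f \<otimes>\<^bsub>M\<^esub> delta_map R m \<in> carrier M" for m by (rule M.A.m_closed[OF f delta_closed])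
  have "quiver_hom (s_H f) = (\<Oplus>\<^bsub>B\<^esub>m\<in>UNIV. quiver_hom (\<iota> (f m) \<otimes>\<^bsub>H\<^esub> jj (row m)))"
    unfolding sH.map_ext_def
    by (rule addhom_finsum[OF khom_addhom[OF quiver_hom_hom] H.abelian_group B.B.abelian_group]) (use fl in auto)
  also have "\<dots> = (\<Oplus>\<^bsub>B\<^esub>m\<in>UNIV. s (f \<otimes>\<^bsub>M\<^esub> delta_map R m))"
    using fl B.s_closed[OF fd] B.s_mult[OF const_closed delta_closed] const_delta[OF f]
    by (intro B.B.finsum_cong') (simp_all add: khom_mult[OF quiver_hom_hom] quiver_hom_parts path_hom_row del: map_algebra_simps)
  also have "\<dots> = s (\<Oplus>\<^bsub>M\<^esub>m\<in>UNIV. f \<otimes>\<^bsub>M\<^esub> delta_map R m)"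
    by (rule addhom_finsum[OF B.s_addhom M.abelian_group B.B.abelian_group, symmetric]) (use fd in blast)
  finally show "quiver_hom (s_H f) = s f" by (simp only: sum_delta[OF f])
  have "quiver_hom (t_H f) = (\<Oplus>\<^bsub>B\<^esub>m\<in>UNIV. quiver_hom (\<iota>' (f m) \<otimes>\<^bsub>H\<^esub> jj (col m)))"
    unfolding tH.map_ext_def
    by (rule addhom_finsum[OF khom_addhom[OF quiver_hom_hom] H.abelian_group B.B.abelian_group]) (use fl in auto)
  also have "\<dots> = (\<Oplus>\<^bsub>B\<^esub>m\<in>UNIV. t (f \<otimes>\<^bsub>M\<^esub> delta_map R m))"
    using fl B.t_closed[OF fd] B.t_mult[OF const_closed delta_closed] const_delta[OF f] delta_commute[OF const_closed]
    by (intro B.B.finsum_cong') (simp_all add: khom_mult[OF quiver_hom_hom] quiver_hom_parts path_hom_col del: map_algebra_simps)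
  also have "\<dots> = t (\<Oplus>\<^bsub>M\<^esub>m\<in>UNIV. f \<otimes>\<^bsub>M\<^esub> delta_map R m)"
    by (rule addhom_finsum[OF B.t_addhom M.abelian_group B.B.abelian_group, symmetric]) (use fd in blast)
  finally show "quiver_hom (t_H f) = t f" by (simp only: sum_delta[OF f])
qed

lemma quiver_hom_l: "\<lbrakk>a \<in> XX; b \<in> XX\<rbrakk> \<Longrightarrow> quiver_hom (l_H True a b) = l True a b"
  using path_hom_pword[OF in_tuples1 in_tuples1, of a b] B.l_closed[OF TK, of a b]
  by (simp add: quiver_hom_parts)

end

end

lemma coefficients_cong:
  assumes "coefficients R B XX s t K \<alpha> l"
    and s: "\<And>f. f \<in> carrier (map_algebra R) \<Longrightarrow> s' f = s f"
    and t: "\<And>f. f \<in> carrier (map_algebra R) \<Longrightarrow> t' f = t f"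
  shows "coefficients R B XX s' t' K \<alpha> l"
proof -
  interpret C: coefficients R B XX s t K \<alpha> l by (rule assms(1))
  have op: "k_algebra (op_algebra C.M)" by (rule k_algebra_op[OF C.M.k_algebra_axioms])
  interpret O: k_algebra "op_algebra C.M" by (rule op)
  show ?thesis
  proof (intro coefficients.intro coefficients_axioms.intro C.R.k_algebra_axioms C.B.k_algebra_axioms C.finite_X)
    show "s' \<in> k_algebra_hom C.M B"
      by (rule khom_cong[OF C.s_hom C.M.A.ring_axioms C.M.scale_closed s])
    show "t' \<in> k_algebra_hom (op_algebra C.M) B"
      by (rule khom_cong[OF C.t_hom O.A.ring_axioms O.scale_closed t]) (simp_all only: op_algebra_simps)
    show "s' f \<otimes>\<^bsub>B\<^esub> t' g = t' g \<otimes>\<^bsub>B\<^esub> s' f" if "f \<in> carrier C.M" "g \<in> carrier C.M" for f g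
      using C.s_t that by (simp only: s t)
  next
    fix i a b assume i: "i \<in> K" "a \<in> XX" "b \<in> XX"
    show "l i a b \<in> carrier B" by (rule C.l_closed[OF i])
    fix f assume f: "f \<in> carrier C.M"
    show "l i a b \<otimes>\<^bsub>B\<^esub> s' f = s' (shift (\<alpha> i a) f) \<otimes>\<^bsub>B\<^esub> l i a b"
      using C.l_s[OF i f] f C.shift_closed[OF f] by (simp only: s)
    show "l i a b \<otimes>\<^bsub>B\<^esub> t' f = t' (shift (\<alpha> i b) f) \<otimes>\<^bsub>B\<^esub> l i a b"
      using C.l_t[OF i f] f C.shift_closed[OF f] by (simp only: t)
  qed
qed

text \<open>Both sides of the FRT relation are preserved by algebra homomorphisms.\<close>

lemma khom_frt:
  assumes h: "h \<in> k_algebra_hom A C" and A: "k_algebra A" and C: "k_algebra C"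
    and abcd: "a \<in> XX" "b \<in> XX" "c \<in> XX" "d \<in> XX"
    and \<sigma>: "\<And>a b c d. \<lbrakk>a \<in> XX; b \<in> XX; c \<in> XX; d \<in> XX\<rbrakk> \<Longrightarrow> \<sigma> a b c d \<in> carrier M"
    and s: "\<And>f. f \<in> carrier M \<Longrightarrow> s f \<in> carrier A \<and> h (s f) = s' f"
    and t: "\<And>f. f \<in> carrier M \<Longrightarrow> t f \<in> carrier A \<and> h (t f) = t' f"
    and m: "\<And>a b. \<lbrakk>a \<in> XX; b \<in> XX\<rbrakk> \<Longrightarrow> m a b \<in> carrier A \<and> h (m a b) = m' a b"
  shows "frt_lhs A XX s m \<sigma> a b c d \<in> carrier A" "frt_rhs A XX t m \<sigma> a b c d \<in> carrier A"
    and "h (frt_lhs A XX s m \<sigma> a b c d) = frt_lhs C XX s' m' \<sigma> a b c d"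
    and "h (frt_rhs A XX t m \<sigma> a b c d) = frt_rhs C XX t' m' \<sigma> a b c d"
proof -
  interpret A: k_algebra A by (rule A)
  interpret C: k_algebra C by (rule C)
  have hc: "h x \<in> carrier C" if "x \<in> carrier A" for x using khom_closed[OF h that] .
  have sc: "s (\<sigma> x y a c) \<in> carrier A" "h (s (\<sigma> x y a c)) = s' (\<sigma> x y a c)"
    "t (\<sigma> b d x y) \<in> carrier A" "h (t (\<sigma> b d x y)) = t' (\<sigma> b d x y)" if "x \<in> XX" "y \<in> XX" for x y
    using s[OF \<sigma>[of x y a c]] t[OF \<sigma>[of b d x y]] abcd that by simp_all
  show "frt_lhs A XX s m \<sigma> a b c d \<in> carrier A" "frt_rhs A XX t m \<sigma> a b c d \<in> carrier A"
    unfolding frt_lhs_def frt_rhs_def by (intro A.finsum_closed; use sc m abcd in auto)+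
  have m': "m' x y \<in> carrier C" "h (m x y) = m' x y" "m x y \<in> carrier A" if "x \<in> XX" "y \<in> XX" for x y
    using m[OF that] hc[of "m x y"] by simp_all
  have s': "s' (\<sigma> x y a c) \<in> carrier C" "t' (\<sigma> b d x y) \<in> carrier C" if "x \<in> XX" "y \<in> XX" for x y
    using sc[OF that] hc[of "s (\<sigma> x y a c)"] hc[of "t (\<sigma> b d x y)"] by simp_all
  note fs = addhom_finsum[OF khom_addhom[OF h] A.abelian_group C.abelian_group]
  show "h (frt_lhs A XX s m \<sigma> a b c d) = frt_lhs C XX s' m' \<sigma> a b c d"
    unfolding frt_lhs_def
    by (subst fs; (rule C.finsum_cong'[OF refl])?) (use sc s' m' abcd in \<open>auto simp: khom_mult[OF h]\<close>)
  show "h (frt_rhs A XX t m \<sigma> a b c d) = frt_rhs C XX t' m' \<sigma> a b c d"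
    unfolding frt_rhs_def
    by (subst fs; (rule C.finsum_cong'[OF refl])?) (use sc s' m' abcd in \<open>auto simp: khom_mult[OF h]\<close>)
qed

context quiver_data
begin

lemma arrows2_eq: "arrows2 XX dg = (\<lambda>(l, y, x). ((l, x), (dg x l, y))) ` (UNIV \<times> XX \<times> XX)"
  by (force simp: arrows2_def arrow_tgt_def)

text \<open>
  In the relations of \<open>\<AA>(w\<^sub>\<sigma>)\<close> only pairs of arrows that start at a fixed vertex contribute, and
  such a pair is determined by its labels.
\<close>

lemma finsum_arrows2:
  assumes f: "\<And>z. z \<in> arrows2 XX dg \<Longrightarrow> f z \<in> carrier H"
    and 0: "\<And>z. \<lbrakk>z \<in> arrows2 XX dg; fst (fst z) \<noteq> l\<rbrakk> \<Longrightarrow> f z = \<zero>\<^bsub>H\<^esub>"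
  shows "(\<Oplus>\<^bsub>H\<^esub>z\<in>arrows2 XX dg. f z) = (\<Oplus>\<^bsub>H\<^esub>z\<in>XX \<times> XX. f ((l, snd z), (dg (snd z) l, fst z)))"
proof -
  let ?h = "\<lambda>z. ((l, snd z), (dg (snd z) l, fst z))"
  have sub: "?h ` (XX \<times> XX) \<subseteq> arrows2 XX dg" by (auto simp: arrows2_def arrow_tgt_def)
  have fin: "finite (arrows2 XX dg)" unfolding arrows2_eq using finite_XX by simp
  have out: "f z = \<zero>\<^bsub>H\<^esub>" if "z \<in> arrows2 XX dg - ?h ` (XX \<times> XX)" for z
  proof (rule 0)
    show "fst (fst z) \<noteq> l"
    proof
      assume "fst (fst z) = l"
      then have "z = ?h (snd (snd z), snd (fst z))" "(snd (snd z), snd (fst z)) \<in> XX \<times> XX"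
        using that by (auto simp: arrows2_def arrow_tgt_def prod_eq_iff)
      then show False using that by blast
    qed
  qed (use that in blast)
  have fh: "f z \<in> carrier H" if "z \<in> ?h ` (XX \<times> XX)" for z
    by (rule f) (use sub that in blast)
  have "(\<Oplus>\<^bsub>H\<^esub>z\<in>arrows2 XX dg. f z) = (\<Oplus>\<^bsub>H\<^esub>z\<in>?h ` (XX \<times> XX). f z)"
    by (rule H.add.finprod_mono_neutral_cong_left[folded finsum_def, simplified, symmetric, OF fin sub])
      (use f out in auto)
  also have "\<dots> = (\<Oplus>\<^bsub>H\<^esub>z\<in>XX \<times> XX. f (?h z))"
    by (rule H.finsum_reindex) (use fh in \<open>auto simp: inj_on_def\<close>)
  finally show ?thesis .
qed

lemma arrow_path_eq: "arrow_path x = path_from dg (fst x) [snd x]"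
  by (simp add: arrow_path_def path_from_def)

lemma arrow_ee_closed: "\<lbrakk>snd x \<in> XX; snd y \<in> XX\<rbrakk> \<Longrightarrow> ee (arrow_path x) (arrow_path y) \<in> carrier G"
  unfolding arrow_path_eq by (intro G.single_closed path_pairsI[OF in_tuples1 in_tuples1])

lemma arrow_ee_mult:
  "ee (arrow_path (l, x)) (arrow_path (m, a)) \<otimes>\<^bsub>G\<^esub> ee (arrow_path (dg x l, y)) (arrow_path (dg a m, b)) =
    ee (path_from dg l [x, y]) (path_from dg m [a, b])"
  by (simp add: G.mult_eq arrow_path_def path_from_def path_tgt_def path_append_def arrow_tgt_def)

lemma ht_zero: "\<lbrakk>r \<in> carrier R; g \<in> carrier G\<rbrakk> \<Longrightarrow> ht \<zero>\<^bsub>R\<^esub> r g = \<zero>\<^bsub>H\<^esub>"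
  "\<lbrakk>r \<in> carrier R; g \<in> carrier G\<rbrakk> \<Longrightarrow> ht r \<zero>\<^bsub>R\<^esub> g = \<zero>\<^bsub>H\<^esub>"
  using sH.i_zero tH.i_zero by (simp_all add: ht_eq)

text \<open>
  A family of values that comes from an additive map on \<open>\<HH>(Q)\<close> lifts to that map.
\<close>

lemma HQ_lift_eq:
  assumes \<Psi>: "\<Psi> \<in> addhom H T" and T: "abelian_group T"
    and v: "\<And>r r' p q. \<lbrakk>r \<in> carrier R; r' \<in> carrier R; (p, q) \<in> path_pairs XX dg\<rbrakk> \<Longrightarrow> v r r' p q = \<Psi> (ht r r' (ee p q))"
    and x: "x \<in> carrier H"
  shows "HQ_lift R T v x = \<Psi> x"
proof -
  interpret T: abelian_group T by (rule T)
  have expand: "(\<Oplus>\<^bsub>T\<^esub>z\<in>keys g. v (lookup g z \<odot>\<^bsub>R\<^esub> r) r' (fst z) (snd z)) = \<Psi> (ht r r' g)"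
    if r: "r \<in> carrier R" "r' \<in> carrier R" and g: "g \<in> carrier G" for r r' g
  proof -
    have k: "z \<in> path_pairs XX dg" if "z \<in> keys g" for z using g that by (auto simp: G.carrier_eq)
    have h: "(\<lambda>g. ht r r' g) \<in> addhom G H"
      using HT.pure_addhom_right[OF RT.pure_closed, of r r'] r by (simp add: hten_def HQ_def)
    have "g = (\<Sum>z\<in>keys g. Poly_Mapping.single z (lookup g z))"
      by (rule poly_mapping_eqI) (simp add: lookup_sum lookup_single when_def in_keys_iff)
    then have "\<Psi> (ht r r' g) = \<Psi> (ht r r' (\<Sum>z\<in>keys g. Poly_Mapping.single z (lookup g z)))" by simp
    also have "\<dots> = (\<Oplus>\<^bsub>T\<^esub>z\<in>keys g. \<Psi> (ht r r' (Poly_Mapping.single z (lookup g z))))"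
      by (rule G.addhom_sum[OF addhom_comp[OF h \<Psi>] T]) (rule G.single_closed[OF k])
    also have "\<dots> = (\<Oplus>\<^bsub>T\<^esub>z\<in>keys g. v (lookup g z \<odot>\<^bsub>R\<^esub> r) r' (fst z) (snd z))"
      by (rule T.finsum_cong')
        (use r v k addhom_closed[OF \<Psi>] G.single_closed[OF k] in \<open>auto simp: ht_coeff[OF r k]\<close>)
    finally show ?thesis by simp
  qed
  have x': "x \<in> carrier HT.T" and \<Psi>': "\<Psi> \<in> addhom HT.T T"
    using x \<Psi> unfolding HQ_def HT.T_eq by simp_all
  show ?thesis
    unfolding HQ_lift_def
  proof (rule HT.additive_lift[OF T \<Psi>' _ x'])
    fix U g assume U: "U \<in> carrier RR" and g: "g \<in> carrier G"
    have U': "U \<in> carrier RT.T" using U unfolding RT.T_eq .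
    have a: "(\<lambda>W. \<Psi> (pure_tensor RR G W g)) \<in> addhom RT.T T"
      using addhom_comp[OF HT.pure_addhom_left[OF g] \<Psi>[unfolded HQ_def]] unfolding RT.T_eq .
    show "tensor_lift T (\<lambda>r r'. \<Oplus>\<^bsub>T\<^esub>z\<in>keys g. v (lookup g z \<odot>\<^bsub>R\<^esub> r) r' (fst z) (snd z)) U = \<Psi> (HT.el U g)"
      unfolding HT.el_eq
    proof (rule RT.additive_lift[OF T a _ U'])
      fix r r' assume "r \<in> carrier R" "r' \<in> carrier (op_algebra R)"
      then show "(\<Oplus>\<^bsub>T\<^esub>z\<in>keys g. v (lookup g z \<odot>\<^bsub>R\<^esub> r) r' (fst z) (snd z)) = \<Psi> (pure_tensor RR G (RT.el r r') g)"
        unfolding RT.el_eq using expand[of r r' g] g by (simp add: hten_def)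
    qed
  qed
qed

context
  fixes B :: "('k, 'b) module" and s t K l
  assumes BC: "coefficients R B XX s t K (signed_shift dg) l" and TK: "True \<in> K"
begin

interpretation B: coefficients R B XX s t K "signed_shift dg" l by (rule BC)

abbreviation "qh \<equiv> quiver_hom B s t l :: ('l, 'x, 'r, 'k) h_elt \<Rightarrow> 'b"

lemma quiver_hom_ee:
  assumes r: "r \<in> carrier R" "r' \<in> carrier R" and xs: "xs \<in> tuples XX n" "ys \<in> tuples XX n"
  shows "qh (ht r r' (ee (path_from dg m xs) (path_from dg m' ys))) =
    s (const_map r \<otimes>\<^bsub>M\<^esub> delta_map R m) \<otimes>\<^bsub>B\<^esub>
      (t (delta_map R m' \<otimes>\<^bsub>M\<^esub> const_map r') \<otimes>\<^bsub>B\<^esub> B.wd (replicate n True) xs ys)"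
proof -
  note qh = quiver_hom_hom[OF BC TK]
  have f: "const_map r \<otimes>\<^bsub>M\<^esub> delta_map R m \<in> carrier M" "delta_map R m' \<otimes>\<^bsub>M\<^esub> const_map r' \<in> carrier M"
    by (intro M.A.m_closed const_closed delta_closed r)+
  have W: "HC.wd (replicate n True) xs ys \<in> carrier H" by (rule HC.wd_closed[OF replicate_True xs])
  have "qh (HC.wd (replicate n True) xs ys) = B.wd (replicate n True) xs ys"
    by (simp only: HC_word[OF xs] quiver_hom_parts(3)[OF BC TK pword_closed[OF xs]] path_hom_pword[OF BC TK xs])
  then show ?thesis
    unfolding ht_single_eq[OF r xs]
    by (simp only: khom_mult[OF qh] HC.s_closed[OF f(1)] HC.t_closed[OF f(2)] W H.A.m_closed
        quiver_hom_s[OF BC TK f(1)] quiver_hom_t[OF BC TK f(2)])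
qed

end

end

section \<open>The relations of \<open>\<AA>(w\<^sub>\<sigma>)\<close>\<close>

locale quiver_sigma = quiver_data R XX dg
  for R :: "('k :: field, 'r) module" and XX :: "'x set" and dg :: "'x \<Rightarrow> 'l :: finite \<Rightarrow> 'l" +
  fixes \<sigma> :: "'x \<Rightarrow> 'x \<Rightarrow> 'x \<Rightarrow> 'x \<Rightarrow> 'l \<Rightarrow> 'r"
  assumes \<sigma>_closed: "\<lbrakk>a \<in> XX; b \<in> XX; c \<in> XX; d \<in> XX\<rbrakk> \<Longrightarrow> \<sigma> a b c d \<in> carrier (map_algebra R)"
    and \<sigma>_central: "\<lbrakk>a \<in> XX; b \<in> XX; c \<in> XX; d \<in> XX\<rbrakk> \<Longrightarrow> \<sigma> a b c d l \<in> center R"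
    and \<sigma>_degree: "\<lbrakk>a \<in> XX; b \<in> XX; c \<in> XX; d \<in> XX; dg b (dg d l) \<noteq> dg a (dg c l)\<rbrakk> \<Longrightarrow>
      \<sigma> b d a c l = \<zero>\<^bsub>R\<^esub>"
begin

abbreviation "L_H \<equiv> frt_lhs H XX s_H (l_H True) \<sigma>"
abbreviation "R_H \<equiv> frt_rhs H XX t_H (l_H True) \<sigma>"

text \<open>
  The component of an element that starts at \<open>(l, m)\<close>.
\<close>

definition "corner l m x = s_H (delta_map R l) \<otimes>\<^bsub>H\<^esub> (t_H (delta_map R m) \<otimes>\<^bsub>H\<^esub> x)"

lemma s_delta_closed: "s_H (delta_map R l) \<in> carrier H" and t_delta_closed: "t_H (delta_map R l) \<in> carrier H"
  by (rule HC.s_closed HC.t_closed, rule delta_closed)+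

lemma corner_closed: "x \<in> carrier H \<Longrightarrow> corner l m x \<in> carrier H"
  unfolding corner_def by (intro H.A.m_closed s_delta_closed t_delta_closed)

lemma corner_finsum:
  assumes "f \<in> I \<rightarrow> carrier H"
  shows "corner l m (\<Oplus>\<^bsub>H\<^esub>z\<in>I. f z) = (\<Oplus>\<^bsub>H\<^esub>z\<in>I. corner l m (f z))"
  unfolding corner_def
  by (rule addhom_finsum[OF addhom_comp[OF H.mult_addhom_left[OF t_delta_closed] H.mult_addhom_left[OF s_delta_closed]]
        H.abelian_group H.abelian_group assms])

lemma two_words:
  assumes "a \<in> XX" "b \<in> XX" "c \<in> XX" "d \<in> XX"
  shows "[a, b] \<in> tuples XX 2" "HC.wd (replicate 2 True) [a, b] [c, d] = l_H True a c \<otimes>\<^bsub>H\<^esub> l_H True b d"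
  using assms by (simp_all add: tuples_def numeral_2_eq_2)

lemma corner_terms:
  assumes x: "x \<in> XX" "y \<in> XX" "c \<in> XX" "d \<in> XX" and f: "f \<in> carrier M"
  shows "corner l m (s_H f \<otimes>\<^bsub>H\<^esub> (l_H True x c \<otimes>\<^bsub>H\<^esub> l_H True y d)) =
      ht (f l) \<one>\<^bsub>R\<^esub> (ee (path_from dg l [x, y]) (path_from dg m [c, d]))"
    and "corner l m (t_H f \<otimes>\<^bsub>H\<^esub> (l_H True x c \<otimes>\<^bsub>H\<^esub> l_H True y d)) =
      ht \<one>\<^bsub>R\<^esub> (f m) (ee (path_from dg l [x, y]) (path_from dg m [c, d]))"
proof -
  let ?W = "l_H True x c \<otimes>\<^bsub>H\<^esub> l_H True y d"
  have W: "?W \<in> carrier H" using x by simp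
  have sf: "s_H f \<in> carrier H" "t_H f \<in> carrier H" by (rule HC.s_closed[OF f] HC.t_closed[OF f])+
  have fl: "f l \<in> carrier R" for l using f by simp
  note c = s_delta_closed t_delta_closed sf W
  have eq: "const_map (f l) \<otimes>\<^bsub>M\<^esub> delta_map R l = delta_map R l \<otimes>\<^bsub>M\<^esub> f"
    "delta_map R m \<otimes>\<^bsub>M\<^esub> const_map (f m) = f \<otimes>\<^bsub>M\<^esub> delta_map R m"
    "const_map \<one>\<^bsub>R\<^esub> \<otimes>\<^bsub>M\<^esub> delta_map R l = delta_map R l" "delta_map R m \<otimes>\<^bsub>M\<^esub> const_map \<one>\<^bsub>R\<^esub> = delta_map R m"
    using const_delta[OF f] delta_commute[OF f] delta_commute[OF const_closed[OF fl]]
      M.A.l_one[OF delta_closed] M.A.r_one[OF delta_closed] by (simp_all only: const_one)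
  note ht = ht_single_eq[OF fl R.A.one_closed two_words(1)[OF x(1,2) x(1,2)] two_words(1)[OF x(3,4) x(3,4)]]
    ht_single_eq[OF R.A.one_closed fl two_words(1)[OF x(1,2) x(1,2)] two_words(1)[OF x(3,4) x(3,4)]]
  have "corner l m (s_H f \<otimes>\<^bsub>H\<^esub> ?W) = s_H (delta_map R l) \<otimes>\<^bsub>H\<^esub> (t_H (delta_map R m) \<otimes>\<^bsub>H\<^esub> s_H f \<otimes>\<^bsub>H\<^esub> ?W)"
    unfolding corner_def using c by (simp add: H.A.m_assoc)
  also have "\<dots> = s_H (delta_map R l) \<otimes>\<^bsub>H\<^esub> s_H f \<otimes>\<^bsub>H\<^esub> (t_H (delta_map R m) \<otimes>\<^bsub>H\<^esub> ?W)"
    unfolding HC.s_t[OF f delta_closed, symmetric] using c by (simp add: H.A.m_assoc)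
  finally show "corner l m (s_H f \<otimes>\<^bsub>H\<^esub> ?W) = ht (f l) \<one>\<^bsub>R\<^esub> (ee (path_from dg l [x, y]) (path_from dg m [c, d]))"
    unfolding ht eq two_words(2)[OF x] HC.s_mult[OF delta_closed f] .
  have "corner l m (t_H f \<otimes>\<^bsub>H\<^esub> ?W) = s_H (delta_map R l) \<otimes>\<^bsub>H\<^esub> (t_H (delta_map R m) \<otimes>\<^bsub>H\<^esub> t_H f \<otimes>\<^bsub>H\<^esub> ?W)"
    unfolding corner_def using c by (simp add: H.A.m_assoc)
  then show "corner l m (t_H f \<otimes>\<^bsub>H\<^esub> ?W) = ht \<one>\<^bsub>R\<^esub> (f m) (ee (path_from dg l [x, y]) (path_from dg m [c, d]))"
    unfolding ht eq two_words(2)[OF x] HC.t_mult[OF delta_closed f] .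
qed

abbreviation "w \<equiv> w_sigma R \<sigma>"
abbreviation "E x y \<equiv> ee (arrow_path x) (arrow_path y)"

lemma w_sums:
  fixes l m :: 'l
  assumes x: "a \<in> XX" "b \<in> XX" "c \<in> XX" "d \<in> XX"
  defines "p \<equiv> (l, a)" and "q \<equiv> (dg a l, b)" and "p' \<equiv> (m, c)" and "q' \<equiv> (dg c m, d)"
  shows "(\<Oplus>\<^bsub>H\<^esub>z\<in>arrows2 XX dg. ht (w (fst z) (snd z) p q) \<one>\<^bsub>R\<^esub> (E (fst z) p' \<otimes>\<^bsub>G\<^esub> E (snd z) q')) =
      corner l m (L_H b d a c)"
    and "(\<Oplus>\<^bsub>H\<^esub>z\<in>arrows2 XX dg. ht \<one>\<^bsub>R\<^esub> (w p' q' (fst z) (snd z)) (E p (fst z) \<otimes>\<^bsub>G\<^esub> E q (snd z))) =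
      corner l m (R_H b d a c)"
proof -
  have sig: "\<sigma> y x b a l \<in> carrier R" "\<sigma> d c y x l \<in> carrier R" if "x \<in> XX" "y \<in> XX" for x y l
    using \<sigma>_closed[of y x b a] \<sigma>_closed[of d c y x] x that by auto
  have z: "snd (fst z) \<in> XX" "snd (snd z) \<in> XX" if "z \<in> arrows2 XX dg" for z
    using that by (auto simp: arrows2_def)
  have wc: "w (fst z) (snd z) p q \<in> carrier R" "w p' q' (fst z) (snd z) \<in> carrier R" if "z \<in> arrows2 XX dg" for z
    using sig z[OF that] by (auto simp: w_sigma_def p_def q_def p'_def q'_def)
  have ec: "E (fst z) p' \<otimes>\<^bsub>G\<^esub> E (snd z) q' \<in> carrier G" "E p (fst z) \<otimes>\<^bsub>G\<^esub> E q (snd z) \<in> carrier G"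
    if "z \<in> arrows2 XX dg" for z
    by (intro GA.A.m_closed arrow_ee_closed; use z[OF that] x in \<open>simp add: p_def q_def p'_def q'_def\<close>)+
  have ls: "s_H (\<sigma> y x b a) \<in> carrier H" "t_H (\<sigma> d c y x) \<in> carrier H" if "x \<in> XX" "y \<in> XX" for x y
    using HC.s_closed[OF \<sigma>_closed[of y x b a]] HC.t_closed[OF \<sigma>_closed[of d c y x]] x that by auto
  have cs: "corner l m (s_H (\<sigma> y x b a) \<otimes>\<^bsub>H\<^esub> (l_H True x c \<otimes>\<^bsub>H\<^esub> l_H True y d)) \<in> carrier H"
    "corner l m (t_H (\<sigma> d c y x) \<otimes>\<^bsub>H\<^esub> (l_H True a x \<otimes>\<^bsub>H\<^esub> l_H True b y)) \<in> carrier H"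
    if "x \<in> XX" "y \<in> XX" for x y
    by (rule corner_closed, use ls[OF that] x that in simp)+
  have e1: "ht (\<sigma> y x b a l) \<one>\<^bsub>R\<^esub> (ee (path_from dg l [x, y]) (path_from dg m [c, d])) =
      corner l m (s_H (\<sigma> y x b a) \<otimes>\<^bsub>H\<^esub> (l_H True x c \<otimes>\<^bsub>H\<^esub> l_H True y d))"
    and e2: "ht \<one>\<^bsub>R\<^esub> (\<sigma> d c y x m) (ee (path_from dg l [a, b]) (path_from dg m [x, y])) =
      corner l m (t_H (\<sigma> d c y x) \<otimes>\<^bsub>H\<^esub> (l_H True a x \<otimes>\<^bsub>H\<^esub> l_H True b y))"
    if "x \<in> XX" "y \<in> XX" for x y
    by (rule corner_terms[symmetric] \<sigma>_closed x that)+
  have "(\<Oplus>\<^bsub>H\<^esub>z\<in>arrows2 XX dg. ht (w (fst z) (snd z) p q) \<one>\<^bsub>R\<^esub> (E (fst z) p' \<otimes>\<^bsub>G\<^esub> E (snd z) q')) =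
      (\<Oplus>\<^bsub>H\<^esub>z\<in>XX \<times> XX. ht (\<sigma> (fst z) (snd z) b a l) \<one>\<^bsub>R\<^esub> (ee (path_from dg l [snd z, fst z]) (path_from dg m [c, d])))"
    by (subst finsum_arrows2[of _ l])
      (use wc ec in \<open>auto simp: ht_zero w_sigma_def p_def q_def p'_def q'_def arrow_ee_mult\<close>)
  also have "\<dots> = (\<Oplus>\<^bsub>H\<^esub>z\<in>XX \<times> XX. corner l m (s_H (\<sigma> (fst z) (snd z) b a) \<otimes>\<^bsub>H\<^esub> (l_H True (snd z) c \<otimes>\<^bsub>H\<^esub> l_H True (fst z) d)))"
    by (rule H.finsum_cong'[OF refl]) (use cs e1 in auto)
  also have "\<dots> = corner l m (L_H b d a c)"
    unfolding frt_lhs_def by (rule corner_finsum[symmetric]) (use ls x in auto)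
  finally show "(\<Oplus>\<^bsub>H\<^esub>z\<in>arrows2 XX dg. ht (w (fst z) (snd z) p q) \<one>\<^bsub>R\<^esub> (E (fst z) p' \<otimes>\<^bsub>G\<^esub> E (snd z) q')) =
      corner l m (L_H b d a c)" .
  have "(\<Oplus>\<^bsub>H\<^esub>z\<in>arrows2 XX dg. ht \<one>\<^bsub>R\<^esub> (w p' q' (fst z) (snd z)) (E p (fst z) \<otimes>\<^bsub>G\<^esub> E q (snd z))) =
      (\<Oplus>\<^bsub>H\<^esub>z\<in>XX \<times> XX. ht \<one>\<^bsub>R\<^esub> (\<sigma> d c (fst z) (snd z) m) (ee (path_from dg l [a, b]) (path_from dg m [snd z, fst z])))"
    by (subst finsum_arrows2[of _ m])
      (use wc ec in \<open>auto simp: ht_zero w_sigma_def p_def q_def p'_def q'_def arrow_ee_mult\<close>)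
  also have "\<dots> = (\<Oplus>\<^bsub>H\<^esub>z\<in>XX \<times> XX. corner l m (t_H (\<sigma> d c (fst z) (snd z)) \<otimes>\<^bsub>H\<^esub> (l_H True a (snd z) \<otimes>\<^bsub>H\<^esub> l_H True b (fst z))))"
    by (rule H.finsum_cong'[OF refl]) (use cs e2 in auto)
  also have "\<dots> = corner l m (R_H b d a c)"
    unfolding frt_rhs_def by (rule corner_finsum[symmetric]) (use ls x in auto)
  finally show "(\<Oplus>\<^bsub>H\<^esub>z\<in>arrows2 XX dg. ht \<one>\<^bsub>R\<^esub> (w p' q' (fst z) (snd z)) (E p (fst z) \<otimes>\<^bsub>G\<^esub> E q (snd z))) =
      corner l m (R_H b d a c)" .
qed

text \<open>
  The labels are permuted because the second arrow of a path carries the first upper and the first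
  lower index of \<open>\<sigma>\<close>.
\<close>

lemma w_rels_eq: "w_rels R XX dg \<sigma> =
    {corner l m (L_H b d a c) \<ominus>\<^bsub>H\<^esub> corner l m (R_H b d a c) | l m a b c d. a \<in> XX \<and> b \<in> XX \<and> c \<in> XX \<and> d \<in> XX}"
proof -
  have arr: "(x, y) \<in> arrows2 XX dg \<longleftrightarrow> (\<exists>l a b. x = (l, a) \<and> y = (dg a l, b) \<and> a \<in> XX \<and> b \<in> XX)" for x y
    by (cases x; cases y) (auto simp: arrows2_def arrow_tgt_def)
  have ex: "(\<exists>a b c d. P a b c d \<and> (a, b) \<in> arrows2 XX dg \<and> (c, d) \<in> arrows2 XX dg) \<longleftrightarrow>
      (\<exists>l m a b c d. P (l, a) (dg a l, b) (m, c) (dg c m, d) \<and> a \<in> XX \<and> b \<in> XX \<and> c \<in> XX \<and> d \<in> XX)" for P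
    unfolding arr by blast
  have "u = (\<Oplus>\<^bsub>H\<^esub>z\<in>arrows2 XX dg. ht (w (fst z) (snd z) (l, a) (dg a l, b)) \<one>\<^bsub>R\<^esub> (E (fst z) (m, c) \<otimes>\<^bsub>G\<^esub> E (snd z) (dg c m, d)))
        \<ominus>\<^bsub>H\<^esub> (\<Oplus>\<^bsub>H\<^esub>z\<in>arrows2 XX dg. ht \<one>\<^bsub>R\<^esub> (w (m, c) (dg c m, d) (fst z) (snd z)) (E (l, a) (fst z) \<otimes>\<^bsub>G\<^esub> E (dg a l, b) (snd z))) \<and>
      a \<in> XX \<and> b \<in> XX \<and> c \<in> XX \<and> d \<in> XX \<longleftrightarrow>
      u = corner l m (L_H b d a c) \<ominus>\<^bsub>H\<^esub> corner l m (R_H b d a c) \<and> a \<in> XX \<and> b \<in> XX \<and> c \<in> XX \<and> d \<in> XX"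
    for u l m a b c d
    using w_sums(1)[of a b c d l m] w_sums(2)[of a b c d m l]
    by (cases "a \<in> XX \<and> b \<in> XX \<and> c \<in> XX \<and> d \<in> XX") (simp, blast)
  then show ?thesis
    unfolding w_rels_def Let_def ex by (simp only:)
qed

end

section \<open>The left bialgebroid \<open>\<AA>(w\<^sub>\<sigma>)\<close>\<close>

context quiver_sigma
begin

abbreviation "Iw \<equiv> I_w R XX dg \<sigma>"
abbreviation "W \<equiv> A_w R XX dg \<sigma>"
abbreviation "clw \<equiv> cls_w R XX dg \<sigma>"
abbreviation "sw \<equiv> s_w R XX dg \<sigma>"
abbreviation "tw \<equiv> t_w R XX dg \<sigma>"
abbreviation "lw k a b \<equiv> clw (l_H k a b)"

lemma frt_H_closed:
  assumes "a \<in> XX" "b \<in> XX" "c \<in> XX" "d \<in> XX"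
  shows "L_H a b c d \<in> carrier H" "R_H a b c d \<in> carrier H"
proof -
  have id: "id \<in> k_algebra_hom H H" by (rule k_algebra_homI) simp_all
  have sc: "s_H f \<in> carrier H \<and> id (s_H f) = s_H f" "t_H f \<in> carrier H \<and> id (t_H f) = t_H f" if "f \<in> carrier M" for f
    using HC.s_closed[OF that] HC.t_closed[OF that] by simp_all
  have lc: "l_H True a b \<in> carrier H \<and> id (l_H True a b) = l_H True a b" if "a \<in> XX" "b \<in> XX" for a b
    using that by simp
  note k = khom_frt[OF id H.k_algebra_axioms H.k_algebra_axioms assms \<sigma>_closed sc lc]
  show "L_H a b c d \<in> carrier H" "R_H a b c d \<in> carrier H" by (rule k(1), assumption+) (rule k(2), assumption+)
qed

lemma w_rels_subset: "w_rels R XX dg \<sigma> \<subseteq> carrier H"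
  unfolding w_rels_eq by (auto intro!: H.minus_closed corner_closed frt_H_closed)

sublocale QW: k_algebra_quotient H Iw
  unfolding I_w_def by (rule k_algebra_quotient_genideal[OF H.k_algebra_axioms w_rels_subset])

lemma W_eq: "W = QW.Q" and clw_eq: "clw = (\<lambda>x. Iw +>\<^bsub>H\<^esub> x)"
  by (simp_all add: A_w_def cls_w_def fun_eq_iff)

sublocale W: k_algebra W
  unfolding W_eq by (rule QW.k_algebra_quot)

lemma clw_hom: "clw \<in> k_algebra_hom H W"
  unfolding W_eq clw_eq by (rule QW.quot_proj)

lemma W_carrierE:
  assumes "x \<in> carrier W" obtains h where "h \<in> carrier H" "x = clw h"
  using assms unfolding W_eq clw_eq QW.quot_carrier by blast

lemma vertex_sums:
  assumes r: "r \<in> carrier R"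
  shows "(\<Oplus>\<^bsub>H\<^esub>m\<in>UNIV. ht r \<one>\<^bsub>R\<^esub> (ee (vertex l) (vertex m))) = \<iota> r \<otimes>\<^bsub>H\<^esub> jj (row l)"
    and "(\<Oplus>\<^bsub>H\<^esub>m\<in>UNIV. ht \<one>\<^bsub>R\<^esub> r (ee (vertex m) (vertex l))) = \<iota>' r \<otimes>\<^bsub>H\<^esub> jj (col l)"
proof -
  have 1: "\<iota> \<one>\<^bsub>R\<^esub> = \<one>\<^bsub>H\<^esub>" "\<iota>' \<one>\<^bsub>R\<^esub> = \<one>\<^bsub>H\<^esub>"
    using khom_one[OF \<iota>_hom] khom_one[OF \<iota>'_hom] by simp_all
  have e: "ht r \<one>\<^bsub>R\<^esub> g = \<iota> r \<otimes>\<^bsub>H\<^esub> jj g" "ht \<one>\<^bsub>R\<^esub> r g = \<iota>' r \<otimes>\<^bsub>H\<^esub> jj g" if "g \<in> carrier G" for g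
    using r that by (simp_all add: ht_eq 1)
  have v: "jj (ee (vertex l) (vertex m)) \<in> carrier H" for l m by (rule ht_closeds(3)[OF vertex_closed])
  show "(\<Oplus>\<^bsub>H\<^esub>m\<in>UNIV. ht r \<one>\<^bsub>R\<^esub> (ee (vertex l) (vertex m))) = \<iota> r \<otimes>\<^bsub>H\<^esub> jj (row l)"
    unfolding row_def jj_sum[OF vertex_closed] e[OF vertex_closed]
    by (rule H.A.finsum_rdistr[symmetric]) (use r v in auto)
  show "(\<Oplus>\<^bsub>H\<^esub>m\<in>UNIV. ht \<one>\<^bsub>R\<^esub> r (ee (vertex m) (vertex l))) = \<iota>' r \<otimes>\<^bsub>H\<^esub> jj (col l)"
    unfolding col_def jj_sum[OF vertex_closed] e[OF vertex_closed]
    by (rule H.A.finsum_rdistr[symmetric]) (use r v in auto)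
qed

lemma sw_eq: "f \<in> carrier M \<Longrightarrow> sw f = clw (s_H f)"
  and tw_eq: "f \<in> carrier M \<Longrightarrow> tw f = clw (t_H f)"
  by (simp_all add: s_w_def t_w_def sH.map_ext_def tH.map_ext_def vertex_sums)

sublocale WC: coefficients R W XX sw tw "{True}" "signed_shift dg" lw
  by (rule coefficients_cong[OF coefficients_image[OF HC.coefficients_axioms clw_hom W.k_algebra_axioms] sw_eq tw_eq])

lemma clw_rel:
  assumes "x \<ominus>\<^bsub>H\<^esub> y \<in> w_rels R XX dg \<sigma>" "x \<in> carrier H" "y \<in> carrier H"
  shows "clw x = clw y"
proof -
  have "x \<ominus>\<^bsub>H\<^esub> y \<in> Iw" unfolding I_w_def using H.A.genideal_self[OF w_rels_subset] assms(1) by blast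
  then have "clw (x \<ominus>\<^bsub>H\<^esub> y) = \<zero>\<^bsub>W\<^esub>"
    unfolding W_eq clw_eq QW.quot_eqs(4) by (rule QW.I.a_rcos_const)
  then have "clw x \<ominus>\<^bsub>W\<^esub> clw y = \<zero>\<^bsub>W\<^esub>"
    using addhom_minus[OF khom_addhom[OF clw_hom] H.abelian_group W.abelian_group assms(2,3)] by simp
  then show ?thesis
    by (rule W.minus_eq_zeroD[OF khom_closed[OF clw_hom assms(2)] khom_closed[OF clw_hom assms(3)]])
qed

lemma frt_transfer:
  assumes BC: "coefficients R B XX s t K (signed_shift dg) l"
    and h: "h \<in> k_algebra_hom H B"
    and s: "\<And>f. f \<in> carrier M \<Longrightarrow> h (s_H f) = s f" and t: "\<And>f. f \<in> carrier M \<Longrightarrow> h (t_H f) = t f"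
    and l: "\<And>a b. \<lbrakk>a \<in> XX; b \<in> XX\<rbrakk> \<Longrightarrow> h (l_H True a b) = l True a b"
    and abcd: "a \<in> XX" "b \<in> XX" "c \<in> XX" "d \<in> XX"
  shows "h (L_H a b c d) = frt_lhs B XX s (l True) \<sigma> a b c d"
    and "h (R_H a b c d) = frt_rhs B XX t (l True) \<sigma> a b c d"
proof -
  interpret B: coefficients R B XX s t K "signed_shift dg" l by (rule BC)
  have sc: "s_H f \<in> carrier H \<and> h (s_H f) = s f" "t_H f \<in> carrier H \<and> h (t_H f) = t f" if "f \<in> carrier M" for f
    using s t HC.s_closed HC.t_closed that by blast+
  have lc: "l_H True a b \<in> carrier H \<and> h (l_H True a b) = l True a b" if "a \<in> XX" "b \<in> XX" for a b
    using l that by simp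
  show "h (L_H a b c d) = frt_lhs B XX s (l True) \<sigma> a b c d"
    by (rule khom_frt(3)[OF h H.k_algebra_axioms B.B.k_algebra_axioms abcd \<sigma>_closed sc(1) sc(2) lc])
  show "h (R_H a b c d) = frt_rhs B XX t (l True) \<sigma> a b c d"
    by (rule khom_frt(4)[OF h H.k_algebra_axioms B.B.k_algebra_axioms abcd \<sigma>_closed sc(1) sc(2) lc])
qed

text \<open>
  The relations of \<open>\<AA>(w\<^sub>\<sigma>)\<close> say that all components of the two sides agree; the sum of the components
  of an element is the element.
\<close>

sublocale WI: frt_coefficients R W XX sw tw "{True}" "signed_shift dg" lw \<sigma> True
proof (intro frt_coefficients.intro frt_coefficients_axioms.intro WC.coefficients_axioms \<sigma>_closed)
  fix a b c d assume x: "a \<in> XX" "b \<in> XX" "c \<in> XX" "d \<in> XX"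
  note cl = frt_H_closed[OF x]
  have corner: "clw (corner l m y) = sw (delta_map R l) \<otimes>\<^bsub>W\<^esub> (tw (delta_map R m) \<otimes>\<^bsub>W\<^esub> clw y)" if "y \<in> carrier H" for l m y
    unfolding corner_def sw_eq[OF delta_closed] tw_eq[OF delta_closed]
    using that by (simp add: khom_mult[OF clw_hom] s_delta_closed t_delta_closed)
  have "clw (corner l m (L_H a b c d)) = clw (corner l m (R_H a b c d))" for l m
  proof (rule clw_rel[OF _ corner_closed[OF cl(1)] corner_closed[OF cl(2)]])
    show "corner l m (L_H a b c d) \<ominus>\<^bsub>H\<^esub> corner l m (R_H a b c d) \<in> w_rels R XX dg \<sigma>"
      unfolding w_rels_eq
      by (intro CollectI exI[of _ l] exI[of _ m] exI[of _ c] exI[of _ a] exI[of _ d] exI[of _ b]) (simp add: x)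
  qed
  then have eq: "sw (delta_map R l) \<otimes>\<^bsub>W\<^esub> (tw (delta_map R m) \<otimes>\<^bsub>W\<^esub> clw (L_H a b c d)) =
      sw (delta_map R l) \<otimes>\<^bsub>W\<^esub> (tw (delta_map R m) \<otimes>\<^bsub>W\<^esub> clw (R_H a b c d))" for l m
    using cl by (simp only: corner)
  have sum: "(\<Oplus>\<^bsub>W\<^esub>l\<in>UNIV. \<Oplus>\<^bsub>W\<^esub>m\<in>UNIV. sw (delta_map R l) \<otimes>\<^bsub>W\<^esub> (tw (delta_map R m) \<otimes>\<^bsub>W\<^esub> y)) = y"
    if y: "y \<in> carrier W" for y
  proof -
    have c: "sw (delta_map R l) \<in> carrier W" "tw (delta_map R m) \<otimes>\<^bsub>W\<^esub> y \<in> carrier W" for l m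
      using WC.s_closed[OF delta_closed] WC.t_closed[OF delta_closed] y by simp_all
    have "(\<Oplus>\<^bsub>W\<^esub>m\<in>UNIV. sw (delta_map R l) \<otimes>\<^bsub>W\<^esub> (tw (delta_map R m) \<otimes>\<^bsub>W\<^esub> y)) = sw (delta_map R l) \<otimes>\<^bsub>W\<^esub> y" for l
      by (subst W.A.finsum_rdistr[symmetric]) (use c sum_t[OF WC.coefficients_axioms _ y] in auto)
    then show ?thesis using sum_s[OF WC.coefficients_axioms _ y] by simp
  qed
  have "clw (L_H a b c d) = (\<Oplus>\<^bsub>W\<^esub>l\<in>UNIV. \<Oplus>\<^bsub>W\<^esub>m\<in>UNIV.
      sw (delta_map R l) \<otimes>\<^bsub>W\<^esub> (tw (delta_map R m) \<otimes>\<^bsub>W\<^esub> clw (L_H a b c d)))"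
    by (rule sum[OF khom_closed[OF clw_hom cl(1)], symmetric])
  also have "\<dots> = (\<Oplus>\<^bsub>W\<^esub>l\<in>UNIV. \<Oplus>\<^bsub>W\<^esub>m\<in>UNIV.
      sw (delta_map R l) \<otimes>\<^bsub>W\<^esub> (tw (delta_map R m) \<otimes>\<^bsub>W\<^esub> clw (R_H a b c d)))"
    by (simp only: eq)
  also have "\<dots> = clw (R_H a b c d)"
    by (rule sum[OF khom_closed[OF clw_hom cl(2)]])
  finally have "clw (L_H a b c d) = clw (R_H a b c d)" .
  moreover have "clw (L_H a b c d) = frt_lhs W XX sw (lw True) \<sigma> a b c d"
    by (rule frt_transfer(1)[OF WC.coefficients_axioms clw_hom])
      (simp_all add: sw_eq tw_eq x del: map_algebra_simps(1))
  moreover have "clw (R_H a b c d) = frt_rhs W XX tw (lw True) \<sigma> a b c d"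
    by (rule frt_transfer(2)[OF WC.coefficients_axioms clw_hom])
      (simp_all add: sw_eq tw_eq x del: map_algebra_simps(1))
  ultimately show "frt_lhs W XX sw (lw True) \<sigma> a b c d = frt_rhs W XX tw (lw True) \<sigma> a b c d" by simp
qed simp

lemma quiver_hom_rels:
  assumes B: "frt_coefficients R B XX s t K (signed_shift dg) l \<sigma> True"
  shows "x \<in> w_rels R XX dg \<sigma> \<Longrightarrow> quiver_hom B s t l x = \<zero>\<^bsub>B\<^esub>"
proof -
  interpret B: frt_coefficients R B XX s t K "signed_shift dg" l \<sigma> True by (rule B)
  note BC = B.coefficients_axioms B.u
  note q = quiver_hom_hom[OF BC]
  assume "x \<in> w_rels R XX dg \<sigma>"
  then obtain l' m a b c d where x: "x = corner l' m (L_H b d a c) \<ominus>\<^bsub>H\<^esub> corner l' m (R_H b d a c)"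
    and abcd: "a \<in> XX" "b \<in> XX" "c \<in> XX" "d \<in> XX" unfolding w_rels_eq by blast
  note cl = frt_H_closed[OF abcd(2,4,1,3)]
  have "quiver_hom B s t l (L_H b d a c) = quiver_hom B s t l (R_H b d a c)"
    using frt_transfer[OF B.coefficients_axioms q quiver_hom_s[OF BC] quiver_hom_t[OF BC] quiver_hom_l[OF BC] abcd(2,4,1,3)]
      B.frt[OF abcd(2,4,1,3)] by simp
  then have "quiver_hom B s t l (corner l' m (L_H b d a c)) = quiver_hom B s t l (corner l' m (R_H b d a c))"
    using cl by (simp add: corner_def khom_mult[OF q] s_delta_closed t_delta_closed)
  then show ?thesis
    unfolding x addhom_minus[OF khom_addhom[OF q] H.abelian_group B.B.abelian_group corner_closed[OF cl(1)] corner_closed[OF cl(2)]]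
    using khom_closed[OF q corner_closed[OF cl(2)]] by (simp add: B.B.minus_self)
qed

lemma quiver_hom_ideal:
  assumes B: "frt_coefficients R B XX s t K (signed_shift dg) l \<sigma> True" and i: "i \<in> Iw"
  shows "quiver_hom B s t l i = \<zero>\<^bsub>B\<^esub>"
proof -
  interpret B: frt_coefficients R B XX s t K "signed_shift dg" l \<sigma> True by (rule B)
  show ?thesis
    by (rule khom_genideal_zero[OF quiver_hom_hom[OF B.coefficients_axioms B.u] H.k_algebra_axioms B.B.k_algebra_axioms
          w_rels_subset quiver_hom_rels[OF B]]) (use i in \<open>simp_all add: I_w_def\<close>)
qed

lemma
  assumes B: "frt_coefficients R B XX s t K (signed_shift dg) l \<sigma> True"
  shows induced_quiver_hom: "induced (quiver_hom B s t l) \<in> k_algebra_hom W B"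
    and induced_quiver_clw: "h \<in> carrier H \<Longrightarrow> induced (quiver_hom B s t l) (clw h) = quiver_hom B s t l h"
    and induced_quiver_s: "f \<in> carrier M \<Longrightarrow> induced (quiver_hom B s t l) (sw f) = s f"
    and induced_quiver_t: "f \<in> carrier M \<Longrightarrow> induced (quiver_hom B s t l) (tw f) = t f"
    and induced_quiver_l: "\<lbrakk>a \<in> XX; b \<in> XX\<rbrakk> \<Longrightarrow> induced (quiver_hom B s t l) (lw k a b) = l True a b"
proof -
  interpret B: frt_coefficients R B XX s t K "signed_shift dg" l \<sigma> True by (rule B)
  note BC = B.coefficients_axioms B.u
  note q = quiver_hom_hom[OF BC]
  note 0 = quiver_hom_ideal[OF B]
  show "induced (quiver_hom B s t l) \<in> k_algebra_hom W B"
    unfolding W_eq by (rule QW.induced_khom[OF q B.B.k_algebra_axioms 0])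
  show e: "induced (quiver_hom B s t l) (clw h) = quiver_hom B s t l h" if "h \<in> carrier H" for h
    unfolding clw_eq by (rule QW.induced_coset[OF khom_addhom[OF q] B.B.abelian_group 0 that])
  show "induced (quiver_hom B s t l) (sw f) = s f" "induced (quiver_hom B s t l) (tw f) = t f" if "f \<in> carrier M"
    using e[OF HC.s_closed[OF that]] e[OF HC.t_closed[OF that]] quiver_hom_s[OF BC that] quiver_hom_t[OF BC that]
    by (simp_all only: sw_eq[OF that] tw_eq[OF that])
  show "induced (quiver_hom B s t l) (lw k a b) = l True a b" if "a \<in> XX" "b \<in> XX"
    using e[of "l_H True a b"] quiver_hom_l[OF BC that] that by simp
qed

lemma W_spanned: "carrier W \<subseteq> WC.coeff_span"
proof
  fix x assume "x \<in> carrier W"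
  then obtain h where h: "h \<in> carrier H" and x: "x = clw h" by (rule W_carrierE)
  have "h \<in> HC.coeff_span" using h HC_spanned by blast
  then have "clw h \<in> WC.coeff_span"
  proof (induction rule: HC.coeff_span.induct)
    case (base f g ks as bs)
    have w: "HC.wd ks as bs \<in> carrier H" "clw (HC.wd ks as bs) = WC.wd ks as bs"
      using khom_coeff_word[OF clw_hom H.k_algebra_axioms, of "{True}" XX l_H lw, OF _ base(3-5)] by simp_all
    have "clw (s_H f \<otimes>\<^bsub>H\<^esub> (t_H g \<otimes>\<^bsub>H\<^esub> HC.wd ks as bs)) = sw f \<otimes>\<^bsub>W\<^esub> (tw g \<otimes>\<^bsub>W\<^esub> WC.wd ks as bs)"
      using w HC.s_closed[OF base(1)] HC.t_closed[OF base(2)]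
      by (simp add: khom_mult[OF clw_hom] sw_eq[OF base(1)] tw_eq[OF base(2)])
    then show ?case using WC.coeff_span.base[OF base] by simp
  next
    case (add x y)
    then show ?case
      using WC.coeff_span.add khom_add[OF clw_hom] HC.coeff_span_closed by simp
  qed
  then show "x \<in> WC.coeff_span" using x by simp
qed

lemma coset_closed: "\<lbrakk>h \<in> carrier H; u \<in> clw h\<rbrakk> \<Longrightarrow> u \<in> carrier H"
  unfolding clw_eq a_r_coset_def' using QW.I.Icarr H.M.a_closed by auto

lemma clw_ht:
  assumes r: "r \<in> carrier R" "r' \<in> carrier R" and xs: "xs \<in> tuples XX n" "ys \<in> tuples XX n"
  shows "clw (ht r r' (ee (path_from dg l xs) (path_from dg m ys))) =
    sw (const_map r \<otimes>\<^bsub>M\<^esub> delta_map R l) \<otimes>\<^bsub>W\<^esub>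
      (tw (delta_map R m \<otimes>\<^bsub>M\<^esub> const_map r') \<otimes>\<^bsub>W\<^esub> WC.wd (replicate n True) xs ys)"
proof -
  have f: "const_map r \<otimes>\<^bsub>M\<^esub> delta_map R l \<in> carrier M" "delta_map R m \<otimes>\<^bsub>M\<^esub> const_map r' \<in> carrier M"
    by (intro M.A.m_closed const_closed delta_closed r)+
  have w: "HC.wd (replicate n True) xs ys \<in> carrier H"
    "clw (HC.wd (replicate n True) xs ys) = WC.wd (replicate n True) xs ys"
    using khom_coeff_word[OF clw_hom H.k_algebra_axioms, of "{True}" XX l_H lw, OF _ replicate_True xs] by simp_all
  show ?thesis
    unfolding ht_single_eq[OF r xs] sw_eq[OF f(1)] tw_eq[OF f(2)]
    using w HC.s_closed[OF f(1)] HC.t_closed[OF f(2)] by (simp add: khom_mult[OF clw_hom])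
qed

end

context coefficients
begin

lemma sT_tT_word:
  assumes f: "f \<in> carrier M" "g \<in> carrier M"
    and w: "ks \<in> lists K" "as \<in> tuples XX (length ks)" "bs \<in> tuples XX (length ks)"
  shows "sT f \<otimes>\<^bsub>TT.TK\<^esub> (tT g \<otimes>\<^bsub>TT.TK\<^esub> coeff_word TT.TK lT ks as bs) =
    (\<Oplus>\<^bsub>TT.T\<^esub>cs\<in>tuples XX (length ks). TT.el (s f \<otimes>\<^bsub>B\<^esub> wd ks as cs) (t g \<otimes>\<^bsub>B\<^esub> wd ks cs bs))"
proof -
  let ?U = "tuples XX (length ks)"
  note W = wd_closed[OF w(1)]
  have c: "wd ks as cs \<in> carrier B" "wd ks cs bs \<in> carrier B" "t g \<otimes>\<^bsub>B\<^esub> wd ks cs bs \<in> carrier B"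
    "s f \<otimes>\<^bsub>B\<^esub> wd ks as cs \<in> carrier B" if "cs \<in> ?U" for cs
    using W[OF w(2) that] W[OF that w(3)] s_closed[OF f(1)] t_closed[OF f(2)] by simp_all
  have distr: "V \<otimes>\<^bsub>TT.T\<^esub> (\<Oplus>\<^bsub>TT.T\<^esub>cs\<in>?U. h cs) = (\<Oplus>\<^bsub>TT.T\<^esub>cs\<in>?U. V \<otimes>\<^bsub>TT.T\<^esub> h cs)"
    if "V \<in> TT.takeuchi" "h \<in> ?U \<rightarrow> carrier TT.T" for V h
    by (rule addhom_finsum[OF TT.mult_addhom_tensor[OF that(1)] TT.abelian_tensor TT.abelian_tensor that(2)])
  have "coeff_word TT.TK lT ks as bs = (\<Oplus>\<^bsub>TT.T\<^esub>cs\<in>?U. TT.el (wd ks as cs) (wd ks cs bs))"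
    unfolding takeuchi_word[OF w] by (rule TK_finsum) (use wd_el_takeuchi[OF w(1,2) _ w(3)] in blast)
  then have "tT g \<otimes>\<^bsub>TT.T\<^esub> coeff_word TT.TK lT ks as bs = (\<Oplus>\<^bsub>TT.T\<^esub>cs\<in>?U. TT.el (wd ks as cs) (t g \<otimes>\<^bsub>B\<^esub> wd ks cs bs))"
    using c by (simp add: distr[OF tT_takeuchi[OF f(2)]] Pi_iff)
      (rule TT.T.finsum_cong', use c tT_mult_el[OF f(2)] in auto)
  then have "sT f \<otimes>\<^bsub>TT.T\<^esub> (tT g \<otimes>\<^bsub>TT.T\<^esub> coeff_word TT.TK lT ks as bs) =
      (\<Oplus>\<^bsub>TT.T\<^esub>cs\<in>?U. TT.el (s f \<otimes>\<^bsub>B\<^esub> wd ks as cs) (t g \<otimes>\<^bsub>B\<^esub> wd ks cs bs))"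
    using c by (simp add: distr[OF sT_takeuchi[OF f(1)]] Pi_iff)
      (rule TT.T.finsum_cong', use c sT_mult_el[OF f(1)] in auto)
  then show ?thesis by simp
qed

end

context quiver_sigma
begin

lemma AA_w_eq: "AA_w R XX dg \<sigma> = WC.TT.T" and elt2_w_eq: "elt2_w R XX dg \<sigma> = WC.TT.el"
  by (simp_all add: AA_w_def elt2_w_def bialgebroid_data.AA_def bialgebroid_data.elt2_def)

lemma delta_idem: "delta_map R l \<otimes>\<^bsub>M\<^esub> delta_map R l = delta_map R l"
  by (auto simp: fun_eq_iff delta_map_def)

abbreviation "\<Psi>T \<equiv> quiver_hom WC.TT.TK WC.sT WC.tT WC.lT"

text \<open>
  In the sum over paths \<open>u\<close>, the source of \<open>u\<close> contributes the factor
  \<open>\<Sum>\<^sub>\<nu> t (\<delta>\<^sub>\<nu>) \<otimes> s (\<delta>\<^sub>\<nu>) = 1 \<otimes> 1\<close> of the tensor product over \<open>M\<^sub>\<Lambda>(R)\<close>. What remains is the sum over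
  the labels of \<open>u\<close>, the comultiplication of a word.
\<close>

lemma comult_value:
  fixes l m :: 'l
  assumes r: "r \<in> carrier R" "r' \<in> carrier R" and xs: "xs \<in> tuples XX n" "ys \<in> tuples XX n"
  defines "p \<equiv> path_from dg l xs" and "q \<equiv> path_from dg m ys"
  shows "(\<Oplus>\<^bsub>WC.TT.T\<^esub>u\<in>paths XX dg n. WC.TT.el (clw (ht r \<one>\<^bsub>R\<^esub> (ee p u))) (clw (ht \<one>\<^bsub>R\<^esub> r' (ee u q)))) =
    \<Psi>T (ht r r' (ee p q))"
proof -
  let ?f = "const_map r \<otimes>\<^bsub>M\<^esub> delta_map R l" and ?g = "delta_map R m \<otimes>\<^bsub>M\<^esub> const_map r'"
  let ?wd = "WC.wd (replicate n True)"
  let ?U = "tuples XX n"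
  have f: "?f \<in> carrier M" "?g \<in> carrier M" by (intro M.A.m_closed const_closed delta_closed r)+
  note one = R.A.one_closed
  note TB = WC.takeuchi_coefficients
  have dl: "const_map \<one>\<^bsub>R\<^esub> \<otimes>\<^bsub>M\<^esub> delta_map R \<nu> = delta_map R \<nu>" "delta_map R \<nu> \<otimes>\<^bsub>M\<^esub> const_map \<one>\<^bsub>R\<^esub> = delta_map R \<nu>" for \<nu>
    by (simp_all only: const_one M.A.l_one[OF delta_closed] M.A.r_one[OF delta_closed])
  define xl yr where "xl cs = sw ?f \<otimes>\<^bsub>W\<^esub> ?wd xs cs" and "yr cs = tw ?g \<otimes>\<^bsub>W\<^esub> ?wd cs ys" for cs
  have wc: "?wd xs cs \<in> carrier W" "?wd cs ys \<in> carrier W" if "cs \<in> ?U" for cs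
    using WC.wd_closed[OF replicate_True] xs that by blast+
  have dc: "sw (delta_map R \<nu>) \<in> carrier W" "tw (delta_map R \<nu>) \<in> carrier W" for \<nu>
    by (rule WC.s_closed WC.t_closed, rule delta_closed)+
  have xyc: "xl cs \<in> carrier W" "yr cs \<in> carrier W" if "cs \<in> ?U" for cs
    using wc[OF that] WC.s_closed[OF f(1)] WC.t_closed[OF f(2)] by (simp_all add: xl_def yr_def)
  have el: "WC.TT.el (clw (ht r \<one>\<^bsub>R\<^esub> (ee p (path_from dg \<nu> cs)))) (clw (ht \<one>\<^bsub>R\<^esub> r' (ee (path_from dg \<nu> cs) q))) =
      WC.TT.el (xl cs) (sw (delta_map R \<nu>) \<otimes>\<^bsub>W\<^esub> yr cs)" if cs: "cs \<in> ?U" for \<nu> cs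
  proof -
    have 1: "clw (ht r \<one>\<^bsub>R\<^esub> (ee p (path_from dg \<nu> cs))) = tw (delta_map R \<nu>) \<otimes>\<^bsub>W\<^esub> xl cs"
      unfolding p_def clw_ht[OF r(1) one xs(1) cs] dl xl_def
      using WC.s_t[OF f(1) delta_closed] WC.s_closed[OF f(1)] dc wc[OF cs] by (simp add: W.A.m_assoc[symmetric])
    have 2: "clw (ht \<one>\<^bsub>R\<^esub> r' (ee (path_from dg \<nu> cs) q)) = sw (delta_map R \<nu>) \<otimes>\<^bsub>W\<^esub> yr cs"
      unfolding q_def clw_ht[OF one r(2) cs xs(2)] dl yr_def ..
    have 3: "sw (delta_map R \<nu>) \<otimes>\<^bsub>W\<^esub> (sw (delta_map R \<nu>) \<otimes>\<^bsub>W\<^esub> yr cs) = sw (delta_map R \<nu>) \<otimes>\<^bsub>W\<^esub> yr cs"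
      using dc xyc[OF cs] WC.s_mult[OF delta_closed delta_closed, of \<nu> \<nu>] by (simp add: W.A.m_assoc[symmetric] delta_idem)
    show ?thesis
      unfolding 1 2 using WC.st_el_eqs[OF delta_closed xyc(1)[OF cs] W.A.m_closed[OF dc(1) xyc(2)[OF cs]], of \<nu> \<nu>] by (simp only: 3)
  qed
  have sum: "(\<Oplus>\<^bsub>WC.TT.T\<^esub>\<nu>\<in>UNIV. WC.TT.el (xl cs) (sw (delta_map R \<nu>) \<otimes>\<^bsub>W\<^esub> yr cs)) = WC.TT.el (xl cs) (yr cs)"
    if cs: "cs \<in> ?U" for cs
  proof -
    have "(\<Oplus>\<^bsub>WC.TT.T\<^esub>\<nu>\<in>UNIV. WC.TT.el (xl cs) (sw (delta_map R \<nu>) \<otimes>\<^bsub>W\<^esub> yr cs)) =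
        WC.TT.el (xl cs) (\<Oplus>\<^bsub>W\<^esub>\<nu>\<in>UNIV. sw (delta_map R \<nu>) \<otimes>\<^bsub>W\<^esub> yr cs)"
      by (rule addhom_finsum[OF WC.TT.el_addhom_right[OF xyc(1)[OF cs]] W.abelian_group WC.TT.abelian_tensor, symmetric])
        (use dc xyc[OF cs] in auto)
    then show ?thesis by (simp only: sum_s[OF WC.coefficients_axioms singletonI xyc(2)[OF cs]])
  qed
  have elc: "WC.TT.el (xl cs) (sw (delta_map R \<nu>) \<otimes>\<^bsub>W\<^esub> yr cs) \<in> carrier WC.TT.T" if "cs \<in> ?U" for cs \<nu>
    by (rule WC.TT.el_closed[OF xyc(1)[OF that] W.A.m_closed[OF dc(1) xyc(2)[OF that]]])
  have "(\<Oplus>\<^bsub>WC.TT.T\<^esub>u\<in>paths XX dg n. WC.TT.el (clw (ht r \<one>\<^bsub>R\<^esub> (ee p u))) (clw (ht \<one>\<^bsub>R\<^esub> r' (ee u q)))) =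
      (\<Oplus>\<^bsub>WC.TT.T\<^esub>z\<in>UNIV \<times> ?U. WC.TT.el (xl (snd z)) (sw (delta_map R (fst z)) \<otimes>\<^bsub>W\<^esub> yr (snd z)))"
    unfolding paths_eq
    by (subst WC.TT.T.finsum_reindex; (rule WC.TT.T.finsum_cong'[OF refl])?) (auto simp: inj_on_def el elc)
  also have "\<dots> = (\<Oplus>\<^bsub>WC.TT.T\<^esub>\<nu>\<in>UNIV. \<Oplus>\<^bsub>WC.TT.T\<^esub>cs\<in>?U. WC.TT.el (xl cs) (sw (delta_map R \<nu>) \<otimes>\<^bsub>W\<^esub> yr cs))"
    by (rule WC.TT.T.finsum_pair[symmetric, OF finite_UNIV finite_tuples[OF finite_XX]]) (rule elc)
  also have "\<dots> = (\<Oplus>\<^bsub>WC.TT.T\<^esub>cs\<in>?U. \<Oplus>\<^bsub>WC.TT.T\<^esub>\<nu>\<in>UNIV. WC.TT.el (xl cs) (sw (delta_map R \<nu>) \<otimes>\<^bsub>W\<^esub> yr cs))"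
    by (rule WC.TT.T.finsum_swap) (rule elc)
  also have "\<dots> = (\<Oplus>\<^bsub>WC.TT.T\<^esub>cs\<in>?U. WC.TT.el (xl cs) (yr cs))"
    by (rule WC.TT.T.finsum_cong'[OF refl _ sum]) (use xyc in auto)
  also have "\<dots> = \<Psi>T (ht r r' (ee p q))"
    unfolding p_def q_def quiver_hom_ee[OF TB singletonI r xs] xl_def yr_def
    using WC.sT_tT_word[OF f replicate_True[of n]] xs by simp
  finally show ?thesis .
qed

lemma comult_w_eq:
  assumes "x \<in> carrier W"
  shows "comult_w R XX dg \<sigma> x = induced \<Psi>T x"
proof -
  obtain h where h: "h \<in> carrier H" "x = clw h" using assms by (rule W_carrierE)
  have \<Psi>: "\<Psi>T \<in> addhom H WC.TT.T"
    using addhom_comp[OF khom_addhom[OF quiver_hom_hom[OF WC.takeuchi_coefficients singletonI]] WC.TT.takeuchi_addhom] .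
  have "HQ_lift R WC.TT.T (\<lambda>r r' p q. \<Oplus>\<^bsub>WC.TT.T\<^esub>u\<in>paths XX dg (length (snd p)).
      WC.TT.el (clw (ht r \<one>\<^bsub>R\<^esub> (ee p u))) (clw (ht \<one>\<^bsub>R\<^esub> r' (ee u q)))) u = \<Psi>T u" if u: "u \<in> carrier H" for u
  proof (rule HQ_lift_eq[OF \<Psi> WC.TT.abelian_tensor _ u])
    fix r r' p q assume r: "r \<in> carrier R" "r' \<in> carrier R" and "(p, q) \<in> path_pairs XX dg"
    then obtain n l xs m ys where pq: "p = path_from dg l xs" "q = path_from dg m ys" and xs: "xs \<in> tuples XX n" "ys \<in> tuples XX n"
      by (auto elim: path_pairsE)
    then show "(\<Oplus>\<^bsub>WC.TT.T\<^esub>u\<in>paths XX dg (length (snd p)).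
        WC.TT.el (clw (ht r \<one>\<^bsub>R\<^esub> (ee p u))) (clw (ht \<one>\<^bsub>R\<^esub> r' (ee u q)))) = \<Psi>T (ht r r' (ee p q))"
      using comult_value[OF r xs, of l m] by (simp add: tuples_def)
  qed
  then show ?thesis
    unfolding comult_w_def AA_w_eq elt2_w_eq h by (intro induced_cong) (use coset_closed[OF h(1)] in blast)
qed

abbreviation "EA \<equiv> end_algebra M"
abbreviation "\<Psi>E \<equiv> quiver_hom EA (end_s R) (end_t R) (end_l R (signed_shift dg))"

lemma end_word:
  "\<lbrakk>xs \<in> tuples XX n; ys \<in> tuples XX n\<rbrakk> \<Longrightarrow>
    coeff_word EA (end_l R (signed_shift dg)) (replicate n True) xs ys \<one>\<^bsub>M\<^esub> = (if xs = ys then \<one>\<^bsub>M\<^esub> else \<zero>\<^bsub>M\<^esub>)"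
proof (induction n arbitrary: xs ys)
  case 0
  then show ?case using M.end_app(4)[OF M.A.one_closed] by (simp add: tuples_0 del: map_algebra_simps)
next
  case (Suc n)
  obtain a xs' b ys' where e: "xs = a # xs'" "ys = b # ys'" "xs' \<in> tuples XX n" "ys' \<in> tuples XX n"
    using Suc.prems by (auto simp: tuples_Suc)
  have s: "shift \<beta> \<one>\<^bsub>M\<^esub> = \<one>\<^bsub>M\<^esub>" "shift \<beta> \<zero>\<^bsub>M\<^esub> = \<zero>\<^bsub>M\<^esub>" for \<beta> :: "'l \<Rightarrow> 'l"
    by (simp_all add: shift_def map_algebra_def)
  have "end_l R (signed_shift dg) True a b h = (if a = b then shift (signed_shift dg True a) h else \<zero>\<^bsub>M\<^esub>)"
    if "h \<in> carrier M" for h using that by (simp only: end_l_def restrict_apply')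
  then show ?case
    using M.end_app(1)[OF M.A.one_closed] Suc.IH[OF e(3,4)] M.A.one_closed M.M.zero_closed s
    by (simp add: e(1,2) del: map_algebra_simps)
qed

lemma end_frt_Q: "frt_coefficients R EA XX (end_s R) (end_t R) {True} (signed_shift dg) (end_l R (signed_shift dg)) \<sigma> True"
  by (rule R.end_frt[OF finite_XX singletonI \<sigma>_closed \<sigma>_central \<sigma>_degree]) (simp_all add: signed_shift_def)

lemma counit_value:
  assumes r: "r \<in> carrier R" "r' \<in> carrier R" and xs: "xs \<in> tuples XX n" "ys \<in> tuples XX n"
  shows "\<Psi>E (ht r r' (ee (path_from dg l xs) (path_from dg m ys))) \<one>\<^bsub>M\<^esub> =
    (if l = m \<and> xs = ys then const_map (r \<otimes>\<^bsub>R\<^esub> r') \<otimes>\<^bsub>M\<^esub> delta_map R m else \<zero>\<^bsub>M\<^esub>)"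
proof -
  interpret E: frt_coefficients R EA XX "end_s R" "end_t R" "{True}" "signed_shift dg" "end_l R (signed_shift dg)" \<sigma> True
    by (rule end_frt_Q)
  let ?f = "const_map r \<otimes>\<^bsub>M\<^esub> delta_map R l" and ?g = "delta_map R m \<otimes>\<^bsub>M\<^esub> const_map r'"
  let ?h = "if xs = ys then \<one>\<^bsub>M\<^esub> else \<zero>\<^bsub>M\<^esub>"
  have f: "?f \<in> carrier M" "?g \<in> carrier M" by (intro M.A.m_closed const_closed delta_closed r)+
  have h: "?h \<in> carrier M" using M.A.one_closed M.M.zero_closed by presburger
  have "\<Psi>E (ht r r' (ee (path_from dg l xs) (path_from dg m ys))) \<one>\<^bsub>M\<^esub> = end_s R ?f (end_t R ?g ?h)"
    unfolding quiver_hom_ee[OF E.coefficients_axioms singletonI r xs] end_word[OF xs, symmetric] M.end_app(1)[OF M.A.one_closed] ..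
  also have "\<dots> = ?f \<otimes>\<^bsub>M\<^esub> (?h \<otimes>\<^bsub>M\<^esub> ?g)"
    by (simp only: end_s_def end_t_def restrict_apply' h M.A.m_closed[OF h f(2)])
  also have "\<dots> = (if l = m \<and> xs = ys then const_map (r \<otimes>\<^bsub>R\<^esub> r') \<otimes>\<^bsub>M\<^esub> delta_map R m else \<zero>\<^bsub>M\<^esub>)"
    using r by (auto simp: fun_eq_iff const_map_def delta_map_def)
  finally show ?thesis .
qed

lemma counit_w_eq:
  assumes "x \<in> carrier W"
  shows "counit_w R x = induced \<Psi>E x \<one>\<^bsub>M\<^esub>"
proof -
  interpret E: frt_coefficients R EA XX "end_s R" "end_t R" "{True}" "signed_shift dg" "end_l R (signed_shift dg)" \<sigma> True
    by (rule end_frt_Q)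
  obtain h where h: "h \<in> carrier H" "x = clw h" using assms by (rule W_carrierE)
  have \<Psi>: "(\<lambda>u. \<Psi>E u \<one>\<^bsub>M\<^esub>) \<in> addhom H M"
    by (rule addhom_comp[OF khom_addhom[OF quiver_hom_hom[OF E.coefficients_axioms singletonI]] M.end_eval_addhom[OF M.A.one_closed]])
  have "HQ_lift R M (\<lambda>r r' p q. if p = q then const_map (r \<otimes>\<^bsub>R\<^esub> r') \<otimes>\<^bsub>M\<^esub> delta_map R (fst q) else \<zero>\<^bsub>M\<^esub>) u =
      \<Psi>E u \<one>\<^bsub>M\<^esub>" if u: "u \<in> carrier H" for u
  proof (rule HQ_lift_eq[OF \<Psi> M.abelian_group _ u])
    fix r r' p q assume r: "r \<in> carrier R" "r' \<in> carrier R" and "(p, q) \<in> path_pairs XX dg"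
    then obtain n l xs m ys where pq: "p = path_from dg l xs" "q = path_from dg m ys" and xs: "xs \<in> tuples XX n" "ys \<in> tuples XX n"
      by (auto elim: path_pairsE)
    show "(if p = q then const_map (r \<otimes>\<^bsub>R\<^esub> r') \<otimes>\<^bsub>M\<^esub> delta_map R (fst q) else \<zero>\<^bsub>M\<^esub>) = \<Psi>E (ht r r' (ee p q)) \<one>\<^bsub>M\<^esub>"
      unfolding pq counit_value[OF r xs] path_from_inject path_from_simps(1) ..
  qed
  then have "counit_w R x = induced (\<lambda>u. \<Psi>E u \<one>\<^bsub>M\<^esub>) x"
    unfolding counit_w_def h by (intro induced_cong) (use coset_closed[OF h(1)] in blast)
  also have "\<dots> = \<Psi>E h \<one>\<^bsub>M\<^esub>"
    unfolding h clw_eq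
  proof (rule QW.induced_coset[OF \<Psi> M.abelian_group _ h(1)])
    show "\<Psi>E i \<one>\<^bsub>M\<^esub> = \<zero>\<^bsub>M\<^esub>" if "i \<in> Iw" for i
      using quiver_hom_ideal[OF end_frt_Q that] M.end_app(5)[OF M.A.one_closed] by simp
  qed
  finally show ?thesis using induced_quiver_clw[OF end_frt_Q h(1)] h(2) by simp
qed

theorem A_w_bialgebroid:
  "coefficient_bialgebroid R W XX sw tw {True} (signed_shift dg) lw (comult_w R XX dg \<sigma>) (counit_w R) (induced \<Psi>E)"
proof (intro coefficient_bialgebroid.intro coefficient_bialgebroid_axioms.intro WC.coefficients_axioms W_spanned)
  note T = WI.takeuchi_frt
  show "comult_w R XX dg \<sigma> \<in> k_algebra_hom W WC.TT.TK"
    by (rule khom_cong[OF induced_quiver_hom[OF T] W.A.ring_axioms _ comult_w_eq]) simp_all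
  show "induced \<Psi>E \<in> k_algebra_hom W EA" by (rule induced_quiver_hom[OF end_frt_Q])
  show "comult_w R XX dg \<sigma> (sw f) = WC.sT f" "comult_w R XX dg \<sigma> (tw f) = WC.tT f"
    "induced \<Psi>E (sw f) = end_s R f" "induced \<Psi>E (tw f) = end_t R f" if "f \<in> carrier M" for f
    using comult_w_eq[OF WC.s_closed[OF that]] comult_w_eq[OF WC.t_closed[OF that]]
      induced_quiver_s[OF T that] induced_quiver_t[OF T that]
      induced_quiver_s[OF end_frt_Q that] induced_quiver_t[OF end_frt_Q that] by simp_all
  show "comult_w R XX dg \<sigma> (lw i a b) = WC.lT i a b" "induced \<Psi>E (lw i a b) = end_l R (signed_shift dg) i a b"
    if "i \<in> {True}" "a \<in> XX" "b \<in> XX" for i a b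
    using comult_w_eq[OF WC.l_closed[OF that]] induced_quiver_l[OF T that(2,3)] induced_quiver_l[OF end_frt_Q that(2,3)] that(1)
    by simp_all
qed (rule counit_w_eq)

end

section \<open>The homomorphism\<close>

context sigma_bialgebroid
begin

lemma cls_mm: "\<lbrakk>f \<in> carrier M; g \<in> carrier M\<rbrakk> \<Longrightarrow> cls (word [Gen_ten (mm R f g)]) = s_A f \<otimes>\<^bsub>A\<^esub> t_A g"
proof -
  assume f: "f \<in> carrier M" "g \<in> carrier M"
  note one = M.A.one_closed
  have "mm R f g = mm R f \<one>\<^bsub>M\<^esub> \<otimes>\<^bsub>MMop R\<^esub> mm R \<one>\<^bsub>M\<^esub> g"
    unfolding mm_eq MMop_eq
    by (subst MT.pure_mult) (use f one M.A.l_one[OF f(2)] M.A.r_one f in \<open>simp_all del: map_algebra_simps\<close>)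
  then show ?thesis
    using khom_mult[OF cls_ten_khom mm_closed[OF f(1) one] mm_closed[OF one f(2)]]
    by (simp add: s_sigma_def t_sigma_def)
qed

lemma cls_L_word:
  "\<lbrakk>xs \<in> tuples XX n; ys \<in> tuples XX n\<rbrakk> \<Longrightarrow>
    map2 Gen_L xs ys \<in> lists S \<and> cls (word (map2 Gen_L xs ys)) = AI.wd (replicate n True) xs ys"
proof (induction n arbitrary: xs ys)
  case 0
  then show ?case using khom_one[OF cls_khom] by (simp add: tuples_0 free_algebra_def)
next
  case (Suc n)
  obtain a xs' b ys' where e: "xs = a # xs'" "ys = b # ys'" "a \<in> XX" "b \<in> XX" "xs' \<in> tuples XX n" "ys' \<in> tuples XX n"
    using Suc.prems by (auto simp: tuples_Suc)
  then show ?case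
    using Suc.IH[OF e(5,6)] hom_word_append[OF cls_khom, of "[Gen_L a b]" "map2 Gen_L xs' ys'"] by simp
qed

lemma cls_path_word:
  assumes f: "f \<in> carrier M" "f' \<in> carrier M" "g \<in> carrier M" "g' \<in> carrier M"
    and xs: "xs \<in> tuples XX n" "ys \<in> tuples XX n"
  shows "cls (word ([Gen_ten (mm R f f'), Gen_ten (mm R g g')] @ map2 Gen_L xs ys)) =
    s_A (f \<otimes>\<^bsub>M\<^esub> g) \<otimes>\<^bsub>A\<^esub> (t_A (g' \<otimes>\<^bsub>M\<^esub> f') \<otimes>\<^bsub>A\<^esub> AI.wd (replicate n True) xs ys)"
proof -
  note L = cls_L_word[OF xs]
  have m: "mm R f f' \<otimes>\<^bsub>MMop R\<^esub> mm R g g' = mm R (f \<otimes>\<^bsub>M\<^esub> g) (g' \<otimes>\<^bsub>M\<^esub> f')"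
    unfolding mm_eq MMop_eq by (subst MT.pure_mult) (use f in \<open>simp_all del: map_algebra_simps\<close>)
  have gens: "Gen_ten (mm R f f') \<in> S" "Gen_ten (mm R g g') \<in> S"
    using mm_closed[OF f(1,2)] mm_closed[OF f(3,4)] by simp_all
  have fg: "f \<otimes>\<^bsub>M\<^esub> g \<in> carrier M" "g' \<otimes>\<^bsub>M\<^esub> f' \<in> carrier M" by (intro M.A.m_closed f)+
  have "cls (word [Gen_ten (mm R f f'), Gen_ten (mm R g g')]) = s_A (f \<otimes>\<^bsub>M\<^esub> g) \<otimes>\<^bsub>A\<^esub> t_A (g' \<otimes>\<^bsub>M\<^esub> f')"
  proof -
    have "cls (word [Gen_ten (mm R f f'), Gen_ten (mm R g g')]) =
        cls (word [Gen_ten (mm R f f')]) \<otimes>\<^bsub>A\<^esub> cls (word [Gen_ten (mm R g g')])"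
      by (rule hom_word2[OF cls_khom gens])
    also have "\<dots> = cls (word [Gen_ten (mm R f f' \<otimes>\<^bsub>MMop R\<^esub> mm R g g')])"
      by (rule khom_mult[OF cls_ten_khom mm_closed[OF f(1,2)] mm_closed[OF f(3,4)], symmetric])
    finally show ?thesis by (simp only: m cls_mm[OF fg])
  qed
  moreover have "cls (word ([Gen_ten (mm R f f'), Gen_ten (mm R g g')] @ map2 Gen_L xs ys)) =
      cls (word [Gen_ten (mm R f f'), Gen_ten (mm R g g')]) \<otimes>\<^bsub>A\<^esub> cls (word (map2 Gen_L xs ys))"
    by (rule hom_word_append[OF cls_khom]) (use gens L in simp_all)
  ultimately have "cls (word ([Gen_ten (mm R f f'), Gen_ten (mm R g g')] @ map2 Gen_L xs ys)) =
      s_A (f \<otimes>\<^bsub>M\<^esub> g) \<otimes>\<^bsub>A\<^esub> t_A (g' \<otimes>\<^bsub>M\<^esub> f') \<otimes>\<^bsub>A\<^esub> AI.wd (replicate n True) xs ys"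
    by (simp only: L)
  also have "\<dots> = s_A (f \<otimes>\<^bsub>M\<^esub> g) \<otimes>\<^bsub>A\<^esub> (t_A (g' \<otimes>\<^bsub>M\<^esub> f') \<otimes>\<^bsub>A\<^esub> AI.wd (replicate n True) xs ys)"
    by (rule A.A.m_assoc[OF AI.s_closed[OF fg(1)] AI.t_closed[OF fg(2)] AI.wd_closed[OF _ xs]]) simp
  finally show ?thesis .
qed

end

theorem theorem4p2:
  fixes R :: "('k :: field, 'r) module"
    and XX :: "'x set"
    and dg :: "'x \<Rightarrow> 'l :: finite \<Rightarrow> 'l"
    and \<sigma> :: "'x \<Rightarrow> 'x \<Rightarrow> 'x \<Rightarrow> 'x \<Rightarrow> 'l \<Rightarrow> 'r"
  assumes "k_algebra R"
    and "finite XX"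
    and "\<And>x. x \<in> XX \<Longrightarrow> bij (dg x)"
    and "\<And>a b c d. \<lbrakk>a \<in> XX; b \<in> XX; c \<in> XX; d \<in> XX\<rbrakk> \<Longrightarrow> \<sigma> a b c d \<in> carrier (map_algebra R)"
    and "\<And>a b c d l. \<lbrakk>a \<in> XX; b \<in> XX; c \<in> XX; d \<in> XX\<rbrakk> \<Longrightarrow> \<sigma> a b c d l \<in> center R"
    and "\<And>a b c d l. \<lbrakk>a \<in> XX; b \<in> XX; c \<in> XX; d \<in> XX; l \<triangleleft> dg d \<triangleleft> dg b \<noteq> l \<triangleleft> dg c \<triangleleft> dg a\<rbrakk>
           \<Longrightarrow> \<sigma> b d a c l = \<zero>\<^bsub>R\<^esub>"
  shows "\<exists>\<Phi>bar \<Phi>.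
    \<Phi>bar \<in> k_linear_map (HQ R XX dg) (A_sigma R XX dg \<sigma>) \<and>
    (\<forall>r\<in>carrier R. \<forall>r'\<in>carrier R. \<forall>m. \<forall>p\<in>paths XX dg m. \<forall>q\<in>paths XX dg m.
       \<Phi>bar (hten R XX dg r r' (ee p q)) =
         cls_sigma R XX dg \<sigma> (word
           ([Gen_ten (mm R (const_map r) (const_map r')),
             Gen_ten (mm R (delta_map R (fst p)) (delta_map R (fst q)))] @
            map2 Gen_L (map snd (snd p)) (map snd (snd q))))) \<and>
    (\<forall>h\<in>carrier (HQ R XX dg). \<Phi> (cls_w R XX dg \<sigma> h) = \<Phi>bar h) \<and>
    left_bialgebroid_hom
      (A_w R XX dg \<sigma>) (map_algebra R) (s_w R XX dg \<sigma>) (t_w R XX dg \<sigma>)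
      (comult_w R XX dg \<sigma>) (counit_w R)
      (A_sigma R XX dg \<sigma>) (map_algebra R) (s_sigma R XX dg \<sigma>) (t_sigma R XX dg \<sigma>)
      (comult_sigma R XX dg \<sigma>) (counit_sigma R dg)
      \<Phi> id"
proof -
  interpret S: sigma_bialgebroid R XX dg \<sigma>
  proof (intro sigma_bialgebroid.intro sigma_data.intro sigma_data_axioms.intro sigma_bialgebroid_axioms.intro)
  qed (fact assms)+
  interpret Q: quiver_sigma R XX dg \<sigma>
  proof (intro quiver_sigma.intro quiver_data.intro quiver_data_axioms.intro quiver_sigma_axioms.intro)
  qed (fact assms)+
  let ?A = "A_sigma R XX dg \<sigma>"
  let ?\<Phi> = "Q.quiver_hom ?A S.s_A S.t_A S.l_A"
  have frt: "frt_coefficients R ?A XX S.s_A S.t_A UNIV (signed_shift dg) S.l_A \<sigma> True"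
    by (rule S.AI.frt_coefficients_axioms)
  have BC: "coefficients R ?A XX S.s_A S.t_A UNIV (signed_shift dg) S.l_A"
    by (rule S.AI.coefficients_axioms)
  show ?thesis
  proof (intro exI conjI ballI allI)
    show "?\<Phi> \<in> k_linear_map (HQ R XX dg) ?A"
      using Q.quiver_hom_hom[OF BC UNIV_I] by (simp add: k_algebra_hom_def)
    show "?\<Phi> (hten R XX dg r r' (ee p q)) =
        cls_sigma R XX dg \<sigma> (word ([Gen_ten (mm R (const_map r) (const_map r')),
             Gen_ten (mm R (delta_map R (fst p)) (delta_map R (fst q)))] @
            map2 Gen_L (map snd (snd p)) (map snd (snd q))))"
      if r: "r \<in> carrier R" "r' \<in> carrier R" and pq: "p \<in> paths XX dg m" "q \<in> paths XX dg m" for r r' m p q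
    proof -
      obtain l xs where p: "p = path_from dg l xs" "xs \<in> tuples XX m" using pq(1) by (rule pathsE)
      obtain l' ys where q: "q = path_from dg l' ys" "ys \<in> tuples XX m" using pq(2) by (rule pathsE)
      show ?thesis
        unfolding p(1) q(1) path_from_simps(1,2)
        by (simp only: Q.quiver_hom_ee[OF BC UNIV_I r p(2) q(2)]
            S.cls_path_word[OF Q.const_closed[OF r(1)] Q.const_closed[OF r(2)] Q.delta_closed Q.delta_closed p(2) q(2)])
    qed
    show "induced ?\<Phi> (cls_w R XX dg \<sigma> h) = ?\<Phi> h" if "h \<in> carrier (HQ R XX dg)" for h
      by (rule Q.induced_quiver_clw[OF frt that])
    show "left_bialgebroid_hom
      (A_w R XX dg \<sigma>) (map_algebra R) (s_w R XX dg \<sigma>) (t_w R XX dg \<sigma>)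
      (comult_w R XX dg \<sigma>) (counit_w R)
      ?A (map_algebra R) (s_sigma R XX dg \<sigma>) (t_sigma R XX dg \<sigma>)
      (comult_sigma R XX dg \<sigma>) (counit_sigma R dg) (induced ?\<Phi>) id"
    proof (rule coefficient_bialgebroid_hom[OF Q.A_w_bialgebroid S.A_sigma_bialgebroid Q.induced_quiver_hom[OF frt] subset_UNIV])
      show "induced ?\<Phi> (s_w R XX dg \<sigma> f) = s_sigma R XX dg \<sigma> f"
        "induced ?\<Phi> (t_w R XX dg \<sigma> f) = t_sigma R XX dg \<sigma> f" if "f \<in> carrier (map_algebra R)" for f
        using Q.induced_quiver_s[OF frt that] Q.induced_quiver_t[OF frt that] .
      show "induced ?\<Phi> (cls_w R XX dg \<sigma> (Q.jj (pword dg [a] [b]))) = S.l_A i a b"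
        if "i \<in> {True}" "a \<in> XX" "b \<in> XX" for i a b
        using Q.induced_quiver_l[OF frt that(2,3)] that(1) by simp
    qed
  qed
qed

end
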